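(* Let $\nu>0$, let $h:\mathbb{R}_+\to[0,\infty)$ be locally bounded and assume $\mu:=\int_0^\infty h(t)\,\mathrm{d}t<1$. Let $N$ be a stationary linear Hawkes process with parameters $(\nu,h)$. Let $\lambda(t):=\nu+\int_{(-\infty,t)}h(t-s)N(\mathrm{d}s)$, $t\in\mathbb{R}$, and, for $u\in L^1(\mathbb{R},\mathrm{d}x)$, let $$\delta(u):=\int_{\mathbb{R}}u(t)(N(\mathrm{d}t)-\lambda(t)\,\mathrm{d}t),\qquad \delta_a(u):=\int_{\mathbb{R}}u(t)(N(\mathrm{d}t)-\nu(1-\mu)^{-1}\,\mathrm{d}t).$$ Let $Z$ be a standard normal random variable. If $u\in L^1(\mathbb{R},\mathrm{d}x)$, then $$d_W(\delta(u),Z)\le\mathfrak L\quad\text{and}\quad d_W(\delta_a(u),Z)\le\mathfrak L+\frac{2\nu\mu}{1-\mu}\|u\|_{L^1(\mathbb{R},\mathrm{d}x)},$$ where $$\begin{aligned}\mathfrak L:={}&\sqrt{2/\pi}\,\Big|1-\frac{\nu}{1-\mu}\|u\|_{L^2(\mathbb{R},\mathrm{d}x)}^2\Big|+\frac{\nu}{1-\mu}\|u\|_{L^3(\mathbb{R},\mathrm{d}x)}^3\\&+\frac{2\sqrt{2/\pi}\,\nu\mu(2-\mu)}{(1-\mu)^2}\|u\|_{L^2(\mathbb{R},\mathrm{d}x)}^2+\frac{\nu\mu}{(1-\mu)^2}\|u\|_{L^2(\mathbb{R},\mathrm{d}x)}\|u^2\|_{L^2(\mathbb{R},\mathrm{d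}x)}.\end{aligned}$$
   Context: A linear Hawkes process (self-exciting process) with parameters $(\nu,h)$, where $\nu>0$ is a constant and $h\ge0$, is a (simple, locally finite) point process $N$ on $\mathbb{R}$ with $\mathcal F^N$-stochastic intensity $\lambda(t)=\nu+\int_{(-\infty,t)}h(t-s)N(\mathrm{d}s)$, $t\in\mathbb{R}$. Here $\mathcal F^N_t:=\sigma\{N(A):A\in\mathcal B(\mathbb{R}),A\subseteq(-\infty,t]\}$, and a nonnegative adapted, a.s. locally integrable process $\{\lambda(t)\}$ is an $\mathcal F$-stochastic intensity of $N$ if $\mathrm{E}[N((a,b])\mid\mathcal F_a]=\mathrm{E}[\int_a^b\lambda(t)\,\mathrm{d}t\mid\mathcal F_a]$ a.s. for all $a<b$. For $\mu<1$ it is known that there is a unique stationary distribution of $N$ with these dynamics and finite intensity $\mathrm{E}[N((0,1])]$, which equals $\nu/(1-\mu)$; "stationary linear Hawkes process" refers to this solution. It is constructed by embedding in a Poisson process $\overline N$ on $\mathbb{R}\times\mathbb{R}_+$ with mean measure $\mathrm{d}t\,\mathrm{d}z$: it is the a.s. limit of $N^{(n)}(\mathrm{d}t):=\overline N(\mathrm{d}t\times(0,\lambda^{(n)}(t)])$, $\lambda^{(0)}\equiv0$, $\lambda^{(n+1)}(t):=\nu+\int_{(-\infty,t)}h(t-s)N^{(n)}(\mathrm{d}s)$, and satisfies $N(\mathrm{d}t)=\overline N(\mathrm{d}t\times(0,\lambda(t)])$. Wasserstein distance: $d_W(X,Y):=\sup_{g\in\mathrm{Lip}(1)}|\mathrm{E}[g(X)]-\mathrm{E}[g(Y)]|$,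 where $\mathrm{Lip}(1)$ is the class of real-valued functions on $\mathbb{R}$ with Lipschitz constant at most $1$. The norms of $u$ may be $+\infty$. *)

theory Defs
  imports "HOL-Probability.Probability"
begin

(* A point process is a random locally finite counting measure: N w is a Borel measure
   for every outcome w, with finite integer values on bounded sets. *)
definition point_process :: "'a measure \<Rightarrow> ('a \<Rightarrow> real measure) \<Rightarrow> bool" where
  "point_process M N \<longleftrightarrow>
     (\<forall>\<omega>\<in>space M. sets (N \<omega>) = sets borel) \<and>
     (\<forall>A\<in>sets borel. (\<lambda>\<omega>. emeasure (N \<omega>) A) \<in> borel_measurable M) \<and>
     (\<forall>\<omega>\<in>space M. \<forall>A\<in>sets borel. bounded A \<longrightarrow> (\<exists>n::nat. emeasure (N \<omega>) A = of_nat n))"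

definition simple_process :: "'a measure \<Rightarrow> ('a \<Rightarrow> real measure) \<Rightarrow> bool" where
  "simple_process M N \<longleftrightarrow> (AE \<omega> in M. \<forall>x. emeasure (N \<omega>) {x} \<le> 1)"

definition natural_filtration :: "'a measure \<Rightarrow> ('a \<Rightarrow> real measure) \<Rightarrow> real \<Rightarrow> 'a measure" where
  "natural_filtration M N t = sigma (space M)
     {(\<lambda>\<omega>. emeasure (N \<omega>) A) -` B \<inter> space M | A B.
        A \<in> sets borel \<and> A \<subseteq> {..t} \<and> B \<in> sets borel}"

(* Joint measurability of l makes the pathwise integrals random variables, so that the
   conditional expectation of the integral is meaningful. Both sides are conditional
   expectations of [0,\<infinity>]-valued random variables. *)
definition stochastic_intensity ::
  "'a measure \<Rightarrow> (real \<Rightarrow> 'a measure) \<Rightarrow> ('a \<Rightarrow> real measure) \<Rightarrow> (real \<Rightarrow> 'a \<Rightarrow> ennreal) \<Rightarrow> bool" where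
  "stochastic_intensity M F N l \<longleftrightarrow>
     (\<forall>t. subalgebra M (F t)) \<and>
     (\<lambda>(t, \<omega>). l t \<omega>) \<in> borel_measurable (lborel \<Otimes>\<^sub>M M) \<and>
     (\<forall>t. l t \<in> borel_measurable (F t)) \<and>
     (AE \<omega> in M. \<forall>a b. (\<integral>\<^sup>+t\<in>{a..b}. l t \<omega> \<partial>lborel) < \<infinity>) \<and>
     (\<forall>a b. a < b \<longrightarrow>
        (AE \<omega> in M. nn_cond_exp M (F a) (\<lambda>\<omega>. emeasure (N \<omega>) {a<..b}) \<omega> =
                    nn_cond_exp M (F a) (\<lambda>\<omega>. \<integral>\<^sup>+t\<in>{a<..b}. l t \<omega> \<partial>lborel) \<omega>))"

(* The kernel h is only evaluated at positive arguments t - s. *)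
definition hawkes_intensity ::
  "real \<Rightarrow> (real \<Rightarrow> real) \<Rightarrow> ('a \<Rightarrow> real measure) \<Rightarrow> real \<Rightarrow> 'a \<Rightarrow> ennreal" where
  "hawkes_intensity \<nu> h N t \<omega> =
     ennreal \<nu> + (\<integral>\<^sup>+s\<in>{..<t}. ennreal (h (t - s)) \<partial>N \<omega>)"

definition linear_hawkes ::
  "'a measure \<Rightarrow> real \<Rightarrow> (real \<Rightarrow> real) \<Rightarrow> ('a \<Rightarrow> real measure) \<Rightarrow> bool" where
  "linear_hawkes M \<nu> h N \<longleftrightarrow>
     point_process M N \<and> simple_process M N \<and>
     stochastic_intensity M (natural_filtration M N) N (hawkes_intensity \<nu> h N)"

(* The law of a random measure as the law of the family of its values on Borel sets, that is,
   with respect to the sigma-algebra generated by the evaluation maps. *)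
definition random_measure_law ::
  "'a measure \<Rightarrow> ('a \<Rightarrow> real measure) \<Rightarrow> (real set \<Rightarrow> ennreal) measure" where
  "random_measure_law M N =
     distr M (PiM (sets borel) (\<lambda>_. borel)) (\<lambda>\<omega>. \<lambda>A\<in>sets borel. emeasure (N \<omega>) A)"

definition stationary_process :: "'a measure \<Rightarrow> ('a \<Rightarrow> real measure) \<Rightarrow> bool" where
  "stationary_process M N \<longleftrightarrow>
     (\<forall>t. random_measure_law M (\<lambda>\<omega>. distr (N \<omega>) borel (\<lambda>x. x + t)) = random_measure_law M N)"

(* The solution with finite mean intensity; when the integral of h is less than 1, its law is
   unique. *)
definition stationary_linear_hawkes ::
  "'a measure \<Rightarrow> real \<Rightarrow> (real \<Rightarrow> real) \<Rightarrow> ('a \<Rightarrow> real measure) \<Rightarrow> bool" where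
  "stationary_linear_hawkes M \<nu> h N \<longleftrightarrow>
     linear_hawkes M \<nu> h N \<and> stationary_process M N \<and>
     (\<integral>\<^sup>+\<omega>. emeasure (N \<omega>) {0<..1} \<partial>M) < \<infinity>"

(* For the stationary process with u integrable, the intensity is finite for almost all
   (t, w) and both integrals converge absolutely almost surely, so the conversion enn2real
   and the total Bochner integrals only take default values on null sets. *)
definition hawkes_delta ::
  "real \<Rightarrow> (real \<Rightarrow> real) \<Rightarrow> ('a \<Rightarrow> real measure) \<Rightarrow> (real \<Rightarrow> real) \<Rightarrow> 'a \<Rightarrow> real" where
  "hawkes_delta \<nu> h N u \<omega> =
     (\<integral>t. u t \<partial>N \<omega>) - (\<integral>t. u t * enn2real (hawkes_intensity \<nu> h N t \<omega>) \<partial>lborel)"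

definition hawkes_delta_a ::
  "real \<Rightarrow> real \<Rightarrow> ('a \<Rightarrow> real measure) \<Rightarrow> (real \<Rightarrow> real) \<Rightarrow> 'a \<Rightarrow> real" where
  "hawkes_delta_a \<nu> \<mu> N u \<omega> = (\<integral>t. u t \<partial>N \<omega>) - (\<integral>t. u t * (\<nu> / (1 - \<mu>)) \<partial>lborel)"

(* Meant for integrable X and Y, for which all the expectations exist; the two variables may
   live on different probability spaces. *)
definition wasserstein_dist ::
  "'a measure \<Rightarrow> ('a \<Rightarrow> real) \<Rightarrow> 'b measure \<Rightarrow> ('b \<Rightarrow> real) \<Rightarrow> ereal" where
  "wasserstein_dist M X M' Y =
     (SUP g\<in>{g :: real \<Rightarrow> real. 1-lipschitz_on UNIV g}.
        ereal \<bar>(\<integral>\<omega>. g (X \<omega>) \<partial>M) - (\<integral>\<omega>. g (Y \<omega>) \<partial>M')\<bar>)"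

(* The norm of L^p(R, dx), with value \<infinity> outside L^p. *)
definition Lp_norm :: "real \<Rightarrow> (real \<Rightarrow> real) \<Rightarrow> ereal" where
  "Lp_norm p u =
     (let I = (\<integral>\<^sup>+x. ennreal (\<bar>u x\<bar> powr p) \<partial>lborel)
      in if I = \<infinity> then \<infinity> else ereal (enn2real I powr (1 / p)))"

definition hawkes_bound :: "real \<Rightarrow> real \<Rightarrow> (real \<Rightarrow> real) \<Rightarrow> ereal" where
  "hawkes_bound \<nu> \<mu> u =
     ereal (sqrt (2 / pi)) * \<bar>1 - ereal (\<nu> / (1 - \<mu>)) * (Lp_norm 2 u)^2\<bar>
     + ereal (\<nu> / (1 - \<mu>)) * (Lp_norm 3 u)^3
     + ereal (2 * sqrt (2 / pi) * \<nu> * \<mu> * (2 - \<mu>) / (1 - \<mu>)^2) * (Lp_norm 2 u)^2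
     + ereal (\<nu> * \<mu> / (1 - \<mu>)^2) * (Lp_norm 2 u * Lp_norm 2 (\<lambda>x. (u x)^2))"

end

theory Submission
  imports Defs "HOL-Real_Asymp.Real_Asymp"
begin

text \<open>
  Heuristically the stationary process consists of immigrants of rate \<open>\<nu>\<close>, each of which starts a
  Galton--Watson cluster. With \<open>X\<^sub>t\<close> the sum of \<open>u(s) - \<integral> h(r) u(s + r) dr\<close> over the points \<open>s\<close> of the cluster
  started at \<open>t\<close>, the variable \<open>\<delta>(u)\<close> is then a compensated compound Poisson variable with jump measure
  \<open>\<nu> \<integral> P(X\<^sub>t \<in> \<cdot>) dt\<close>, and \<open>E X\<^sub>t = u(t)\<close>, \<open>\<integral> E X\<^sub>t\<^sup>2 dt = \<integral> u\<^sup>2 / (1 - \<mu>)\<close>. The compound Poisson form of Stein's identity,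
  Taylor expansion, and the regularity of the solution of Stein's equation give the bound, where the variance of
  \<open>X\<^sub>t\<close> is the source of the terms with the factor \<open>\<mu>\<close>.

  The cluster representation need not be proved for the given process. For bounded \<open>u\<close> of bounded support let
  \<open>\<psi>(t) = E exp(i \<theta> X\<^sub>t)\<close> and \<open>\<kappa> = \<psi> - 1 - i \<theta> u\<close>. The recursion for \<open>\<psi>\<close> makes the stochastic exponential
  \<open>exp(\<integral> c dN - \<integral> (e\<^sup>c - 1) \<lambda> dt)\<close> with \<open>c(t) = i \<theta> u(t) + \<integral> h(s) \<kappa>(t + s) ds\<close> equal to
  \<open>exp(i \<theta> \<delta>(u) - \<nu> \<integral> \<kappa>)\<close>. Its expectation is 1 by the intensity property, which determines the law of \<open>\<delta>(u)\<close>.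
  The general case follows by truncation of \<open>u\<close>, and the second estimate from
  \<open>E \<bar>\<lambda>(t) - \<nu> / (1 - \<mu>)\<bar> \<le> 2 \<nu> \<mu> / (1 - \<mu>)\<close>.
\<close>

subsection \<open>Stein's equation for the normal law\<close>

text \<open>The process is accessible only through expectations over intervals
  \<open>{a<..b}\<close> with weights from the past. So the exponential is studied along a single
  path, where it solves a linear equation driven by the points and the compensator; its increments
  are limits of Riemann sums with weights at left endpoints, each of mean zero. The passage to the
  limit needs a bound uniform in the path, which holds because, with the compensator written as an
  integral over the points, the contribution of every point to the exponent has nonpositive real
  part.

  The function \<psi> is the limit of the characteristic functions of clusters with n generations,
  and \<mu> < 1 makes the recursion a contraction, uniformly and in L1. The approximating laws are
  compound Poisson, so Stein's identity is applied to them and weak convergence carries the estimate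
  to the law of \<delta>(u). The Taylor expansion is made around the mean u(t), not around 0: this
  leaves |u(t)|^3 and otherwise only the variance. The resulting constants are at most those claimed
  and are enlarged at the very end.\<close>

lemma lborel_Iic_deriv:
  fixes F :: "real \<Rightarrow> real"
  assumes "integrable lborel F" "\<And>x. isCont F x"
  shows "((\<lambda>x. LINT t|lborel. indicator {..x} t * F t) has_real_derivative F x) (at x)"
proof -
  define a where "a = x - 1"
  have i: "set_integrable lborel S F" if "S \<in> sets borel" for S
    using assms(1) that unfolding set_integrable_def by (intro integrable_mult_indicator) auto
  have eq: "(LINT t|lborel. indicator {..y} t * F t) = (LINT t|lborel. indicator {..a} t * F t) + integral {a..y} F"
    if "y \<in> {a<..<x+1}" for y
  proof -
    have *: "indicator {..y} t * F t = indicator {..a} t * F t + indicator {a<..y} t * F t" for t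
      using that by (auto simp: indicator_def)
    have "(LINT t|lborel. indicator {..y} t * F t) = (LINT t|lborel. indicator {..a} t * F t) + (LINT t|lborel. indicator {a<..y} t * F t)"
      unfolding * using i[of "{..a}"] i[of "{a<..y}"]
      by (intro Bochner_Integration.integral_add) (auto simp: set_integrable_def)
    also have "(LINT t|lborel. indicator {a<..y} t * F t) = (LINT t|lborel. indicator {a..y} t * F t)"
    proof (rule integral_cong_AE)
      show "AE t in lborel. indicator {a<..y} t * F t = indicator {a..y} t * F t"
        using AE_lborel_singleton[of a] by eventually_elim (auto simp: indicator_def)
    qed (use i[of "{a<..y}"] i[of "{a..y}"] in \<open>auto simp: set_integrable_def\<close>)
    also have "\<dots> = integral {a..y} F"
      using set_borel_integral_eq_integral(2)[OF i[of "{a..y}"]] by (simp add: set_lebesgue_integral_def)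
    finally show ?thesis .
  qed
  have "((\<lambda>y. (LINT t|lborel. indicator {..a} t * F t) + integral {a..y} F) has_real_derivative (0 + F x)) (at x within {a..x+1})"
    using assms(2) by (intro derivative_intros integral_has_real_derivative continuous_at_imp_continuous_on)
       (auto simp: a_def)
  then have "((\<lambda>y. (LINT t|lborel. indicator {..a} t * F t) + integral {a..y} F) has_real_derivative F x) (at x)"
    by (simp add: at_within_Icc_at a_def)
  then show ?thesis
    by (rule has_field_derivative_transform_within_open[where S="{a<..<x+1}"]) (auto simp: eq a_def)
qed

lemma lborel_Iic_at_bot:
  fixes F :: "real \<Rightarrow> real"
  assumes "integrable lborel F"
  shows "((\<lambda>x. LINT t|lborel. indicator {..x} t * F t) \<longlongrightarrow> 0) at_bot"
proof -
  have "((\<lambda>x. LINT t|lborel. indicator {..x} t * F t) \<longlongrightarrow> (LINT (t::real)|lborel. (0::real))) at_bot"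
    unfolding at_bot_mirror filterlim_filtermap
  proof (rule integral_dominated_convergence_at_top[where s="\<lambda>x t. indicator {..-x} t * F t" and f="\<lambda>t. 0" and M=lborel and w="\<lambda>t. norm (F t)"])
    show "AE t in lborel. ((\<lambda>x. indicator {..-x} t * F t) \<longlongrightarrow> 0) at_top"
    proof (rule AE_I2)
      fix t
      have "eventually (\<lambda>x. indicator {..-x} t * F t = 0) at_top"
        using eventually_gt_at_top[of "-t"] by eventually_elim (auto simp: indicator_def)
      then show "((\<lambda>x. indicator {..-x} t * F t) \<longlongrightarrow> 0) at_top"
        by (rule tendsto_eventually)
    qed
    show "\<forall>\<^sub>F i in at_top. AE x in lborel. norm (indicator {..- i} x * F x) \<le> norm (F x)"
      by (auto simp: indicator_def)
  qed (use assms in auto)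
  then show ?thesis by simp
qed

text \<open>Two antiderivatives of \<open>F\<close> that vanish at minus infinity coincide. The
  truncated Gaussian moments are evaluated by exhibiting such a \<open>G\<close>.\<close>

lemma lborel_Iic_unique:
  fixes F G :: "real \<Rightarrow> real"
  assumes "integrable lborel F" "\<And>x. isCont F x"
    "\<And>x. (G has_real_derivative F x) (at x)" "(G \<longlongrightarrow> 0) at_bot"
  shows "(LINT t|lborel. indicator {..x} t * F t) = G x"
proof -
  let ?I = "\<lambda>x. LINT t|lborel. indicator {..x} t * F t"
  have "((\<lambda>x. ?I x - G x) has_real_derivative 0) (at y)" for y
    using DERIV_diff[OF lborel_Iic_deriv[OF assms(1,2)] assms(3)] by simp
  then have c: "?I y - G y = ?I x - G x" for y
    using DERIV_isconst_all by blast
  have "((\<lambda>y. ?I y - G y) \<longlongrightarrow> 0 - 0) at_bot"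
    by (intro tendsto_diff lborel_Iic_at_bot assms)
  then have "((\<lambda>y::real. ?I x - G x) \<longlongrightarrow> 0) at_bot" unfolding ext[OF c, of "\<lambda>y. y"] by simp
  then show ?thesis by (simp add: tendsto_const_iff)
qed

section \<open>The normal density, its distribution function and truncated moments\<close>

abbreviation gphi :: "real \<Rightarrow> real" where "gphi \<equiv> std_normal_density"

definition gcdf :: "real \<Rightarrow> real" where
  "gcdf x = (LINT t|lborel. indicator {..x} t * gphi t)"

lemma gphi_pos: "gphi x > 0" by (simp add: normal_density_pos)

lemma gphi_deriv: "(gphi has_real_derivative (- x * gphi x)) (at x)"
proof -
  have *: "((\<lambda>x. C * exp (- x\<^sup>2 / 2)) has_real_derivative - x * (C * exp (- x\<^sup>2 / 2))) (at x)" for C :: real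
    by (auto intro!: derivative_eq_intros)
  show ?thesis unfolding std_normal_density_def[abs_def] by (rule *)
qed

lemma gphi_cont: "isCont gphi x"
  using gphi_deriv DERIV_isCont by blast

lemma gphi_even: "gphi (-x) = gphi x" by (simp add: std_normal_density_def)

lemma gphi_le: "gphi x \<le> gphi 0" by (simp add: std_normal_density_def divide_simps)

lemma integrable_gphi: "integrable lborel gphi" by simp

lemma integrable_gphi_pow: "integrable lborel (\<lambda>t. t ^ k * gphi t)"
  using integrable_std_normal_moment[of k] by (simp add: mult.commute)

lemma integrable_gphi_id: "integrable lborel (\<lambda>t. t * gphi t)"
  using integrable_gphi_pow[of 1] by simp

lemma integral_gphi: "(LINT t|lborel. gphi t) = 1"
  using integral_std_normal_moment_even[of 0] by simp

lemma integral_gphi_id: "(LINT t|lborel. t * gphi t) = 0"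
  using integral_std_normal_moment_odd[of 0] by (simp add: mult.commute)

lemma gphi_at_bot: "((\<lambda>x. x ^ k * gphi x) \<longlongrightarrow> 0) at_bot"
  unfolding filterlim_at_bot_mirror std_normal_density_def
  by (simp add: power_minus') real_asymp

lemma Iic_gphi_id: "(LINT t|lborel. indicator {..x} t * (t * gphi t)) = - gphi x"
  by (rule lborel_Iic_unique[OF integrable_gphi_id])
    (use gphi_deriv gphi_at_bot[of 0] in \<open>auto intro!: derivative_eq_intros continuous_intros gphi_cont tendsto_eq_intros\<close>)

lemma gcdf_deriv: "(gcdf has_real_derivative gphi x) (at x)"
  unfolding gcdf_def[abs_def] by (intro lborel_Iic_deriv) (auto simp: gphi_cont)

lemma gcdf_bot: "(gcdf \<longlongrightarrow> 0) at_bot"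
  unfolding gcdf_def[abs_def] by (intro lborel_Iic_at_bot) auto

lemma Iic_gphi_sq: "(LINT t|lborel. indicator {..x} t * (t^2 * gphi t)) = gcdf x - x * gphi x"
proof (rule lborel_Iic_unique[OF integrable_gphi_pow])
  show "((\<lambda>x. gcdf x - x * gphi x) has_real_derivative x\<^sup>2 * gphi x) (at x)" for x
    by (auto intro!: derivative_eq_intros gcdf_deriv gphi_deriv simp: algebra_simps power2_eq_square)
  show "((\<lambda>x. gcdf x - x * gphi x) \<longlongrightarrow> 0) at_bot"
    using tendsto_diff[OF gcdf_bot gphi_at_bot[of 1]] by simp
qed (auto intro!: continuous_intros gphi_cont)

lemma integrable_Iic: "integrable lborel F \<Longrightarrow> S \<in> sets borel \<Longrightarrow> integrable lborel (\<lambda>t. indicator S t * F t :: real)"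
  using integrable_mult_indicator[of S lborel F] by simp

lemma integral_Ioi:
  fixes F :: "real \<Rightarrow> real"
  assumes "integrable lborel F"
  shows "(LINT t|lborel. indicator {x<..} t * F t) = (LINT t|lborel. F t) - (LINT t|lborel. indicator {..x} t * F t)"
proof -
  have "(LINT t|lborel. F t) = (LINT t|lborel. indicator {x<..} t * F t + indicator {..x} t * F t)"
    by (intro Bochner_Integration.integral_cong) (auto simp: indicator_def)
  also have "\<dots> = (LINT t|lborel. indicator {x<..} t * F t) + (LINT t|lborel. indicator {..x} t * F t)"
    by (intro Bochner_Integration.integral_add integrable_Iic assms) auto
  finally show ?thesis by simp
qed

lemma gcdf_pos: "gcdf x \<ge> 0" "gcdf x \<le> 1"
proof -
  show "gcdf x \<ge> 0" unfolding gcdf_def by (intro integral_nonneg_AE) (auto simp: normal_density_nonneg)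
  have "gcdf x \<le> (LINT t|lborel. gphi t)" unfolding gcdf_def
    by (intro integral_mono integrable_Iic) (auto simp: indicator_def normal_density_nonneg)
  then show "gcdf x \<le> 1" by (simp add: integral_gphi)
qed

lemma gcdf_minus: "gcdf (-x) = 1 - gcdf x"
proof -
  have "gcdf (-x) = (LINT t|lborel. indicator {..-x} (-t) * gphi (-t))"
    unfolding gcdf_def using lborel_integral_real_affine[of "-1" "\<lambda>t. indicator {..-x} t * gphi t" 0] by simp
  also have "\<dots> = (LINT t|lborel. indicator {x<..} t * gphi t)"
  proof (rule integral_cong_AE)
    show "AE t in lborel. indicator {..- x} (- t) * gphi (- t) = indicator {x<..} t * gphi t"
      using AE_lborel_singleton[of x] by eventually_elim (auto simp: indicator_def gphi_even)
  qed auto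
  also have "\<dots> = 1 - gcdf x" unfolding gcdf_def
    by (subst integral_Ioi) (auto simp: integral_gphi)
  finally show ?thesis .
qed

text \<open>For a standard normal \<open>Z\<close> these are \<open>E (Z - x)\<^sup>+\<close> and \<open>E (x - Z)\<^sup>+\<close>.\<close>
definition gA :: "real \<Rightarrow> real" where "gA x = gphi x - x * (1 - gcdf x)"
definition gB :: "real \<Rightarrow> real" where "gB x = gphi x + x * gcdf x"

lemma gB_int: "(LINT t|lborel. indicator {..x} t * ((x - t) * gphi t)) = gB x"
proof -
  have "(LINT t|lborel. indicator {..x} t * ((x - t) * gphi t)) =
     (LINT t|lborel. x * (indicator {..x} t * gphi t) - indicator {..x} t * (t * gphi t))"
    by (simp add: algebra_simps)
  also have "\<dots> = x * (LINT t|lborel. (indicator {..x} t * gphi t)) - (LINT t|lborel. indicator {..x} t * (t * gphi t))"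
    by (subst Bochner_Integration.integral_diff) (auto intro!: integrable_mult_right integrable_Iic integrable_gphi_id)
  finally show ?thesis by (simp add: Iic_gphi_id gB_def gcdf_def)
qed

lemma gA_int: "(LINT t|lborel. indicator {x<..} t * ((t - x) * gphi t)) = gA x"
proof -
  have i: "integrable lborel (\<lambda>t. (t - x) * gphi t)" 
    using Bochner_Integration.integrable_diff[OF integrable_gphi_id integrable_mult_right[of x, OF integrable_gphi]] by (simp add: algebra_simps)
  have "(LINT t|lborel. (t - x) * gphi t) = - x"
    using Bochner_Integration.integral_diff[OF integrable_gphi_id integrable_mult_right[of x, OF integrable_gphi]]
    by (simp add: algebra_simps integral_gphi_id integral_gphi)
  moreover have "(LINT t|lborel. indicator {..x} t * ((t - x) * gphi t)) = - gB x"
    unfolding gB_int[symmetric] by (subst Bochner_Integration.integral_minus[symmetric]) (simp add: algebra_simps)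
  ultimately have "(LINT t|lborel. indicator {x<..} t * ((t - x) * gphi t)) = - x - - gB x"
    by (simp only: integral_Ioi[OF i])
  then show ?thesis by (simp add: gA_def gB_def algebra_simps)
qed

lemma gB_nonneg: "gB x \<ge> 0" and gA_nonneg: "gA x \<ge> 0"
  unfolding gB_int[symmetric] gA_int[symmetric]
  by (intro integral_nonneg_AE; auto simp: indicator_def normal_density_nonneg)+

text \<open>The left side is the mean square of the positive part of \<open>x - Z\<close> for a
  standard normal \<open>Z\<close>, computed from the truncated moments of order 0, 1 and 2. For
  negative \<open>x\<close> it is a bound on the Mills ratio.\<close>

lemma mills_B: "gcdf x + x * gB x \<ge> 0"
proof -
  have "(LINT t|lborel. indicator {..x} t * ((x - t)^2 * gphi t)) =
     (LINT t|lborel. x^2 * (indicator {..x} t * gphi t) - 2 * x * (indicator {..x} t * (t * gphi t)) + indicator {..x} t * (t^2 * gphi t))"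
    by (simp add: algebra_simps power2_eq_square)
  also have "\<dots> = x^2 * gcdf x - 2 * x * (- gphi x) + (gcdf x - x * gphi x)"
    using has_bochner_integral_integrable[OF integrable_Iic[OF integrable_gphi, of "{..x}"]]
      has_bochner_integral_integrable[OF integrable_Iic[OF integrable_gphi_id, of "{..x}"]]
      has_bochner_integral_integrable[OF integrable_Iic[OF integrable_gphi_pow, of "{..x}" 2]]
    unfolding Iic_gphi_id Iic_gphi_sq gcdf_def[of x, symmetric]
    by (intro has_bochner_integral_integral_eq has_bochner_integral_add has_bochner_integral_diff has_bochner_integral_mult_right) auto
  also have "\<dots> = gcdf x + x * gB x" by (simp add: gB_def algebra_simps power2_eq_square)
  finally have "gcdf x + x * gB x = (LINT t|lborel. indicator {..x} t * ((x - t)^2 * gphi t))" ..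
  also have "\<dots> \<ge> 0" by (intro integral_nonneg_AE) (auto simp: normal_density_nonneg)
  finally show ?thesis .
qed

lemma gA_minus: "gA (-x) = gB x" by (simp add: gA_def gB_def gcdf_minus gphi_even)
lemma gB_minus: "gB (-x) = gA x" by (simp add: gA_def gB_def gcdf_minus gphi_even)

lemma mills_A: "(1 - gcdf x) - x * gA x \<ge> 0"
  using mills_B[of "-x"] by (simp add: gB_minus gcdf_minus)

text \<open>This inequality is behind the constant \<open>sqrt (2 / pi)\<close>: the derivative of
  the Stein solution turns out to be bounded by \<open>2 * gA w * gB w / gphi w\<close>, which is
  then at most \<open>2 * gphi 0\<close>. The difference of the two sides, divided by
  \<open>w^2\<close>, decreases to 0 on the positive half-line, hence is nonnegative.\<close>

lemma gAB_le_pos: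
  assumes w: "w > 0"
  shows "gA w * gB w \<le> gphi 0 * gphi w"
proof -
  \<comment> \<open>\<open>k\<close> is the factor that decides the sign of the derivative of
    \<open>L\<close>, and \<open>k'\<close> is its derivative. Both vanish at 0, and
    \<open>k'\<close> decreases because \<open>gphi\<close> is largest at 0.\<close>
  define k where "k w = w * (2 * gcdf w - 1) + 2 * gphi w - 2 * gphi 0 - gphi 0 * w^2" for w
  define k' where "k' w = 2 * gcdf w - 1 - 2 * gphi 0 * w" for w
  have g0: "gcdf 0 = 1/2" using gcdf_minus[of 0] by simp
  have dk': "(k' has_real_derivative (2 * gphi w - 2 * gphi 0)) (at w)" for w
    unfolding k'_def[abs_def] by (auto intro!: derivative_eq_intros gcdf_deriv)
  have k'neg: "k' w \<le> 0" if "w \<ge> 0" for w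
  proof -
    have "k' w \<le> k' 0"
      by (rule DERIV_nonpos_imp_nonincreasing[OF that]) (use dk' gphi_le in \<open>fastforce\<close>)
    then show ?thesis by (simp add: k'_def g0)
  qed
  have psi_step: "(k has_real_derivative k' w) (at w)" for w
    unfolding k_def[abs_def] k'_def by (auto intro!: derivative_eq_intros gcdf_deriv gphi_deriv simp: algebra_simps)
  have kneg: "k w \<le> 0" if "w \<ge> 0" for w
  proof -
    have "k w \<le> k 0"
      by (rule DERIV_nonpos_imp_nonincreasing[OF that]) (use psi_step k'neg in \<open>fastforce\<close>)
    then show ?thesis by (simp add: k_def)
  qed
  define D where "D w = gphi 0 * gphi w - gA w * gB w" for w
  have Deq: "D w = w^2 * gcdf w * (1 - gcdf w) - gphi w ^2 - w * gphi w * (2 * gcdf w - 1) + gphi 0 * gphi w" for w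
    by (simp add: D_def gA_def gB_def power2_eq_square algebra_simps)
  \<comment> \<open>Division by \<open>w^2\<close> frees the product
    \<open>gcdf w * (1 - gcdf w)\<close> of its polynomial factor. In the derivative the terms
    without a negative power of \<open>w\<close> then cancel, and \<open>gphi w / w^3\<close> can be
    factored out.\<close>
  define L where "L w = gcdf w * (1 - gcdf w) + (gphi 0 * gphi w - gphi w ^2 - w * gphi w * (2 * gcdf w - 1)) / w^2" for w
  have DL: "L w = D w / w^2" if "w \<noteq> 0" for w
    using that by (simp add: Deq L_def field_simps)
  have dL: "(L has_real_derivative gphi w / w^3 * k w) (at w)" if w: "w > 0" for w
  proof -
    define N where "N w = gphi 0 * gphi w - gphi w ^2 - w * gphi w * (2 * gcdf w - 1)" for w
    define N' where "N' = - (gphi w * (2 * gcdf w - 1) * (1 - w^2) + w * gphi 0 * gphi w)"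
    have dN: "(N has_real_derivative N') (at w)"
      unfolding N_def[abs_def] N'_def
      by (auto intro!: derivative_eq_intros gcdf_deriv gphi_deriv simp: algebra_simps power2_eq_square)
    have dG: "((\<lambda>w. gcdf w * (1 - gcdf w)) has_real_derivative gphi w * (1 - 2 * gcdf w)) (at w)"
      by (auto intro!: derivative_eq_intros gcdf_deriv simp: algebra_simps)
    have "(L has_real_derivative gphi w * (1 - 2 * gcdf w) + (N' * w^2 - N w * (2 * w)) / (w^2 * w^2)) (at w)"
      unfolding L_def[abs_def] N_def[symmetric] using w
      by (intro DERIV_add dG DERIV_divide dN) (auto intro!: derivative_eq_intros)
    moreover have "gphi w * (1 - 2 * gcdf w) + (N' * w^2 - N w * (2 * w)) / (w^2 * w^2) = gphi w / w^3 * k w"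
      unfolding N'_def N_def k_def using w by (simp add: divide_simps) (simp add: algebra_simps eval_nat_numeral)
    ultimately show ?thesis by simp
  qed
  have anti: "L y \<le> L x" if "0 < x" "x \<le> y" for x y
  proof (rule DERIV_nonpos_imp_nonincreasing[OF that(2)])
    fix z assume "x \<le> z" "z \<le> y"
    then have z: "z > 0" using that by simp
    have "gphi z / z^3 * k z \<le> 0"
      using z kneg[of z] gphi_pos[of z] by (intro mult_nonneg_nonpos) auto
    then show "\<exists>d. (L has_real_derivative d) (at z) \<and> d \<le> 0" using dL[OF z] by blast
  qed
  have lim: "(L \<longlongrightarrow> 0) at_top"
  proof (rule Lim_null_comparison)
    show "\<forall>\<^sub>F w in at_top. norm (L w) \<le> (gphi 0 * gphi 0 + gphi 0 * (gphi 0 + w)) / w^2"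
      using eventually_gt_at_top[of 0]
    proof eventually_elim
      case (elim w)
      have "w * (1 - gcdf w) \<ge> 0" using gcdf_pos[of w] elim by (intro mult_nonneg_nonneg) auto
      then have a: "gA w \<le> gphi 0" using gphi_le[of w] by (simp add: gA_def)
      have "w * gcdf w \<le> w * 1" using gcdf_pos[of w] elim by (intro mult_left_mono) auto
      then have b: "gB w \<le> gphi 0 + w" using gphi_le[of w] by (simp add: gB_def)
      have "\<bar>D w\<bar> \<le> gphi 0 * gphi w + gA w * gB w"
        unfolding D_def using gA_nonneg[of w] gB_nonneg[of w] gphi_pos[of w] gphi_pos[of 0] 
         mult_nonneg_nonneg[of "gA w" "gB w"] mult_nonneg_nonneg[of "gphi 0" "gphi w"] by linarith
      also have "\<dots> \<le> gphi 0 * gphi 0 + gphi 0 * (gphi 0 + w)"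
        using gA_nonneg[of w] gB_nonneg[of w] gphi_pos[of 0] gphi_le[of w] a b elim by (intro add_mono mult_mono) auto
      finally show ?case using elim by (simp add: DL divide_simps)
    qed
    show "((\<lambda>w. (gphi 0 * gphi 0 + gphi 0 * (gphi 0 + w)) / w^2) \<longlongrightarrow> 0) at_top"
      using gphi_pos[of 0] by real_asymp
  qed
  have "L w \<ge> 0"
  proof (rule tendsto_upperbound[OF lim])
    show "\<forall>\<^sub>F y in at_top. L y \<le> L w" using eventually_ge_at_top[of w] 
      by eventually_elim (rule anti[OF w])
  qed simp
  then have "D w \<ge> 0" using w by (simp add: DL zero_le_divide_iff)
  then show ?thesis by (simp add: D_def)
qed

lemma gAB_le: "gA w * gB w \<le> gphi 0 * gphi w"
proof (cases w "0::real" rule: linorder_cases)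
  case less
  then show ?thesis using gAB_le_pos[of "-w"] by (simp add: gA_minus gB_minus gphi_even mult.commute)
next
  case equal
  then show ?thesis by (simp add: gA_def gB_def)
qed (rule gAB_le_pos)

lemma gphi_0: "2 * gphi 0 = sqrt (2 / pi)"
  by (simp add: std_normal_density_def real_sqrt_mult real_sqrt_divide field_simps)

text \<open>Multiplied by the density, \<open>f\<close>, \<open>f'\<close> and
  \<open>f + x f'\<close> become linear combinations of \<open>P x\<close> and \<open>R x\<close>,
  the integrals of \<open>g x - g t\<close> and \<open>g t - g x\<close> against the density over
  the two sides of \<open>x\<close>. Since \<open>g\<close> is 1-Lipschitz,
  \<open>\<bar>P x\<bar> \<le> gB x\<close> and \<open>\<bar>R x\<bar> \<le> gA x\<close>. With
  these, the bounds for \<open>f\<close> and \<open>f + x f'\<close> collapse to exactly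
  \<open>gphi x\<close>, and the bound for \<open>f'\<close> is
  \<open>2 * gA x * gB x\<close>.\<close>

lemma stein_solution:
  fixes g g' :: "real \<Rightarrow> real"
  assumes dg: "\<And>x. (g has_real_derivative g' x) (at x)" and g'1: "\<And>x. \<bar>g' x\<bar> \<le> 1"
  obtains f f' where "\<And>x. (f has_real_derivative f' x) (at x)" "\<And>x. \<bar>f x\<bar> \<le> 1"
    "\<And>x. \<bar>f' x\<bar> \<le> sqrt (2 / pi)" "\<And>x y. \<bar>f' x - f' y\<bar> \<le> 2 * \<bar>x - y\<bar>"
    "\<And>x. f' x - x * f x = g x - (LINT t|lborel. gphi t * g t)"
proof -
  have lip: "\<bar>g x - g y\<bar> \<le> \<bar>x - y\<bar>" for x y
    using field_differentiable_bound[of UNIV g g' 1 x y] dg g'1 by (auto simp: has_field_derivative_at_within)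
  have gc: "isCont g x" for x using dg DERIV_isCont by blast
  have gm[measurable]: "g \<in> borel_measurable borel"
    by (intro borel_measurable_continuous_onI) (simp add: gc continuous_at_imp_continuous_on)
  have ig: "integrable lborel (\<lambda>t. g t * gphi t)"
  proof (rule Bochner_Integration.integrable_bound)
    show "integrable lborel (\<lambda>t. \<bar>g 0\<bar> * gphi t + gphi t * \<bar>t\<bar> ^ 1)"
      by (intro Bochner_Integration.integrable_add integrable_mult_right integrable_std_normal_moment_abs) auto
    show "AE x in lborel. norm (g x * gphi x) \<le> norm (\<bar>g 0\<bar> * gphi x + gphi x * \<bar>x\<bar> ^ 1)"
    proof (rule AE_I2)
      fix x
      have "\<bar>g x\<bar> \<le> \<bar>g 0\<bar> + \<bar>x\<bar>" using lip[of x 0] by simp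
      then have "\<bar>g x\<bar> * gphi x \<le> (\<bar>g 0\<bar> + \<bar>x\<bar>) * gphi x" by (intro mult_right_mono) (auto simp: normal_density_nonneg)
      then show "norm (g x * gphi x) \<le> norm (\<bar>g 0\<bar> * gphi x + gphi x * \<bar>x\<bar> ^ 1)"
        by (simp add: abs_mult algebra_simps)
    qed
  qed auto
  define I where "I x = (LINT t|lborel. indicator {..x} t * (g t * gphi t))" for x
  define e where "e = (LINT t|lborel. g t * gphi t)"
  \<comment> \<open>The density is an integrating factor for \<open>f' - x f\<close>, which gives
    this formula. Subtracting \<open>gcdf x * e\<close> makes the numerator vanish at both ends of
    the line.\<close>
  define f where "f x = (I x - gcdf x * e) / gphi x" for x
  define f' where "f' x = x * f x + g x - e" for x
  define P where "P x = g x * gcdf x - I x" for x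
  define R where "R x = e - I x - g x * (1 - gcdf x)" for x
  have igx: "integrable lborel (\<lambda>t. (g t - g x) * gphi t)" for x
    using Bochner_Integration.integrable_diff[OF ig integrable_mult_right[of "g x", OF integrable_gphi]] by (simp add: algebra_simps)
  have ixx: "integrable lborel (\<lambda>t. (t - x) * gphi t)" for x
    using Bochner_Integration.integrable_diff[OF integrable_gphi_id integrable_mult_right[of x, OF integrable_gphi]] by (simp add: algebra_simps)
  have ixx': "integrable lborel (\<lambda>t. (x - t) * gphi t)" for x
    using Bochner_Integration.integrable_minus[OF ixx[of x]] by (simp add: algebra_simps)
  have Ieq: "(LINT t|lborel. indicator {..x} t * ((g t - g x) * gphi t)) = - P x" for x
  proof -
    have "(LINT t|lborel. indicator {..x} t * ((g t - g x) * gphi t)) =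
      (LINT t|lborel. indicator {..x} t * (g t * gphi t) - g x * (indicator {..x} t * gphi t))"
      by (simp add: algebra_simps)
    also have "\<dots> = I x - g x * gcdf x" unfolding I_def gcdf_def
      by (subst Bochner_Integration.integral_diff) (auto intro!: integrable_mult_right integrable_Iic ig)
    finally show ?thesis by (simp add: P_def)
  qed
  have Req: "R x = (LINT t|lborel. indicator {x<..} t * ((g t - g x) * gphi t))" for x
  proof -
    have "(LINT t|lborel. (g t - g x) * gphi t) = e - g x"
      using Bochner_Integration.integral_diff[OF ig integrable_mult_right[of "g x", OF integrable_gphi]]
      by (simp add: algebra_simps integral_gphi e_def)
    then have "(LINT t|lborel. indicator {x<..} t * ((g t - g x) * gphi t)) = e - g x - - P x"
      by (simp only: integral_Ioi[OF igx] Ieq)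
    then show ?thesis by (simp only: R_def P_def) (simp only: algebra_simps)
  qed
  have Pb: "\<bar>P x\<bar> \<le> gB x" for x
  proof -
    have "\<bar>P x\<bar> = \<bar>LINT t|lborel. indicator {..x} t * ((g t - g x) * gphi t)\<bar>" by (simp add: Ieq)
    also have "\<dots> \<le> (LINT t|lborel. \<bar>indicator {..x} t * ((g t - g x) * gphi t)\<bar>)" by (rule integral_abs_bound)
    also have "\<dots> \<le> (LINT t|lborel. indicator {..x} t * ((x - t) * gphi t))"
    proof (intro integral_mono integrable_Iic integrable_abs igx ixx')
      fix t show "\<bar>indicator {..x} t * ((g t - g x) * gphi t)\<bar> \<le> indicator {..x} t * ((x - t) * gphi t)"
        using lip[of t x] by (auto simp: indicator_def abs_mult normal_density_nonneg intro!: mult_right_mono)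
    qed auto
    finally show ?thesis by (simp add: gB_int)
  qed
  have Rb: "\<bar>R x\<bar> \<le> gA x" for x
  proof -
    have "\<bar>R x\<bar> \<le> (LINT t|lborel. \<bar>indicator {x<..} t * ((g t - g x) * gphi t)\<bar>)" unfolding Req by (rule integral_abs_bound)
    also have "\<dots> \<le> (LINT t|lborel. indicator {x<..} t * ((t - x) * gphi t))"
    proof (intro integral_mono integrable_Iic integrable_abs igx ixx)
      fix t show "\<bar>indicator {x<..} t * ((g t - g x) * gphi t)\<bar> \<le> indicator {x<..} t * ((t - x) * gphi t)"
        using lip[of t x] by (auto simp: indicator_def abs_mult normal_density_nonneg intro!: mult_right_mono)
    qed auto
    finally show ?thesis by (simp add: gA_int)
  qed
  have df: "(f has_real_derivative f' x) (at x)" for x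
  proof -
    have dI: "(I has_real_derivative g x * gphi x) (at x)" unfolding I_def[abs_def]
      by (intro lborel_Iic_deriv ig) (auto intro!: continuous_intros gphi_cont gc)
    have "(f has_real_derivative (((g x * gphi x - gphi x * e) * gphi x - (I x - gcdf x * e) * (- x * gphi x)) / (gphi x * gphi x))) (at x)"
      unfolding f_def[abs_def] using gphi_pos[of x]
      by (auto intro!: derivative_eq_intros dI gcdf_deriv gphi_deriv)
    also have "(((g x * gphi x - gphi x * e) * gphi x - (I x - gcdf x * e) * (- x * gphi x)) / (gphi x * gphi x)) = f' x"
      unfolding f'_def f_def using gphi_pos[of x] by (simp add: field_simps)
    finally show ?thesis .
  qed
  have feq: "gphi x * f x = - ((1 - gcdf x) * P x + gcdf x * R x)" for x
    using gphi_pos[of x] by (simp add: f_def P_def R_def field_simps)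
  have fb: "\<bar>f x\<bar> \<le> 1" for x
  proof -
    have "gphi x * \<bar>f x\<bar> = \<bar>(1 - gcdf x) * P x + gcdf x * R x\<bar>"
      using arg_cong[OF feq[of x], of abs] gphi_pos[of x] by (simp add: abs_mult)
    also have "\<dots> \<le> (1 - gcdf x) * \<bar>P x\<bar> + gcdf x * \<bar>R x\<bar>"
      using gcdf_pos[of x] abs_triangle_ineq[of "(1 - gcdf x) * P x" "gcdf x * R x"] by (simp add: abs_mult)
    also have "\<dots> \<le> (1 - gcdf x) * gB x + gcdf x * gA x"
      using gcdf_pos[of x] Pb[of x] Rb[of x] by (intro add_mono mult_left_mono) auto
    also have "\<dots> = gphi x * 1" by (simp add: gA_def gB_def algebra_simps)
    finally show ?thesis using gphi_pos[of x] by (simp only: mult_le_cancel_left_pos)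
  qed
  have f'eq: "f' x = x * f x + P x - R x" for x by (simp add: f'_def P_def R_def algebra_simps)
  have f'eq2: "gphi x * f' x = P x * gA x - R x * gB x" for x
  proof -
    have "gphi x * f' x = x * (gphi x * f x) + gphi x * P x - gphi x * R x" by (simp add: f'eq algebra_simps)
    then show ?thesis unfolding feq by (simp add: gA_def gB_def algebra_simps)
  qed
  have f'b: "\<bar>f' x\<bar> \<le> sqrt (2 / pi)" for x
  proof -
    have "gphi x * \<bar>f' x\<bar> = \<bar>P x * gA x - R x * gB x\<bar>"
      using arg_cong[OF f'eq2[of x], of abs] gphi_pos[of x] by (simp add: abs_mult)
    also have "\<dots> \<le> \<bar>P x\<bar> * gA x + \<bar>R x\<bar> * gB x"
      using abs_triangle_ineq4[of "P x * gA x" "R x * gB x"] gA_nonneg[of x] gB_nonneg[of x] by (simp add: abs_mult)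
    also have "\<dots> \<le> gB x * gA x + gA x * gB x"
      using gA_nonneg[of x] gB_nonneg[of x] Pb[of x] Rb[of x] by (intro add_mono mult_right_mono) auto
    also have "\<dots> \<le> gphi x * (2 * gphi 0)" using gAB_le[of x] by (simp add: mult.commute)
    finally show ?thesis using gphi_pos[of x] by (simp only: mult_le_cancel_left_pos gphi_0)
  qed
  \<comment> \<open>Stein's equation differentiated once. The part \<open>f + x f'\<close> is
    bounded by 1 as a whole and the derivative of \<open>g\<close> by another 1; this is the
    Lipschitz constant 2 of \<open>f'\<close>.\<close>
  define f'' where "f'' x = f x + x * f' x + g' x" for x
  have df': "(f' has_real_derivative f'' x) (at x)" for x
    unfolding f'_def[abs_def] f''_def using df[of x] dg[of x] by (auto intro!: derivative_eq_intros simp: f'_def)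
  have f''b: "\<bar>f'' x\<bar> \<le> 2" for x
  proof -
    have *: "gphi x * (f x + x * f' x) = P x * (x * gA x - (1 - gcdf x)) - R x * (gcdf x + x * gB x)"
    proof -
      have "gphi x * (f x + x * f' x) = gphi x * f x + x * (gphi x * f' x)" by (simp add: algebra_simps)
      then show ?thesis unfolding feq f'eq2 by (simp add: algebra_simps)
    qed
    have "gphi x * \<bar>f x + x * f' x\<bar> = \<bar>P x * (x * gA x - (1 - gcdf x)) - R x * (gcdf x + x * gB x)\<bar>"
      using arg_cong[OF *, of abs] gphi_pos[of x] by (simp add: abs_mult)
    also have "\<dots> \<le> \<bar>P x\<bar> * \<bar>x * gA x - (1 - gcdf x)\<bar> + \<bar>R x\<bar> * \<bar>gcdf x + x * gB x\<bar>"
      unfolding abs_mult[symmetric] by (rule abs_triangle_ineq4)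
    also have "\<dots> \<le> gB x * ((1 - gcdf x) - x * gA x) + gA x * (gcdf x + x * gB x)"
      using gA_nonneg[of x] gB_nonneg[of x] Pb[of x] Rb[of x] mills_A[of x] mills_B[of x]
      by (intro add_mono mult_mono) auto
    also have "\<dots> = gphi x * 1" by (simp add: gA_def gB_def algebra_simps)
    finally have "\<bar>f x + x * f' x\<bar> \<le> 1" using gphi_pos[of x] by (simp only: mult_le_cancel_left_pos)
    then show ?thesis using g'1[of x] by (simp add: f''_def)
  qed
  have "\<bar>f' x - f' y\<bar> \<le> 2 * \<bar>x - y\<bar>" for x y
    using field_differentiable_bound[of UNIV f' f'' 2 x y] df' f''b by (auto simp: has_field_derivative_at_within)
  moreover have "f' x - x * f x = g x - (LINT t|lborel. gphi t * g t)" for x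
    by (simp add: f'_def e_def mult.commute)
  ultimately show thesis using df fb f'b by (intro that[of f f'])
qed

subsection \<open>Compound Poisson laws and their mixtures\<close>

text \<open>Positive and negative part are integrated separately with values in the extended
  half-line. Integrability of \<open>f\<close> under the mixture makes both inner integrals finite
  for almost every \<open>x\<close> only; elsewhere the Bochner integral has its default value,
  which does not affect the outer one.\<close>

lemma integral_bind_real:
  fixes f :: "'b \<Rightarrow> real"
  assumes ne: "space M \<noteq> {}" and K[measurable]: "K \<in> M \<rightarrow>\<^sub>M subprob_algebra N" and f[measurable]: "f \<in> borel_measurable N"
    and int: "integrable (M \<bind> K) f"
  shows "(\<integral>x. f x \<partial>(M \<bind> K)) = (\<integral>x. (\<integral>y. f y \<partial>K x) \<partial>M)"
proof -
  have nn: "(\<integral>\<^sup>+x. g x \<partial>(M \<bind> K)) = (\<integral>\<^sup>+x. (\<integral>\<^sup>+y. g y \<partial>K x) \<partial>M)" if "g \<in> borel_measurable N" for g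
    by (rule nn_integral_bind[OF that K])
  have sK: "sets (M \<bind> K) = sets N" using ne by (simp add: sets_bind[OF sets_kernel[OF K]])
  have sKx: "sets (K x) = sets N" if "x \<in> space M" for x using sets_kernel[OF K that] .
  have meas[measurable]: "(\<lambda>x. \<integral>\<^sup>+y. g y \<partial>K x) \<in> borel_measurable M" if [measurable]: "g \<in> borel_measurable N" for g
    by measurable
  have fin: "(\<integral>\<^sup>+x. (\<integral>\<^sup>+y. ennreal (f y) \<partial>K x) \<partial>M) < \<infinity>" "(\<integral>\<^sup>+x. (\<integral>\<^sup>+y. ennreal (- f y) \<partial>K x) \<partial>M) < \<infinity>"
    using real_integrable_def[of "M \<bind> K" f] int by (auto simp: nn top.not_eq_extremum)
  have AE1: "AE x in M. (\<integral>\<^sup>+y. ennreal (f y) \<partial>K x) < \<infinity>" "AE x in M. (\<integral>\<^sup>+y. ennreal (- f y) \<partial>K x) < \<infinity>"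
  proof -
    have "AE x in M. (\<integral>\<^sup>+y. ennreal (f y) \<partial>K x) \<noteq> \<infinity>"
      by (rule nn_integral_PInf_AE) (use fin(1) in auto)
    then show "AE x in M. (\<integral>\<^sup>+y. ennreal (f y) \<partial>K x) < \<infinity>" by (simp add: less_top)
    have "AE x in M. (\<integral>\<^sup>+y. ennreal (- f y) \<partial>K x) \<noteq> \<infinity>"
      by (rule nn_integral_PInf_AE) (use fin(2) in auto)
    then show "AE x in M. (\<integral>\<^sup>+y. ennreal (- f y) \<partial>K x) < \<infinity>" by (simp add: less_top)
  qed
  define P where "P x = (\<integral>\<^sup>+y. ennreal (f y) \<partial>K x)" for x
  define Q where "Q x = (\<integral>\<^sup>+y. ennreal (- f y) \<partial>K x)" for x
  have [measurable]: "P \<in> borel_measurable M" "Q \<in> borel_measurable M" unfolding P_def Q_def by auto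
  have PQ: "AE x in M. ennreal (enn2real (P x)) = P x" "AE x in M. ennreal (enn2real (Q x)) = Q x"
    using AE1 by (auto simp: P_def Q_def)
  have iP: "integrable M (\<lambda>x. enn2real (P x))" "integrable M (\<lambda>x. enn2real (Q x))"
    using fin nn_integral_cong_AE[OF PQ(1)] nn_integral_cong_AE[OF PQ(2)] by (auto simp: integrable_iff_bounded P_def Q_def)
  have eP: "(\<integral>x. enn2real (P x) \<partial>M) = enn2real (\<integral>\<^sup>+x. P x \<partial>M)" "(\<integral>x. enn2real (Q x) \<partial>M) = enn2real (\<integral>\<^sup>+x. Q x \<partial>M)"
    using nn_integral_cong_AE[OF PQ(1)] nn_integral_cong_AE[OF PQ(2)] by (simp_all add: integral_eq_nn_integral)
  have "(\<integral>x. (\<integral>y. f y \<partial>K x) \<partial>M) = (\<integral>x. enn2real (P x) - enn2real (Q x) \<partial>M)"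
  proof (rule integral_cong_AE)
    show "(\<lambda>x. \<integral>y. f y \<partial>K x) \<in> borel_measurable M" by measurable
    show "AE x in M. (\<integral>y. f y \<partial>K x) = enn2real (P x) - enn2real (Q x)"
      using AE1 AE_space
    proof eventually_elim
      case (elim x)
      have "f \<in> borel_measurable (K x)" using f measurable_cong_sets[OF sKx[OF elim(3)] refl] by blast
      then have "integrable (K x) f"
        using elim by (auto simp: real_integrable_def)
      then show ?case by (simp add: real_lebesgue_integral_def P_def Q_def)
    qed
  qed auto
  also have "\<dots> = enn2real (\<integral>\<^sup>+x. P x \<partial>M) - enn2real (\<integral>\<^sup>+x. Q x \<partial>M)"
    using iP by (simp add: eP)
  also have "\<dots> = (\<integral>x. f x \<partial>(M \<bind> K))"
    by (simp add: real_lebesgue_integral_def[OF int] nn P_def Q_def)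
  finally show ?thesis ..
qed

lemma integral_bind_complex:
  fixes f :: "'b \<Rightarrow> complex"
  assumes M: "prob_space M" and K[measurable]: "K \<in> M \<rightarrow>\<^sub>M prob_algebra N" and f[measurable]: "f \<in> borel_measurable N"
    and bd: "\<And>x. norm (f x) \<le> B"
  shows "(\<integral>x. f x \<partial>(M \<bind> K)) = (\<integral>x. (\<integral>y. f y \<partial>K x) \<partial>M)"
proof -
  interpret M: prob_space M by fact
  have K': "K \<in> M \<rightarrow>\<^sub>M subprob_algebra N" by (rule measurable_prob_algebraD[OF K])
  have pK: "prob_space (K x)" "sets (K x) = sets N" if "x \<in> space M" for x
    using measurable_space[OF K that] by (auto simp: space_prob_algebra)
  have pB: "prob_space (M \<bind> K)" "sets (M \<bind> K) = sets N"
    using prob_space_bind'[of M M K N] sets_bind[OF sets_kernel[OF K'] M.not_empty] M K by (auto simp: space_prob_algebra)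
  interpret B: prob_space "M \<bind> K" by (rule pB)
  have fB: "f \<in> borel_measurable (M \<bind> K)" using f pB(2) by (simp cong: measurable_cong_sets)
  have iB: "integrable (M \<bind> K) f" by (rule B.integrable_const_bound[of _ B]) (use fB bd in auto)
  have iK: "integrable (K x) f" if "x \<in> space M" for x
  proof -
    interpret k: prob_space "K x" using pK that by auto
    show ?thesis by (rule k.integrable_const_bound[of _ B]) (use pK(2)[OF that] f bd in \<open>auto cong: measurable_cong_sets\<close>)
  qed
  have nK: "norm (\<integral>y. f y \<partial>K x) \<le> B" if "x \<in> space M" for x
  proof -
    interpret k: prob_space "K x" using pK that by auto
    have "norm (\<integral>y. f y \<partial>K x) \<le> (\<integral>y. norm (f y) \<partial>K x)" by (rule integral_norm_bound)
    also have "\<dots> \<le> (\<integral>y. B \<partial>K x)" by (rule integral_mono) (use iK[OF that] bd in auto)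
    finally show ?thesis by (simp add: k.prob_space)
  qed
  have mK: "(\<lambda>x. \<integral>y. f y \<partial>K x) \<in> borel_measurable M" using K' by measurable
  have iM: "integrable M (\<lambda>x. \<integral>y. f y \<partial>K x)"
    by (rule M.integrable_const_bound[of _ B]) (use nK mK in auto)
  show ?thesis
  proof (rule complex_eqI)
    have "Re (\<integral>x. f x \<partial>(M \<bind> K)) = (\<integral>x. (\<integral>y. Re (f y) \<partial>K x) \<partial>M)"
      unfolding integral_Re[OF iB, symmetric] by (rule integral_bind_real[OF M.not_empty K']) (use iB in auto)
    also have "\<dots> = Re (\<integral>x. (\<integral>y. f y \<partial>K x) \<partial>M)"
      unfolding integral_Re[OF iM, symmetric] by (rule Bochner_Integration.integral_cong) (auto simp: integral_Re[OF iK])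
    finally show "Re (\<integral>x. f x \<partial>(M \<bind> K)) = Re (\<integral>x. (\<integral>y. f y \<partial>K x) \<partial>M)" .
    have "Im (\<integral>x. f x \<partial>(M \<bind> K)) = (\<integral>x. (\<integral>y. Im (f y) \<partial>K x) \<partial>M)"
      unfolding integral_Im[OF iB, symmetric] by (rule integral_bind_real[OF M.not_empty K']) (use iB in auto)
    also have "\<dots> = Im (\<integral>x. (\<integral>y. f y \<partial>K x) \<partial>M)"
      unfolding integral_Im[OF iM, symmetric] by (rule Bochner_Integration.integral_cong) (auto simp: integral_Im[OF iK])
    finally show "Im (\<integral>x. f x \<partial>(M \<bind> K)) = Im (\<integral>x. (\<integral>y. f y \<partial>K x) \<partial>M)" .
  qed
qed

lemma sums_integral_nat_pmf:
  fixes f :: "nat \<Rightarrow> 'b::{banach, second_countable_topology}"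
  assumes "integrable (measure_pmf p) f"
  shows "(\<lambda>k. pmf p k *\<^sub>R f k) sums (\<integral>k. f k \<partial>measure_pmf p)"
proof -
  have "integrable (count_space UNIV) (\<lambda>k. pmf p k *\<^sub>R f k)"
    using assms unfolding measure_pmf_eq_density by (subst (asm) integrable_density) auto
  then have "(\<lambda>k. pmf p k *\<^sub>R f k) sums (\<integral>k. pmf p k *\<^sub>R f k \<partial>count_space UNIV)"
    by (rule sums_integral_count_space_nat)
  also have "(\<integral>k. pmf p k *\<^sub>R f k \<partial>count_space UNIV) = (\<integral>k. f k \<partial>measure_pmf p)"
    unfolding measure_pmf_eq_density by (subst integral_density) auto
  finally show ?thesis .
qed

text \<open>The recursion \<open>k p(k) = m p(k - 1)\<close> of the Poisson weights, summed against
  \<phi>. At \<open>k = 0\<close> the truncated difference \<open>k - 1\<close> is harmless, since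
  the factor \<open>k\<close> vanishes.\<close>

lemma nn_integral_poisson_shift:
  assumes m: "m > 0"
  shows "(\<integral>\<^sup>+k. of_nat k * \<phi> (k - 1) \<partial>measure_pmf (poisson_pmf m)) = ennreal m * (\<integral>\<^sup>+k. \<phi> k \<partial>measure_pmf (poisson_pmf m))"
proof -
  have eq: "ennreal (pmf (poisson_pmf m) (Suc k)) * (of_nat (Suc k) * \<phi> k) = ennreal m * (ennreal (pmf (poisson_pmf m) k) * \<phi> k)" for k
  proof -
    have "pmf (poisson_pmf m) (Suc k) * real (Suc k) = m * pmf (poisson_pmf m) k"
      using m by (simp add: divide_simps del: of_nat_Suc)
    then have "ennreal (pmf (poisson_pmf m) (Suc k)) * ennreal (real (Suc k)) = ennreal m * ennreal (pmf (poisson_pmf m) k)"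
      using m by (metis ennreal_mult' less_imp_le pmf_nonneg)
    then show ?thesis by (simp add: mult.assoc[symmetric] ennreal_of_nat_eq_real_of_nat)
  qed
  have "(\<integral>\<^sup>+k. of_nat k * \<phi> (k - 1) \<partial>measure_pmf (poisson_pmf m)) = (\<Sum>k. ennreal (pmf (poisson_pmf m) k) * (of_nat k * \<phi> (k - 1)))"
    by (simp add: nn_integral_measure_pmf nn_integral_count_space_nat)
  also have "\<dots> = (\<Sum>k. ennreal (pmf (poisson_pmf m) (Suc k)) * (of_nat (Suc k) * \<phi> k))"
    by (subst suminf_offset[of _ 1]) (auto intro: summableI)
  also have "\<dots> = (\<Sum>k. ennreal m * (ennreal (pmf (poisson_pmf m) k) * \<phi> k))" by (simp only: eq)
  also have "\<dots> = ennreal m * (\<integral>\<^sup>+k. \<phi> k \<partial>measure_pmf (poisson_pmf m))"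
    by (simp add: nn_integral_measure_pmf nn_integral_count_space_nat)
  finally show ?thesis .
qed

lemma integral_poisson_shift:
  fixes \<phi> :: "nat \<Rightarrow> real"
  assumes m: "m > 0" and i: "integrable (measure_pmf (poisson_pmf m)) \<phi>"
  shows "(\<integral>k. real k * \<phi> (k - 1) \<partial>measure_pmf (poisson_pmf m)) = m * (\<integral>k. \<phi> k \<partial>measure_pmf (poisson_pmf m))"
proof -
  have "(\<integral>\<^sup>+k. ennreal (norm (real k * \<phi> (k - 1))) \<partial>measure_pmf (poisson_pmf m)) =
      (\<integral>\<^sup>+k. of_nat k * ennreal (norm (\<phi> (k - 1))) \<partial>measure_pmf (poisson_pmf m))"
    by (intro nn_integral_cong) (simp add: abs_mult ennreal_mult' ennreal_of_nat_eq_real_of_nat)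
  also have "\<dots> < \<infinity>" using i by (subst nn_integral_poisson_shift[OF m, of "\<lambda>k. ennreal (norm (\<phi> k))"]) (auto simp: integrable_iff_bounded ennreal_mult_less_top)
  finally have i2: "integrable (measure_pmf (poisson_pmf m)) (\<lambda>k. real k * \<phi> (k - 1))"
    by (auto simp: integrable_iff_bounded)
  have "(\<lambda>k. pmf (poisson_pmf m) (Suc k) *\<^sub>R (real (Suc k) * \<phi> k)) sums (\<integral>k. real k * \<phi> (k - 1) \<partial>measure_pmf (poisson_pmf m))"
    using sums_Suc_iff[of "\<lambda>k. pmf (poisson_pmf m) k *\<^sub>R (real k * \<phi> (k - 1))"] sums_integral_nat_pmf[OF i2] by simp
  also have "(\<lambda>k. pmf (poisson_pmf m) (Suc k) *\<^sub>R (real (Suc k) * \<phi> k)) = (\<lambda>k. m * (pmf (poisson_pmf m) k *\<^sub>R \<phi> k))"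
    using m by (auto simp: divide_simps simp del: of_nat_Suc)
  finally show ?thesis using sums_mult[OF sums_integral_nat_pmf[OF i], of m] by (metis sums_unique2)
qed

lemma exp_poisson:
  fixes z :: complex
  assumes m: "m > 0" and z: "norm z \<le> 1"
  shows "(\<integral>k. z ^ k \<partial>measure_pmf (poisson_pmf m)) = exp (of_real m * (z - 1))"
proof -
  have i: "integrable (measure_pmf (poisson_pmf m)) (\<lambda>k. z ^ k)"
    by (rule measure_pmf.integrable_const_bound[of _ 1]) (use z in \<open>auto simp: norm_power power_le_one\<close>)
  have "(\<lambda>k. (of_real m * z)^k /\<^sub>R fact k) sums exp (of_real m * z)" by (rule exp_converges)
  from sums_mult[OF this, of "exp (- of_real m)"]
  have "(\<lambda>k. pmf (poisson_pmf m) k *\<^sub>R z ^ k) sums (exp (- of_real m) * exp (of_real m * z))"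
    using m by (simp add: scaleR_conv_of_real power_mult_distrib divide_inverse mult_ac exp_of_real flip: of_real_minus of_real_inverse of_real_power)
  then have "(\<integral>k. z ^ k \<partial>measure_pmf (poisson_pmf m)) = exp (- of_real m) * exp (of_real m * z)"
    using sums_integral_nat_pmf[OF i] sums_unique2 by blast
  also have "\<dots> = exp (of_real m * (z - 1))" by (simp add: mult_exp_exp algebra_simps)
  finally show ?thesis .
qed

section \<open>Laws with finite second moment and their convolution powers\<close>

definition sq_moment :: "real measure \<Rightarrow> bool" where
  "sq_moment P \<longleftrightarrow> P \<in> space (prob_algebra borel) \<and> integrable P (\<lambda>x. x^2)"

lemma sq_momentD: assumes "sq_moment P" shows "prob_space P" "sets P = sets borel" "integrable P (\<lambda>x. x^2)"
  using assms by (auto simp: sq_moment_def space_prob_algebra)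

lemma quad_integrable:
  fixes f :: "real \<Rightarrow> real"
  assumes P: "sq_moment P" and [measurable]: "f \<in> borel_measurable borel" and b: "\<And>x. \<bar>f x\<bar> \<le> C * (1 + x^2)"
  shows "integrable P f"
proof -
  note [measurable_cong] = sq_momentD(2)[OF P]
  interpret prob_space P using sq_momentD[OF P] by auto
  show ?thesis
  proof (rule Bochner_Integration.integrable_bound)
    show "integrable P (\<lambda>x. C * (1 + x^2))" using sq_momentD[OF P] by auto
    show "AE x in P. norm (f x) \<le> norm (C * (1 + x^2))" using b by (auto intro: order_trans[OF _ abs_ge_self])
  qed measurable
qed

lemma quad_integrable_pair:
  fixes f :: "real \<times> real \<Rightarrow> real"
  assumes P: "sq_moment P" and Q: "sq_moment Q" and [measurable]: "f \<in> borel_measurable borel"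
    and b: "\<And>x y. \<bar>f (x, y)\<bar> \<le> C * (1 + x^2 + y^2)"
  shows "integrable (P \<Otimes>\<^sub>M Q) f"
proof -
  note [measurable_cong] = sq_momentD(2)[OF P] sq_momentD(2)[OF Q]
  interpret P: prob_space P using sq_momentD[OF P] by auto
  interpret Q: prob_space Q using sq_momentD[OF Q] by auto
  interpret PQ: pair_prob_space P Q ..
  have [measurable]: "f \<in> borel_measurable (P \<Otimes>\<^sub>M Q)"
    using assms(3) by (simp add: borel_prod[symmetric] cong: measurable_cong_sets)


  have "distr (P \<Otimes>\<^sub>M Q) P fst = P" by (rule Q.distr_pair_fst)
  then have 1: "integrable (P \<Otimes>\<^sub>M Q) (\<lambda>z. (fst z)^2)"
    using sq_momentD(3)[OF P] integrable_distr[of fst "P \<Otimes>\<^sub>M Q" P "\<lambda>x. x^2"] by simp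
  interpret QP: pair_prob_space Q P ..
  have "distr (Q \<Otimes>\<^sub>M P) Q fst = Q" by (rule P.distr_pair_fst)
  then have "integrable (Q \<Otimes>\<^sub>M P) (\<lambda>z. (fst z)^2)"
    using sq_momentD(3)[OF Q] integrable_distr[of fst "Q \<Otimes>\<^sub>M P" Q "\<lambda>x. x^2"] by simp
  from QP.integrable_product_swap[OF this]
  have 2: "integrable (P \<Otimes>\<^sub>M Q) (\<lambda>z. (snd z)^2)" by (simp add: case_prod_beta')
  show ?thesis
  proof (rule Bochner_Integration.integrable_bound)
    show "integrable (P \<Otimes>\<^sub>M Q) (\<lambda>z. C * (1 + (fst z)^2 + (snd z)^2))" using 1 2 by auto
    have "norm (f x) \<le> norm (C * (1 + (fst x)^2 + (snd x)^2))" for x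
      using b[of "fst x" "snd x"] by simp
    then show "AE x in P \<Otimes>\<^sub>M Q. norm (f x) \<le> norm (C * (1 + (fst x)^2 + (snd x)^2))" by simp
  qed measurable
qed

primrec conv_pow :: "real measure \<Rightarrow> nat \<Rightarrow> real measure" where
  "conv_pow P 0 = return borel 0"
| "conv_pow P (Suc k) = distr (P \<Otimes>\<^sub>M conv_pow P k) borel (\<lambda>(x, y). x + y)"

lemma conv_pow_kernel[measurable]:
  assumes [measurable]: "K \<in> M \<rightarrow>\<^sub>M prob_algebra borel"
  shows "(\<lambda>x. conv_pow (K x) k) \<in> M \<rightarrow>\<^sub>M prob_algebra borel"
  by (induction k) (simp_all, measurable)

lemma conv_pow_prob:
  assumes "P \<in> space (prob_algebra borel)"
  shows "conv_pow P k \<in> space (prob_algebra borel)"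
  using measurable_space[OF conv_pow_kernel[of "\<lambda>P. P" "prob_algebra borel" k], of P] assms by simp

lemma sq_moment_distr_add:
  assumes P: "sq_moment P" and Q: "sq_moment Q"
  shows "sq_moment (distr (P \<Otimes>\<^sub>M Q) borel (\<lambda>(x, y). x + y))"
proof -
  note [measurable_cong] = sq_momentD(2)[OF P] sq_momentD(2)[OF Q]
  interpret P: prob_space P using sq_momentD[OF P] by auto
  interpret Q: prob_space Q using sq_momentD[OF Q] by auto
  interpret PQ: pair_prob_space P Q ..
  have 1: "prob_space (distr (P \<Otimes>\<^sub>M Q) borel (\<lambda>(x, y). x + y))"
    by (rule PQ.prob_space_distr) measurable
  have "integrable (P \<Otimes>\<^sub>M Q) (\<lambda>z. (fst z + snd z)^2)"
  proof (rule quad_integrable_pair[OF P Q, where C=2])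
    show "\<bar>(fst (x, y) + snd (x, y))\<^sup>2\<bar> \<le> 2 * (1 + x\<^sup>2 + y\<^sup>2)" for x y :: real
    proof -
      have "(x + y)^2 \<le> 2 * (1 + x\<^sup>2 + y\<^sup>2)" using sum_squares_bound[of x y] by (simp add: power2_sum)
      then show ?thesis by simp
    qed
  qed (auto simp: borel_prod[symmetric])
  then have "integrable (distr (P \<Otimes>\<^sub>M Q) borel (\<lambda>(x, y). x + y)) (\<lambda>x. x^2)"
    by (subst integrable_distr_eq) (auto simp: case_prod_beta)
  with 1 show ?thesis by (auto simp: sq_moment_def space_prob_algebra)
qed

lemma sq_moment_return: "sq_moment (return borel x)"
  by (auto simp: sq_moment_def space_prob_algebra prob_space_return integrable_iff_bounded nn_integral_return)

lemma sq_moment_conv_pow: "sq_moment P \<Longrightarrow> sq_moment (conv_pow P k)"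
  by (induction k) (auto intro: sq_moment_return sq_moment_distr_add)

lemma integral_distr_add:
  fixes f :: "real \<Rightarrow> real"
  assumes P: "sq_moment P" and Q: "sq_moment Q" and [measurable]: "f \<in> borel_measurable borel" and b: "\<And>x. \<bar>f x\<bar> \<le> C * (1 + x^2)"
  shows "(\<integral>x. f x \<partial>distr (P \<Otimes>\<^sub>M Q) borel (\<lambda>(x, y). x + y)) = (\<integral>x. (\<integral>y. f (x + y) \<partial>Q) \<partial>P)"
proof -
  note [measurable_cong] = sq_momentD(2)[OF P] sq_momentD(2)[OF Q]
  interpret P: prob_space P using sq_momentD[OF P] by auto
  interpret Q: prob_space Q using sq_momentD[OF Q] by auto
  interpret PQ: pair_prob_space P Q ..
  have C: "C \<ge> 0" using b[of 0] by simp
  have i: "integrable (P \<Otimes>\<^sub>M Q) (\<lambda>z. f (fst z + snd z))"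
  proof (rule quad_integrable_pair[OF P Q, where C="2 * C"])
    show "\<bar>f (fst (x, y) + snd (x, y))\<bar> \<le> 2 * C * (1 + x\<^sup>2 + y\<^sup>2)" for x y :: real
    proof -
      have "1 + (x + y)^2 \<le> 2 * (1 + x^2 + y^2)" using sum_squares_bound[of x y] by (simp add: power2_sum)
      from mult_left_mono[OF this C] show ?thesis using b[of "x + y"] by (simp add: mult_ac)
    qed
  qed (auto simp: borel_prod[symmetric])
  show ?thesis using PQ.integral_fst'[OF i]
    by (subst integral_distr) (auto simp: case_prod_beta)
qed

lemma char_distr_add':
  assumes P: "P \<in> space (prob_algebra borel)" and Q: "Q \<in> space (prob_algebra borel)"
  shows "char (distr (P \<Otimes>\<^sub>M Q) borel (\<lambda>(x, y). x + y)) t = char P t * char Q t"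
proof -
  have s[measurable_cong]: "sets P = sets borel" "sets Q = sets borel" using P Q by (auto simp: space_prob_algebra)
  interpret P: prob_space P using P by (auto simp: space_prob_algebra)
  interpret Q: prob_space Q using Q by (auto simp: space_prob_algebra)
  interpret PQ: pair_prob_space P Q ..
  have i: "integrable (P \<Otimes>\<^sub>M Q) (\<lambda>z. iexp (t * (fst z + snd z)))"
    by (rule PQ.integrable_const_bound[of _ 1]) (auto, measurable)
  have "char (distr (P \<Otimes>\<^sub>M Q) borel (\<lambda>(x, y). x + y)) t = (\<integral>z. iexp (t * (fst z + snd z)) \<partial>(P \<Otimes>\<^sub>M Q))"
    unfolding char_def by (subst integral_distr) (auto simp: case_prod_beta)
  also have "\<dots> = (\<integral>x. (\<integral>y. iexp (t * (x + y)) \<partial>Q) \<partial>P)" using PQ.integral_fst'[OF i] by simp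
  also have "\<dots> = (\<integral>x. (\<integral>y. iexp (t * x) * iexp (t * y) \<partial>Q) \<partial>P)"
    by (simp add: mult_exp_exp algebra_simps)
  also have "\<dots> = char P t * char Q t" unfolding char_def by simp
  finally show ?thesis .
qed

lemma char_conv_pow:
  assumes P: "P \<in> space (prob_algebra borel)"
  shows "char (conv_pow P k) t = char P t ^ k"
proof (induction k)
  case 0
  then show ?case by (simp add: char_def integral_return)
next
  case (Suc k)
  then show ?case using char_distr_add'[OF P conv_pow_prob[OF P], of k t] by simp
qed


lemma integral_abs_le_quad:
  assumes P: "sq_moment P"
  shows "integrable P (\<lambda>x. \<bar>x\<bar>)" "integrable P (\<lambda>x. x)"
proof -
  have b: "\<bar>x\<bar> \<le> 1 * (1 + x^2)" for x :: real
    using sum_squares_bound[of "\<bar>x\<bar>" 1] by simp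
  show "integrable P (\<lambda>x. \<bar>x\<bar>)" "integrable P (\<lambda>x. x)"
    by (rule quad_integrable[OF P, where C=1]; use b in simp)+
qed

lemma abs_le_one_plus_sq: "\<bar>x\<bar> \<le> 1 + (x::real)^2"
  using sum_squares_bound[of "\<bar>x\<bar>" 1] by simp

text \<open>The class contains the solutions of Stein's equation as well as the identity and the
  constants, so that one identity for compound Poisson laws yields the error estimate, the mean and
  the variance.\<close>

definition lin_growth :: "(real \<Rightarrow> real) \<Rightarrow> bool" where
  "lin_growth f \<longleftrightarrow> f \<in> borel_measurable borel \<and> (\<exists>C\<ge>0. \<forall>x. \<bar>f x\<bar> \<le> C * (1 + \<bar>x\<bar>))"

lemma lin_growth_shift: assumes "lin_growth f" shows "lin_growth (\<lambda>x. f (x + c))"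
proof -
  obtain C where C: "C \<ge> 0" "\<And>x. \<bar>f x\<bar> \<le> C * (1 + \<bar>x\<bar>)" and [measurable]: "f \<in> borel_measurable borel"
    using assms by (auto simp: lin_growth_def)
  have "\<bar>f (x + c)\<bar> \<le> (C * (1 + \<bar>c\<bar>)) * (1 + \<bar>x\<bar>)" for x
  proof -
    have "\<bar>f (x + c)\<bar> \<le> C * (1 + \<bar>x + c\<bar>)" by (rule C)
    also have "\<dots> \<le> C * ((1 + \<bar>c\<bar>) * (1 + \<bar>x\<bar>))"
      by (rule mult_left_mono[OF _ C(1)]) (simp add: algebra_simps, smt (verit) abs_ge_zero mult_nonneg_nonneg)
    finally show ?thesis by (simp add: mult.assoc)
  qed
  moreover have "C * (1 + \<bar>c\<bar>) \<ge> 0" using C by simp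
  ultimately show ?thesis unfolding lin_growth_def by auto
qed

lemma quad_aux: "\<bar>y\<bar> + \<bar>x\<bar> * \<bar>y\<bar> + \<bar>y\<bar>^2 \<le> 3 * (1 + x^2 + (y::real)^2)"
proof -
  have "2 * (\<bar>x\<bar> * \<bar>y\<bar>) \<le> x^2 + y^2" using sum_squares_bound[of "\<bar>x\<bar>" "\<bar>y\<bar>"] by (simp add: mult.assoc)
  moreover have "\<bar>y\<bar> \<le> 1 + y^2" by (rule abs_le_one_plus_sq)
  moreover have "x^2 \<ge> 0" "y^2 \<ge> 0" by auto
  moreover have "\<bar>y\<bar>^2 = y^2" by simp
  ultimately show ?thesis unfolding distrib_left by linarith
qed

lemma lin_growth_mult_quad:
  assumes "lin_growth f" obtains C where "C \<ge> 0" "\<And>x y. \<bar>y * f (x + y)\<bar> \<le> C * (1 + x^2 + y^2)"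
proof -
  obtain C where C: "C \<ge> 0" "\<And>x. \<bar>f x\<bar> \<le> C * (1 + \<bar>x\<bar>)"
    using assms by (auto simp: lin_growth_def)
  have "\<bar>y * f (x + y)\<bar> \<le> (3 * C) * (1 + x^2 + y^2)" for x y
  proof -
    have "\<bar>y * f (x + y)\<bar> \<le> \<bar>y\<bar> * (C * (1 + \<bar>x + y\<bar>))" unfolding abs_mult by (intro mult_left_mono C) auto
    also have "\<dots> \<le> \<bar>y\<bar> * (C * (1 + \<bar>x\<bar> + \<bar>y\<bar>))" using C(1) by (intro mult_left_mono) auto
    also have "\<dots> = C * (\<bar>y\<bar> + \<bar>x\<bar> * \<bar>y\<bar> + \<bar>y\<bar>^2)" by (simp add: algebra_simps power2_eq_square)
    also have "\<dots> \<le> C * (3 * (1 + x^2 + y^2))"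
    proof (rule mult_left_mono[OF _ C(1)])
      show "\<bar>y\<bar> + \<bar>x\<bar> * \<bar>y\<bar> + \<bar>y\<bar>^2 \<le> 3 * (1 + x^2 + y^2)" by (rule quad_aux)
    qed
    finally show ?thesis by (simp add: algebra_simps)
  qed
  moreover have "3 * C \<ge> 0" using C by simp
  ultimately show thesis using that by blast
qed

text \<open>Integrating out one jump turns linear growth of \<open>f\<close> into at most quadratic
  growth, which every law with a finite second moment can still integrate.\<close>

lemma inner_quad:
  assumes P: "sq_moment P" and f: "lin_growth f"
  obtains C where "(\<lambda>x. \<integral>y. y * f (x + y) \<partial>P) \<in> borel_measurable borel" "\<And>x. \<bar>\<integral>y. y * f (x + y) \<partial>P\<bar> \<le> C * (1 + x^2)"
    "\<And>x. integrable P (\<lambda>y. y * f (x + y))"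
proof -
  obtain C where C: "C \<ge> 0" "\<And>x y. \<bar>y * f (x + y)\<bar> \<le> C * (1 + x^2 + y^2)" by (rule lin_growth_mult_quad[OF f]) blast
  have [measurable]: "f \<in> borel_measurable borel" using f by (auto simp: lin_growth_def)
  note [measurable_cong] = sq_momentD(2)[OF P]
  interpret P: prob_space P using sq_momentD[OF P] by auto
  define S where "S = (\<integral>y. y^2 \<partial>P)"
  have S: "S \<ge> 0" by (simp add: S_def)
  have i: "integrable P (\<lambda>y. C * (1 + x^2 + y^2))" for x using sq_momentD[OF P] by auto
  have i2: "integrable P (\<lambda>y. y * f (x + y))" for x
    by (rule Bochner_Integration.integrable_bound[OF i[of x]]) (use C in \<open>auto intro: order_trans[OF _ abs_ge_self]\<close>)
  have "\<bar>\<integral>y. y * f (x + y) \<partial>P\<bar> \<le> (C * (1 + S)) * (1 + x^2)" for x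
  proof -
    have "\<bar>\<integral>y. y * f (x + y) \<partial>P\<bar> \<le> (\<integral>y. \<bar>y * f (x + y)\<bar> \<partial>P)" by (rule integral_abs_bound)
    also have "\<dots> \<le> (\<integral>y. C * (1 + x^2 + y^2) \<partial>P)" using C i i2 by (intro integral_mono) auto
    also have "\<dots> = C * (1 + x^2 + S)" using sq_momentD[OF P] by (simp add: S_def P.prob_space)
    also have "\<dots> \<le> C * ((1 + S) * (1 + x^2))" using C S by (intro mult_left_mono) (auto simp: algebra_simps)
    finally show ?thesis by (simp add: mult.assoc)
  qed
  moreover have "(\<lambda>x. \<integral>y. y * f (x + y) \<partial>P) \<in> borel_measurable borel" by measurable
  ultimately show thesis using that i2 by blast
qed

text \<open>In a sum of \<open>k\<close> independent copies of a jump, exchangeability replaces the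
  factor \<open>x\<close> by \<open>k\<close> times one jump that is independent of the sum of the
  other \<open>k - 1\<close>. The induction splits off one jump: its own term already has this form,
  and the rest of the sum is treated by the induction hypothesis for a shift of \<open>f\<close>,
  which is why \<open>f\<close> is arbitrary there.\<close>

lemma conv_pow_stein:
  assumes P: "sq_moment P" and f: "lin_growth f"
  shows "(\<integral>x. x * f x \<partial>conv_pow P k) = real k * (\<integral>x. (\<integral>y. y * f (x + y) \<partial>P) \<partial>conv_pow P (k - 1))"
  using f
proof (induction k arbitrary: f)
  case 0
  have [measurable]: "f \<in> borel_measurable borel" using 0 by (auto simp: lin_growth_def)
  show ?case by (simp add: integral_return)
next
  case (Suc k)
  have [measurable]: "f \<in> borel_measurable borel" using Suc.prems by (auto simp: lin_growth_def)
  note [measurable_cong] = sq_momentD(2)[OF P] sq_momentD(2)[OF sq_moment_conv_pow[OF P]]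
  let ?Q = "conv_pow P k"
  interpret P: prob_space P using sq_momentD[OF P] by auto
  interpret Q: prob_space ?Q using sq_momentD[OF sq_moment_conv_pow[OF P]] by auto
  interpret PQ: pair_prob_space P ?Q ..
  obtain C where C: "C \<ge> 0" "\<And>x y. \<bar>y * f (x + y)\<bar> \<le> C * (1 + x^2 + y^2)" by (rule lin_growth_mult_quad[OF Suc.prems]) blast
  have i1: "integrable (P \<Otimes>\<^sub>M ?Q) (\<lambda>z. fst z * f (snd z + fst z))"
    by (rule quad_integrable_pair[OF P sq_moment_conv_pow[OF P], where C=C])
      (use C in \<open>auto simp: borel_prod[symmetric] add_ac\<close>)
  have C': "\<bar>y * f (y + x)\<bar> \<le> C * (1 + x\<^sup>2 + y\<^sup>2)" for x y using C(2)[of y x] by (simp add: add.commute)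
  have i2: "integrable (P \<Otimes>\<^sub>M ?Q) (\<lambda>z. snd z * f (snd z + fst z))"
    by (rule quad_integrable_pair[OF P sq_moment_conv_pow[OF P], where C=C]) (use C' in \<open>auto simp: borel_prod[symmetric]\<close>)
  have "(\<integral>x. x * f x \<partial>conv_pow P (Suc k)) = (\<integral>z. (snd z + fst z) * f (snd z + fst z) \<partial>(P \<Otimes>\<^sub>M ?Q))"
    by (simp add: integral_distr case_prod_beta add.commute)
  also have "\<dots> = (\<integral>z. fst z * f (snd z + fst z) \<partial>(P \<Otimes>\<^sub>M ?Q)) + (\<integral>z. snd z * f (snd z + fst z) \<partial>(P \<Otimes>\<^sub>M ?Q))"
    by (subst Bochner_Integration.integral_add[OF i1 i2, symmetric]) (simp add: algebra_simps)
  also have "(\<integral>z. snd z * f (snd z + fst z) \<partial>(P \<Otimes>\<^sub>M ?Q)) = (\<integral>y. (\<integral>x. x * f (x + y) \<partial>?Q) \<partial>P)"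
    using PQ.integral_fst'[OF i2] by simp
  also have "\<dots> = (\<integral>z. real k * (\<integral>x. (\<integral>y. y * f (x + y + z) \<partial>P) \<partial>conv_pow P (k - 1)) \<partial>P)"
    using Suc.IH[OF lin_growth_shift[OF Suc.prems]] by simp
  \<comment> \<open>The jump that was split off joins the other \<open>k - 1\<close> again and
    completes the convolution power of order \<open>k\<close>. For \<open>k = 0\<close> both sides
    carry the factor 0.\<close>
  also have "\<dots> = real k * (\<integral>x. (\<integral>y. y * f (x + y) \<partial>P) \<partial>?Q)"
  proof (cases k)
    case (Suc j)
    obtain D where D: "(\<lambda>x. \<integral>y. y * f (x + y) \<partial>P) \<in> borel_measurable borel" "\<And>x. \<bar>\<integral>y. y * f (x + y) \<partial>P\<bar> \<le> D * (1 + x^2)"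
      using inner_quad[OF P Suc.prems] by blast
    have "(\<integral>x. (\<integral>y. y * f (x + y) \<partial>P) \<partial>?Q) = (\<integral>z. (\<integral>x. (\<integral>y. y * f (z + x + y) \<partial>P) \<partial>conv_pow P j) \<partial>P)"
      unfolding Suc conv_pow.simps by (rule integral_distr_add[OF P sq_moment_conv_pow[OF P] D])
    then show ?thesis by (simp add: Suc add_ac)
  qed simp
  also have "(\<integral>z. fst z * f (snd z + fst z) \<partial>(P \<Otimes>\<^sub>M ?Q)) = (\<integral>x. (\<integral>y. y * f (x + y) \<partial>P) \<partial>?Q)"
    using PQ.integral_snd[of "\<lambda>x y. x * f (y + x)"] i1 by (simp add: case_prod_beta' split_beta')
  finally show ?case by (simp add: algebra_simps)
qed


section \<open>Compound Poisson laws and Stein's identity for them\<close>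

definition comp_poisson :: "real \<Rightarrow> real measure \<Rightarrow> real measure" where
  "comp_poisson m P = measure_pmf (poisson_pmf m) \<bind> conv_pow P"

lemma measure_pmf_prob_algebra: "measure_pmf p \<in> space (prob_algebra (count_space UNIV))"
  by (auto simp: space_prob_algebra measure_pmf.prob_space_axioms)

lemma comp_poisson_kernel[measurable]:
  assumes [measurable]: "K \<in> M \<rightarrow>\<^sub>M prob_algebra borel"
  shows "(\<lambda>x. comp_poisson m (K x)) \<in> M \<rightarrow>\<^sub>M prob_algebra borel"
  unfolding comp_poisson_def
proof (rule measurable_bind_prob_space2)
  show "(\<lambda>x. measure_pmf (poisson_pmf m)) \<in> M \<rightarrow>\<^sub>M prob_algebra (count_space UNIV)"
    by (rule measurable_const[OF measure_pmf_prob_algebra])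
  show "(\<lambda>(x, y). conv_pow (K x) y) \<in> M \<Otimes>\<^sub>M count_space UNIV \<rightarrow>\<^sub>M prob_algebra borel"
    using measurable_compose_countable[where f="\<lambda>i z. conv_pow (K (fst z)) i" and g=snd and M="M \<Otimes>\<^sub>M count_space UNIV" and N="prob_algebra borel"]
    by (simp add: case_prod_beta')
qed

lemma comp_poisson_prob:
  assumes "P \<in> space (prob_algebra borel)"
  shows "comp_poisson m P \<in> space (prob_algebra borel)"
  using measurable_space[OF comp_poisson_kernel[of "\<lambda>P. P" "prob_algebra borel" m], of P] assms by simp

lemma conv_pow_kernel_nat:
  assumes "P \<in> space (prob_algebra borel)"
  shows "conv_pow P \<in> measure_pmf p \<rightarrow>\<^sub>M prob_algebra borel"
  using conv_pow_prob[OF assms] by (simp add: Pi_def)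

lemma char_comp_poisson:
  assumes m: "m > 0" and P: "P \<in> space (prob_algebra borel)"
  shows "char (comp_poisson m P) t = exp (of_real m * (char P t - 1))"
proof -
  interpret P: real_distribution P using P by (auto simp: space_prob_algebra real_distribution_def real_distribution_axioms_def)
  have "char (comp_poisson m P) t = (\<integral>k. char (conv_pow P k) t \<partial>measure_pmf (poisson_pmf m))"
    unfolding comp_poisson_def char_def
    by (rule integral_bind_complex[OF measure_pmf.prob_space_axioms conv_pow_kernel_nat[OF P], where B=1]) auto
  also have "\<dots> = exp (of_real m * (char P t - 1))"
    by (simp add: char_conv_pow[OF P] exp_poisson[OF m P.cmod_char_le_1])
  finally show ?thesis .
qed

text \<open>A crude bound by the square of the number of summands is enough: it serves to show that
  the second moment stays finite after averaging over a Poisson number of summands.\<close>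

lemma conv_pow_sq_bound:
  assumes P: "sq_moment P"
  shows "(\<integral>\<^sup>+x. ennreal (x^2) \<partial>conv_pow P k) \<le> of_nat (k * k) * (\<integral>\<^sup>+x. ennreal (x^2) \<partial>P)"
proof -
  let ?S = "\<integral>\<^sup>+x. ennreal (x^2) \<partial>P"
  have "(\<integral>x. x^2 \<partial>conv_pow P k) \<le> real (k * k) * (\<integral>x. x^2 \<partial>P)"
  proof (induction k)
    case 0
    show ?case by (simp add: integral_return)
  next
    case (Suc k)
    note Q = sq_moment_conv_pow[OF P, of k]
    interpret P: prob_space P using sq_momentD[OF P] by auto
    interpret Q: prob_space "conv_pow P k" using sq_momentD[OF Q] by auto
    define M where "M = (\<integral>x. x^2 \<partial>P)"
    have iQ: "integrable (conv_pow P k) (\<lambda>y. (x + y)^2)" for x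
    proof (rule quad_integrable[OF Q, where C="2 * (1 + x^2)"])
      fix y
      have "(x + y)^2 \<le> 2 * x^2 + 2 * y^2" using sum_squares_bound[of x y] by (simp add: power2_sum)
      also have "\<dots> \<le> 2 * (1 + x^2) * (1 + y^2)" by (simp add: algebra_simps)
      finally show "\<bar>(x + y)\<^sup>2\<bar> \<le> 2 * (1 + x\<^sup>2) * (1 + y\<^sup>2)" by simp
    qed auto
    show ?case
    proof (cases "k = 0")
      case True
      have "(\<integral>x. x^2 \<partial>conv_pow P (Suc k)) = (\<integral>x. (\<integral>y. (x + y)^2 \<partial>return borel 0) \<partial>P)"
        unfolding conv_pow.simps True using sq_momentD[OF P]
        by (intro integral_distr_add[OF P sq_moment_return, where C=1]) auto
      then show ?thesis by (simp add: True integral_return)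
    next
      case False
      have "(\<integral>x. x^2 \<partial>conv_pow P (Suc k)) = (\<integral>x. (\<integral>y. (x + y)^2 \<partial>conv_pow P k) \<partial>P)"
        unfolding conv_pow.simps by (intro integral_distr_add[OF P Q, where C=1]) auto
      also have "\<dots> \<le> (\<integral>x. (1 + real k) * x^2 + (1 + 1 / real k) * (\<integral>y. y^2 \<partial>conv_pow P k) \<partial>P)"
      proof (rule integral_mono')
        show "integrable P (\<lambda>x. (1 + real k) * x^2 + (1 + 1 / real k) * (\<integral>y. y^2 \<partial>conv_pow P k))"
          using sq_momentD[OF P] by auto
        fix x
        have "(\<integral>y. (x + y)^2 \<partial>conv_pow P k) \<le> (\<integral>y. (1 + real k) * x^2 + (1 + 1 / real k) * y^2 \<partial>conv_pow P k)"
        proof (rule integral_mono[OF iQ])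
          show "integrable (conv_pow P k) (\<lambda>y. (1 + real k) * x^2 + (1 + 1 / real k) * y^2)" using sq_momentD[OF Q] by auto
          fix y
          \<comment> \<open>The weights \<open>1 + k\<close> and \<open>1 + 1 / k\<close> are chosen
            such that \<open>(1 + k) + (1 + 1 / k) * k^2 = (k + 1)^2\<close>.\<close>
          have "0 \<le> (real k * x - y)^2 / real k" by simp
          also have "\<dots> = (1 + real k) * x^2 + (1 + 1 / real k) * y^2 - (x + y)^2"
            using False by (simp add: field_simps power2_eq_square)
          finally show "(x + y)^2 \<le> (1 + real k) * x^2 + (1 + 1 / real k) * y^2" by simp
        qed
        also have "\<dots> = (1 + real k) * x^2 + (1 + 1 / real k) * (\<integral>y. y^2 \<partial>conv_pow P k)"
          using sq_momentD[OF Q] by (simp add: Q.prob_space)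
        finally show "(\<integral>y. (x + y)^2 \<partial>conv_pow P k) \<le> (1 + real k) * x^2 + (1 + 1 / real k) * (\<integral>y. y^2 \<partial>conv_pow P k)" .
      qed (auto intro!: integral_nonneg_AE)
      also have "\<dots> = (1 + real k) * M + (1 + 1 / real k) * (\<integral>y. y^2 \<partial>conv_pow P k)"
        using sq_momentD[OF P] by (simp add: P.prob_space M_def)
      also have "\<dots> \<le> (1 + real k) * M + (1 + 1 / real k) * (real (k * k) * M)"
        using Suc by (intro add_left_mono mult_left_mono) (auto simp: M_def)
      also have "\<dots> = real (Suc k * Suc k) * M" using False by (simp add: field_simps)
      finally show ?thesis by (simp add: M_def)
    qed
  qed
  then have "ennreal (\<integral>x. x^2 \<partial>conv_pow P k) \<le> ennreal (real (k * k) * (\<integral>x. x^2 \<partial>P))" by (rule ennreal_leI)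
  then show ?thesis
    using sq_momentD(3)[OF P] sq_momentD(3)[OF sq_moment_conv_pow[OF P, of k]]
    by (simp add: nn_integral_eq_integral ennreal_mult ennreal_of_nat_eq_real_of_nat del: of_nat_mult)
qed

lemma sq_moment_comp_poisson:
  assumes m: "m > 0" and P: "sq_moment P"
  shows "sq_moment (comp_poisson m P)"
proof -
  have P': "P \<in> space (prob_algebra borel)" using P by (simp add: sq_moment_def)
  have CP: "comp_poisson m P \<in> space (prob_algebra borel)" by (rule comp_poisson_prob[OF P'])
  note k = conv_pow_kernel_nat[OF P', of "poisson_pmf m", THEN measurable_prob_algebraD]
  have [measurable_cong]: "sets (comp_poisson m P) = sets borel" using CP by (auto simp: space_prob_algebra)
  have S: "(\<integral>\<^sup>+x. ennreal (x^2) \<partial>P) < \<infinity>" using sq_momentD(3)[OF P] by (auto simp: integrable_iff_bounded)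
  have "(\<integral>\<^sup>+x. ennreal (x^2) \<partial>comp_poisson m P) = (\<integral>\<^sup>+k. (\<integral>\<^sup>+x. ennreal (x^2) \<partial>conv_pow P k) \<partial>measure_pmf (poisson_pmf m))"
    unfolding comp_poisson_def by (rule nn_integral_bind[OF _ k]) auto
  also have "\<dots> \<le> (\<integral>\<^sup>+k. of_nat (k * k) * (\<integral>\<^sup>+x. ennreal (x^2) \<partial>P) \<partial>measure_pmf (poisson_pmf m))"
    by (intro nn_integral_mono conv_pow_sq_bound[OF P])
  also have "\<dots> = (\<integral>\<^sup>+k. of_nat (k * k) \<partial>measure_pmf (poisson_pmf m)) * (\<integral>\<^sup>+x. ennreal (x^2) \<partial>P)"
    by (rule nn_integral_multc) auto
  \<comment> \<open>Writing \<open>k * k\<close> as \<open>k * ((k - 1) + 1)\<close> opens the way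
    to the shift of the Poisson weights, which evaluates the second moment as
    \<open>m * (m + 1)\<close>.\<close>
  also have "(\<integral>\<^sup>+k. of_nat (k * k) \<partial>measure_pmf (poisson_pmf m)) = (\<integral>\<^sup>+k. of_nat k * of_nat (k - 1 + 1) \<partial>measure_pmf (poisson_pmf m))"
  proof (intro nn_integral_cong)
    fix k :: nat
    have "k * k = k * (k - 1 + 1)" by (cases k) auto
    then show "of_nat (k * k) = (of_nat k * of_nat (k - 1 + 1) :: ennreal)" by (metis of_nat_mult)
  qed
  also have "\<dots> = ennreal m * (\<integral>\<^sup>+k. of_nat (k + 1) \<partial>measure_pmf (poisson_pmf m))"
    by (rule nn_integral_poisson_shift[OF m])
  also have "(\<integral>\<^sup>+k. of_nat (k + 1) \<partial>measure_pmf (poisson_pmf m)) = (\<integral>\<^sup>+k. of_nat k \<partial>measure_pmf (poisson_pmf m)) + 1"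
    by (simp add: nn_integral_add measure_pmf.emeasure_space_1[simplified])
  also have "(\<integral>\<^sup>+k. of_nat k \<partial>measure_pmf (poisson_pmf m)) = ennreal m"
    using nn_integral_poisson_shift[OF m, of "\<lambda>_. 1"] by (simp add: measure_pmf.emeasure_space_1[simplified])
  finally have "(\<integral>\<^sup>+x. ennreal (x^2) \<partial>comp_poisson m P) \<le> ennreal m * (ennreal m + 1) * (\<integral>\<^sup>+x. ennreal (x^2) \<partial>P)" .
  also have "\<dots> < \<infinity>" using S by (auto simp: ennreal_mult_less_top)
  finally have "integrable (comp_poisson m P) (\<lambda>x. x^2)" by (auto simp: integrable_iff_bounded)
  then show ?thesis using CP by (simp add: sq_moment_def)
qed

text \<open>Conditionally on the number \<open>k\<close> of jumps, \<open>conv_pow_stein\<close>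
  yields the factor \<open>k\<close> and removes one jump. Averaging over the Poisson number turns
  \<open>k\<close> into \<open>m\<close> and restores the number of jumps.\<close>

lemma comp_poisson_stein:
  assumes m: "m > 0" and P: "sq_moment P" and f: "lin_growth f"
  shows "(\<integral>x. x * f x \<partial>comp_poisson m P) = m * (\<integral>x. (\<integral>y. y * f (x + y) \<partial>P) \<partial>comp_poisson m P)"
proof -
  have P': "P \<in> space (prob_algebra borel)" using P by (simp add: sq_moment_def)
  note k = conv_pow_kernel_nat[OF P', of "poisson_pmf m", THEN measurable_prob_algebraD]
  note Q = sq_moment_comp_poisson[OF m P]
  have [measurable]: "f \<in> borel_measurable borel" using f by (auto simp: lin_growth_def)
  obtain D where D: "(\<lambda>x. \<integral>y. y * f (x + y) \<partial>P) \<in> borel_measurable borel" "\<And>x. \<bar>\<integral>y. y * f (x + y) \<partial>P\<bar> \<le> D * (1 + x^2)"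
    using inner_quad[OF P f] by blast
  obtain C where C: "C \<ge> 0" "\<And>x y. \<bar>y * f (x + y)\<bar> \<le> C * (1 + x^2 + y^2)" by (rule lin_growth_mult_quad[OF f]) blast
  have i1: "integrable (comp_poisson m P) (\<lambda>x. x * f x)"
    by (rule quad_integrable[OF Q, where C=C]) (use C(2)[of _ 0] in auto)
  have i2: "integrable (comp_poisson m P) (\<lambda>x. \<integral>y. y * f (x + y) \<partial>P)"
    by (rule quad_integrable[OF Q D])
  define U where "U k = (\<integral>x. (\<integral>y. y * f (x + y) \<partial>P) \<partial>conv_pow P k)" for k
  have U: "(\<integral>x. (\<integral>y. y * f (x + y) \<partial>P) \<partial>comp_poisson m P) = (\<integral>k. U k \<partial>measure_pmf (poisson_pmf m))"
    unfolding comp_poisson_def U_def by (rule integral_bind_real[OF _ k D(1)]) (use i2 in \<open>auto simp: comp_poisson_def\<close>)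
  have iU: "integrable (measure_pmf (poisson_pmf m)) U"
  proof -
    have "(\<integral>\<^sup>+k. ennreal (norm (U k)) \<partial>measure_pmf (poisson_pmf m)) \<le> (\<integral>\<^sup>+k. (\<integral>\<^sup>+x. ennreal (norm (\<integral>y. y * f (x + y) \<partial>P)) \<partial>conv_pow P k) \<partial>measure_pmf (poisson_pmf m))"
      unfolding U_def by (intro nn_integral_mono integral_norm_bound_ennreal quad_integrable[OF sq_moment_conv_pow[OF P] D])
    also have "\<dots> = (\<integral>\<^sup>+x. ennreal (norm (\<integral>y. y * f (x + y) \<partial>P)) \<partial>comp_poisson m P)"
      unfolding comp_poisson_def using D(1) by (intro nn_integral_bind[OF _ k, symmetric]) measurable
    also have "\<dots> < \<infinity>" using i2 by (auto simp: integrable_iff_bounded)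
    finally show ?thesis by (auto simp: integrable_iff_bounded)
  qed
  have "(\<integral>x. x * f x \<partial>comp_poisson m P) = (\<integral>k. (\<integral>x. x * f x \<partial>conv_pow P k) \<partial>measure_pmf (poisson_pmf m))"
    unfolding comp_poisson_def by (rule integral_bind_real[OF _ k]) (use i1 in \<open>auto simp: comp_poisson_def\<close>)
  also have "\<dots> = (\<integral>k. real k * U (k - 1) \<partial>measure_pmf (poisson_pmf m))"
    by (simp add: conv_pow_stein[OF P f] U_def)
  also have "\<dots> = m * (\<integral>k. U k \<partial>measure_pmf (poisson_pmf m))" by (rule integral_poisson_shift[OF m iU])
  finally show ?thesis by (simp add: U)
qed


section \<open>Compound Poisson laws with a prescribed jump measure\<close>

definition mixture :: "(real \<Rightarrow> real) \<Rightarrow> (real \<Rightarrow> real measure) \<Rightarrow> real measure" where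
  "mixture w K = density lborel (\<lambda>s. ennreal (w s / (LINT s|lborel. w s))) \<bind> K"

text \<open>The compound Poisson law with jump measure \<open>\<integral> w s * K s ds\<close>: the
  total mass of \<open>w\<close> is the rate and the normalized mixture is the law of one jump. The
  normalization is the reason for the positive mass in \<open>weight\<close>.\<close>

definition cp_mixture :: "(real \<Rightarrow> real) \<Rightarrow> (real \<Rightarrow> real measure) \<Rightarrow> real measure" where
  "cp_mixture w K = comp_poisson (LINT s|lborel. w s) (mixture w K)"

locale weight =
  fixes w :: "real \<Rightarrow> real"
  assumes w_nonneg: "\<And>s. w s \<ge> 0" and w_int: "integrable lborel w" and w_pos: "(LINT s|lborel. w s) > 0"
begin

definition "mass = (LINT s|lborel. w s)"

lemma mass_pos: "mass > 0" using w_pos by (simp add: mass_def)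

lemma w_meas[measurable]: "w \<in> borel_measurable borel" using w_int by auto

definition "dens = density lborel (\<lambda>s. ennreal (w s / mass))"

lemma sets_dens[measurable_cong]: "sets dens = sets borel" by (simp add: dens_def)

lemma prob_dens: "prob_space dens"
proof
  have "emeasure dens (space dens) = (\<integral>\<^sup>+s. ennreal (w s / mass) \<partial>lborel)"
    unfolding dens_def by (subst emeasure_density) auto
  also have "\<dots> = ennreal (\<integral>s. w s / mass \<partial>lborel)"
    using w_nonneg w_int mass_pos by (intro nn_integral_eq_integral) auto
  also have "\<dots> = 1" using mass_pos by (simp add: mass_def[symmetric])
  finally show "emeasure dens (space dens) = 1" .
qed

lemma dens_prob_algebra: "dens \<in> space (prob_algebra borel)"
  using prob_dens by (simp add: space_prob_algebra sets_dens)

lemma mixture_kernel[measurable]: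
  assumes [measurable]: "(\<lambda>(t, s). K t s) \<in> M \<Otimes>\<^sub>M borel \<rightarrow>\<^sub>M prob_algebra borel"
  shows "(\<lambda>t. mixture w (K t)) \<in> M \<rightarrow>\<^sub>M prob_algebra borel"
  unfolding mixture_def mass_def[symmetric] dens_def[symmetric]
  by (rule measurable_bind_prob_space2[OF measurable_const[OF dens_prob_algebra] assms])

lemma mixture_prob:
  assumes K: "K \<in> borel \<rightarrow>\<^sub>M prob_algebra borel"
  shows "mixture w K \<in> space (prob_algebra borel)"
proof -
  have "(\<lambda>t::unit. mixture w K) \<in> count_space UNIV \<rightarrow>\<^sub>M prob_algebra borel"
    using measurable_compose[OF measurable_snd K] by (intro mixture_kernel) (simp add: case_prod_beta')
  from measurable_space[OF this, of "()"] show ?thesis by simp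
qed

lemma cp_mixture_prob:
  assumes K: "K \<in> borel \<rightarrow>\<^sub>M prob_algebra borel"
  shows "cp_mixture w K \<in> space (prob_algebra borel)"
  unfolding cp_mixture_def by (intro comp_poisson_prob mixture_prob K)

lemma kernel_dens: "K \<in> borel \<rightarrow>\<^sub>M prob_algebra borel \<Longrightarrow> K \<in> dens \<rightarrow>\<^sub>M prob_algebra borel"
  by (simp cong: measurable_cong_sets add: sets_dens)

lemma nn_integral_mixture:
  assumes K: "K \<in> borel \<rightarrow>\<^sub>M prob_algebra borel" and f[measurable]: "f \<in> borel_measurable borel"
  shows "ennreal mass * (\<integral>\<^sup>+x. f x \<partial>mixture w K) = (\<integral>\<^sup>+s. ennreal (w s) * (\<integral>\<^sup>+x. f x \<partial>K s) \<partial>lborel)"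
proof -
  note K' = measurable_prob_algebraD[OF K] and Kd = measurable_prob_algebraD[OF kernel_dens[OF K]]
  have m: "(\<lambda>s. \<integral>\<^sup>+x. f x \<partial>K s) \<in> borel_measurable borel" using K' by measurable
  have "(\<integral>\<^sup>+x. f x \<partial>mixture w K) = (\<integral>\<^sup>+s. (\<integral>\<^sup>+x. f x \<partial>K s) \<partial>dens)"
    unfolding mixture_def mass_def[symmetric] dens_def[symmetric] by (rule nn_integral_bind[OF f Kd])
  also have "\<dots> = (\<integral>\<^sup>+s. ennreal (w s / mass) * (\<integral>\<^sup>+x. f x \<partial>K s) \<partial>lborel)"
    unfolding dens_def using m by (subst nn_integral_density) auto
  also have "ennreal mass * \<dots> = (\<integral>\<^sup>+s. ennreal mass * (ennreal (w s / mass) * (\<integral>\<^sup>+x. f x \<partial>K s)) \<partial>lborel)"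
    using m by (subst nn_integral_cmult) auto
  also have "\<dots> = (\<integral>\<^sup>+s. ennreal (w s) * (\<integral>\<^sup>+x. f x \<partial>K s) \<partial>lborel)"
    using mass_pos w_nonneg by (intro nn_integral_cong) (simp add: mult.assoc[symmetric] ennreal_mult[symmetric])
  finally show ?thesis .
qed

lemma integral_mixture:
  fixes f :: "real \<Rightarrow> real"
  assumes K: "K \<in> borel \<rightarrow>\<^sub>M prob_algebra borel" and f[measurable]: "f \<in> borel_measurable borel"
    and i: "integrable (mixture w K) f"
  shows "mass * (\<integral>x. f x \<partial>mixture w K) = (\<integral>s. w s * (\<integral>x. f x \<partial>K s) \<partial>lborel)"
proof -
  note K' = measurable_prob_algebraD[OF K] and Kd = measurable_prob_algebraD[OF kernel_dens[OF K]]
  have m: "(\<lambda>s. \<integral>x. f x \<partial>K s) \<in> borel_measurable borel" using K' by measurable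
  have "(\<integral>x. f x \<partial>mixture w K) = (\<integral>s. (\<integral>x. f x \<partial>K s) \<partial>dens)"
    using i unfolding mixture_def mass_def[symmetric] dens_def[symmetric]
    by (intro integral_bind_real[OF prob_space.not_empty[OF prob_dens] Kd f])
  also have "\<dots> = (\<integral>s. w s / mass * (\<integral>x. f x \<partial>K s) \<partial>lborel)"
    unfolding dens_def using m mass_pos w_nonneg by (subst integral_density) auto
  also have "mass * \<dots> = (\<integral>s. mass * (w s / mass * (\<integral>x. f x \<partial>K s)) \<partial>lborel)" by simp
  also have "\<dots> = (\<integral>s. w s * (\<integral>x. f x \<partial>K s) \<partial>lborel)" using mass_pos by simp
  finally show ?thesis .
qed

lemma char_mixture:
  assumes K: "K \<in> borel \<rightarrow>\<^sub>M prob_algebra borel"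
  shows "of_real mass * char (mixture w K) t = (\<integral>s. of_real (w s) * char (K s) t \<partial>lborel)"
proof -
  note K' = measurable_prob_algebraD[OF K]
  have m: "(\<lambda>s. char (K s) t) \<in> borel_measurable borel" unfolding char_def using K' by measurable
  have "char (mixture w K) t = (\<integral>s. char (K s) t \<partial>dens)"
    unfolding mixture_def mass_def[symmetric] dens_def[symmetric] char_def
    by (rule integral_bind_complex[OF prob_dens kernel_dens[OF K], where B=1]) auto
  also have "\<dots> = (\<integral>s. (w s / mass) *\<^sub>R char (K s) t \<partial>lborel)"
    unfolding dens_def using m mass_pos w_nonneg by (subst integral_density) auto
  also have "of_real mass * \<dots> = (\<integral>s. of_real mass * ((w s / mass) *\<^sub>R char (K s) t) \<partial>lborel)" by (simp flip: integral_mult_right_zero)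
  also have "\<dots> = (\<integral>s. of_real (w s) * char (K s) t \<partial>lborel)"
    using mass_pos by (simp add: scaleR_conv_of_real)
  finally show ?thesis .
qed

lemma kernel_real_distribution:
  assumes K: "K \<in> borel \<rightarrow>\<^sub>M prob_algebra borel"
  shows "real_distribution (K s)"
  using measurable_space[OF K, of s] by (auto simp: space_prob_algebra real_distribution_def real_distribution_axioms_def)

lemma char_kernel_meas:
  assumes K: "K \<in> borel \<rightarrow>\<^sub>M prob_algebra borel"
  shows "(\<lambda>s. char (K s) t) \<in> borel_measurable borel"
  unfolding char_def using measurable_prob_algebraD[OF K] by measurable

text \<open>The Levy-Khintchine form. The normalization of the mixture cancels against the rate, so
  that the exponent is linear in the weight.\<close>

lemma char_cp_mixture:
  assumes K: "K \<in> borel \<rightarrow>\<^sub>M prob_algebra borel"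
  shows "char (cp_mixture w K) t = exp (\<integral>s. of_real (w s) * (char (K s) t - 1) \<partial>lborel)"
proof -
  have i: "integrable lborel (\<lambda>s. of_real (w s) * char (K s) t)"
  proof (rule Bochner_Integration.integrable_bound[OF w_int])
    show "AE s in lborel. norm (of_real (w s) * char (K s) t) \<le> norm (w s)"
    proof (rule AE_I2)
      fix s
      show "norm (of_real (w s) * char (K s) t) \<le> norm (w s)"
        using real_distribution.cmod_char_le_1[OF kernel_real_distribution[OF K], of s t] w_nonneg[of s]
        by (simp add: norm_mult mult_left_le)
    qed
  qed (use char_kernel_meas[OF K] in measurable)
  have j: "integrable lborel (\<lambda>s. complex_of_real (w s))" using w_int by (rule integrable_of_real)
  have "(\<integral>s. of_real (w s) * (char (K s) t - 1) \<partial>lborel) = (\<integral>s. of_real (w s) * char (K s) t - of_real (w s) \<partial>lborel)"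
    by (simp add: algebra_simps)
  also have "\<dots> = of_real mass * char (mixture w K) t - of_real mass"
    by (subst Bochner_Integration.integral_diff[OF i j]) (simp add: char_mixture[OF K, symmetric] mass_def)
  also have "\<dots> = of_real mass * (char (mixture w K) t - 1)" by (simp add: algebra_simps)
  finally have e: "(\<integral>s. of_real (w s) * (char (K s) t - 1) \<partial>lborel) = of_real mass * (char (mixture w K) t - 1)" .
  show ?thesis
    unfolding e cp_mixture_def by (simp only: char_comp_poisson[OF w_pos mixture_prob[OF K]] mass_def)
qed

lemma sq_moment_mixture:
  assumes K: "K \<in> borel \<rightarrow>\<^sub>M prob_algebra borel"
    and fin: "(\<integral>\<^sup>+s. ennreal (w s) * (\<integral>\<^sup>+x. ennreal (x^2) \<partial>K s) \<partial>lborel) < \<infinity>"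
  shows "sq_moment (mixture w K)"
proof -
  have [measurable_cong]: "sets (mixture w K) = sets borel" using mixture_prob[OF K] by (simp add: space_prob_algebra)
  have "(\<integral>\<^sup>+x. ennreal (x^2) \<partial>mixture w K) < \<infinity>"
  proof (rule ccontr)
    assume "\<not> ?thesis"
    then have "(\<integral>\<^sup>+x. ennreal (x^2) \<partial>mixture w K) = \<infinity>" by (auto simp: less_top[symmetric])
    then have "ennreal mass * (\<integral>\<^sup>+x. ennreal (x^2) \<partial>mixture w K) = \<infinity>" using mass_pos by (simp add: ennreal_mult_eq_top_iff)
    then show False using fin by (simp add: nn_integral_mixture[OF K])
  qed
  then have "integrable (mixture w K) (\<lambda>x. x^2)" by (auto simp: integrable_iff_bounded)
  then show ?thesis using mixture_prob[OF K] by (simp add: sq_moment_def)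
qed

lemma sq_moment_cp_mixture:
  assumes "K \<in> borel \<rightarrow>\<^sub>M prob_algebra borel"
    and "(\<integral>\<^sup>+s. ennreal (w s) * (\<integral>\<^sup>+x. ennreal (x^2) \<partial>K s) \<partial>lborel) < \<infinity>"
  shows "sq_moment (cp_mixture w K)"
  unfolding cp_mixture_def by (rule sq_moment_comp_poisson[OF w_pos sq_moment_mixture[OF assms]])

lemma lin_growth_id: "lin_growth (\<lambda>x. x)" "lin_growth (\<lambda>x. c)"
proof -
  have "\<bar>c\<bar> \<le> \<bar>c\<bar> * (1 + \<bar>x\<bar>)" for x by (simp add: algebra_simps)
  then show "lin_growth (\<lambda>x. c)" unfolding lin_growth_def by (auto intro!: exI[of _ "\<bar>c\<bar>"])
qed (auto simp: lin_growth_def intro!: exI[of _ 1])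

text \<open>Stein's identity for the constant function 1. The second moment is the same identity for
  the identity function.\<close>

lemma mean_cp_mixture:
  assumes K: "K \<in> borel \<rightarrow>\<^sub>M prob_algebra borel"
    and fin: "(\<integral>\<^sup>+s. ennreal (w s) * (\<integral>\<^sup>+x. ennreal (x^2) \<partial>K s) \<partial>lborel) < \<infinity>"
  shows "(\<integral>x. x \<partial>cp_mixture w K) = (\<integral>s. w s * (\<integral>x. x \<partial>K s) \<partial>lborel)"
proof -
  interpret cp: prob_space "cp_mixture w K" using cp_mixture_prob[OF K] by (simp add: space_prob_algebra)
  have "(\<integral>x. x * 1 \<partial>cp_mixture w K) = mass * (\<integral>x. (\<integral>y. y * 1 \<partial>mixture w K) \<partial>cp_mixture w K)"
    unfolding cp_mixture_def mass_def by (rule comp_poisson_stein[OF w_pos sq_moment_mixture[OF K fin] lin_growth_id(2)])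
  then show ?thesis
    using integral_mixture[OF K _ integral_abs_le_quad(2)[OF sq_moment_mixture[OF K fin]]]
    by (simp add: cp.prob_space)
qed

lemma var_cp_mixture:
  assumes K: "K \<in> borel \<rightarrow>\<^sub>M prob_algebra borel"
    and fin: "(\<integral>\<^sup>+s. ennreal (w s) * (\<integral>\<^sup>+x. ennreal (x^2) \<partial>K s) \<partial>lborel) < \<infinity>"
  shows "(\<integral>x. x^2 \<partial>cp_mixture w K) = (\<integral>s. w s * (\<integral>x. x^2 \<partial>K s) \<partial>lborel) + (\<integral>s. w s * (\<integral>x. x \<partial>K s) \<partial>lborel)^2"
proof -
  interpret cp: prob_space "cp_mixture w K" using cp_mixture_prob[OF K] by (simp add: space_prob_algebra)
  note P = sq_moment_mixture[OF K fin]
  note iP = integral_abs_le_quad(2)[OF P] sq_momentD(3)[OF P]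
  note iQ = integral_abs_le_quad(2)[OF sq_moment_cp_mixture[OF K fin]]
  have "(\<integral>x. x * x \<partial>cp_mixture w K) = mass * (\<integral>x. (\<integral>y. y * (x + y) \<partial>mixture w K) \<partial>cp_mixture w K)"
    unfolding cp_mixture_def mass_def by (rule comp_poisson_stein[OF w_pos P lin_growth_id(1)])
  also have "(\<lambda>x. \<integral>y. y * (x + y) \<partial>mixture w K) = (\<lambda>x. x * (\<integral>y. y \<partial>mixture w K) + (\<integral>y. y^2 \<partial>mixture w K))"
  proof
    fix x
    have "(\<integral>y. y * (x + y) \<partial>mixture w K) = (\<integral>y. x * y + y^2 \<partial>mixture w K)" by (simp add: algebra_simps power2_eq_square)
    also have "\<dots> = x * (\<integral>y. y \<partial>mixture w K) + (\<integral>y. y^2 \<partial>mixture w K)" using iP by simp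
    finally show "(\<integral>y. y * (x + y) \<partial>mixture w K) = x * (\<integral>y. y \<partial>mixture w K) + (\<integral>y. y^2 \<partial>mixture w K)" .
  qed
  also have "(\<integral>x. x * (\<integral>y. y \<partial>mixture w K) + (\<integral>y. y^2 \<partial>mixture w K) \<partial>cp_mixture w K)
      = (\<integral>x. x \<partial>cp_mixture w K) * (\<integral>y. y \<partial>mixture w K) + (\<integral>y. y^2 \<partial>mixture w K)"
    using iQ by (simp add: cp.prob_space)
  finally show ?thesis
    using integral_mixture[OF K _ iP(1)] integral_mixture[OF K _ iP(2)]
    by (simp add: mean_cp_mixture[OF K fin] algebra_simps power2_eq_square)
qed

lemma stein_cp_mixture:
  assumes K: "K \<in> borel \<rightarrow>\<^sub>M prob_algebra borel"
    and fin: "(\<integral>\<^sup>+s. ennreal (w s) * (\<integral>\<^sup>+x. ennreal (x^2) \<partial>K s) \<partial>lborel) < \<infinity>"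
    and f: "lin_growth f"
  shows "(\<integral>x. x * f x \<partial>cp_mixture w K) = (\<integral>x. (\<integral>s. w s * (\<integral>y. y * f (x + y) \<partial>K s) \<partial>lborel) \<partial>cp_mixture w K)"
proof -
  have [measurable]: "f \<in> borel_measurable borel" using f by (auto simp: lin_growth_def)
  have i: "integrable (mixture w K) (\<lambda>y. y * f (x + y))" for x
    using inner_quad[OF sq_moment_mixture[OF K fin] f] by blast
  have "(\<integral>x. x * f x \<partial>cp_mixture w K) = (\<integral>x. mass * (\<integral>y. y * f (x + y) \<partial>mixture w K) \<partial>cp_mixture w K)"
    unfolding cp_mixture_def mass_def by (simp add: comp_poisson_stein[OF w_pos sq_moment_mixture[OF K fin] f])
  then show ?thesis by (simp add: integral_mixture[OF K _ i])
qed

end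

text \<open>A Lipschitz derivative takes the place of a second derivative. The functions
  \<open>f (z + t) - t * f' z - t^2\<close> and \<open>f (z + t) - t * f' z + t^2\<close> are
  monotone in \<open>t\<close>, since \<open>f' (z + t) - f' z\<close> is at most
  \<open>2 * t\<close> in absolute value; the Lipschitz constant 2 thus gives the remainder
  \<open>d^2\<close>.\<close>

lemma taylor_bound_pos:
  fixes f f' :: "real \<Rightarrow> real"
  assumes df: "\<And>x. (f has_real_derivative f' x) (at x)" and lip: "\<And>x y. \<bar>f' x - f' y\<bar> \<le> 2 * \<bar>x - y\<bar>" and d: "d \<ge> 0"
  shows "\<bar>f (z + d) - f z - d * f' z\<bar> \<le> d^2"
proof -
  have dz: "((\<lambda>t. f (z + t)) has_real_derivative f' (z + t)) (at t)" for t
    using DERIV_shift[of f "f' (z + t)" t z] df[of "z + t"] by (simp add: add.commute)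
  have l: "\<bar>f' (z + t) - f' z\<bar> \<le> 2 * t" if "t \<ge> 0" for t using lip[of "z + t" z] that by simp
  have "f (z + d) - d * f' z - d^2 \<le> f (z + 0) - 0 * f' z - 0^2"
  proof (rule DERIV_nonpos_imp_nonincreasing[OF d, of "\<lambda>t. f (z + t) - t * f' z - t^2"])
    fix t assume "0 \<le> t" "t \<le> d"
    have "((\<lambda>t. f (z + t) - t * f' z - t^2) has_real_derivative f' (z + t) - f' z - 2 * t) (at t)"
      by (auto intro!: derivative_eq_intros dz)
    then show "\<exists>y. ((\<lambda>t. f (z + t) - t * f' z - t^2) has_real_derivative y) (at t) \<and> y \<le> 0"
      using l[OF \<open>0 \<le> t\<close>] by (intro exI conjI) auto
  qed
  moreover have "f (z + d) - d * f' z + d^2 \<ge> f (z + 0) - 0 * f' z + 0^2"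
  proof (rule DERIV_nonneg_imp_nondecreasing[OF d, of "\<lambda>t. f (z + t) - t * f' z + t^2"])
    fix t assume "0 \<le> t" "t \<le> d"
    have "((\<lambda>t. f (z + t) - t * f' z + t^2) has_real_derivative f' (z + t) - f' z + 2 * t) (at t)"
      by (auto intro!: derivative_eq_intros dz)
    then show "\<exists>y. ((\<lambda>t. f (z + t) - t * f' z + t^2) has_real_derivative y) (at t) \<and> y \<ge> 0"
      using l[OF \<open>0 \<le> t\<close>] by (intro exI conjI) auto
  qed
  ultimately show ?thesis by (simp add: abs_le_iff)
qed

lemma taylor_bound:
  fixes f f' :: "real \<Rightarrow> real"
  assumes df: "\<And>x. (f has_real_derivative f' x) (at x)" and lip: "\<And>x y. \<bar>f' x - f' y\<bar> \<le> 2 * \<bar>x - y\<bar>"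
  shows "\<bar>f (z + d) - f z - d * f' z\<bar> \<le> d^2"
proof (cases "d \<ge> 0")
  case True
  then show ?thesis using taylor_bound_pos[OF df lip] by blast
next
  case False
  have 1: "((\<lambda>x. - f (- x)) has_real_derivative f' (- x)) (at x)" for x
    using DERIV_minus[OF DERIV_chain'[OF DERIV_minus[OF DERIV_ident] df], of x] by simp
  have 2: "\<bar>f' (- x) - f' (- y)\<bar> \<le> 2 * \<bar>x - y\<bar>" for x y using lip[of "-x" "-y"] by (simp add: abs_minus_commute)
  have "\<bar>- f (- (- z + - d)) - (- f (- (- z))) - (- d) * f' (- (- z))\<bar> \<le> (-d)^2"
    by (rule taylor_bound_pos[OF 1 2]) (use False in simp)
  also have "\<bar>- f (- (- z + - d)) - (- f (- (- z))) - (- d) * f' (- (- z))\<bar> = \<bar>- (f (z + d) - f z - d * f' z)\<bar>"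
    by (rule arg_cong[of _ _ abs]) (simp add: algebra_simps)
  also have "\<dots> = \<bar>f (z + d) - f z - d * f' z\<bar>" by (rule abs_minus_cancel)
  finally show ?thesis by simp
qed

locale stein_fun =
  fixes f f' :: "real \<Rightarrow> real" and \<sigma> :: real
  assumes df: "\<And>x. (f has_real_derivative f' x) (at x)"
    and f'_bd: "\<And>x. \<bar>f' x\<bar> \<le> \<sigma>"
    and f'_lip: "\<And>x y. \<bar>f' x - f' y\<bar> \<le> 2 * \<bar>x - y\<bar>"
begin

lemma f_lip: "\<bar>f x - f y\<bar> \<le> \<sigma> * \<bar>x - y\<bar>"
  using field_differentiable_bound[of UNIV f f' \<sigma> x y] df f'_bd by (auto simp: has_field_derivative_at_within)

lemma sigma_nonneg: "\<sigma> \<ge> 0" using f'_bd[of 0] by simp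

lemma f_meas[measurable]: "f \<in> borel_measurable borel"
  using df by (intro borel_measurable_continuous_onI) (meson DERIV_isCont continuous_at_imp_continuous_on)

lemma f'_meas[measurable]: "f' \<in> borel_measurable borel"
proof (intro borel_measurable_continuous_onI continuous_at_imp_continuous_on ballI)
  have "2-lipschitz_on UNIV f'" using f'_lip by (auto simp: lipschitz_on_def dist_real_def)
  then show "isCont f' x" for x
    using lipschitz_on_continuous_on continuous_on_eq_continuous_at open_UNIV by blast
qed

lemma lin_growth_f: "lin_growth f"
proof -
  have "\<bar>f x\<bar> \<le> (\<bar>f 0\<bar> + \<sigma>) * (1 + \<bar>x\<bar>)" for x
  proof -
    have "\<bar>f x\<bar> \<le> \<bar>f 0\<bar> + \<sigma> * \<bar>x\<bar>" using f_lip[of x 0] by simp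
    also have "\<dots> \<le> (\<bar>f 0\<bar> + \<sigma>) * (1 + \<bar>x\<bar>)" using sigma_nonneg by (simp add: algebra_simps)
    finally show ?thesis .
  qed
  then show ?thesis unfolding lin_growth_def using sigma_nonneg by (intro conjI exI[of _ "\<bar>f 0\<bar> + \<sigma>"]) auto
qed

text \<open>The expansion is around the mean \<open>u\<close>. With \<open>D y = y - u\<close>, the
  product \<open>y * G y\<close> splits into its value at \<open>u\<close>, a term linear in
  \<open>D y\<close> that integrates to 0, and a remainder \<open>R y\<close> of order
  \<open>(D y)^2\<close>. The value at \<open>u\<close> gives \<open>\<bar>u\<bar>^3\<close>. In the
  remainder, Taylor's formula at \<open>x + u\<close> contributes \<open>\<bar>u\<bar> * v\<close>,
  and the Lipschitz constant \<open>2 * \<sigma>\<close> of \<open>G\<close> contributes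
  \<open>2 * \<sigma> * v\<close>.\<close>

lemma pointwise_bound:
  assumes P: "sq_moment P" and mean: "(\<integral>y. y \<partial>P) = u" and var: "(\<integral>y. (y - u)^2 \<partial>P) = v"
  shows "\<bar>\<integral>y. y * (f (x + y) - f x - y * f' x) \<partial>P\<bar> \<le> \<bar>u\<bar>^3 + \<bar>u\<bar> * v + 2 * \<sigma> * v"
proof -
  interpret P: prob_space P using sq_momentD[OF P] by auto
  note [measurable_cong] = sq_momentD(2)[OF P]
  note i1 = integral_abs_le_quad(2)[OF P] and i2 = sq_momentD(3)[OF P]
  define G where "G y = f (x + y) - f x - y * f' x" for y
  define D where "D y = y - u" for y
  define R where "R y = u * (f (x + y) - f (x + u) - D y * f' (x + u)) + D y * (G y - G u)" for y
  have eq: "y * G y = u * G u + D y * (u * (f' (x + u) - f' x) + G u) + R y" for y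
    by (simp add: R_def G_def D_def algebra_simps)
  have iD2: "integrable P (\<lambda>y. (D y)^2)"
  proof -
    have "integrable P (\<lambda>y. y^2 - 2 * u * y + u^2)" using i1 i2 by auto
    then show ?thesis by (simp add: D_def power2_diff algebra_simps)
  qed
  have iD: "integrable P D" using i1 unfolding D_def[abs_def] by auto
  have mD: "(\<integral>y. D y \<partial>P) = 0" using i1 by (simp add: D_def mean P.prob_space)
  have Rb: "\<bar>R y\<bar> \<le> (\<bar>u\<bar> + 2 * \<sigma>) * (D y)^2" for y
  proof -
    have "\<bar>f (x + y) - f (x + u) - D y * f' (x + u)\<bar> \<le> (D y)^2"
      using taylor_bound[OF df f'_lip, of "x + u" "D y"] by (simp add: D_def)
    then have 1: "\<bar>u * (f (x + y) - f (x + u) - D y * f' (x + u))\<bar> \<le> \<bar>u\<bar> * (D y)^2"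
      unfolding abs_mult by (intro mult_left_mono) auto
    have "\<bar>G y - G u\<bar> = \<bar>(f (x + y) - f (x + u)) - D y * f' x\<bar>" by (simp add: G_def D_def algebra_simps)
    also have "\<dots> \<le> \<bar>f (x + y) - f (x + u)\<bar> + \<bar>D y\<bar> * \<bar>f' x\<bar>" unfolding abs_mult[symmetric] by (rule abs_triangle_ineq4)
    also have "\<dots> \<le> \<sigma> * \<bar>D y\<bar> + \<bar>D y\<bar> * \<sigma>"
      using f_lip[of "x + y" "x + u"] f'_bd[of x] by (intro add_mono mult_left_mono) (auto simp: D_def)
    finally have "\<bar>D y\<bar> * \<bar>G y - G u\<bar> \<le> \<bar>D y\<bar> * (2 * \<sigma> * \<bar>D y\<bar>)" by (intro mult_left_mono) auto
    also have "\<dots> = 2 * \<sigma> * (\<bar>D y\<bar> * \<bar>D y\<bar>)" by simp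
    also have "\<bar>D y\<bar> * \<bar>D y\<bar> = (D y)^2" by (simp only: abs_mult_self_eq power2_eq_square)
    finally have 2: "\<bar>D y * (G y - G u)\<bar> \<le> 2 * \<sigma> * (D y)^2" by (simp only: abs_mult)
    show ?thesis unfolding R_def using abs_triangle_ineq[of "u * (f (x + y) - f (x + u) - D y * f' (x + u))" "D y * (G y - G u)"] 1 2
      by (simp add: algebra_simps)
  qed
  have Rm: "R \<in> borel_measurable P" unfolding R_def[abs_def] G_def[abs_def] D_def[abs_def] by measurable
  have iR: "integrable P R"
    by (rule Bochner_Integration.integrable_bound[OF integrable_mult_right[OF iD2, of "\<bar>u\<bar> + 2 * \<sigma>"] Rm])
      (use Rb in \<open>auto intro: order_trans[OF _ abs_ge_self]\<close>)
  have "(\<integral>y. y * G y \<partial>P) = (\<integral>y. u * G u + D y * (u * (f' (x + u) - f' x) + G u) + R y \<partial>P)"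
    by (rule Bochner_Integration.integral_cong[OF refl]) (rule eq)
  also have "\<dots> = u * G u + (\<integral>y. R y \<partial>P)"
    using iD iR mD by (simp add: P.prob_space)
  finally have "(\<integral>y. y * G y \<partial>P) = u * G u + (\<integral>y. R y \<partial>P)" .
  then have "\<bar>\<integral>y. y * G y \<partial>P\<bar> \<le> \<bar>u\<bar> * \<bar>G u\<bar> + \<bar>\<integral>y. R y \<partial>P\<bar>" unfolding abs_mult[symmetric] by simp
  moreover have "\<bar>\<integral>y. R y \<partial>P\<bar> \<le> (\<integral>y. \<bar>R y\<bar> \<partial>P)" by (rule integral_abs_bound)
  moreover have "(\<integral>y. \<bar>R y\<bar> \<partial>P) \<le> (\<integral>y. (\<bar>u\<bar> + 2 * \<sigma>) * (D y)^2 \<partial>P)" using Rb iR iD2 by (intro integral_mono) auto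
  moreover have "(\<integral>y. (\<bar>u\<bar> + 2 * \<sigma>) * (D y)^2 \<partial>P) = (\<bar>u\<bar> + 2 * \<sigma>) * v" by (simp add: D_def var)
  moreover have "\<bar>u\<bar> * \<bar>G u\<bar> \<le> \<bar>u\<bar> * u^2"
    using taylor_bound[OF df f'_lip, of x u] unfolding G_def by (intro mult_left_mono) auto
  moreover have "\<bar>u\<bar> * u^2 = \<bar>u\<bar>^3" by (simp add: eval_nat_numeral)
  ultimately have "\<bar>\<integral>y. y * G y \<partial>P\<bar> \<le> \<bar>u\<bar>^3 + (\<bar>u\<bar> + 2 * \<sigma>) * v" by linarith
  then show ?thesis unfolding G_def by (simp add: algebra_simps)
qed

end

context weight
begin

lemma integrable_quad_mix:
  fixes f :: "real \<Rightarrow> real"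
  assumes K: "K \<in> borel \<rightarrow>\<^sub>M prob_algebra borel"
    and fin: "(\<integral>\<^sup>+s. ennreal (w s) * (\<integral>\<^sup>+x. ennreal (x^2) \<partial>K s) \<partial>lborel) < \<infinity>"
    and Ks: "\<And>s. sq_moment (K s)"
    and f[measurable]: "f \<in> borel_measurable borel" and b: "\<And>x. \<bar>f x\<bar> \<le> C * (1 + x^2)"
  shows "integrable lborel (\<lambda>s. w s * (\<integral>x. f x \<partial>K s))"
proof -
  note K' = measurable_prob_algebraD[OF K]
  have m: "(\<lambda>s. \<integral>x. f x \<partial>K s) \<in> borel_measurable borel" using K' by measurable
  have i: "integrable (mixture w K) f" by (rule quad_integrable[OF sq_moment_mixture[OF K fin] f b])
  have "(\<integral>\<^sup>+s. ennreal (norm (w s * (\<integral>x. f x \<partial>K s))) \<partial>lborel) \<le> (\<integral>\<^sup>+s. ennreal (w s) * (\<integral>\<^sup>+x. ennreal (norm (f x)) \<partial>K s) \<partial>lborel)"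
  proof (rule nn_integral_mono)
    fix s
    have "ennreal (norm (\<integral>x. f x \<partial>K s)) \<le> (\<integral>\<^sup>+x. ennreal (norm (f x)) \<partial>K s)"
      by (rule integral_norm_bound_ennreal[OF quad_integrable[OF Ks f b]])
    then show "ennreal (norm (w s * (\<integral>x. f x \<partial>K s))) \<le> ennreal (w s) * (\<integral>\<^sup>+x. ennreal (norm (f x)) \<partial>K s)"
      using w_nonneg[of s] by (simp add: abs_mult ennreal_mult mult_left_mono)
  qed
  also have "\<dots> = ennreal mass * (\<integral>\<^sup>+x. ennreal (norm (f x)) \<partial>mixture w K)" by (rule nn_integral_mixture[OF K, symmetric]) measurable
  also have "\<dots> < \<infinity>" using i by (auto simp: integrable_iff_bounded ennreal_mult_less_top)
  finally show ?thesis using m by (auto simp: integrable_iff_bounded)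
qed

text \<open>By Stein's identity the expectation of \<open>x * F x\<close> is that of
  \<open>H x\<close>, which is expanded to first order in the jump. The term \<open>a * F x\<close>
  cancels the centring, the term \<open>f' (x - a) * S\<close> compares the variance
  \<open>S\<close> with 1, and the remainder \<open>R x\<close> is the estimate of
  \<open>pointwise_bound\<close> integrated against the weight, uniformly in
  \<open>x\<close>.\<close>

lemma stein_bound_cp_mixture:
  assumes K: "K \<in> borel \<rightarrow>\<^sub>M prob_algebra borel"
    and fin: "(\<integral>\<^sup>+s. ennreal (w s) * (\<integral>\<^sup>+x. ennreal (x^2) \<partial>K s) \<partial>lborel) < \<infinity>"
    and Ks: "\<And>s. sq_moment (K s)"
    and mean: "\<And>s. (\<integral>x. x \<partial>K s) = u s" and var: "\<And>s. (\<integral>x. (x - u s)^2 \<partial>K s) = v s"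
    and ib: "integrable lborel (\<lambda>s. w s * (\<bar>u s\<bar>^3 + \<bar>u s\<bar> * v s + 2 * \<sigma> * v s))"
    and sf: "stein_fun f f' \<sigma>"
    and a: "a = (\<integral>s. w s * u s \<partial>lborel)"
  shows "\<bar>\<integral>x. f' (x - a) - (x - a) * f (x - a) \<partial>cp_mixture w K\<bar>
     \<le> \<sigma> * \<bar>1 - (\<integral>s. w s * (\<integral>x. x^2 \<partial>K s) \<partial>lborel)\<bar> + (\<integral>s. w s * (\<bar>u s\<bar>^3 + \<bar>u s\<bar> * v s + 2 * \<sigma> * v s) \<partial>lborel)"
proof -
  interpret stein_fun f f' \<sigma> by fact
  note Q = sq_moment_cp_mixture[OF K fin]
  interpret Q: prob_space "cp_mixture w K" using sq_momentD[OF Q] by auto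
  note [measurable_cong] = sq_momentD(2)[OF Q]
  define F where "F x = f (x - a)" for x
  have F: "lin_growth F" using lin_growth_shift[OF lin_growth_f, of "-a"] by (simp add: F_def[abs_def])
  then have [measurable]: "F \<in> borel_measurable borel" by (auto simp: lin_growth_def)
  define S where "S = (\<integral>s. w s * (\<integral>x. x^2 \<partial>K s) \<partial>lborel)"
  define B where "B = (\<integral>s. w s * (\<bar>u s\<bar>^3 + \<bar>u s\<bar> * v s + 2 * \<sigma> * v s) \<partial>lborel)"
  define H where "H x = (\<integral>s. w s * (\<integral>y. y * F (x + y) \<partial>K s) \<partial>lborel)" for x
  define R where "R x = H x - a * F x - f' (x - a) * S" for x
  obtain C where C: "C \<ge> 0" "\<And>x y. \<bar>y * F (x + y)\<bar> \<le> C * (1 + x^2 + y^2)" by (rule lin_growth_mult_quad[OF F]) blast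
  have iF: "integrable lborel (\<lambda>s. w s * (\<integral>y. y * F (x + y) \<partial>K s))" for x
  proof (rule integrable_quad_mix[OF K fin Ks, where C="C * (1 + x^2)"])
    fix y
    have "\<bar>y * F (x + y)\<bar> \<le> C * (1 + x^2 + y^2)" by (rule C)
    also have "\<dots> \<le> C * ((1 + x^2) * (1 + y^2))" using C by (intro mult_left_mono) (auto simp: algebra_simps)
    finally show "\<bar>y * F (x + y)\<bar> \<le> C * (1 + x^2) * (1 + y^2)" by (simp add: mult.assoc)
  qed measurable
  have i1: "integrable lborel (\<lambda>s. w s * u s)"
    using integrable_quad_mix[OF K fin Ks, of "\<lambda>x. x" 1] abs_le_one_plus_sq by (simp add: mean)
  have i2: "integrable lborel (\<lambda>s. w s * (\<integral>x. x^2 \<partial>K s))"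
    using integrable_quad_mix[OF K fin Ks, of "\<lambda>x. x^2" 1] by simp
  have Rb: "\<bar>R x\<bar> \<le> B" for x
  proof -
    have in1: "integrable (K s) (\<lambda>y. y * F (x + y))" for s
      using inner_quad[OF Ks F] by blast
    have "R x = (\<integral>s. w s * (\<integral>y. y * F (x + y) \<partial>K s) - F x * (w s * u s) - f' (x - a) * (w s * (\<integral>x. x^2 \<partial>K s)) \<partial>lborel)"
      unfolding R_def H_def S_def a using iF[of x] i1 i2 by simp
    also have "\<dots> = (\<integral>s. w s * (\<integral>y. y * (F (x + y) - F x - y * f' (x - a)) \<partial>K s) \<partial>lborel)"
    proof (rule Bochner_Integration.integral_cong[OF refl])
      fix s
      have "(\<integral>y. y * (F (x + y) - F x - y * f' (x - a)) \<partial>K s) = (\<integral>y. y * F (x + y) - F x * y - f' (x - a) * y^2 \<partial>K s)"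
        by (simp add: algebra_simps power2_eq_square)
      also have "\<dots> = (\<integral>y. y * F (x + y) \<partial>K s) - F x * u s - f' (x - a) * (\<integral>x. x^2 \<partial>K s)"
        using in1[of s] integral_abs_le_quad(2)[OF Ks[of s]] sq_momentD(3)[OF Ks[of s]] by (simp add: mean)
      finally have e: "(\<integral>y. y * (F (x + y) - F x - y * f' (x - a)) \<partial>K s) = (\<integral>y. y * F (x + y) \<partial>K s) - F x * u s - f' (x - a) * (\<integral>x. x^2 \<partial>K s)" .
      show "w s * (\<integral>y. y * F (x + y) \<partial>K s) - F x * (w s * u s) - f' (x - a) * (w s * (\<integral>x. x^2 \<partial>K s)) =
        w s * (\<integral>y. y * (F (x + y) - F x - y * f' (x - a)) \<partial>K s)" unfolding e by (simp add: algebra_simps)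
    qed
    also have "\<bar>\<dots>\<bar> \<le> B" unfolding B_def
    proof (rule integral_abs_bound[THEN order_trans], rule integral_mono'[OF ib])
      fix s
      have "\<bar>\<integral>y. y * (f (x - a + y) - f (x - a) - y * f' (x - a)) \<partial>K s\<bar> \<le> \<bar>u s\<bar>^3 + \<bar>u s\<bar> * v s + 2 * \<sigma> * v s"
        by (rule pointwise_bound[OF Ks mean var])
      then have "\<bar>\<integral>y. y * (F (x + y) - F x - y * f' (x - a)) \<partial>K s\<bar> \<le> \<bar>u s\<bar>^3 + \<bar>u s\<bar> * v s + 2 * \<sigma> * v s"
        by (simp add: F_def algebra_simps)
      then show "\<bar>w s * (\<integral>y. y * (F (x + y) - F x - y * f' (x - a)) \<partial>K s)\<bar> \<le> w s * (\<bar>u s\<bar>^3 + \<bar>u s\<bar> * v s + 2 * \<sigma> * v s)"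
        using w_nonneg[of s] by (simp add: abs_mult mult_left_mono)
      have "v s \<ge> 0" unfolding var[symmetric] by simp
      then show "0 \<le> w s * (\<bar>u s\<bar>^3 + \<bar>u s\<bar> * v s + 2 * \<sigma> * v s)"
        using w_nonneg[of s] sigma_nonneg by simp
    qed
    finally show ?thesis .
  qed
  obtain CF where CF: "CF \<ge> 0" "\<And>x. \<bar>F x\<bar> \<le> CF * (1 + \<bar>x\<bar>)" using F by (auto simp: lin_growth_def)
  have iQF: "integrable (cp_mixture w K) F"
  proof (rule quad_integrable[OF Q, where C="2 * CF"])
    fix x :: real
    have "1 + \<bar>x\<bar> \<le> 2 + x^2" using abs_le_one_plus_sq[of x] by simp
    also have "2 + x^2 \<le> 2 * (1 + x^2)" by simp
    finally have "CF * (1 + \<bar>x\<bar>) \<le> CF * (2 * (1 + x^2))" using CF(1) by (rule mult_left_mono)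
    with CF(2)[of x] have "\<bar>F x\<bar> \<le> CF * (2 * (1 + x^2))" by (rule order_trans)
    then show "\<bar>F x\<bar> \<le> 2 * CF * (1 + x\<^sup>2)" by (simp add: algebra_simps)
  qed measurable
  have iQxF: "integrable (cp_mixture w K) (\<lambda>x. x * F x)"
    by (rule quad_integrable[OF Q, where C=C]) (use C(2)[of _ 0] in auto)
  have iQf': "integrable (cp_mixture w K) (\<lambda>x. f' (x - a))"
    by (rule Q.integrable_const_bound[of _ \<sigma>]) (use f'_bd in auto)
  have Hm: "H \<in> borel_measurable borel"
  proof -
    obtain "(\<lambda>x. \<integral>y. y * F (x + y) \<partial>mixture w K) \<in> borel_measurable borel" "\<And>x. integrable (mixture w K) (\<lambda>y. y * F (x + y))"
      using inner_quad[OF sq_moment_mixture[OF K fin] F] by blast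
    moreover from this(2) have "H = (\<lambda>x. mass * (\<integral>y. y * F (x + y) \<partial>mixture w K))"
      unfolding H_def by (subst integral_mixture[OF K]) auto
    ultimately show ?thesis by simp
  qed
  have Rm[measurable]: "R \<in> borel_measurable borel" unfolding R_def[abs_def] using Hm by measurable
  have iR: "integrable (cp_mixture w K) R" by (rule Q.integrable_const_bound[of _ B]) (use Rb in auto)
  have "(\<integral>x. x * F x \<partial>cp_mixture w K) = (\<integral>x. H x \<partial>cp_mixture w K)" unfolding H_def by (rule stein_cp_mixture[OF K fin F])
  also have "\<dots> = (\<integral>x. R x + a * F x + f' (x - a) * S \<partial>cp_mixture w K)" by (simp add: R_def)
  also have "\<dots> = (\<integral>x. R x \<partial>cp_mixture w K) + a * (\<integral>x. F x \<partial>cp_mixture w K) + (\<integral>x. f' (x - a) \<partial>cp_mixture w K) * S"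
    using iR iQF iQf' by simp
  finally have "(\<integral>x. f' (x - a) - (x * F x - a * F x) \<partial>cp_mixture w K) = (\<integral>x. f' (x - a) \<partial>cp_mixture w K) * (1 - S) - (\<integral>x. R x \<partial>cp_mixture w K)"
    using iQxF iQF iQf' by (simp add: algebra_simps)
  moreover have "(\<lambda>x. f' (x - a) - (x - a) * f (x - a)) = (\<lambda>x. f' (x - a) - (x * F x - a * F x))" by (auto simp: F_def algebra_simps)
  moreover have "\<bar>(\<integral>x. f' (x - a) \<partial>cp_mixture w K) * (1 - S) - (\<integral>x. R x \<partial>cp_mixture w K)\<bar> \<le> \<sigma> * \<bar>1 - S\<bar> + B"
  proof -
    have "\<bar>\<integral>x. f' (x - a) \<partial>cp_mixture w K\<bar> \<le> (\<integral>x. \<bar>f' (x - a)\<bar> \<partial>cp_mixture w K)" by (rule integral_abs_bound)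
    also have "\<dots> \<le> (\<integral>x. \<sigma> \<partial>cp_mixture w K)" using iQf' f'_bd by (intro integral_mono) auto
    finally have 1: "\<bar>\<integral>x. f' (x - a) \<partial>cp_mixture w K\<bar> * \<bar>1 - S\<bar> \<le> \<sigma> * \<bar>1 - S\<bar>" by (intro mult_right_mono) (auto simp: Q.prob_space)
    have "\<bar>\<integral>x. R x \<partial>cp_mixture w K\<bar> \<le> (\<integral>x. \<bar>R x\<bar> \<partial>cp_mixture w K)" by (rule integral_abs_bound)
    also have "\<dots> \<le> (\<integral>x. B \<partial>cp_mixture w K)" using iR Rb by (intro integral_mono) auto
    finally have 2: "\<bar>\<integral>x. R x \<partial>cp_mixture w K\<bar> \<le> B" by (simp add: Q.prob_space)
    show ?thesis using abs_triangle_ineq4[of "(\<integral>x. f' (x - a) \<partial>cp_mixture w K) * (1 - S)" "\<integral>x. R x \<partial>cp_mixture w K"] 1 2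
      by (simp add: abs_mult)
  qed
  ultimately show ?thesis by (simp add: S_def B_def)
qed

end

subsection \<open>Laws of cluster functionals\<close>

lemma nn_integral_shift:
  fixes t :: real
  assumes [measurable]: "f \<in> borel_measurable borel"
  shows "(\<integral>\<^sup>+x. f (x + t) \<partial>lborel) = (\<integral>\<^sup>+x. f x \<partial>lborel)"
  using nn_integral_real_affine[OF assms, of 1 t] by (simp add: add.commute)

locale cluster =
  fixes hp u :: "real \<Rightarrow> real" and \<mu> U T :: real
  assumes hp_nonneg: "\<And>s. hp s \<ge> 0" and hp_zero: "\<And>s. s \<le> 0 \<Longrightarrow> hp s = 0"
    and hp_int: "integrable lborel hp" and mu_eq: "\<mu> = (LINT s|lborel. hp s)" and mu1: "\<mu> < 1"
    and u_meas[measurable]: "u \<in> borel_measurable borel" and u_bd: "\<And>t. \<bar>u t\<bar> \<le> U"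
    and u_supp: "\<And>t. \<bar>t\<bar> > T \<Longrightarrow> u t = 0"
begin

lemma hp_meas[measurable]: "hp \<in> borel_measurable borel" using hp_int by auto

lemma mu0: "\<mu> \<ge> 0" unfolding mu_eq using hp_nonneg by simp

lemma U0: "U \<ge> 0" using u_bd[of 0] by simp

text \<open>The unit mass on \<open>[-1, 0)\<close> only produces jumps of size 0 in \<open>cluster_law\<close>. It keeps the total mass
  positive when \<open>\<mu> = 0\<close>.\<close>
definition "wt s = hp s + indicator {-1..<0} s"

lemma wt_int: "integrable lborel wt" unfolding wt_def by (intro Bochner_Integration.integrable_add hp_int) (auto simp: integrable_indicator_iff)

sublocale W: weight wt
proof
  show "integrable lborel wt" by (rule wt_int)
  have "(LINT s|lborel. wt s) = \<mu> + 1"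
    unfolding wt_def mu_eq by (subst Bochner_Integration.integral_add[OF hp_int]) (auto simp: integrable_indicator_iff)
  then show "(LINT s|lborel. wt s) > 0" using mu0 by simp
qed (simp add: wt_def hp_nonneg)

lemma wt_if: "wt s * (if s > 0 then c else 0) = hp s * (c::real)"
  by (auto simp: wt_def hp_zero indicator_def)

text \<open>The compensator attached to a point at \<open>t\<close>. It is also the mean of the
  offspring part of a cluster started at \<open>t\<close>, because a cluster started at
  \<open>r\<close> has mean \<open>u r\<close>.\<close>

definition "hu t = (LINT s|lborel. hp s * u (t + s))"

lemma hu_meas[measurable]: "hu \<in> borel_measurable borel"
  unfolding hu_def by measurable

text \<open>The law of the sum of \<open>u(s) - \<integral> hp(r) u(s + r) dr\<close> over the points \<open>s\<close> of the first \<open>n\<close> generations of the cluster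
  started at \<open>t\<close>, without the compensator in the last generation, so that the mean is \<open>u(t)\<close>.\<close>
primrec cluster_law :: "nat \<Rightarrow> real \<Rightarrow> real measure" where
  "cluster_law 0 = (\<lambda>t. return borel (u t))"
| "cluster_law (Suc n) = (\<lambda>t. distr (cp_mixture wt (\<lambda>s. if s > 0 then cluster_law n (t + s) else return borel 0)) borel (\<lambda>x. x + (u t - hu t)))"

lemma kernel_off:
  fixes P :: "real \<Rightarrow> real measure" and t :: real
  assumes [measurable]: "P \<in> borel \<rightarrow>\<^sub>M prob_algebra borel"
  shows "(\<lambda>(t, s). if s > 0 then P (t + s) else return borel 0) \<in> borel \<Otimes>\<^sub>M borel \<rightarrow>\<^sub>M prob_algebra borel"
    "(\<lambda>s. if s > 0 then P (t + s) else return borel 0) \<in> borel \<rightarrow>\<^sub>M prob_algebra borel"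
proof -
  have [measurable]: "(\<lambda>x. return borel (0::real)) \<in> M \<rightarrow>\<^sub>M prob_algebra borel" for M :: "'x measure"
    by (rule measurable_const) (simp add: space_prob_algebra prob_space_return)
  show "(\<lambda>(t, s). if s > 0 then P (t + s) else return borel 0) \<in> borel \<Otimes>\<^sub>M borel \<rightarrow>\<^sub>M prob_algebra borel"
    "(\<lambda>s. if s > 0 then P (t + s) else return borel 0) \<in> borel \<rightarrow>\<^sub>M prob_algebra borel"
    by measurable
qed

lemma cluster_law_kernel[measurable]: "cluster_law n \<in> borel \<rightarrow>\<^sub>M prob_algebra borel"
proof (induction n)
  case 0
  show ?case by simp
next
  case (Suc n)
  have [measurable]: "(\<lambda>t. cp_mixture wt (\<lambda>s. if s > 0 then cluster_law n (t + s) else return borel 0)) \<in> borel \<rightarrow>\<^sub>M prob_algebra borel"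
    unfolding cp_mixture_def by (intro comp_poisson_kernel W.mixture_kernel kernel_off(1) Suc)
  show ?case unfolding cluster_law.simps by (rule measurable_distr_prob_space2) measurable
qed

definition "m2 n t = (\<integral>x. x^2 \<partial>cluster_law n t)"

lemma m2_meas[measurable]: "m2 n \<in> borel_measurable borel"
  unfolding m2_def[abs_def] using measurable_prob_algebraD[OF cluster_law_kernel[of n]] by measurable

lemma m2_nonneg: "m2 n t \<ge> 0" by (simp add: m2_def)

lemma hp_shift_int:
  assumes [measurable]: "f \<in> borel_measurable borel" and "\<And>t. \<bar>f t\<bar> \<le> C"
  shows "integrable lborel (\<lambda>s. hp s * f (t + s))"
proof (rule Bochner_Integration.integrable_bound[OF integrable_mult_right[OF hp_int, of C]])
  show "AE s in lborel. norm (hp s * f (t + s)) \<le> norm (C * hp s)"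
  proof (rule AE_I2)
    fix s
    have "\<bar>f (t + s)\<bar> * hp s \<le> C * hp s" using assms(2) hp_nonneg by (intro mult_right_mono) auto
    moreover have "C \<ge> 0" using assms(2)[of 0] by simp
    ultimately show "norm (hp s * f (t + s)) \<le> norm (C * hp s)" using hp_nonneg[of s] by (simp add: abs_mult mult.commute)
  qed
qed measurable

text \<open>All statements come from one induction, since the recursion for the second moment needs
  square integrability one generation earlier. The offspring of a point at \<open>t\<close> give a
  compound Poisson variable with mean \<open>hu t\<close> and variance
  \<open>\<integral> hp s * m2 n (t + s) ds\<close>; adding \<open>u t - hu t\<close> brings the
  mean to \<open>u t\<close> and leaves the variance. The bound \<open>U^2 / (1 - \<mu>)\<close> is
  the solution of \<open>V = U^2 + \<mu> * V\<close>.\<close>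

lemma cluster_law_moments:
  "sq_moment (cluster_law n t)" "(\<integral>x. x \<partial>cluster_law n t) = u t" "m2 n t \<le> U^2 / (1 - \<mu>)"
  "m2 (Suc n) t = (u t)^2 + (\<integral>s. hp s * m2 n (t + s) \<partial>lborel)"
proof -
  let ?V = "U^2 / (1 - \<mu>)"
  have V: "?V \<ge> 0" using mu1 by simp
  have u2: "(u t)^2 \<le> U^2" for t using power_mono[OF u_bd[of t], of 2] by simp
  have "(\<forall>t. sq_moment (cluster_law n t) \<and> (\<integral>x. x \<partial>cluster_law n t) = u t \<and> m2 n t \<le> ?V) \<and>
     (\<forall>t. m2 (Suc n) t = (u t)^2 + (\<integral>s. hp s * m2 n (t + s) \<partial>lborel) \<and> sq_moment (cluster_law (Suc n) t) \<and> (\<integral>x. x \<partial>cluster_law (Suc n) t) = u t \<and> m2 (Suc n) t \<le> ?V)"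
  proof (induction n)
    have step: "\<forall>t. m2 (Suc n) t = (u t)^2 + (\<integral>s. hp s * m2 n (t + s) \<partial>lborel) \<and> sq_moment (cluster_law (Suc n) t) \<and> (\<integral>x. x \<partial>cluster_law (Suc n) t) = u t \<and> m2 (Suc n) t \<le> ?V"
      if IH: "\<forall>t. sq_moment (cluster_law n t) \<and> (\<integral>x. x \<partial>cluster_law n t) = u t \<and> m2 n t \<le> ?V" for n
    proof
      fix t
      define K where "K s = (if s > 0 then cluster_law n (t + s) else return borel 0)" for s
      have K: "K \<in> borel \<rightarrow>\<^sub>M prob_algebra borel" unfolding K_def[abs_def] by (rule kernel_off(2)[OF cluster_law_kernel])
      have Ks: "sq_moment (K s)" for s using IH sq_moment_return by (simp add: K_def)
      have Kmean: "(\<integral>x. x \<partial>K s) = (if s > 0 then u (t + s) else 0)" for s using IH by (simp add: K_def integral_return)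
      have K2: "(\<integral>x. x^2 \<partial>K s) = (if s > 0 then m2 n (t + s) else 0)" for s by (simp add: K_def integral_return m2_def)
      have "(\<integral>\<^sup>+s. ennreal (wt s) * (\<integral>\<^sup>+x. ennreal (x^2) \<partial>K s) \<partial>lborel) \<le> (\<integral>\<^sup>+s. ennreal (wt s * ?V) \<partial>lborel)"
      proof (rule nn_integral_mono)
        fix s
        have "(\<integral>\<^sup>+x. ennreal (x^2) \<partial>K s) = ennreal (\<integral>x. x^2 \<partial>K s)"
          using sq_momentD(3)[OF Ks[of s]] by (intro nn_integral_eq_integral) auto
        also have "\<dots> \<le> ennreal ?V" unfolding K2 using IH V by (intro ennreal_leI) auto
        finally show "ennreal (wt s) * (\<integral>\<^sup>+x. ennreal (x^2) \<partial>K s) \<le> ennreal (wt s * ?V)"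
          using W.w_nonneg[of s] V unfolding ennreal_mult[OF W.w_nonneg V] by (intro mult_left_mono) auto
      qed
      also have "\<dots> < \<infinity>" using W.w_nonneg mu1 integrable_mult_left[OF W.w_int, of ?V]
        by (subst nn_integral_eq_integral) auto
      finally have fin: "(\<integral>\<^sup>+s. ennreal (wt s) * (\<integral>\<^sup>+x. ennreal (x^2) \<partial>K s) \<partial>lborel) < \<infinity>" .
      have mean: "(\<integral>x. x \<partial>cp_mixture wt K) = hu t"
        unfolding W.mean_cp_mixture[OF K fin] Kmean hu_def wt_if ..
      have sq: "(\<integral>x. x^2 \<partial>cp_mixture wt K) = (\<integral>s. hp s * m2 n (t + s) \<partial>lborel) + (hu t)^2"
        unfolding W.var_cp_mixture[OF K fin] Kmean K2 hu_def wt_if ..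
      note Q = W.sq_moment_cp_mixture[OF K fin]
      note [measurable_cong] = sq_momentD(2)[OF Q]
      interpret Q: prob_space "cp_mixture wt K" using sq_momentD[OF Q] by auto
      note iQ = integral_abs_le_quad(2)[OF Q] sq_momentD(3)[OF Q]
      define c where "c = u t - hu t"
      have P: "cluster_law (Suc n) t = distr (cp_mixture wt K) borel (\<lambda>x. x + c)" by (simp add: K_def[abs_def] c_def)
      have "sq_moment (cluster_law (Suc n) t)"
      proof -
        have "cluster_law (Suc n) t \<in> space (prob_algebra borel)" using measurable_space[OF cluster_law_kernel[of "Suc n"], of t] by simp
        moreover have "integrable (cp_mixture wt K) (\<lambda>x. x^2 + 2 * c * x + c^2)" using iQ by auto
        then have "integrable (cluster_law (Suc n) t) (\<lambda>x. x^2)"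
          unfolding P by (subst integrable_distr_eq) (auto simp: power2_sum algebra_simps)
        ultimately show ?thesis by (simp add: sq_moment_def)
      qed
      moreover have "(\<integral>x. x \<partial>cluster_law (Suc n) t) = u t"
      proof -
        have "(\<integral>x. x \<partial>cluster_law (Suc n) t) = (\<integral>x. x + c \<partial>cp_mixture wt K)" unfolding P by (rule integral_distr) measurable
        also have "\<dots> = (\<integral>x. x \<partial>cp_mixture wt K) + c" using iQ(1) by (simp add: Q.prob_space)
        finally show ?thesis by (simp add: mean c_def)
      qed
      moreover have m2S: "m2 (Suc n) t = (u t)^2 + (\<integral>s. hp s * m2 n (t + s) \<partial>lborel)"
      proof -
        have "m2 (Suc n) t = (\<integral>x. x^2 + 2 * c * x + c^2 \<partial>cp_mixture wt K)"
        proof -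
          have "m2 (Suc n) t = (\<integral>x. (x + c)^2 \<partial>cp_mixture wt K)" unfolding m2_def P by (rule integral_distr) measurable
          then show ?thesis by (simp add: power2_sum algebra_simps)
        qed
        also have "\<dots> = (\<integral>s. hp s * m2 n (t + s) \<partial>lborel) + (hu t)^2 + 2 * c * hu t + c^2"
          using iQ by (simp add: sq mean Q.prob_space)
        finally show ?thesis by (simp add: c_def power2_eq_square algebra_simps)
      qed
      moreover have "m2 (Suc n) t \<le> ?V"
      proof -
        have "(\<integral>s. hp s * m2 n (t + s) \<partial>lborel) \<le> (\<integral>s. hp s * ?V \<partial>lborel)"
          using IH hp_nonneg m2_nonneg hp_int mu1 by (intro integral_mono hp_shift_int[where C="?V"] mult_left_mono) auto
        also have "\<dots> = \<mu> * ?V" by (simp add: mu_eq)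
        finally have "m2 (Suc n) t \<le> U^2 + \<mu> * ?V" unfolding m2S using u2[of t] by simp
        also have "\<dots> = ?V" using mu1 by (simp add: field_simps)
        finally show ?thesis .
      qed
      ultimately show "m2 (Suc n) t = (u t)^2 + (\<integral>s. hp s * m2 n (t + s) \<partial>lborel) \<and> sq_moment (cluster_law (Suc n) t) \<and> (\<integral>x. x \<partial>cluster_law (Suc n) t) = u t \<and> m2 (Suc n) t \<le> ?V"
        by blast
    qed
    {
      case 0
      have "m2 0 t \<le> ?V" for t
      proof -
        have "m2 0 t \<le> U^2" using u2 by (simp add: m2_def integral_return)
        also have "\<dots> \<le> ?V" using mu0 mu1 by (simp add: field_simps)
        finally show ?thesis .
      qed
      then have "\<forall>t. sq_moment (cluster_law 0 t) \<and> (\<integral>x. x \<partial>cluster_law 0 t) = u t \<and> m2 0 t \<le> ?V"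
        by (simp add: sq_moment_return integral_return)
      with step[OF this] show ?case by blast
    next
      case (Suc n)
      then have "\<forall>t. sq_moment (cluster_law (Suc n) t) \<and> (\<integral>x. x \<partial>cluster_law (Suc n) t) = u t \<and> m2 (Suc n) t \<le> ?V" by blast
      with step[OF this] show ?case by blast
    }
  qed
  then show "sq_moment (cluster_law n t)" "(\<integral>x. x \<partial>cluster_law n t) = u t" "m2 n t \<le> U^2 / (1 - \<mu>)"
    "m2 (Suc n) t = (u t)^2 + (\<integral>s. hp s * m2 n (t + s) \<partial>lborel)" by blast+
qed

lemma m2_0: "m2 0 t = (u t)^2" by (simp add: m2_def integral_return)

definition "psi n \<theta> t = char (cluster_law n t) \<theta>"

lemma psi_meas[measurable]: "psi n \<theta> \<in> borel_measurable borel"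
  unfolding psi_def[abs_def] by (rule W.char_kernel_meas[OF cluster_law_kernel])

lemma psi_le1: "norm (psi n \<theta> t) \<le> 1"
  unfolding psi_def by (rule real_distribution.cmod_char_le_1[OF W.kernel_real_distribution[OF cluster_law_kernel]])

lemma psi_0: "psi 0 \<theta> t = iexp (\<theta> * u t)"
  by (simp add: psi_def char_def integral_return)

text \<open>The first factor is the deterministic shift, the second the characteristic function of
  the compound Poisson offspring. The jumps of size 0 that \<open>wt\<close> adds have
  characteristic function 1 and drop out of the exponent.\<close>

lemma psi_Suc: "psi (Suc n) \<theta> t = iexp (\<theta> * (u t - hu t)) * exp (\<integral>s. of_real (hp s) * (psi n \<theta> (t + s) - 1) \<partial>lborel)"
proof -
  define K where "K s = (if s > 0 then cluster_law n (t + s) else return borel 0)" for s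
  have K: "K \<in> borel \<rightarrow>\<^sub>M prob_algebra borel" unfolding K_def[abs_def] by (rule kernel_off(2)[OF cluster_law_kernel])
  have [measurable_cong]: "sets (cp_mixture wt K) = sets borel" using W.cp_mixture_prob[OF K] by (simp add: space_prob_algebra)
  have "psi (Suc n) \<theta> t = (\<integral>x. iexp (\<theta> * (x + (u t - hu t))) \<partial>cp_mixture wt K)"
    unfolding psi_def cluster_law.simps K_def[abs_def, symmetric] char_def by (subst integral_distr) auto
  also have "\<dots> = (\<integral>x. iexp (\<theta> * (u t - hu t)) * iexp (\<theta> * x) \<partial>cp_mixture wt K)"
    by (intro Bochner_Integration.integral_cong refl) (simp add: mult_exp_exp algebra_simps)
  also have "\<dots> = iexp (\<theta> * (u t - hu t)) * char (cp_mixture wt K) \<theta>" unfolding char_def by simp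
  also have "char (cp_mixture wt K) \<theta> = exp (\<integral>s. of_real (wt s) * (char (K s) \<theta> - 1) \<partial>lborel)" by (rule W.char_cp_mixture[OF K])
  also have "(\<lambda>s. of_real (wt s) * (char (K s) \<theta> - 1)) = (\<lambda>s. of_real (hp s) * (psi n \<theta> (t + s) - 1))"
    by (auto simp: K_def psi_def wt_def hp_zero char_def[of "return _ _"] integral_return indicator_def)
  finally show ?thesis .
qed


lemma m2_mono: "m2 n t \<le> m2 (Suc n) t"
proof (induction n arbitrary: t)
  case 0
  show ?case unfolding m2_0 cluster_law_moments(4) using hp_nonneg m2_nonneg by simp
next
  case (Suc n)
  show ?case unfolding cluster_law_moments(4)[of _ t]
    using Suc hp_nonneg m2_nonneg cluster_law_moments(3) mu1
    by (intro add_left_mono integral_mono hp_shift_int[where C="U^2 / (1 - \<mu>)"] mult_left_mono) auto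
qed

text \<open>Tonelli's theorem and a translation: the shift by \<open>s\<close> moves from
  \<open>g\<close> to \<open>a\<close> with the sign reversed. Every estimate that is integrated
  over the starting point of a cluster uses the recursion in this form.\<close>

lemma nn_conv_swap:
  assumes [measurable]: "a \<in> borel_measurable borel" "g \<in> borel_measurable borel"
  shows "(\<integral>\<^sup>+t. a t * (\<integral>\<^sup>+s. ennreal (hp s) * g (t + s) \<partial>lborel) \<partial>lborel) =
    (\<integral>\<^sup>+s. ennreal (hp s) * (\<integral>\<^sup>+t. a (t - s) * g t \<partial>lborel) \<partial>lborel)"
proof -
  have "(\<integral>\<^sup>+t. a t * (\<integral>\<^sup>+s. ennreal (hp s) * g (t + s) \<partial>lborel) \<partial>lborel) =
     (\<integral>\<^sup>+t. (\<integral>\<^sup>+s. a t * (ennreal (hp s) * g (t + s)) \<partial>lborel) \<partial>lborel)"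
    by (simp add: nn_integral_cmult)
  also have "\<dots> = (\<integral>\<^sup>+s. (\<integral>\<^sup>+t. a t * (ennreal (hp s) * g (t + s)) \<partial>lborel) \<partial>lborel)"
    by (rule lborel_pair.Fubini') measurable
  also have "\<dots> = (\<integral>\<^sup>+s. ennreal (hp s) * (\<integral>\<^sup>+t. a (t - s) * g t \<partial>lborel) \<partial>lborel)"
  proof (rule nn_integral_cong)
    fix s :: real
    have "(\<integral>\<^sup>+t. a t * (ennreal (hp s) * g (t + s)) \<partial>lborel) = (\<integral>\<^sup>+t. ennreal (hp s) * (a (t + s - s) * g (t + s)) \<partial>lborel)"
      by (simp add: mult_ac)
    also have "\<dots> = ennreal (hp s) * (\<integral>\<^sup>+t. a (t + s - s) * g (t + s) \<partial>lborel)" by (rule nn_integral_cmult) measurable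
    also have "(\<integral>\<^sup>+t. a (t + s - s) * g (t + s) \<partial>lborel) = (\<integral>\<^sup>+t. a (t - s) * g t \<partial>lborel)"
      using nn_integral_shift[of "\<lambda>t. a (t - s) * g t" s] by simp
    finally show "(\<integral>\<^sup>+t. a t * (ennreal (hp s) * g (t + s)) \<partial>lborel) = ennreal (hp s) * (\<integral>\<^sup>+t. a (t - s) * g t \<partial>lborel)" .
  qed
  finally show ?thesis .
qed

text \<open>The mean of \<open>cluster_law n t\<close> is \<open>u t\<close>, so this is its
  variance. It is entirely due to the offspring: for \<open>Suc n\<close> it is the integral of
  \<open>hp s * m2 n (t + s)\<close>.\<close>

definition "vn n t = m2 n t - (u t)^2"

lemma vn_meas[measurable]: "vn n \<in> borel_measurable borel" unfolding vn_def[abs_def] by measurable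

lemma vn_Suc: "ennreal (vn (Suc n) t) = (\<integral>\<^sup>+s. ennreal (hp s) * ennreal (m2 n (t + s)) \<partial>lborel)"
proof -
  have "integrable lborel (\<lambda>s. hp s * m2 n (t + s))"
    by (rule hp_shift_int[where C="U^2 / (1 - \<mu>)"]) (use cluster_law_moments(3) m2_nonneg mu1 in auto)
  then show ?thesis using hp_nonneg m2_nonneg
    by (simp add: vn_def cluster_law_moments(4) nn_integral_eq_integral ennreal_mult[symmetric])
qed

lemma vn_nonneg: "vn n t \<ge> 0"
proof (cases n)
  case (Suc k)
  then show ?thesis using hp_nonneg m2_nonneg by (simp add: vn_def cluster_law_moments(4))
qed (simp add: vn_def m2_0)

lemma var_cluster_law: "(\<integral>x. (x - u t)^2 \<partial>cluster_law n t) = vn n t"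
proof -
  interpret P: prob_space "cluster_law n t" using sq_momentD[OF cluster_law_moments(1)] by auto
  have "(\<integral>x. (x - u t)^2 \<partial>cluster_law n t) = (\<integral>x. x^2 - 2 * u t * x + (u t)^2 \<partial>cluster_law n t)" by (simp add: power2_diff algebra_simps)
  also have "\<dots> = m2 n t - 2 * u t * u t + (u t)^2"
    using sq_momentD(3)[OF cluster_law_moments(1)] integral_abs_le_quad(2)[OF cluster_law_moments(1)]
    by (simp add: P.prob_space m2_def cluster_law_moments(2))
  finally show ?thesis by (simp add: vn_def power2_eq_square)
qed

lemma nn_hp: "(\<integral>\<^sup>+s. ennreal (hp s) \<partial>lborel) = ennreal \<mu>"
  unfolding mu_eq using hp_nonneg hp_int by (intro nn_integral_eq_integral) auto

lemma u_pow_int: "k > 0 \<Longrightarrow> integrable lborel (\<lambda>t. \<bar>u t\<bar> ^ k)"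
proof (rule Bochner_Integration.integrable_bound)
  show "integrable lborel (\<lambda>t. U ^ k * indicator {-T..T} t)" by (auto simp: integrable_indicator_iff emeasure_lborel_Icc_eq)
  assume k: "k > 0"
  show "AE t in lborel. norm (\<bar>u t\<bar> ^ k) \<le> norm (U ^ k * indicator {-T..T} t)"
  proof (rule AE_I2)
    fix t
    show "norm (\<bar>u t\<bar> ^ k) \<le> norm (U ^ k * indicator {-T..T} t)"
    proof (cases "\<bar>t\<bar> > T")
      case True
      then show ?thesis using u_supp[OF True] k by (simp add: zero_power)
    next
      case False
      then show ?thesis using power_mono[OF u_bd[of t], of k] U0 by (auto simp: indicator_def abs_if split: if_splits)
    qed
  qed
qed measurable

lemma u2_int: "integrable lborel (\<lambda>t. (u t)^2)" and u4_int: "integrable lborel (\<lambda>t. (u t)^4)" and u_int: "integrable lborel u"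
  using u_pow_int[of 2] u_pow_int[of 4] u_pow_int[of 1] by (simp_all add: power_even_abs_numeral integrable_abs_iff)

definition "S2 = (\<integral>t. (u t)^2 \<partial>lborel)"
definition "S3 = (\<integral>t. \<bar>u t\<bar>^3 \<partial>lborel)"
definition "S4 = (\<integral>t. (u t)^4 \<partial>lborel)"

lemma nn_S2: "(\<integral>\<^sup>+t. ennreal ((u t)^2) \<partial>lborel) = ennreal S2"
  unfolding S2_def using u2_int by (intro nn_integral_eq_integral) auto

lemma nn_S4: "(\<integral>\<^sup>+t. ennreal ((u t)^4) \<partial>lborel) = ennreal S4"
  unfolding S4_def using u4_int by (intro nn_integral_eq_integral) auto

lemma S_nonneg: "S2 \<ge> 0" "S3 \<ge> 0" "S4 \<ge> 0" by (simp_all add: S2_def S3_def S4_def)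

lemma nn_m2_split: "ennreal (m2 n t) = ennreal ((u t)^2) + ennreal (vn n t)"
  using vn_nonneg[of n t] by (simp add: ennreal_plus[symmetric] vn_def del: ennreal_plus)

lemma nn_vn_Suc: "(\<integral>\<^sup>+t. ennreal (vn (Suc n) t) \<partial>lborel) = ennreal \<mu> * (\<integral>\<^sup>+t. ennreal (m2 n t) \<partial>lborel)"
proof -
  have "(\<integral>\<^sup>+t. ennreal (vn (Suc n) t) \<partial>lborel) = (\<integral>\<^sup>+s. ennreal (hp s) * (\<integral>\<^sup>+t. ennreal (m2 n t) \<partial>lborel) \<partial>lborel)"
    unfolding vn_Suc using nn_conv_swap[of "\<lambda>_. 1" "\<lambda>t. ennreal (m2 n t)"] by simp
  also have "\<dots> = ennreal \<mu> * (\<integral>\<^sup>+t. ennreal (m2 n t) \<partial>lborel)" by (simp add: nn_integral_multc nn_hp)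
  finally show ?thesis .
qed

text \<open>Each further generation multiplies the integrated second moment by \<mu>, which yields
  the geometric sum of \<open>S2 * \<mu>^k\<close> over \<open>k \<le> n\<close>.\<close>

lemma nn_m2: "(\<integral>\<^sup>+t. ennreal (m2 n t) \<partial>lborel) = ennreal (S2 * (1 - \<mu> ^ Suc n) / (1 - \<mu>))"
proof (induction n)
  case 0
  show ?case using mu1 by (simp add: m2_0 nn_S2)
next
  case (Suc n)
  have p: "\<mu> ^ k \<le> 1" for k using mu0 mu1 by (simp add: power_le_one)
  have "(\<integral>\<^sup>+t. ennreal (m2 (Suc n) t) \<partial>lborel) = ennreal S2 + ennreal \<mu> * (\<integral>\<^sup>+t. ennreal (m2 n t) \<partial>lborel)"
    unfolding nn_m2_split[of "Suc n"] nn_vn_Suc[symmetric] nn_S2[symmetric] by (rule nn_integral_add) auto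
  also have "\<dots> = ennreal (S2 + \<mu> * (S2 * (1 - \<mu> ^ Suc n) / (1 - \<mu>)))"
    unfolding Suc using S_nonneg mu0 mu1 p[of "Suc n"] by (simp add: ennreal_mult[symmetric] ennreal_plus[symmetric] del: ennreal_plus power_Suc)
  also have "S2 + \<mu> * (S2 * (1 - \<mu> ^ Suc n) / (1 - \<mu>)) = S2 * (1 - \<mu> ^ Suc (Suc n)) / (1 - \<mu>)"
    using mu1 by (simp add: field_simps)
  finally show ?case .
qed

lemma nn_m2_le: "(\<integral>\<^sup>+t. ennreal (m2 n t) \<partial>lborel) \<le> ennreal (S2 / (1 - \<mu>))"
proof -
  have "\<mu> ^ Suc n \<ge> 0" using mu0 by simp
  then have "S2 * (1 - \<mu> ^ Suc n) \<le> S2 * 1" using S_nonneg by (intro mult_left_mono) linarith+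
  then show ?thesis unfolding nn_m2 using mu1 by (intro ennreal_leI divide_right_mono) auto
qed

lemma nn_vn_le: "(\<integral>\<^sup>+t. ennreal (vn n t) \<partial>lborel) \<le> ennreal (\<mu> * S2 / (1 - \<mu>))"
proof (cases n)
  case 0
  then show ?thesis using mu0 mu1 S_nonneg by (simp add: vn_def m2_0)
next
  case (Suc k)
  have "(\<integral>\<^sup>+t. ennreal (vn n t) \<partial>lborel) \<le> ennreal \<mu> * ennreal (S2 / (1 - \<mu>))"
    unfolding Suc nn_vn_Suc by (intro mult_left_mono nn_m2_le) auto
  also have "\<dots> = ennreal (\<mu> * S2 / (1 - \<mu>))" using mu0 mu1 S_nonneg by (simp add: ennreal_mult[symmetric])
  finally show ?thesis .
qed

text \<open>For \<open>u^2\<close> in place of \<open>m2 n\<close> this is the Cauchy-Schwarz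
  inequality, with \<open>sqrt S4\<close> as the L2 norm of \<open>u^2\<close>. In the recursion the
  offspring part is an average of the same integrals with \<open>a\<close> translated; translation
  preserves the L2 norm, so the induction runs over all \<open>a\<close> at once, and the constant
  solves \<open>K = \<alpha> * sqrt S4 + \<mu> * K\<close>.\<close>

lemma nn_a_m2:
  assumes [measurable]: "a \<in> borel_measurable borel" and "\<alpha> \<ge> 0" and a: "(\<integral>\<^sup>+t. (a t)^2 \<partial>lborel) \<le> ennreal (\<alpha>^2)"
  shows "(\<integral>\<^sup>+t. a t * ennreal (m2 n t) \<partial>lborel) \<le> ennreal (\<alpha> * sqrt S4 / (1 - \<mu>))"
  using assms
proof (induction n arbitrary: a)
  have sq: "(\<integral>\<^sup>+t. a t * ennreal ((u t)^2) \<partial>lborel) \<le> ennreal (\<alpha> * sqrt S4)"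
    if [measurable]: "a \<in> borel_measurable borel" and a: "(\<integral>\<^sup>+t. (a t)^2 \<partial>lborel) \<le> ennreal (\<alpha>^2)" for a
  proof -
    let ?I = "\<integral>\<^sup>+t. a t * ennreal ((u t)^2) \<partial>lborel"
    have "?I^2 \<le> (\<integral>\<^sup>+t. (a t)^2 \<partial>lborel) * (\<integral>\<^sup>+t. (ennreal ((u t)^2))^2 \<partial>lborel)"
      by (rule Cauchy_Schwarz_nn_integral) measurable
    also have "(\<integral>\<^sup>+t. (ennreal ((u t)^2))^2 \<partial>lborel) = ennreal S4"
      unfolding nn_S4[symmetric] by (intro nn_integral_cong) (simp add: ennreal_power power_mult[symmetric])
    also have "(\<integral>\<^sup>+t. (a t)^2 \<partial>lborel) * ennreal S4 \<le> ennreal (\<alpha>^2) * ennreal S4" by (intro mult_right_mono a) auto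
    also have "\<dots> = (ennreal (\<alpha> * sqrt S4))^2"
      using assms(2) S_nonneg by (simp add: ennreal_mult[symmetric] ennreal_power power_mult_distrib)
    finally have le: "?I^2 \<le> (ennreal (\<alpha> * sqrt S4))^2" .
    \<comment> \<open>The square root is taken by contradiction, with the value \<infinity> of the
      integral treated apart.\<close>
    show ?thesis
    proof (rule ccontr)
      assume "\<not> ?thesis"
      then have lt: "ennreal (\<alpha> * sqrt S4) < ?I" by simp
      then show False
      proof (cases ?I)
        case (real r)
        with lt assms(2) S_nonneg have "\<alpha> * sqrt S4 < r" by (simp add: ennreal_less_iff)
        moreover from le real assms(2) S_nonneg have "r^2 \<le> (\<alpha> * sqrt S4)^2" by (simp add: ennreal_power)
        ultimately show False using power2_le_imp_le[of r "\<alpha> * sqrt S4"] assms(2) S_nonneg by simp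
      next
        case top
        then show False using le assms(2) S_nonneg by (simp add: power2_eq_square ennreal_mult[symmetric] top_unique)
      qed
    qed
  qed
  have c: "\<alpha> * sqrt S4 \<ge> 0" using assms(2) S_nonneg by simp
  {
    case (0 a)
    have "ennreal (\<alpha> * sqrt S4) \<le> ennreal (\<alpha> * sqrt S4 / (1 - \<mu>))"
      using mu0 mu1 c by (intro ennreal_leI) (simp add: pos_le_divide_eq mult_left_le)
    then show ?case using sq[OF 0(1) 0(3)] by (simp add: m2_0)
  next
    case (Suc n a)
    note [measurable] = Suc.prems(1)
    have "(\<integral>\<^sup>+t. a t * ennreal (m2 (Suc n) t) \<partial>lborel) = (\<integral>\<^sup>+t. a t * ennreal ((u t)^2) \<partial>lborel) + (\<integral>\<^sup>+t. a t * ennreal (vn (Suc n) t) \<partial>lborel)"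
      unfolding nn_m2_split[of "Suc n"] distrib_left by (rule nn_integral_add) auto
    also have "(\<integral>\<^sup>+t. a t * ennreal (vn (Suc n) t) \<partial>lborel) = (\<integral>\<^sup>+s. ennreal (hp s) * (\<integral>\<^sup>+t. a (t - s) * ennreal (m2 n t) \<partial>lborel) \<partial>lborel)"
      unfolding vn_Suc by (rule nn_conv_swap) auto
    also have "\<dots> \<le> (\<integral>\<^sup>+s. ennreal (hp s) * ennreal (\<alpha> * sqrt S4 / (1 - \<mu>)) \<partial>lborel)"
    proof (intro nn_integral_mono mult_left_mono)
      fix s :: real
      have "(\<integral>\<^sup>+t. (a (t - s))^2 \<partial>lborel) = (\<integral>\<^sup>+t. (a t)^2 \<partial>lborel)"
        using nn_integral_shift[of "\<lambda>t. (a t)^2" "-s"] by simp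
      then show "(\<integral>\<^sup>+t. a (t - s) * ennreal (m2 n t) \<partial>lborel) \<le> ennreal (\<alpha> * sqrt S4 / (1 - \<mu>))"
        using Suc.prems by (intro Suc.IH) auto
    qed auto
    also have "\<dots> = ennreal (\<mu> * (\<alpha> * sqrt S4 / (1 - \<mu>)))"
      using c mu0 mu1 by (simp add: nn_integral_multc nn_hp ennreal_mult[symmetric])
    finally have "(\<integral>\<^sup>+t. a t * ennreal (m2 (Suc n) t) \<partial>lborel) \<le> ennreal (\<alpha> * sqrt S4) + ennreal (\<mu> * (\<alpha> * sqrt S4 / (1 - \<mu>)))"
      using sq[OF Suc.prems(1) Suc.prems(3)] by (meson add_left_mono add_right_mono order_trans)
    also have "\<dots> = ennreal (\<alpha> * sqrt S4 + \<mu> * (\<alpha> * sqrt S4 / (1 - \<mu>)))"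
      using assms(2) S_nonneg mu0 mu1 by (intro ennreal_plus[symmetric] mult_nonneg_nonneg divide_nonneg_nonneg) auto
    also have "\<alpha> * sqrt S4 + \<mu> * (\<alpha> * sqrt S4 / (1 - \<mu>)) = \<alpha> * sqrt S4 / (1 - \<mu>)"
      using mu1 by (simp add: field_simps)
    finally show ?case .
  }
qed

text \<open>The preceding estimate with a translate of \<open>\<bar>u\<bar>\<close> as
  \<open>a\<close>; integrating against \<open>hp\<close> gains the factor \<mu>. This is the origin
  of the product of the L2 norms of \<open>u\<close> and \<open>u^2\<close> in the bound.\<close>

lemma nn_u_vn: "(\<integral>\<^sup>+t. ennreal \<bar>u t\<bar> * ennreal (vn n t) \<partial>lborel) \<le> ennreal (\<mu> / (1 - \<mu>) * (sqrt S2 * sqrt S4))"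
proof (cases n)
  case 0
  then show ?thesis using mu0 mu1 S_nonneg by (simp add: vn_def m2_0)
next
  case (Suc k)
  have "(\<integral>\<^sup>+t. ennreal \<bar>u t\<bar> * ennreal (vn n t) \<partial>lborel) = (\<integral>\<^sup>+s. ennreal (hp s) * (\<integral>\<^sup>+t. ennreal \<bar>u (t - s)\<bar> * ennreal (m2 k t) \<partial>lborel) \<partial>lborel)"
    unfolding Suc vn_Suc by (rule nn_conv_swap) auto
  also have "\<dots> \<le> (\<integral>\<^sup>+s. ennreal (hp s) * ennreal (sqrt S2 * sqrt S4 / (1 - \<mu>)) \<partial>lborel)"
  proof (intro nn_integral_mono mult_left_mono nn_a_m2)
    fix s :: real
    have "(\<integral>\<^sup>+t. (ennreal \<bar>u (t - s)\<bar>)^2 \<partial>lborel) = (\<integral>\<^sup>+t. ennreal ((u t)^2) \<partial>lborel)"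
      using nn_integral_shift[of "\<lambda>t. ennreal ((u t)^2)" "-s"] by (simp add: ennreal_power)
    then show "(\<integral>\<^sup>+t. (ennreal \<bar>u (t - s)\<bar>)^2 \<partial>lborel) \<le> ennreal ((sqrt S2)^2)" using S_nonneg by (simp add: nn_S2)
  qed (use S_nonneg in auto)
  also have "\<dots> = ennreal (\<mu> * (sqrt S2 * sqrt S4 / (1 - \<mu>)))"
    using S_nonneg mu0 mu1 by (simp add: nn_integral_multc nn_hp ennreal_mult[symmetric])
  finally show ?thesis by simp
qed

end

text \<open>On the closed left half-plane, which is convex, the derivative of \<open>exp\<close> has
  norm at most 1. This is the reason why the signs of the real parts are recorded for all
  exponents.\<close>

lemma norm_exp_diff_le:
  assumes "Re a \<le> 0" "Re b \<le> 0"
  shows "norm (exp a - exp b) \<le> norm (a - b)"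
proof -
  have "norm (exp a - exp b) \<le> 1 * norm (a - b)"
  proof (rule field_differentiable_bound[of "{z. Re z \<le> 0}" exp exp 1 a b])
    show "convex {z. Re z \<le> 0}" by (rule convex_halfspace_Re_le)
    show "(exp has_field_derivative exp z) (at z within {z. Re z \<le> 0})" for z
      by (auto intro!: derivative_eq_intros)
    show "norm (exp z) \<le> 1" if "z \<in> {z. Re z \<le> 0}" for z using that by simp
  qed (use assms in auto)
  then show ?thesis by simp
qed

section \<open>Compound Poisson approximation on growing windows\<close>

context cluster
begin

text \<open>The summand 1 in the endpoints keeps the total mass positive at \<open>n = 0\<close>, so
  that \<open>weight\<close> applies to every \<open>n\<close>.\<close>

definition window :: "real \<Rightarrow> nat \<Rightarrow> real \<Rightarrow> real" where "window \<nu> n s = \<nu> * indicator {-(real n + 1)..real n + 1} s"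

lemma weight_window: "\<nu> > 0 \<Longrightarrow> weight (window \<nu> n)"
proof
  assume "\<nu> > 0"
  show "integrable lborel (window \<nu> n)" unfolding window_def[abs_def] by (auto simp: integrable_indicator_iff emeasure_lborel_Icc_eq)
  have "(LINT s|lborel. window \<nu> n s) = \<nu> * (2 * real n + 2)" unfolding window_def by simp
  then show "(LINT s|lborel. window \<nu> n s) > 0" using \<open>\<nu> > 0\<close> by simp
qed (simp add: window_def)

lemma window_le: "\<nu> > 0 \<Longrightarrow> 0 \<le> window \<nu> n s \<and> window \<nu> n s \<le> \<nu>" by (auto simp: window_def indicator_def)

lemma m2_int: "integrable lborel (m2 n)" "(\<integral>t. m2 n t \<partial>lborel) = S2 * (1 - \<mu> ^ Suc n) / (1 - \<mu>)"
proof -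
  have p: "\<mu> ^ Suc n \<le> 1" using mu0 mu1 by (simp add: power_le_one del: power_Suc)
  have "(\<integral>\<^sup>+t. ennreal (norm (m2 n t)) \<partial>lborel) < \<infinity>" using nn_m2[of n] m2_nonneg by simp
  then show "integrable lborel (m2 n)" by (auto simp: integrable_iff_bounded)
  show "(\<integral>t. m2 n t \<partial>lborel) = S2 * (1 - \<mu> ^ Suc n) / (1 - \<mu>)"
    using m2_nonneg p S_nonneg mu1 by (subst integral_eq_nn_integral) (auto simp: nn_m2 simp del: power_Suc)
qed

lemma vn_int: "integrable lborel (vn n)" "(\<integral>t. vn n t \<partial>lborel) \<le> \<mu> * S2 / (1 - \<mu>)"
proof -
  show "integrable lborel (vn n)" unfolding vn_def[abs_def] by (intro Bochner_Integration.integrable_diff m2_int u2_int)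
  have "ennreal (\<integral>t. vn n t \<partial>lborel) \<le> ennreal (\<mu> * S2 / (1 - \<mu>))"
    using nn_vn_le[of n] nn_integral_eq_integral[OF \<open>integrable lborel (vn n)\<close>] vn_nonneg by simp
  then show "(\<integral>t. vn n t \<partial>lborel) \<le> \<mu> * S2 / (1 - \<mu>)" using mu0 mu1 S_nonneg by (simp add: ennreal_le_iff)
qed

lemma u_vn_int: "integrable lborel (\<lambda>t. \<bar>u t\<bar> * vn n t)" "(\<integral>t. \<bar>u t\<bar> * vn n t \<partial>lborel) \<le> \<mu> / (1 - \<mu>) * (sqrt S2 * sqrt S4)"
proof -
  have "(\<integral>\<^sup>+t. ennreal (norm (\<bar>u t\<bar> * vn n t)) \<partial>lborel) = (\<integral>\<^sup>+t. ennreal \<bar>u t\<bar> * ennreal (vn n t) \<partial>lborel)"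
    using vn_nonneg by (intro nn_integral_cong) (simp add: ennreal_mult abs_mult)
  also note nn_u_vn
  finally have le: "(\<integral>\<^sup>+t. ennreal (norm (\<bar>u t\<bar> * vn n t)) \<partial>lborel) \<le> ennreal (\<mu> / (1 - \<mu>) * (sqrt S2 * sqrt S4))" .
  also have "\<dots> < \<infinity>" by simp
  finally show i: "integrable lborel (\<lambda>t. \<bar>u t\<bar> * vn n t)" by (auto simp: integrable_iff_bounded)
  have "ennreal (\<integral>t. \<bar>u t\<bar> * vn n t \<partial>lborel) \<le> ennreal (\<mu> / (1 - \<mu>) * (sqrt S2 * sqrt S4))"
    using le nn_integral_eq_integral[OF i] vn_nonneg by simp
  then show "(\<integral>t. \<bar>u t\<bar> * vn n t \<partial>lborel) \<le> \<mu> / (1 - \<mu>) * (sqrt S2 * sqrt S4)" using mu0 mu1 S_nonneg by (simp add: ennreal_le_iff)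
qed

text \<open>\<open>window_law \<nu> n\<close> shifted by \<open>- an \<nu> n\<close> approximates the law of \<open>\<delta>(u)\<close>: only immigrants in the window
  \<open>[-(n + 1), n + 1]\<close> and \<open>n\<close> generations are taken into account.\<close>
definition "window_law \<nu> n = cp_mixture (window \<nu> n) (cluster_law n)"
definition "an \<nu> n = (\<integral>s. window \<nu> n s * u s \<partial>lborel)"

lemma window_law_fin:
  assumes "\<nu> > 0"
  shows "(\<integral>\<^sup>+s. ennreal (window \<nu> n s) * (\<integral>\<^sup>+x. ennreal (x^2) \<partial>cluster_law n s) \<partial>lborel) < \<infinity>"
proof -
  have "(\<integral>\<^sup>+s. ennreal (window \<nu> n s) * (\<integral>\<^sup>+x. ennreal (x^2) \<partial>cluster_law n s) \<partial>lborel) \<le> (\<integral>\<^sup>+s. ennreal \<nu> * ennreal (m2 n s) \<partial>lborel)"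
  proof (rule nn_integral_mono)
    fix s
    have "(\<integral>\<^sup>+x. ennreal (x^2) \<partial>cluster_law n s) = ennreal (m2 n s)"
      unfolding m2_def using sq_momentD(3)[OF cluster_law_moments(1)] by (intro nn_integral_eq_integral) auto
    then show "ennreal (window \<nu> n s) * (\<integral>\<^sup>+x. ennreal (x^2) \<partial>cluster_law n s) \<le> ennreal \<nu> * ennreal (m2 n s)"
      using window_le[OF assms, of n s] by (auto intro!: mult_right_mono ennreal_leI)
  qed
  also have "\<dots> < \<infinity>" by (simp add: nn_integral_cmult nn_m2 ennreal_mult_less_top)
  finally show ?thesis .
qed

text \<open>In the error terms the window may be enlarged to the whole line at once, because they
  are monotone in the weight. The distance of the variance from 1 is not, and the windowed variance
  is kept there until the limit is taken.\<close>

lemma window_law_stein: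
  fixes g g' :: "real \<Rightarrow> real"
  assumes nu: "\<nu> > 0" and dg: "\<And>x. (g has_real_derivative g' x) (at x)" and g'1: "\<And>x. \<bar>g' x\<bar> \<le> 1"
  shows "\<bar>(\<integral>x. g (x - an \<nu> n) \<partial>window_law \<nu> n) - (LINT t|lborel. gphi t * g t)\<bar> \<le>
    sqrt (2 / pi) * \<bar>1 - (\<integral>s. window \<nu> n s * m2 n s \<partial>lborel)\<bar>
    + \<nu> * (S3 + \<mu> / (1 - \<mu>) * (sqrt S2 * sqrt S4) + 2 * sqrt (2 / pi) * (\<mu> * S2 / (1 - \<mu>)))"
proof -
  interpret w: weight "window \<nu> n" by (rule weight_window[OF nu])
  obtain f f' where f: "\<And>x. (f has_real_derivative f' x) (at x)" "\<And>x. \<bar>f x\<bar> \<le> 1"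
    "\<And>x. \<bar>f' x\<bar> \<le> sqrt (2 / pi)" "\<And>x y. \<bar>f' x - f' y\<bar> \<le> 2 * \<bar>x - y\<bar>"
    "\<And>x. f' x - x * f x = g x - (LINT t|lborel. gphi t * g t)"
    apply (rule stein_solution[OF dg g'1])
    subgoal premises p by (rule p(1)[OF p(2-6)])
    done
  have sf: "stein_fun f f' (sqrt (2 / pi))" by unfold_locales (use f in auto)
  define \<sigma> where "\<sigma> = sqrt (2 / pi)"
  have s0: "\<sigma> \<ge> 0" by (simp add: \<sigma>_def)
  have i0: "integrable lborel (\<lambda>s. \<bar>u s\<bar>^3 + \<bar>u s\<bar> * vn n s + 2 * \<sigma> * vn n s)"
    using u_pow_int[of 3] u_vn_int(1) vn_int(1) by auto
  have wb: "\<bar>window \<nu> n s * (\<bar>u s\<bar>^3 + \<bar>u s\<bar> * vn n s + 2 * \<sigma> * vn n s)\<bar> \<le> \<nu> * (\<bar>u s\<bar>^3 + \<bar>u s\<bar> * vn n s + 2 * \<sigma> * vn n s)" for s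
  proof -
    have "0 \<le> \<bar>u s\<bar>^3 + \<bar>u s\<bar> * vn n s + 2 * \<sigma> * vn n s" using s0 vn_nonneg[of n s] by simp
    then show ?thesis using window_le[OF nu, of n s] by (simp add: abs_mult mult_right_mono)
  qed
  have ib: "integrable lborel (\<lambda>s. window \<nu> n s * (\<bar>u s\<bar>^3 + \<bar>u s\<bar> * vn n s + 2 * \<sigma> * vn n s))"
    by (rule Bochner_Integration.integrable_bound[OF integrable_mult_right[OF i0, of \<nu>]])
      (use wb in \<open>auto intro: order_trans[OF _ abs_ge_self]\<close>)
  interpret Q: prob_space "window_law \<nu> n" unfolding window_law_def using w.cp_mixture_prob[OF cluster_law_kernel] by (simp add: space_prob_algebra)
  have gm: "g \<in> borel_measurable borel"
    using dg by (intro borel_measurable_continuous_onI) (meson DERIV_isCont continuous_at_imp_continuous_on)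
  note Qs = w.sq_moment_cp_mixture[OF cluster_law_kernel window_law_fin[OF nu]]
  have lip: "\<bar>g x - g y\<bar> \<le> \<bar>x - y\<bar>" for x y
    using field_differentiable_bound[of UNIV g g' 1 x y] dg g'1 by (auto simp: has_field_derivative_at_within)
  define a where "a = an \<nu> n"
  have ig: "integrable (window_law \<nu> n) (\<lambda>x. g (x - a))"
    unfolding window_law_def
  proof (rule quad_integrable[OF Qs, where C="1 + \<bar>g 0\<bar> + \<bar>a\<bar>"])
    fix x :: real
    have "\<bar>g (x - a)\<bar> \<le> \<bar>g 0\<bar> + \<bar>x - a\<bar>" using lip[of "x - a" 0] by simp
    also have "\<dots> \<le> \<bar>g 0\<bar> + \<bar>a\<bar> + (1 + x^2)" using abs_le_one_plus_sq[of x] by simp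
    also have "\<dots> \<le> (1 + \<bar>g 0\<bar> + \<bar>a\<bar>) * (1 + x\<^sup>2)" by (simp add: algebra_simps)
    finally show "\<bar>g (x - a)\<bar> \<le> (1 + \<bar>g 0\<bar> + \<bar>a\<bar>) * (1 + x\<^sup>2)" .
  qed (use gm in measurable)
  have "(\<integral>x. g (x - a) \<partial>window_law \<nu> n) - (LINT t|lborel. gphi t * g t) = (\<integral>x. g (x - a) - (LINT t|lborel. gphi t * g t) \<partial>window_law \<nu> n)"
    using ig by (simp add: Q.prob_space)
  also have "\<dots> = (\<integral>x. f' (x - a) - (x - a) * f (x - a) \<partial>window_law \<nu> n)" by (simp only: f(5))
  finally have eq: "(\<integral>x. g (x - a) \<partial>window_law \<nu> n) - (LINT t|lborel. gphi t * g t) = (\<integral>x. f' (x - a) - (x - a) * f (x - a) \<partial>window_law \<nu> n)" .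
  have "\<bar>\<integral>x. f' (x - a) - (x - a) * f (x - a) \<partial>window_law \<nu> n\<bar> \<le> \<sigma> * \<bar>1 - (\<integral>s. window \<nu> n s * (\<integral>x. x^2 \<partial>cluster_law n s) \<partial>lborel)\<bar>
      + (\<integral>s. window \<nu> n s * (\<bar>u s\<bar>^3 + \<bar>u s\<bar> * vn n s + 2 * \<sigma> * vn n s) \<partial>lborel)"
    unfolding window_law_def
    by (rule w.stein_bound_cp_mixture[OF cluster_law_kernel window_law_fin[OF nu] cluster_law_moments(1) cluster_law_moments(2) var_cluster_law ib])
      (use sf in \<open>auto simp: \<sigma>_def a_def an_def\<close>)
  also have "(\<integral>s. window \<nu> n s * (\<bar>u s\<bar>^3 + \<bar>u s\<bar> * vn n s + 2 * \<sigma> * vn n s) \<partial>lborel)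
     \<le> (\<integral>s. \<nu> * (\<bar>u s\<bar>^3 + \<bar>u s\<bar> * vn n s + 2 * \<sigma> * vn n s) \<partial>lborel)"
    by (rule integral_mono[OF ib integrable_mult_right[OF i0]]) (rule order_trans[OF abs_ge_self wb])
  also have "\<dots> = \<nu> * (S3 + (\<integral>s. \<bar>u s\<bar> * vn n s \<partial>lborel) + 2 * \<sigma> * (\<integral>s. vn n s \<partial>lborel))"
    using u_pow_int[of 3] u_vn_int(1)[of n] vn_int(1)[of n] by (simp add: S3_def)
  also have "\<dots> \<le> \<nu> * (S3 + \<mu> / (1 - \<mu>) * (sqrt S2 * sqrt S4) + 2 * \<sigma> * (\<mu> * S2 / (1 - \<mu>)))"
    using nu s0 u_vn_int(2)[of n] vn_int(2)[of n] by (intro mult_left_mono add_mono) auto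
  finally show ?thesis unfolding eq[unfolded a_def] a_def \<sigma>_def m2_def by simp
qed

text \<open>Subtracting the mean \<open>an \<nu> n\<close> puts
  \<open>- \<i> * \<theta> * u s\<close> under the integral of the exponent. Only this compensated
  integrand has a limit that does not depend on the window.\<close>

lemma window_law_char:
  assumes nu: "\<nu> > 0"
  shows "real_distribution (distr (window_law \<nu> n) borel (\<lambda>x. x - an \<nu> n))"
    "char (distr (window_law \<nu> n) borel (\<lambda>x. x - an \<nu> n)) \<theta> = exp (\<integral>s. of_real (window \<nu> n s) * (psi n \<theta> s - 1 - \<i> * of_real (\<theta> * u s)) \<partial>lborel)"
proof -
  interpret w: weight "window \<nu> n" by (rule weight_window[OF nu])
  have [measurable_cong]: "sets (window_law \<nu> n) = sets borel" and "prob_space (window_law \<nu> n)"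
    unfolding window_law_def using w.cp_mixture_prob[OF cluster_law_kernel] by (simp_all add: space_prob_algebra)
  interpret Q: prob_space "window_law \<nu> n" by fact
  show "real_distribution (distr (window_law \<nu> n) borel (\<lambda>x. x - an \<nu> n))"
    by (auto simp: real_distribution_def real_distribution_axioms_def intro!: Q.prob_space_distr)
  have "char (distr (window_law \<nu> n) borel (\<lambda>x. x - an \<nu> n)) \<theta> = (\<integral>x. iexp (\<theta> * (x - an \<nu> n)) \<partial>window_law \<nu> n)"
    unfolding char_def by (subst integral_distr) auto
  also have "\<dots> = (\<integral>x. iexp (- \<theta> * an \<nu> n) * iexp (\<theta> * x) \<partial>window_law \<nu> n)"
    by (intro Bochner_Integration.integral_cong refl) (simp add: mult_exp_exp algebra_simps)
  also have "\<dots> = iexp (- \<theta> * an \<nu> n) * exp (\<integral>s. of_real (window \<nu> n s) * (psi n \<theta> s - 1) \<partial>lborel)"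
    unfolding window_law_def psi_def w.char_cp_mixture[OF cluster_law_kernel, symmetric] by (simp add: char_def)
  also have "\<dots> = exp ((\<integral>s. of_real (window \<nu> n s) * (psi n \<theta> s - 1) \<partial>lborel) - \<i> * of_real (\<theta> * an \<nu> n))"
    by (simp add: mult_exp_exp)
  also have "(\<integral>s. of_real (window \<nu> n s) * (psi n \<theta> s - 1) \<partial>lborel) - \<i> * of_real (\<theta> * an \<nu> n)
     = (\<integral>s. of_real (window \<nu> n s) * (psi n \<theta> s - 1 - \<i> * of_real (\<theta> * u s)) \<partial>lborel)"
  proof -
    have i1: "integrable lborel (\<lambda>s. of_real (window \<nu> n s) * (psi n \<theta> s - 1))"
    proof (rule Bochner_Integration.integrable_bound[OF integrable_mult_right[OF w.w_int, of 2]])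
      show "AE s in lborel. norm (of_real (window \<nu> n s) * (psi n \<theta> s - 1)) \<le> norm (2 * window \<nu> n s)"
      proof (rule AE_I2)
        fix s
        have "norm (psi n \<theta> s - 1) \<le> 2" using norm_triangle_ineq4[of "psi n \<theta> s" 1] psi_le1[of n \<theta> s] by simp
        from mult_left_mono[OF this w.w_nonneg[of s]]
        show "norm (of_real (window \<nu> n s) * (psi n \<theta> s - 1)) \<le> norm (2 * window \<nu> n s)"
          using w.w_nonneg[of s] by (simp add: norm_mult mult.commute)
      qed
    qed measurable
    have i2: "integrable lborel (\<lambda>s. window \<nu> n s * u s)"
      by (rule Bochner_Integration.integrable_bound[OF integrable_mult_right[OF u_int, of \<nu>]])
        (use window_le[OF nu] nu in \<open>auto simp: abs_mult intro!: mult_right_mono\<close>)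
    have i3: "integrable lborel (\<lambda>s. \<i> * of_real \<theta> * of_real (window \<nu> n s * u s))" using i2 by (intro integrable_mult_right integrable_of_real)
    have "(\<integral>s. of_real (window \<nu> n s) * (psi n \<theta> s - 1 - \<i> * of_real (\<theta> * u s)) \<partial>lborel)
      = (\<integral>s. of_real (window \<nu> n s) * (psi n \<theta> s - 1) - \<i> * of_real \<theta> * of_real (window \<nu> n s * u s) \<partial>lborel)"
      by (intro Bochner_Integration.integral_cong refl) (simp add: algebra_simps)
    also have "\<dots> = (\<integral>s. of_real (window \<nu> n s) * (psi n \<theta> s - 1) \<partial>lborel) - (\<integral>s. \<i> * of_real \<theta> * of_real (window \<nu> n s * u s) \<partial>lborel)"
      by (rule Bochner_Integration.integral_diff[OF i1 i3])
    also have "(\<integral>s. \<i> * of_real \<theta> * of_real (window \<nu> n s * u s) \<partial>lborel) = \<i> * of_real \<theta> * of_real (an \<nu> n)"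
      unfolding an_def integral_complex_of_real[symmetric] by (rule integral_mult_right_zero)
    finally show ?thesis by simp
  qed
  finally show "char (distr (window_law \<nu> n) borel (\<lambda>x. x - an \<nu> n)) \<theta> = exp (\<integral>s. of_real (window \<nu> n s) * (psi n \<theta> s - 1 - \<i> * of_real (\<theta> * u s)) \<partial>lborel)" .
qed

text \<open>Window and number of generations grow together, so the integral is squeezed. The limit
  itself is an upper bound. For the lower bound \<open>k\<close> is fixed such that the geometric
  sum up to generation \<open>k\<close> is within \<open>r / 2\<close> of its limit; then the window
  is enlarged for this \<open>k\<close>, and monotonicity of \<open>m2\<close> in the number of
  generations replaces \<open>k\<close> by \<open>n\<close>.\<close>

lemma window_limit:
  assumes nu: "\<nu> > 0"
  shows "(\<lambda>n. \<integral>s. window \<nu> n s * m2 n s \<partial>lborel) \<longlonglongrightarrow> \<nu> * S2 / (1 - \<mu>)"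
proof (rule LIMSEQ_I)
  fix r :: real assume r: "r > 0"
  have le: "(\<integral>s. window \<nu> n s * m2 n s \<partial>lborel) \<le> \<nu> * S2 / (1 - \<mu>)" for n
  proof -
    have "(\<integral>s. window \<nu> n s * m2 n s \<partial>lborel) \<le> (\<integral>s. \<nu> * m2 n s \<partial>lborel)"
      using window_le[OF nu] m2_nonneg nu by (intro integral_mono' integrable_mult_right m2_int mult_right_mono) auto
    also have "\<dots> = \<nu> * (S2 * (1 - \<mu> ^ Suc n) / (1 - \<mu>))" by (simp add: m2_int)
    also have "\<dots> \<le> \<nu> * (S2 * 1 / (1 - \<mu>))"
      using nu mu0 mu1 S_nonneg by (intro mult_left_mono divide_right_mono) auto
    finally show ?thesis by simp
  qed
  have nm': "norm (window \<nu> n s * m2 k s) \<le> \<nu> * m2 k s" for n k s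
    using mult_right_mono[OF conjunct2[OF window_le[OF nu, of n s]] m2_nonneg[of k s]] window_le[OF nu, of n s] m2_nonneg[of k s]
    by (simp add: abs_mult)
  then have nm: "norm (window \<nu> n s * m2 k s) \<le> norm (\<nu> * m2 k s)" for n k s
    by (rule order_trans) simp
  have wi: "integrable lborel (\<lambda>s. window \<nu> n s * m2 k s)" for n k
    by (rule Bochner_Integration.integrable_bound[OF integrable_mult_right[OF m2_int(1), of \<nu> k]])
      (use nm in \<open>auto simp: window_def[abs_def]\<close>)
  have "(\<lambda>k. \<nu> * (S2 * (1 - \<mu> * \<mu> ^ k) / (1 - \<mu>))) \<longlonglongrightarrow> \<nu> * (S2 * (1 - \<mu> * 0) / (1 - \<mu>))"
    using mu0 mu1 by (intro tendsto_intros LIMSEQ_realpow_zero) auto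
  then obtain k where k: "\<bar>\<nu> * (S2 * (1 - \<mu> * \<mu> ^ k) / (1 - \<mu>)) - \<nu> * S2 / (1 - \<mu>)\<bar> < r / 2"
    using LIMSEQ_D[of _ _ "r/2"] r by fastforce
  have "(\<lambda>n. \<integral>s. window \<nu> n s * m2 k s \<partial>lborel) \<longlonglongrightarrow> (\<integral>s. \<nu> * m2 k s \<partial>lborel)"
  proof (rule integral_dominated_convergence[where w="\<lambda>s. \<nu> * m2 k s"])
    show "AE s in lborel. (\<lambda>n. window \<nu> n s * m2 k s) \<longlonglongrightarrow> \<nu> * m2 k s"
    proof (rule AE_I2)
      fix s
      have "eventually (\<lambda>n. \<bar>s\<bar> \<le> real n) sequentially" using real_arch_simple[of "\<bar>s\<bar>"]
        by (metis eventually_sequentiallyI le_trans of_nat_le_iff order_trans)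
      then have "eventually (\<lambda>n. window \<nu> n s * m2 k s = \<nu> * m2 k s) sequentially"
        by eventually_elim (auto simp: window_def indicator_def)
      then show "(\<lambda>n. window \<nu> n s * m2 k s) \<longlonglongrightarrow> \<nu> * m2 k s" by (rule tendsto_eventually)
    qed
    show "AE s in lborel. norm (window \<nu> n s * m2 k s) \<le> \<nu> * m2 k s" for n
      using nm' by simp
  qed (use m2_int wi in auto)
  then obtain N where N: "\<And>n. n \<ge> N \<Longrightarrow> \<bar>(\<integral>s. window \<nu> n s * m2 k s \<partial>lborel) - \<nu> * (S2 * (1 - \<mu> * \<mu> ^ k) / (1 - \<mu>))\<bar> < r / 2"
    using LIMSEQ_D[of _ _ "r/2"] r by (fastforce simp: m2_int)
  have mono: "m2 k s \<le> m2 n s" if "k \<le> n" for n s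
    using that by (rule lift_Suc_mono_le[of "\<lambda>n. m2 n s", rotated]) (rule m2_mono)
  show "\<exists>no. \<forall>n\<ge>no. norm ((\<integral>s. window \<nu> n s * m2 n s \<partial>lborel) - \<nu> * S2 / (1 - \<mu>)) < r"
  proof (intro exI[of _ "max N k"] allI impI)
    fix n assume n: "n \<ge> max N k"
    have "(\<integral>s. window \<nu> n s * m2 k s \<partial>lborel) \<le> (\<integral>s. window \<nu> n s * m2 n s \<partial>lborel)"
      using mono[of n] n window_le[OF nu] by (intro integral_mono wi mult_left_mono) auto
    moreover have aux: "\<bar>x - c\<bar> < r" if "\<bar>y - b\<bar> < r / 2" "\<bar>b - c\<bar> < r / 2" "y \<le> x" "x \<le> c" for x y b c :: real
      using that by linarith
    ultimately show "norm ((\<integral>s. window \<nu> n s * m2 n s \<partial>lborel) - \<nu> * S2 / (1 - \<mu>)) < r"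
      unfolding real_norm_def using n by (intro aux[OF N k _ le]) auto
  qed
qed

end

lemma norm_iexp_diff_le: "norm (iexp x - 1) \<le> \<bar>x\<bar>"
  using norm_exp_diff_le[of "\<i> * of_real x" 0] by (simp add: norm_mult)

section \<open>The limit of the characteristic exponents\<close>

context cluster
begin

definition kap :: "nat \<Rightarrow> real \<Rightarrow> real \<Rightarrow> complex" where
  "kap n \<theta> t = psi n \<theta> t - 1 - \<i> * of_real (\<theta> * u t)"

lemma kap_meas[measurable]: "kap n \<theta> \<in> borel_measurable borel"
  unfolding kap_def[abs_def] by measurable

lemma hp_cint:
  fixes k :: "real \<Rightarrow> complex"
  assumes [measurable]: "k \<in> borel_measurable borel" and b: "\<And>t. norm (k t) \<le> C"
  shows "integrable lborel (\<lambda>s. of_real (hp s) * k (t + s))"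
proof (rule Bochner_Integration.integrable_bound[OF integrable_mult_right[OF hp_int, of C]])
  show "AE s in lborel. norm (of_real (hp s) * k (t + s)) \<le> norm (C * hp s)"
  proof (rule AE_I2)
    fix s
    have "0 \<le> C" using b[of 0] norm_ge_zero order_trans by blast
    moreover have "hp s * norm (k (t + s)) \<le> hp s * C" by (rule mult_left_mono[OF b hp_nonneg])
    ultimately show "norm (of_real (hp s) * k (t + s)) \<le> norm (C * hp s)"
      using hp_nonneg[of s] by (simp add: norm_mult mult.commute)
  qed
qed measurable

lemma kap_bd: "norm (kap n \<theta> t) \<le> 2 + \<bar>\<theta>\<bar> * U"
proof -
  have "norm (kap n \<theta> t) \<le> norm (psi n \<theta> t - 1) + norm (\<i> * of_real (\<theta> * u t))"
    unfolding kap_def by (rule norm_triangle_ineq4)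
  also have "norm (psi n \<theta> t - 1) \<le> 2" using norm_triangle_ineq4[of "psi n \<theta> t" 1] psi_le1[of n \<theta> t] by simp
  also have "norm (\<i> * complex_of_real (\<theta> * u t)) \<le> \<bar>\<theta>\<bar> * U" using u_bd[of t] by (simp add: norm_mult abs_mult mult_left_mono)
  finally show ?thesis by simp
qed

text \<open>The compensator \<open>hu t\<close> is absorbed by passing from \<open>psi n - 1\<close>
  to \<open>kap n\<close> under the integral. In this form the exponent has nonpositive real part by
  inspection, and the fixed point equation of the limit can be read off.\<close>

lemma psi_Suc': "psi (Suc n) \<theta> t = exp (\<i> * of_real (\<theta> * u t) + (\<integral>s. of_real (hp s) * kap n \<theta> (t + s) \<partial>lborel))"
proof -
  have i1: "integrable lborel (\<lambda>s. of_real (hp s) * (psi n \<theta> (t + s) - 1))"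
  proof (rule hp_cint[where k="\<lambda>t. psi n \<theta> t - 1" and C=2])
    show "norm (psi n \<theta> t - 1) \<le> 2" for t using norm_triangle_ineq4[of "psi n \<theta> t" 1] psi_le1[of n \<theta> t] by simp
  qed measurable
  have i2: "integrable lborel (\<lambda>s. hp s * u (t + s))" by (rule hp_shift_int[OF u_meas u_bd])
  have i3: "integrable lborel (\<lambda>s. \<i> * of_real \<theta> * of_real (hp s * u (t + s)))" using i2 by (intro integrable_mult_right integrable_of_real)
  have "(\<integral>s. of_real (hp s) * kap n \<theta> (t + s) \<partial>lborel)
    = (\<integral>s. of_real (hp s) * (psi n \<theta> (t + s) - 1) - \<i> * of_real \<theta> * of_real (hp s * u (t + s)) \<partial>lborel)"
    by (intro Bochner_Integration.integral_cong refl) (simp add: kap_def algebra_simps)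
  also have "\<dots> = (\<integral>s. of_real (hp s) * (psi n \<theta> (t + s) - 1) \<partial>lborel) - (\<integral>s. \<i> * of_real \<theta> * of_real (hp s * u (t + s)) \<partial>lborel)"
    by (rule Bochner_Integration.integral_diff[OF i1 i3])
  also have "(\<integral>s. \<i> * of_real \<theta> * of_real (hp s * u (t + s)) \<partial>lborel) = \<i> * of_real \<theta> * of_real (hu t)"
    unfolding hu_def integral_complex_of_real[symmetric] by (rule integral_mult_right_zero)
  finally have e: "(\<integral>s. of_real (hp s) * kap n \<theta> (t + s) \<partial>lborel) =
    (\<integral>s. of_real (hp s) * (psi n \<theta> (t + s) - 1) \<partial>lborel) - \<i> * of_real \<theta> * of_real (hu t)" .
  have a: "\<i> * of_real (\<theta> * (u t - hu t)) + I = \<i> * of_real (\<theta> * u t) + (I - \<i> * of_real \<theta> * of_real (hu t))" for I :: complex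
    by (simp add: algebra_simps)
  show ?thesis unfolding psi_Suc e mult_exp_exp by (simp only: a)
qed

lemma Re_kap_int_le: 
  assumes [measurable]: "k \<in> borel_measurable borel" and b: "\<And>t. norm (k t) \<le> C" and r: "\<And>t. Re (k t) \<le> 0"
  shows "Re (\<i> * of_real (\<theta> * u t) + (\<integral>s. of_real (hp s) * k (t + s) \<partial>lborel)) \<le> 0"
proof -
  have "Re (\<integral>s. of_real (hp s) * k (t + s) \<partial>lborel) = (\<integral>s. hp s * Re (k (t + s)) \<partial>lborel)"
    by (subst integral_Re[symmetric, OF hp_cint[OF assms(1) b]]) simp
  also have "\<dots> \<le> 0"
    using integral_mono'[of lborel "\<lambda>_. 0" "\<lambda>s. hp s * Re (k (t + s))"] r hp_nonneg by (simp add: mult_nonneg_nonpos)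
  finally show ?thesis by simp
qed

lemma Re_kap: "Re (kap n \<theta> t) \<le> 0"
  using psi_le1[of n \<theta> t] complex_Re_le_cmod[of "psi n \<theta> t"] by (simp add: kap_def)

definition "psi_step \<theta> n t = norm (psi (Suc n) \<theta> t - psi n \<theta> t)"

lemma psi_step_meas[measurable]: "psi_step \<theta> n \<in> borel_measurable borel"
  unfolding psi_step_def[abs_def] by measurable

text \<open>Both exponents lie in the left half-plane, where \<open>exp\<close> is 1-Lipschitz, and
  differences of \<open>kap\<close> are differences of \<open>psi\<close>. Since \<open>hp\<close>
  has integral \<mu>, the recursion contracts by this factor in the supremum norm and, by Tonelli,
  in L1.\<close>

lemma psi_step_Suc: "psi_step \<theta> (Suc n) t \<le> (\<integral>s. hp s * psi_step \<theta> n (t + s) \<partial>lborel)"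
proof -
  let ?E = "\<lambda>n. \<i> * of_real (\<theta> * u t) + (\<integral>s. of_real (hp s) * kap n \<theta> (t + s) \<partial>lborel)"
  have i: "integrable lborel (\<lambda>s. of_real (hp s) * kap n \<theta> (t + s))" for n
    by (rule hp_cint[OF kap_meas kap_bd])
  have "psi_step \<theta> (Suc n) t \<le> norm (?E (Suc n) - ?E n)"
    unfolding psi_step_def psi_Suc' by (intro norm_exp_diff_le Re_kap_int_le[OF kap_meas kap_bd Re_kap])
  also have "?E (Suc n) - ?E n = (\<integral>s. of_real (hp s) * kap (Suc n) \<theta> (t + s) - of_real (hp s) * kap n \<theta> (t + s) \<partial>lborel)"
    using i by simp
  also have "norm \<dots> \<le> (\<integral>s. norm (of_real (hp s) * kap (Suc n) \<theta> (t + s) - of_real (hp s) * kap n \<theta> (t + s)) \<partial>lborel)"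
    by (rule integral_norm_bound)
  also have "\<dots> = (\<integral>s. hp s * psi_step \<theta> n (t + s) \<partial>lborel)"
  proof (intro Bochner_Integration.integral_cong refl)
    fix s
    have "of_real (hp s) * kap (Suc n) \<theta> (t + s) - of_real (hp s) * kap n \<theta> (t + s) = of_real (hp s) * (psi (Suc n) \<theta> (t + s) - psi n \<theta> (t + s))"
      by (simp add: kap_def algebra_simps)
    then show "norm (of_real (hp s) * kap (Suc n) \<theta> (t + s) - of_real (hp s) * kap n \<theta> (t + s)) = hp s * psi_step \<theta> n (t + s)"
      using hp_nonneg[of s] by (simp add: norm_mult psi_step_def)
  qed
  finally show ?thesis .
qed

lemma psi_step_bound: "psi_step \<theta> n t \<le> 2 * \<mu> ^ n"
proof (induction n arbitrary: t)
  case 0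
  show ?case using norm_triangle_ineq4[of "psi 1 \<theta> t" "psi 0 \<theta> t"] psi_le1[of 0 \<theta> t] psi_le1[of 1 \<theta> t] by (simp add: psi_step_def)
next
  case (Suc n)
  have "psi_step \<theta> (Suc n) t \<le> (\<integral>s. hp s * psi_step \<theta> n (t + s) \<partial>lborel)" by (rule psi_step_Suc)
  also have "\<dots> \<le> (\<integral>s. hp s * (2 * \<mu> ^ n) \<partial>lborel)"
    using Suc hp_nonneg hp_int mu0 by (intro integral_mono hp_shift_int[where C="2 * \<mu> ^ n"] mult_left_mono) (auto simp: psi_step_def)
  also have "\<dots> = 2 * \<mu> ^ Suc n" by (simp add: mu_eq)
  finally show ?case .
qed

lemma kap0_bd: "norm (kap 0 \<theta> t) \<le> 2 * \<bar>\<theta>\<bar> * \<bar>u t\<bar>"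
proof -
  have "norm (kap 0 \<theta> t) \<le> norm (iexp (\<theta> * u t) - 1) + norm (\<i> * of_real (\<theta> * u t))"
    unfolding kap_def psi_0 by (rule norm_triangle_ineq4)
  also have "\<dots> \<le> \<bar>\<theta> * u t\<bar> + \<bar>\<theta> * u t\<bar>" by (intro add_mono norm_iexp_diff_le) (simp add: norm_mult)
  finally show ?thesis by (simp add: abs_mult)
qed

text \<open>The uniform bound on the steps gives pointwise convergence but no integrable majorant on
  the line. The L1 contraction supplies one; it starts from the linear bound on
  \<open>kap 0\<close>, which makes the first step integrable.\<close>

lemma nn_psi_step: "(\<integral>\<^sup>+t. ennreal (psi_step \<theta> n t) \<partial>lborel) \<le> ennreal (\<mu> ^ n * (2 * \<bar>\<theta>\<bar> * (\<integral>t. \<bar>u t\<bar> \<partial>lborel)))"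
proof (induction n)
  case 0
  have "(\<integral>\<^sup>+t. ennreal (psi_step \<theta> 0 t) \<partial>lborel) \<le> (\<integral>\<^sup>+t. 1 * (\<integral>\<^sup>+s. ennreal (hp s) * ennreal (2 * \<bar>\<theta>\<bar> * \<bar>u (t + s)\<bar>) \<partial>lborel) \<partial>lborel)"
  proof (rule nn_integral_mono)
    fix t
    have i: "integrable lborel (\<lambda>s. of_real (hp s) * kap 0 \<theta> (t + s))" by (rule hp_cint[OF kap_meas kap_bd])
    have "psi_step \<theta> 0 t = norm (exp (\<i> * of_real (\<theta> * u t) + (\<integral>s. of_real (hp s) * kap 0 \<theta> (t + s) \<partial>lborel)) - exp (\<i> * of_real (\<theta> * u t)))"
      unfolding psi_step_def psi_Suc' by (simp add: psi_0)
    also have "\<dots> \<le> norm (\<i> * of_real (\<theta> * u t) + (\<integral>s. of_real (hp s) * kap 0 \<theta> (t + s) \<partial>lborel) - \<i> * of_real (\<theta> * u t))"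
      by (intro norm_exp_diff_le Re_kap_int_le[OF kap_meas kap_bd Re_kap]) simp
    also have "\<dots> = norm (\<integral>s. of_real (hp s) * kap 0 \<theta> (t + s) \<partial>lborel)" by simp
    finally have "ennreal (psi_step \<theta> 0 t) \<le> ennreal (norm (\<integral>s. of_real (hp s) * kap 0 \<theta> (t + s) \<partial>lborel))" by (rule ennreal_leI)
    also have "\<dots> \<le> (\<integral>\<^sup>+s. ennreal (norm (of_real (hp s) * kap 0 \<theta> (t + s))) \<partial>lborel)" by (rule integral_norm_bound_ennreal[OF i])
    also have "\<dots> \<le> (\<integral>\<^sup>+s. ennreal (hp s) * ennreal (2 * \<bar>\<theta>\<bar> * \<bar>u (t + s)\<bar>) \<partial>lborel)"
    proof (rule nn_integral_mono)
      fix s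
      have "norm (of_real (hp s) * kap 0 \<theta> (t + s)) \<le> hp s * (2 * \<bar>\<theta>\<bar> * \<bar>u (t + s)\<bar>)"
        using hp_nonneg[of s] kap0_bd[of \<theta> "t + s"] by (simp add: norm_mult mult_left_mono)
      then show "ennreal (norm (of_real (hp s) * kap 0 \<theta> (t + s))) \<le> ennreal (hp s) * ennreal (2 * \<bar>\<theta>\<bar> * \<bar>u (t + s)\<bar>)"
        using ennreal_mult[OF hp_nonneg[of s], of "2 * \<bar>\<theta>\<bar> * \<bar>u (t + s)\<bar>"] by (metis abs_ge_zero ennreal_leI mult_nonneg_nonneg zero_le_numeral)
    qed
    finally show "ennreal (psi_step \<theta> 0 t) \<le> 1 * (\<integral>\<^sup>+s. ennreal (hp s) * ennreal (2 * \<bar>\<theta>\<bar> * \<bar>u (t + s)\<bar>) \<partial>lborel)" by simp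
  qed
  also have "\<dots> = (\<integral>\<^sup>+s. ennreal (hp s) * (\<integral>\<^sup>+t. ennreal (2 * \<bar>\<theta>\<bar> * \<bar>u t\<bar>) \<partial>lborel) \<partial>lborel)"
    by (subst nn_conv_swap) auto
  also have "(\<integral>\<^sup>+t. ennreal (2 * \<bar>\<theta>\<bar> * \<bar>u t\<bar>) \<partial>lborel) = ennreal (2 * \<bar>\<theta>\<bar> * (\<integral>t. \<bar>u t\<bar> \<partial>lborel))"
    using u_pow_int[of 1] by (subst nn_integral_eq_integral) auto
  also have "(\<integral>\<^sup>+s. ennreal (hp s) * ennreal (2 * \<bar>\<theta>\<bar> * (\<integral>t. \<bar>u t\<bar> \<partial>lborel)) \<partial>lborel) = ennreal \<mu> * ennreal (2 * \<bar>\<theta>\<bar> * (\<integral>t. \<bar>u t\<bar> \<partial>lborel))"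
    by (simp add: nn_integral_multc nn_hp)
  also have "\<dots> \<le> 1 * ennreal (2 * \<bar>\<theta>\<bar> * (\<integral>t. \<bar>u t\<bar> \<partial>lborel))" using mu1 by (intro mult_right_mono) (auto simp: ennreal_le_1)
  finally show ?case by simp
next
  case (Suc n)
  let ?c = "2 * \<bar>\<theta>\<bar> * (\<integral>t. \<bar>u t\<bar> \<partial>lborel)"
  have "(\<integral>\<^sup>+t. ennreal (psi_step \<theta> (Suc n) t) \<partial>lborel) \<le> (\<integral>\<^sup>+t. 1 * (\<integral>\<^sup>+s. ennreal (hp s) * ennreal (psi_step \<theta> n (t + s)) \<partial>lborel) \<partial>lborel)"
  proof (rule nn_integral_mono)
    fix t
    have i: "integrable lborel (\<lambda>s. hp s * psi_step \<theta> n (t + s))"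
      by (rule hp_shift_int[where C="2 * \<mu> ^ n"]) (use psi_step_bound in \<open>auto simp: psi_step_def\<close>)
    have "ennreal (psi_step \<theta> (Suc n) t) \<le> ennreal (\<integral>s. hp s * psi_step \<theta> n (t + s) \<partial>lborel)" by (rule ennreal_leI[OF psi_step_Suc])
    also have "\<dots> = (\<integral>\<^sup>+s. ennreal (hp s * psi_step \<theta> n (t + s)) \<partial>lborel)"
      using hp_nonneg by (intro nn_integral_eq_integral[OF i, symmetric]) (auto simp: psi_step_def)
    finally show "ennreal (psi_step \<theta> (Suc n) t) \<le> 1 * (\<integral>\<^sup>+s. ennreal (hp s) * ennreal (psi_step \<theta> n (t + s)) \<partial>lborel)"
      using hp_nonneg by (simp add: ennreal_mult psi_step_def)
  qed
  also have "\<dots> = (\<integral>\<^sup>+s. ennreal (hp s) * (\<integral>\<^sup>+t. ennreal (psi_step \<theta> n t) \<partial>lborel) \<partial>lborel)"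
    by (subst nn_conv_swap) auto
  also have "\<dots> = ennreal \<mu> * (\<integral>\<^sup>+t. ennreal (psi_step \<theta> n t) \<partial>lborel)" by (simp add: nn_integral_multc nn_hp)
  also have "\<dots> \<le> ennreal \<mu> * ennreal (\<mu> ^ n * ?c)" by (intro mult_left_mono Suc) auto
  also have "\<dots> = ennreal (\<mu> ^ Suc n * ?c)" using mu0 by (simp add: ennreal_mult[symmetric] mult_ac)
  finally show ?case .
qed

lemma psi_step_summable: "summable (\<lambda>n. psi_step \<theta> n t)"
proof (rule summable_comparison_test')
  show "summable (\<lambda>n. 2 * \<mu> ^ n)" using mu0 mu1 by (intro summable_mult summable_geometric) auto
  show "norm (psi_step \<theta> n t) \<le> 2 * \<mu> ^ n" if "n \<ge> 0" for n using psi_step_bound[of \<theta> n t] by (simp add: psi_step_def)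
qed

lemma psi_step_sum_int: "integrable lborel (\<lambda>t. \<Sum>n. psi_step \<theta> n t)"
proof -
  let ?c = "2 * \<bar>\<theta>\<bar> * (\<integral>t. \<bar>u t\<bar> \<partial>lborel)"
  have c: "?c \<ge> 0" by simp
  have nn: "0 \<le> (\<Sum>n. psi_step \<theta> n t)" for t by (rule suminf_nonneg[OF psi_step_summable]) (simp add: psi_step_def)
  have "(\<integral>\<^sup>+t. ennreal (norm (\<Sum>n. psi_step \<theta> n t)) \<partial>lborel) = (\<integral>\<^sup>+t. (\<Sum>n. ennreal (psi_step \<theta> n t)) \<partial>lborel)"
    using nn by (intro nn_integral_cong) (subst suminf_ennreal2[OF _ psi_step_summable], simp_all add: psi_step_def)
  also have "\<dots> = (\<Sum>n. \<integral>\<^sup>+t. ennreal (psi_step \<theta> n t) \<partial>lborel)" by (rule nn_integral_suminf) measurable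
  also have "\<dots> \<le> (\<Sum>n. ennreal (\<mu> ^ n * ?c))" by (intro suminf_le nn_psi_step summableI)
  also have "\<dots> = ennreal (\<Sum>n. \<mu> ^ n * ?c)"
    using mu0 mu1 c by (intro suminf_ennreal2 summable_mult2 summable_geometric) (auto intro!: mult_nonneg_nonneg)
  also have "\<dots> < \<infinity>" by simp
  finally show ?thesis by (auto simp: integrable_iff_bounded)
qed

text \<open>The limit of \<open>kap n\<close> is taken twice under an integral. In the fixed point
  equation the majorant is a constant times \<open>hp\<close>. In the integral over the window it is
  \<open>\<nu> * g\<close>, where \<open>g\<close> adds to the bound on \<open>kap 0\<close> the sum
  of all steps; this \<open>g\<close> also makes \<kappa> integrable.\<close>

lemma kappa_exists:
  assumes nu: "\<nu> > 0"
  obtains \<kappa> :: "real \<Rightarrow> complex" where "integrable lborel \<kappa>"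
    "\<And>t. norm (\<kappa> t + 1 + \<i> * of_real (\<theta> * u t)) \<le> 1"
    "\<And>t. \<kappa> t + 1 + \<i> * of_real (\<theta> * u t) = exp (\<i> * of_real (\<theta> * u t) + (\<integral>s. of_real (hp s) * \<kappa> (t + s) \<partial>lborel))"
    "(\<lambda>n. \<integral>s. of_real (window \<nu> n s) * (psi n \<theta> s - 1 - \<i> * of_real (\<theta> * u s)) \<partial>lborel) \<longlonglongrightarrow> of_real \<nu> * (\<integral>s. \<kappa> s \<partial>lborel)"
proof -
  have sm: "summable (\<lambda>n. psi (Suc n) \<theta> t - psi n \<theta> t)" for t
    using psi_step_summable[of \<theta> t] unfolding psi_step_def by (rule summable_norm_cancel)
  have tel: "(\<Sum>k<n. psi (Suc k) \<theta> t - psi k \<theta> t) = psi n \<theta> t - psi 0 \<theta> t" for n t by (rule sum_lessThan_telescope)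
  have "(\<lambda>n. psi n \<theta> t - psi 0 \<theta> t + psi 0 \<theta> t) \<longlonglongrightarrow> (\<Sum>k. psi (Suc k) \<theta> t - psi k \<theta> t) + psi 0 \<theta> t" for t
    using summable_LIMSEQ[OF sm[of t]] unfolding tel by (intro tendsto_intros)
  then have conv: "(\<lambda>n. psi n \<theta> t) \<longlonglongrightarrow> (\<Sum>k. psi (Suc k) \<theta> t - psi k \<theta> t) + psi 0 \<theta> t" for t by simp
  define \<kappa> where "\<kappa> t = (\<Sum>k. psi (Suc k) \<theta> t - psi k \<theta> t) + psi 0 \<theta> t - 1 - \<i> * of_real (\<theta> * u t)" for t
  have lim: "(\<lambda>n. kap n \<theta> t) \<longlonglongrightarrow> \<kappa> t" for t
    unfolding kap_def \<kappa>_def by (intro tendsto_intros conv)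
  have km[measurable]: "\<kappa> \<in> borel_measurable borel"
    by (rule borel_measurable_LIMSEQ_metric[OF kap_meas lim])
  define g where "g t = 2 * \<bar>\<theta>\<bar> * \<bar>u t\<bar> + (\<Sum>n. psi_step \<theta> n t)" for t
  have gi: "integrable lborel g" unfolding g_def[abs_def]
    using u_pow_int[of 1] by (intro Bochner_Integration.integrable_add integrable_mult_right psi_step_sum_int) auto
  have kb: "norm (kap n \<theta> t) \<le> g t" for n t
  proof -
    have e: "kap n \<theta> t = kap 0 \<theta> t + (\<Sum>k<n. psi (Suc k) \<theta> t - psi k \<theta> t)" unfolding tel by (simp add: kap_def)
    have "norm (kap n \<theta> t) \<le> norm (kap 0 \<theta> t) + norm (\<Sum>k<n. psi (Suc k) \<theta> t - psi k \<theta> t)" unfolding e by (rule norm_triangle_ineq)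
    also have "\<dots> \<le> 2 * \<bar>\<theta>\<bar> * \<bar>u t\<bar> + (\<Sum>k<n. psi_step \<theta> k t)"
      unfolding psi_step_def by (intro add_mono kap0_bd norm_sum)
    also have "(\<Sum>k<n. psi_step \<theta> k t) \<le> (\<Sum>k. psi_step \<theta> k t)" by (rule sum_le_suminf[OF psi_step_summable]) (auto simp: psi_step_def)
    finally show ?thesis by (simp add: g_def)
  qed
  have kb': "norm (\<kappa> t) \<le> g t" for t
    by (rule tendsto_upperbound[OF tendsto_norm[OF lim]]) (auto simp: kb)
  have kb2: "norm (\<kappa> t) \<le> 2 + \<bar>\<theta>\<bar> * U" for t
    by (rule tendsto_upperbound[OF tendsto_norm[OF lim]]) (auto simp: kap_bd)
  have c1: "integrable lborel \<kappa>"
    by (rule Bochner_Integration.integrable_bound[OF gi]) (use km kb' in \<open>auto intro: order_trans[OF _ abs_ge_self]\<close>)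
  have c2: "norm (\<kappa> t + 1 + \<i> * of_real (\<theta> * u t)) \<le> 1" for t
  proof (rule tendsto_upperbound)
    show "(\<lambda>n. norm (psi n \<theta> t)) \<longlonglongrightarrow> norm (\<kappa> t + 1 + \<i> * of_real (\<theta> * u t))"
      unfolding \<kappa>_def using tendsto_norm[OF conv[of t]] by simp
  qed (auto simp: psi_le1)
  have c3: "\<kappa> t + 1 + \<i> * of_real (\<theta> * u t) = exp (\<i> * of_real (\<theta> * u t) + (\<integral>s. of_real (hp s) * \<kappa> (t + s) \<partial>lborel))" for t
  proof (rule LIMSEQ_unique)
    show "(\<lambda>n. psi (Suc n) \<theta> t) \<longlonglongrightarrow> \<kappa> t + 1 + \<i> * of_real (\<theta> * u t)"
      using LIMSEQ_Suc[OF conv[of t]] by (simp add: \<kappa>_def)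
    have "(\<lambda>n. \<integral>s. of_real (hp s) * kap n \<theta> (t + s) \<partial>lborel) \<longlonglongrightarrow> (\<integral>s. of_real (hp s) * \<kappa> (t + s) \<partial>lborel)"
    proof (rule integral_dominated_convergence[where w="\<lambda>s. hp s * (2 + \<bar>\<theta>\<bar> * U)"])
      show "AE s in lborel. (\<lambda>n. of_real (hp s) * kap n \<theta> (t + s)) \<longlonglongrightarrow> of_real (hp s) * \<kappa> (t + s)"
        by (intro AE_I2 tendsto_intros lim)
      show "AE s in lborel. norm (of_real (hp s) * kap n \<theta> (t + s)) \<le> hp s * (2 + \<bar>\<theta>\<bar> * U)" for n
        using hp_nonneg kap_bd by (intro AE_I2) (simp add: norm_mult mult_left_mono)
    qed (use hp_int in auto)
    then show "(\<lambda>n. psi (Suc n) \<theta> t) \<longlonglongrightarrow> exp (\<i> * of_real (\<theta> * u t) + (\<integral>s. of_real (hp s) * \<kappa> (t + s) \<partial>lborel))"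
      unfolding psi_Suc' by (intro tendsto_intros)
  qed
  have c4: "(\<lambda>n. \<integral>s. of_real (window \<nu> n s) * (psi n \<theta> s - 1 - \<i> * of_real (\<theta> * u s)) \<partial>lborel) \<longlonglongrightarrow> of_real \<nu> * (\<integral>s. \<kappa> s \<partial>lborel)"
  proof -
    have wm[measurable]: "window \<nu> n \<in> borel_measurable borel" for n unfolding window_def[abs_def] by measurable
    have "(\<lambda>n. \<integral>s. of_real (window \<nu> n s) * kap n \<theta> s \<partial>lborel) \<longlonglongrightarrow> (\<integral>s. of_real \<nu> * \<kappa> s \<partial>lborel)"
    proof (rule integral_dominated_convergence[where w="\<lambda>s. \<nu> * g s"])
      show "AE s in lborel. (\<lambda>n. of_real (window \<nu> n s) * kap n \<theta> s) \<longlonglongrightarrow> of_real \<nu> * \<kappa> s"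
      proof (rule AE_I2)
        fix s
        obtain N where "\<bar>s\<bar> \<le> real N" using real_arch_simple by blast
        then have "eventually (\<lambda>n. window \<nu> n s = \<nu>) sequentially"
          by (intro eventually_sequentiallyI[of N]) (auto simp: window_def indicator_def)
        then have "(\<lambda>n. window \<nu> n s) \<longlonglongrightarrow> \<nu>" by (rule tendsto_eventually)
        then show "(\<lambda>n. of_real (window \<nu> n s) * kap n \<theta> s) \<longlonglongrightarrow> of_real \<nu> * \<kappa> s" by (intro tendsto_intros lim)
      qed
      show "AE s in lborel. norm (of_real (window \<nu> n s) * kap n \<theta> s) \<le> \<nu> * g s" for n
      proof (rule AE_I2)
        fix s
        have "\<bar>window \<nu> n s\<bar> * norm (kap n \<theta> s) \<le> \<nu> * g s"
          using window_le[OF nu, of n s] by (intro mult_mono kb) auto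
        then show "norm (of_real (window \<nu> n s) * kap n \<theta> s) \<le> \<nu> * g s" by (simp add: norm_mult)
      qed
    qed (use gi in auto)
    then show ?thesis by (simp add: kap_def)
  qed
  show thesis using c1 c2 c3 c4 by (rule that)
qed

end

subsection \<open>Exponentials of pure jump paths\<close>

lemma integrable_ind_mult:
  fixes f :: "'b \<Rightarrow> complex"
  assumes "integrable M f" "A \<in> sets M"
  shows "integrable M (\<lambda>t. indicator A t * f t)"
proof -
  have "integrable M (\<lambda>t. indicator A t *\<^sub>R f t)" by (rule integrable_mult_indicator[OF assms(2,1)])
  moreover have "(\<lambda>t. indicator A t *\<^sub>R f t) = (\<lambda>t. indicator A t * f t)" by (auto simp: indicator_def)
  ultimately show ?thesis by simp
qed

lemma ind_split:
  fixes f :: "real \<Rightarrow> complex"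
  assumes f: "integrable M f" and s: "sets M = sets borel" and ab: "a \<le> b"
  shows "(\<integral>t. indicator {..b} t * f t \<partial>M) = (\<integral>t. indicator {..a} t * f t \<partial>M) + (\<integral>t. indicator {a<..b} t * f t \<partial>M)"
proof -
  have "(\<integral>t. indicator {..b} t * f t \<partial>M) = (\<integral>t. indicator {..a} t * f t + indicator {a<..b} t * f t \<partial>M)"
    using ab by (intro Bochner_Integration.integral_cong) (auto simp: indicator_def)
  then show ?thesis using f s by (simp add: integrable_ind_mult)
qed

lemma ind_split2:
  fixes f :: "real \<Rightarrow> complex"
  assumes f: "integrable M f" and s: "sets M = sets borel" and ab: "a \<le> b" "b \<le> c"
  shows "(\<integral>t. indicator {a<..c} t * f t \<partial>M) = (\<integral>t. indicator {a<..b} t * f t \<partial>M) + (\<integral>t. indicator {b<..c} t * f t \<partial>M)"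
proof -
  have "(\<integral>t. indicator {a<..c} t * f t \<partial>M) = (\<integral>t. indicator {a<..b} t * f t + indicator {b<..c} t * f t \<partial>M)"
    using ab by (intro Bochner_Integration.integral_cong) (auto simp: indicator_def)
  then show ?thesis using f s by (simp add: integrable_ind_mult)
qed

section \<open>Primitives of integrable functions\<close>

definition prim :: "real \<Rightarrow> (real \<Rightarrow> complex) \<Rightarrow> real \<Rightarrow> complex" where
  "prim x f t = (\<integral>s. indicator {x<..t} s * f s \<partial>lborel)"

lemma prim_meas[measurable]:
  assumes [measurable]: "f \<in> borel_measurable borel"
  shows "prim x f \<in> borel_measurable borel"
proof -
  have [measurable]: "Measurable.pred (borel \<Otimes>\<^sub>M lborel) (\<lambda>(t, s). s \<in> {x<..t})" by simp measurable
  have "(\<lambda>t. \<integral>s. (if s \<in> {x<..t} then f s else 0) \<partial>lborel) \<in> borel_measurable borel"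
    by (rule lborel.borel_measurable_lebesgue_integral) (simp add: case_prod_beta, measurable)
  moreover have "prim x f = (\<lambda>t. \<integral>s. (if s \<in> {x<..t} then f s else 0) \<partial>lborel)"
    unfolding prim_def by (intro ext Bochner_Integration.integral_cong) (auto simp: indicator_def)
  ultimately show ?thesis by simp
qed

lemma prim_bound:
  assumes f: "integrable lborel f"
  shows "norm (prim x f t) \<le> (\<integral>s. norm (f s) \<partial>lborel)"
proof -
  have "norm (prim x f t) \<le> (\<integral>s. norm (indicator {x<..t} s * f s) \<partial>lborel)"
    unfolding prim_def by (rule integral_norm_bound)
  also have "\<dots> \<le> (\<integral>s. norm (f s) \<partial>lborel)"
    using f by (intro integral_mono integrable_norm integrable_ind_mult) (auto simp: norm_mult indicator_def)
  finally show ?thesis .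
qed

lemma integrable_mult_bounded:
  fixes f g :: "'b \<Rightarrow> complex"
  assumes f: "integrable M f" and [measurable]: "g \<in> borel_measurable M" and b: "\<And>t. norm (g t) \<le> C"
  shows "integrable M (\<lambda>t. f t * g t)"
proof (rule Bochner_Integration.integrable_bound[OF integrable_mult_right[OF integrable_norm[OF f], of C]])
  show "AE t in M. norm (f t * g t) \<le> norm (C * norm (f t))"
  proof (rule AE_I2)
    fix t
    have "0 \<le> C" using b[of t] norm_ge_zero order_trans by blast
    moreover have "norm (f t) * norm (g t) \<le> norm (f t) * C" by (intro mult_left_mono b) simp
    ultimately show "norm (f t * g t) \<le> norm (C * norm (f t))" by (simp add: norm_mult mult.commute abs_mult)
  qed
qed (use f in measurable)

text \<open>Integration by parts in the form of Fubini's theorem: the square over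
  \<open>{x<..y}\<close> is divided by the indicator \<open>D\<close> into the triangles below and
  above the diagonal, and the diagonal itself is a null set.\<close>

lemma prim_product:
  assumes f: "integrable lborel f" and g: "integrable lborel g"
  shows "prim x f y * prim x g y = prim x (\<lambda>t. f t * prim x g t) y + prim x (\<lambda>t. g t * prim x f t) y"
proof -
  have [measurable]: "f \<in> borel_measurable borel" "g \<in> borel_measurable borel" using f g by auto
  let ?I = "{x<..y}"
  define F where "F s = indicator ?I s * f s" for s
  define G where "G s = indicator ?I s * g s" for s
  have iF: "integrable lborel F" and iG: "integrable lborel G" unfolding F_def G_def by (auto intro!: integrable_ind_mult f g)
  have [measurable]: "F \<in> borel_measurable borel" "G \<in> borel_measurable borel" using iF iG by auto
  have iFG: "integrable (lborel \<Otimes>\<^sub>M lborel) (\<lambda>(s, t). F s * G t)"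
  proof (rule lborel_pair.Fubini_integrable)
    show "integrable lborel (\<lambda>s. \<integral>t. norm (case (s, t) of (s, t) \<Rightarrow> F s * G t) \<partial>lborel)"
      using integrable_mult_left[OF integrable_norm[OF iF], of "\<integral>t. norm (G t) \<partial>lborel"] by (simp add: norm_mult)
    show "AE s in lborel. integrable lborel (\<lambda>t. case (s, t) of (s, t) \<Rightarrow> F s * G t)" using iG by simp
  qed measurable
  have iFG': "integrable (lborel \<Otimes>\<^sub>M lborel) (\<lambda>p. F (fst p) * G (snd p))" using iFG by (simp add: case_prod_beta')
  define D where "D p = (if snd p \<le> (fst p::real) then 1 else 0 :: complex)" for p :: "real \<times> real"
  have [measurable]: "D \<in> borel_measurable (lborel \<Otimes>\<^sub>M lborel)" unfolding D_def[abs_def] by measurable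
  have i1: "integrable (lborel \<Otimes>\<^sub>M lborel) (\<lambda>p. (F (fst p) * G (snd p)) * D p)"
    using iFG' by (intro integrable_mult_bounded[where C=1 and f="\<lambda>p. F (fst p) * G (snd p)" and g="D"]) (auto simp: D_def case_prod_beta)
  have i2: "integrable (lborel \<Otimes>\<^sub>M lborel) (\<lambda>p. (F (fst p) * G (snd p)) * (1 - D p))"
    using iFG' by (intro integrable_mult_bounded[where C=1 and f="\<lambda>p. F (fst p) * G (snd p)" and g="\<lambda>p. 1 - D p"]) (auto simp: D_def case_prod_beta)
  have "prim x f y * prim x g y = (\<integral>s. F s * (\<integral>t. G t \<partial>lborel) \<partial>lborel)"
    by (simp add: prim_def F_def G_def)
  also have "\<dots> = (\<integral>p. F (fst p) * G (snd p) \<partial>(lborel \<Otimes>\<^sub>M lborel))"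
    using lborel_pair.integral_fst'[OF iFG'] by simp
  also have "\<dots> = (\<integral>p. (F (fst p) * G (snd p)) * D p + (F (fst p) * G (snd p)) * (1 - D p) \<partial>(lborel \<Otimes>\<^sub>M lborel))"
    by (simp add: algebra_simps)
  also have "\<dots> = (\<integral>p. (F (fst p) * G (snd p)) * D p \<partial>(lborel \<Otimes>\<^sub>M lborel)) + (\<integral>p. (F (fst p) * G (snd p)) * (1 - D p) \<partial>(lborel \<Otimes>\<^sub>M lborel))"
    using i1 i2 by simp
  also have "(\<integral>p. (F (fst p) * G (snd p)) * D p \<partial>(lborel \<Otimes>\<^sub>M lborel)) = (\<integral>s. (\<integral>t. F s * G t * D (s, t) \<partial>lborel) \<partial>lborel)"
    using lborel_pair.integral_fst'[OF i1] by simp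
  also have "\<dots> = prim x (\<lambda>t. f t * prim x g t) y"
    unfolding prim_def
  proof (intro Bochner_Integration.integral_cong refl)
    fix s
    have "(\<integral>t. F s * G t * D (s, t) \<partial>lborel) = F s * (\<integral>t. G t * D (s, t) \<partial>lborel)" by (simp add: mult.assoc)
    also have "\<dots> = F s * (\<integral>t. indicator {x<..s} t * g t \<partial>lborel)"
    proof (cases "s \<in> ?I")
      case True
      then have "(\<integral>t. G t * D (s, t) \<partial>lborel) = (\<integral>t. indicator {x<..s} t * g t \<partial>lborel)"
        by (intro Bochner_Integration.integral_cong) (auto simp: G_def D_def indicator_def)
      then show ?thesis by simp
    qed (simp add: F_def)
    finally show "(\<integral>t. F s * G t * D (s, t) \<partial>lborel) = indicator {x<..y} s * (f s * (\<integral>t. indicator {x<..s} t * g t \<partial>lborel))"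
      by (simp add: F_def)
  qed
  also have "(\<integral>p. (F (fst p) * G (snd p)) * (1 - D p) \<partial>(lborel \<Otimes>\<^sub>M lborel)) = (\<integral>t. (\<integral>s. F s * G t * (1 - D (s, t)) \<partial>lborel) \<partial>lborel)"
    using lborel_pair.integral_snd[of "\<lambda>s t. F s * G t * (1 - D (s, t))"] i2 by (simp add: case_prod_beta')
  also have "\<dots> = prim x (\<lambda>t. g t * prim x f t) y"
    unfolding prim_def
  proof (intro Bochner_Integration.integral_cong refl)
    fix t
    have "(\<integral>s. F s * G t * (1 - D (s, t)) \<partial>lborel) = (\<integral>s. G t * (F s * (1 - D (s, t))) \<partial>lborel)" by (simp add: mult_ac)
    also have "\<dots> = G t * (\<integral>s. F s * (1 - D (s, t)) \<partial>lborel)" by simp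
    also have "\<dots> = G t * (\<integral>s. indicator {x<..t} s * f s \<partial>lborel)"
    proof (cases "t \<in> ?I")
      case True
      have "(\<integral>s. F s * (1 - D (s, t)) \<partial>lborel) = (\<integral>s. indicator {x<..t} s * f s \<partial>lborel)"
      proof (rule integral_cong_AE)
        show "AE s in lborel. F s * (1 - D (s, t)) = indicator {x<..t} s * f s"
          using AE_lborel_singleton[of t] by eventually_elim (use True in \<open>auto simp: F_def D_def indicator_def\<close>)
      qed (unfold D_def[abs_def], measurable)
      then show ?thesis by simp
    qed (simp add: G_def)
    finally show "(\<integral>s. F s * G t * (1 - D (s, t)) \<partial>lborel) = indicator {x<..y} t * (g t * (\<integral>s. indicator {x<..t} s * f s \<partial>lborel))"
      by (simp add: G_def)
  qed
  finally show ?thesis .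
qed

lemma prim_cmult: "prim x (\<lambda>t. c * h t) y = c * prim x h y"
proof -
  have "(\<lambda>s. indicator {x<..y} s * (c * h s)) = (\<lambda>s. c * (indicator {x<..y} s * h s))" by (simp add: mult_ac)
  then show ?thesis unfolding prim_def by simp
qed

text \<open>Integration by parts reproduces the unknown integral \<open>J\<close> with the factor
  \<open>Suc k\<close>, which determines \<open>Suc (Suc k)\<close> times \<open>J\<close>.\<close>

lemma prim_power:
  assumes f: "integrable lborel f"
  shows "prim x (\<lambda>t. f t * (prim x f t ^ k / fact k)) y = prim x f y ^ Suc k / fact (Suc k)"
proof (induction k arbitrary: y)
  case 0
  show ?case by simp
next
  case (Suc k)
  have [measurable]: "f \<in> borel_measurable borel" using f by auto
  define g where "g t = f t * (prim x f t ^ k / fact k)" for t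
  have gi: "integrable lborel g" unfolding g_def
  proof (rule integrable_mult_bounded[OF f, where C="(\<integral>s. norm (f s) \<partial>lborel) ^ k / fact k"])
    show "norm (prim x f t ^ k / fact k) \<le> (\<integral>s. norm (f s) \<partial>lborel) ^ k / fact k" for t
      using prim_bound[OF f, of x t] by (auto simp: norm_divide norm_power intro!: divide_right_mono power_mono)
  qed measurable
  have pg: "prim x g t = prim x f t ^ Suc k / fact (Suc k)" for t unfolding g_def by (rule Suc)
  define J where "J = prim x (\<lambda>t. f t * (prim x f t ^ Suc k / fact (Suc k))) y"
  have "prim x f y * prim x g y = J + prim x (\<lambda>t. g t * prim x f t) y"
    unfolding J_def by (subst prim_product[OF f gi]) (simp add: pg)
  also have "(\<lambda>t. g t * prim x f t) = (\<lambda>t. of_nat (Suc k) * (f t * (prim x f t ^ Suc k / fact (Suc k))))"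
    by (intro ext) (simp add: g_def del: of_nat_Suc)
  also have "prim x \<dots> y = of_nat (Suc k) * J" 
    unfolding J_def by (rule prim_cmult)
  finally have "of_nat (Suc (Suc k)) * J = prim x f y * (prim x f y ^ Suc k / fact (Suc k))"
    by (simp add: pg algebra_simps)
  then have "J = prim x f y ^ Suc (Suc k) / (of_nat (Suc (Suc k)) * fact (Suc k))"
    by (simp add: nonzero_eq_divide_eq mult_ac del: of_nat_Suc fact_Suc)
  then show ?case unfolding J_def by (simp only: fact_Suc of_nat_mult)
qed

text \<open>The function \<open>f\<close> is merely integrable, so its primitive need not be
  differentiable everywhere. The chain rule for \<open>exp\<close> is instead obtained by
  integrating the power series term by term, with the series of the L1 norm of \<open>f\<close> as
  majorant.\<close>

lemma prim_exp:
  assumes f: "integrable lborel f"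
  shows "prim x (\<lambda>t. f t * exp (prim x f t)) y = exp (prim x f y) - 1"
proof -
  have [measurable]: "f \<in> borel_measurable borel" using f by auto
  let ?C = "\<integral>s. norm (f s) \<partial>lborel"
  define T where "T k t = indicator {x<..y} t * (f t * (prim x f t ^ k / fact k))" for k t
  have nT: "norm (T k t) \<le> norm (f t) * (?C ^ k / fact k)" for k t
  proof -
    have "norm (prim x f t ^ k / fact k) \<le> ?C ^ k / fact k"
      using prim_bound[OF f, of x t] by (auto simp: norm_divide norm_power intro!: divide_right_mono power_mono)
    then have "norm (f t) * norm (prim x f t ^ k / fact k) \<le> norm (f t) * (?C ^ k / fact k)" by (rule mult_left_mono) simp
    then have "norm (f t * (prim x f t ^ k / fact k)) \<le> norm (f t) * (?C ^ k / fact k)" by (simp only: norm_mult)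
    then show ?thesis by (cases "t \<in> {x<..y}") (simp_all add: T_def)
  qed
  have iT: "integrable lborel (T k)" for k
    by (rule Bochner_Integration.integrable_bound[OF integrable_mult_left[OF integrable_norm[OF f], of "?C ^ k / fact k"]])
      (use nT in \<open>auto intro: order_trans[OF _ abs_ge_self] simp: T_def[abs_def]\<close>)
  have sC: "summable (\<lambda>k. ?C ^ k / fact k)" using summable_exp[of ?C] by (simp add: field_simps)
  have "(\<lambda>k. \<integral>t. T k t \<partial>lborel) sums (\<integral>t. (\<Sum>k. T k t) \<partial>lborel)"
  proof (rule sums_integral[OF iT])
    show "AE t in lborel. summable (\<lambda>k. norm (T k t))"
      by (intro AE_I2 summable_comparison_test'[OF summable_mult[OF sC], of 0]) (use nT in auto)
    show "summable (\<lambda>k. \<integral>t. norm (T k t) \<partial>lborel)"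
    proof (rule summable_comparison_test'[OF summable_mult[OF sC, of ?C], of 0])
      fix k
      have "(\<integral>t. norm (T k t) \<partial>lborel) \<le> (\<integral>t. norm (f t) * (?C ^ k / fact k) \<partial>lborel)"
        using nT f by (intro integral_mono integrable_norm iT integrable_mult_left) auto
      then show "norm (\<integral>t. norm (T k t) \<partial>lborel) \<le> ?C * (?C ^ k / fact k)" by simp
    qed
  qed
  also have "(\<lambda>k. \<integral>t. T k t \<partial>lborel) = (\<lambda>k. prim x f y ^ Suc k / fact (Suc k))"
    using prim_power[OF f, of x _ y] unfolding T_def prim_def[of x "\<lambda>t. f t * (prim x f t ^ _ / fact _)"] by simp
  also have "(\<integral>t. (\<Sum>k. T k t) \<partial>lborel) = prim x (\<lambda>t. f t * exp (prim x f t)) y"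
    unfolding prim_def[of x "\<lambda>t. f t * exp (prim x f t)"]
  proof (intro Bochner_Integration.integral_cong refl)
    fix t
    have "(\<lambda>k. prim x f t ^ k / fact k) sums exp (prim x f t)"
      using exp_converges[of "prim x f t"] by (simp add: scaleR_conv_of_real field_simps)
    then have "(\<lambda>k. T k t) sums (indicator {x<..y} t * (f t * exp (prim x f t)))"
      unfolding T_def by (intro sums_mult)
    then show "(\<Sum>k. T k t) = indicator {x<..y} t * (f t * exp (prim x f t))" by (simp add: sums_iff)
  qed
  finally have 1: "(\<lambda>k. prim x f y ^ Suc k / fact (Suc k)) sums prim x (\<lambda>t. f t * exp (prim x f t)) y" .
  have "(\<lambda>k. prim x f y ^ k / fact k) sums exp (prim x f y)"
    using exp_converges[of "prim x f y"] by (simp add: scaleR_conv_of_real field_simps)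
  then have "(\<lambda>k. prim x f y ^ Suc k / fact (Suc k)) sums (exp (prim x f y) - 1)"
    using sums_Suc_iff[of "\<lambda>k. prim x f y ^ k / fact k" "exp (prim x f y) - 1"] by simp
  then show ?thesis using 1 sums_unique2 by blast
qed


section \<open>The exponential along a single path\<close>

locale jump_path =
  fixes n :: "real measure" and c \<phi> :: "real \<Rightarrow> complex"
  assumes sets_n[measurable_cong]: "sets n = sets borel"
    and int_n: "\<And>A. A \<in> sets borel \<Longrightarrow> bounded A \<Longrightarrow> \<exists>k::nat. emeasure n A = of_nat k"
    and simple_n: "\<And>x. emeasure n {x} \<le> 1"
    and ic: "integrable n c" and iq: "integrable n (\<lambda>t. exp (c t) - 1)" and iphi: "integrable lborel \<phi>"
begin

lemma space_n: "space n = UNIV" using sets_eq_imp_space_eq[OF sets_n] by simp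

lemma c_meas[measurable]: "c \<in> borel_measurable borel"
  using borel_measurable_integrable[OF ic] by (simp cong: measurable_cong_sets)

lemma phi_meas[measurable]: "\<phi> \<in> borel_measurable borel" using iphi by auto

lemma fin_Ioc: "emeasure n {a<..b} < \<infinity>"
  using int_n[of "{a<..b}"] bounded_subset[OF bounded_closed_interval[of a b], of "{a<..b}"]
  by (auto simp: subset_eq ennreal_of_nat_eq_real_of_nat)

lemma sigma_finite_n: "sigma_finite_measure n"
proof
  show "\<exists>A. countable A \<and> A \<subseteq> sets n \<and> \<Union> A = space n \<and> (\<forall>a\<in>A. emeasure n a \<noteq> \<infinity>)"
  proof (intro exI[of _ "range (\<lambda>k::nat. {- real k<..real k})"] conjI)
    show "\<Union> (range (\<lambda>k::nat. {- real k<..real k})) = space n"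
    proof (auto simp: space_n)
      fix x :: real
      obtain k :: nat where "\<bar>x\<bar> < real k" using reals_Archimedean2 by blast
      then show "\<exists>k::nat. - real k < x \<and> x \<le> real k" by (intro exI[of _ k]) auto
    qed
  qed (use fin_Ioc in \<open>auto simp: sets_n less_top\<close>)
qed

sublocale n: sigma_finite_measure n by (rule sigma_finite_n)

definition "J t = (\<integral>s. indicator {..t} s * c s \<partial>n)"
definition "J' t = (\<integral>s. indicator {..<t} s * c s \<partial>n)"
definition "\<Phi> t = (\<integral>s. indicator {..t} s * \<phi> s \<partial>lborel)"
text \<open>\<open>E\<close> is the right-continuous exponential and \<open>L\<close> its left-hand
  limit. Only the sum over the points distinguishes them; \<open>\<Phi>\<close> is continuous and is
  therefore the same in both.\<close>

definition "E t = exp (J t - \<Phi> t)"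
definition "L t = exp (J' t - \<Phi> t)"
definition "Cb = exp ((\<integral>s. norm (c s) \<partial>n) + (\<integral>s. norm (\<phi> s) \<partial>lborel))"

lemma ind_norm_bound:
  fixes f :: "real \<Rightarrow> complex"
  assumes "integrable M f" "A \<in> sets M"
  shows "norm (\<integral>s. indicator A s * f s \<partial>M) \<le> (\<integral>s. norm (f s) \<partial>M)"
proof -
  have "norm (\<integral>s. indicator A s * f s \<partial>M) \<le> (\<integral>s. norm (indicator A s * f s) \<partial>M)" by (rule integral_norm_bound)
  also have "\<dots> \<le> (\<integral>s. norm (f s) \<partial>M)"
    using assms by (intro integral_mono integrable_norm integrable_ind_mult) (auto simp: norm_mult indicator_def)
  finally show ?thesis .
qed

lemma L_bound: "norm (L t) \<le> Cb"
proof -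
  have "Re (J' t - \<Phi> t) \<le> norm (J' t - \<Phi> t)" by (rule complex_Re_le_cmod)
  also have "\<dots> \<le> norm (J' t) + norm (\<Phi> t)" by (rule norm_triangle_ineq4)
  also have "\<dots> \<le> (\<integral>s. norm (c s) \<partial>n) + (\<integral>s. norm (\<phi> s) \<partial>lborel)"
    unfolding J'_def \<Phi>_def by (intro add_mono ind_norm_bound ic iphi) (auto simp: sets_n)
  finally show ?thesis by (simp add: L_def Cb_def)
qed

lemma L_meas[measurable]: "L \<in> borel_measurable borel"
proof -
  have "(\<lambda>t. \<integral>s. (if s < t then c s else 0) \<partial>n) \<in> borel_measurable borel"
    by (rule n.borel_measurable_lebesgue_integral) (simp add: case_prod_beta, measurable)
  moreover have "J' = (\<lambda>t. \<integral>s. (if s < t then c s else 0) \<partial>n)"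
    unfolding J'_def by (intro ext Bochner_Integration.integral_cong) (auto simp: indicator_def)
  ultimately have [measurable]: "J' \<in> borel_measurable borel" by simp
  have "(\<lambda>t. \<integral>s. (if s \<le> t then \<phi> s else 0) \<partial>lborel) \<in> borel_measurable borel"
    by (rule lborel.borel_measurable_lebesgue_integral) (simp add: case_prod_beta, measurable)
  moreover have "\<Phi> = (\<lambda>t. \<integral>s. (if s \<le> t then \<phi> s else 0) \<partial>lborel)"
    unfolding \<Phi>_def by (intro ext Bochner_Integration.integral_cong) (auto simp: indicator_def)
  ultimately have [measurable]: "\<Phi> \<in> borel_measurable borel" by simp
  show ?thesis unfolding L_def[abs_def] by measurable
qed

lemma iLq: "integrable n (\<lambda>t. (exp (c t) - 1) * L t)"
  using L_bound by (intro integrable_mult_bounded[OF iq]) auto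

lemma iLphi: "integrable lborel (\<lambda>t. \<phi> t * L t)"
  using L_bound by (intro integrable_mult_bounded[OF iphi]) auto

text \<open>The integrated form of \<open>dE = (exp c - 1) E(t-) dn - \<phi> E(t-) dt\<close>. As a
  predicate of the endpoints it can be added up over adjacent intervals, and its integrands involve
  the left limit, as the martingale argument requires.\<close>

definition "jump_identity x y \<longleftrightarrow> E y - E x = (\<integral>t. indicator {x<..y} t * ((exp (c t) - 1) * L t) \<partial>n) - (\<integral>t. indicator {x<..y} t * (\<phi> t * L t) \<partial>lborel)"

lemma jump_identity_trans: "jump_identity x z \<Longrightarrow> jump_identity z y \<Longrightarrow> x \<le> z \<Longrightarrow> z \<le> y \<Longrightarrow> jump_identity x y"
  unfolding jump_identity_def
proof -
  assume xz: "x \<le> z" and zy: "z \<le> y"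
  let ?A = "\<lambda>x y. \<integral>t. indicator {x<..y} t * ((exp (c t) - 1) * L t) \<partial>n"
  let ?B = "\<lambda>x y. \<integral>t. indicator {x<..y} t * (\<phi> t * L t) \<partial>lborel"
  assume 1: "E z - E x = ?A x z - ?B x z" and 2: "E y - E z = ?A z y - ?B z y"
  have A: "?A x y = ?A x z + ?A z y" by (rule ind_split2[OF iLq sets_n xz zy])
  have B: "?B x y = ?B x z + ?B z y" by (rule ind_split2[OF iLphi _ xz zy]) simp
  have "E y - E x = (E z - E x) + (E y - E z)" by simp
  also have "\<dots> = ?A x y - ?B x y" unfolding 1 2 A B by simp
  finally show "E y - E x = ?A x y - ?B x y" .
qed

lemma integral_null_ind:
  fixes f :: "real \<Rightarrow> complex"
  assumes "emeasure n A = 0" "A \<in> sets borel" "A \<subseteq> B" and [measurable]: "f \<in> borel_measurable borel" "B \<in> sets borel"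
  shows "(\<integral>t. indicator B t * f t \<partial>n) = (\<integral>t. indicator (B - A) t * f t \<partial>n)"
proof (rule integral_cong_AE)
  have "AE t in n. t \<notin> A" using assms(1,2) by (intro AE_not_in) (auto simp: null_sets_def sets_n)
  then show "AE t in n. indicator B t * f t = indicator (B - A) t * f t"
    by eventually_elim (auto simp: indicator_def)
qed (use assms(2) in measurable)

lemma integral_ind_single:
  fixes f :: "real \<Rightarrow> complex"
  shows "(\<integral>t. indicator {y} t * f t \<partial>n) = of_real (measure n {y}) * f y"
proof -
  have "(\<integral>t. indicator {y} t * f t \<partial>n) = (\<integral>t. f y * of_real (indicator {y} t) \<partial>n)"
    by (intro Bochner_Integration.integral_cong) (auto simp: indicator_def)
  also have "\<dots> = f y * of_real (\<integral>t. indicator {y} t \<partial>n)" by simp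
  finally show ?thesis by (simp add: space_n)
qed

lemma atom_01: "measure n {y} = 0 \<or> measure n {y} = 1"
proof -
  obtain k :: nat where k: "emeasure n {y} = of_nat k" using int_n[of "{y}"] by auto
  then have "of_nat k \<le> (1::ennreal)" using simple_n[of y] by simp
  then have "k \<le> 1" by (metis of_nat_1 of_nat_le_iff)
  with k show ?thesis by (cases k) (auto simp: measure_def)
qed

text \<open>Without points in the open interval, \<open>L\<close> is on \<open>{x<..y}\<close> the
  value \<open>E x\<close> times the exponential of a primitive, and \<open>prim_exp\<close>
  evaluates the drift integral as \<open>E x - L y\<close>. What remains is the step from
  \<open>L y\<close> to \<open>E y\<close>, which is a factor \<open>exp (c y)\<close> if there is a
  point at \<open>y\<close> and 1 otherwise.\<close>

lemma jump_identity_base: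
  assumes xy: "x < y" and z: "emeasure n {x<..<y} = 0"
  shows "jump_identity x y"
proof -
  have z': "emeasure n {x<..<t} = 0" if "t \<le> y" for t
    using emeasure_mono[of "{x<..<t}" "{x<..<y}" n] that z by (auto simp: sets_n subset_eq)
  have J't: "J' t = J x" if "x < t" "t \<le> y" for t
  proof -
    have "J' t = (\<integral>s. indicator ({..<t} - {x<..<t}) s * c s \<partial>n)" unfolding J'_def
      by (rule integral_null_ind[OF z'[OF that(2)]]) auto
    also have "{..<t} - {x<..<t} = {..x}" using that by auto
    finally show ?thesis by (simp add: J_def)
  qed
  have Pt: "\<Phi> t = \<Phi> x + prim x \<phi> t" if "x \<le> t" for t
    unfolding \<Phi>_def prim_def by (rule ind_split[OF iphi _ that]) simp
  have Lt: "L t = E x * exp (prim x (\<lambda>t. - \<phi> t) t)" if "x < t" "t \<le> y" for t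
  proof -
    have "prim x (\<lambda>t. - \<phi> t) t = - prim x \<phi> t" using prim_cmult[of x "-1" \<phi> t] by simp
    then show ?thesis unfolding L_def E_def J't[OF that] Pt[OF less_imp_le[OF that(1)]] mult_exp_exp
      by (simp add: algebra_simps)
  qed
  have "(\<integral>t. indicator {x<..y} t * (\<phi> t * L t) \<partial>lborel) = (\<integral>t. indicator {x<..y} t * ((- E x) * ((- \<phi> t) * exp (prim x (\<lambda>t. - \<phi> t) t))) \<partial>lborel)"
    by (intro Bochner_Integration.integral_cong) (auto simp: indicator_def Lt)
  also have "\<dots> = (- E x) * prim x (\<lambda>t. (- \<phi> t) * exp (prim x (\<lambda>t. - \<phi> t) t)) y"
    unfolding prim_cmult[symmetric] by (simp only: prim_def)
  also have "\<dots> = (- E x) * (exp (prim x (\<lambda>t. - \<phi> t) y) - 1)" using iphi by (subst prim_exp) auto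
  also have "\<dots> = E x - L y" using Lt[of y] xy by (simp add: algebra_simps)
  finally have A: "(\<integral>t. indicator {x<..y} t * (\<phi> t * L t) \<partial>lborel) = E x - L y" .
  have B: "(\<integral>t. indicator {x<..y} t * ((exp (c t) - 1) * L t) \<partial>n) = of_real (measure n {y}) * ((exp (c y) - 1) * L y)"
  proof -
    have "(\<integral>t. indicator {x<..y} t * ((exp (c t) - 1) * L t) \<partial>n) = (\<integral>t. indicator ({x<..y} - {x<..<y}) t * ((exp (c t) - 1) * L t) \<partial>n)"
      by (rule integral_null_ind[OF z]) (auto, measurable)
    also have "{x<..y} - {x<..<y} = {y}" using xy by auto
    finally show ?thesis by (simp only: integral_ind_single)
  qed
  have "J y = J' y + of_real (measure n {y}) * c y"
  proof -
    have "J y = (\<integral>s. indicator {..<y} s * c s + indicator {y} s * c s \<partial>n)" unfolding J_def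
      by (intro Bochner_Integration.integral_cong) (auto simp: indicator_def)
    also have "\<dots> = J' y + (\<integral>s. indicator {y} s * c s \<partial>n)" unfolding J'_def
      by (intro Bochner_Integration.integral_add integrable_ind_mult ic) (auto simp: sets_n)
    finally show ?thesis by (simp only: integral_ind_single)
  qed
  then have "E y = L y * exp (of_real (measure n {y}) * c y)" by (simp add: E_def L_def mult_exp_exp algebra_simps)
  then show ?thesis unfolding jump_identity_def A B using atom_01[of y] by (auto simp: algebra_simps)
qed

lemma nat_Ioc: obtains k :: nat where "emeasure n {a<..b} = of_nat k"
  using int_n[of "{a<..b}"] bounded_subset[OF bounded_closed_interval[of a b], of "{a<..b}"] by (auto simp: subset_eq)

text \<open>\<open>z\<close> is the infimum of the times \<open>t\<close> for which
  \<open>{x<..t}\<close> has mass. Up to \<open>z\<close>, exclusively, there is no mass by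
  continuity from below. For \<open>t > z\<close> the mass is an integer different from 0, hence at
  least 1, and continuity from above carries this to \<open>{x<..z}\<close>; in particular
  \<open>z\<close> differs from \<open>x\<close>.\<close>

lemma first_jump:
  assumes xy: "x < y" and nz: "emeasure n {x<..<y} \<noteq> 0"
  obtains z where "x < z" "z < y" "emeasure n {x<..<z} = 0" "emeasure n {x<..z} \<ge> 1"
proof -
  have pos: "emeasure n {x<..t} \<ge> 1" if "emeasure n {x<..t} \<noteq> 0" for t
  proof -
    obtain k :: nat where k: "emeasure n {x<..t} = of_nat k" by (rule nat_Ioc)
    then have "k \<ge> 1" using that by (cases k) auto
    then show ?thesis unfolding k by (metis of_nat_1 of_nat_le_iff)
  qed
  define S where "S = {t. x < t \<and> t < y \<and> emeasure n {x<..t} \<noteq> 0}"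
  have Un: "(\<Union>i::nat. {x<..t - 1 / real (Suc i)}) = {x<..<t}" for t
  proof (intro equalityI subsetI)
    fix s assume "s \<in> {x<..<t}"
    then obtain i where "1 / real (Suc i) < t - s" using nat_approx_posE[of "t - s"] by auto
    then show "s \<in> (\<Union>i::nat. {x<..t - 1 / real (Suc i)})" using \<open>s \<in> {x<..<t}\<close> by (auto intro!: exI[of _ i])
  next
    fix s assume "s \<in> (\<Union>i::nat. {x<..t - 1 / real (Suc i)})"
    then obtain i :: nat where i: "x < s" "s \<le> t - 1 / real (Suc i)" unfolding UN_iff greaterThanAtMost_iff by blast
    have "1 / real (Suc i) > 0" by (simp del: of_nat_Suc)
    with i have "s < t" by linarith
    with i show "s \<in> {x<..<t}" by simp
  qed
  have zero_open: "emeasure n {x<..<t} = 0" if "\<And>s. x < s \<Longrightarrow> s < t \<Longrightarrow> emeasure n {x<..s} = 0" for t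
  proof -
    have "emeasure n (\<Union>i::nat. {x<..t - 1 / real (Suc i)}) = 0"
    proof (rule emeasure_UN_eq_0)
      fix i :: nat
      show "emeasure n {x<..t - 1 / real (Suc i)} = 0"
      proof (cases "x < t - 1 / real (Suc i)")
        case False
        then have "{x<..t - 1 / real (Suc i)} = {}" by auto
        then show ?thesis by simp
      qed (auto intro!: that)
    qed (auto simp: sets_n)
    then show ?thesis by (simp only: Un)
  qed
  have "S \<noteq> {}"
  proof
    assume "S = {}"
    then have "emeasure n {x<..<y} = 0" by (intro zero_open) (auto simp: S_def)
    then show False using nz by simp
  qed
  have bdd: "bdd_below S" by (rule bdd_belowI[of _ x]) (auto simp: S_def)
  define z where "z = Inf S"
  obtain s0 where s0: "s0 \<in> S" using \<open>S \<noteq> {}\<close> by auto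
  have "z \<le> s0" unfolding z_def by (rule cInf_lower[OF s0 bdd])
  then have zy: "z < y" using s0 by (auto simp: S_def)
  have xz: "x \<le> z" unfolding z_def by (rule cInf_greatest[OF \<open>S \<noteq> {}\<close>]) (auto simp: S_def)
  have o: "emeasure n {x<..<z} = 0"
  proof (rule zero_open, rule ccontr)
    fix s assume s: "x < s" "s < z" "emeasure n {x<..s} \<noteq> 0"
    then have "s \<in> S" using zy by (auto simp: S_def)
    then show False using cInf_lower[OF _ bdd, of s] s by (simp add: z_def)
  qed
  have right: "emeasure n {x<..t} \<ge> 1" if "z < t" for t
  proof -
    have "\<exists>s\<in>S. s < t" using cInf_lessD[OF \<open>S \<noteq> {}\<close>, of t] that by (simp add: z_def)
    then obtain s where s: "s \<in> S" "s < t" by blast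
    then have "emeasure n {x<..s} \<ge> 1" using pos by (auto simp: S_def)
    also have "\<dots> \<le> emeasure n {x<..t}" using s by (intro emeasure_mono) (auto simp: sets_n)
    finally show ?thesis .
  qed
  have Int: "(\<Inter>i::nat. {x<..z + 1 / real (Suc i)}) = {x<..z}"
  proof (intro equalityI subsetI)
    fix s assume s: "s \<in> (\<Inter>i::nat. {x<..z + 1 / real (Suc i)})"
    show "s \<in> {x<..z}"
    proof (rule ccontr)
      assume "s \<notin> {x<..z}"
      then have "s - z > 0" using s by auto
      then obtain i where "1 / real (Suc i) < s - z" using nat_approx_posE by metis
      moreover have "s \<le> z + 1 / real (Suc i)" using s by auto
      ultimately show False by simp
    qed
  next
    fix s assume "s \<in> {x<..z}"
    then show "s \<in> (\<Inter>i::nat. {x<..z + 1 / real (Suc i)})" by (auto intro: add_increasing2)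
  qed
  have "(INF i. emeasure n {x<..z + 1 / real (Suc i)}) = emeasure n (\<Inter>i::nat. {x<..z + 1 / real (Suc i)})"
  proof (rule INF_emeasure_decseq)
    show "decseq (\<lambda>i. {x<..z + 1 / real (Suc i)})"
      by (intro antimonoI) (auto simp: subset_eq frac_le intro: order_trans)
  qed (use fin_Ioc in \<open>auto simp: sets_n less_top\<close>)
  moreover have "(INF i. emeasure n {x<..z + 1 / real (Suc i)}) \<ge> 1" by (rule INF_greatest, rule right) simp
  ultimately have c: "emeasure n {x<..z} \<ge> 1" by (simp only: Int)
  then have "x \<noteq> z" by auto
  with xz zy o c show thesis by (intro that[of z]) auto
qed

text \<open>Strong induction on the number of points in \<open>{x<..y}\<close>, which is finite. The
  first point \<open>z\<close> inside the interval separates a piece without inner points, to which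
  the base case applies, from \<open>{z<..y}\<close>, which contains fewer points.\<close>

lemma jump_identity_all:
  assumes "x \<le> y"
  shows "jump_identity x y"
proof -
  have "\<forall>x y. x \<le> y \<longrightarrow> emeasure n {x<..y} = of_nat k \<longrightarrow> jump_identity x y" for k
  proof (induction k rule: less_induct)
    case (less k)
    show ?case
    proof (intro allI impI)
      fix x y :: real assume xy: "x \<le> y" and k: "emeasure n {x<..y} = of_nat k"
      consider "x = y" | "x < y" "emeasure n {x<..<y} = 0" | "x < y" "emeasure n {x<..<y} \<noteq> 0" using xy by force
      then show "jump_identity x y"
      proof cases
        case 3
        obtain z where z: "x < z" "z < y" "emeasure n {x<..<z} = 0" "emeasure n {x<..z} \<ge> 1" using first_jump[OF 3] by blast
        obtain k1 :: nat where k1: "emeasure n {x<..z} = of_nat k1" by (rule nat_Ioc)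
        obtain k2 :: nat where k2: "emeasure n {z<..y} = of_nat k2" by (rule nat_Ioc)
        have "{x<..y} = {x<..z} \<union> {z<..y}" using z by auto
        then have "emeasure n {x<..y} = emeasure n {x<..z} + emeasure n {z<..y}"
          by (simp only:) (rule plus_emeasure[symmetric], auto simp: sets_n)
        then have "k = k1 + k2" unfolding k k1 k2 by (metis of_nat_add of_nat_eq_iff)
        moreover have "k1 \<noteq> 0" using z(4) k1 by auto
        ultimately have "jump_identity z y" using less.IH[of k2] k2 z by auto
        then show ?thesis using jump_identity_trans[OF jump_identity_base[OF z(1,3)]] z by simp
      next
        case 1
        then show ?thesis by (simp add: jump_identity_def)
      next
        case 2
        then show ?thesis by (rule jump_identity_base)
      qed
    qed
  qed
  then show ?thesis using nat_Ioc[of x y] assms by metis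
qed

text \<open>The approach must be strictly from the left: then a point at \<open>t\<close> itself is
  never counted, and the limit is \<open>L t\<close> instead of \<open>E t\<close>.\<close>

lemma E_tendsto_L:
  assumes "\<And>i. s i < t" "s \<longlonglongrightarrow> t"
  shows "(\<lambda>i. E (s i)) \<longlonglongrightarrow> L t"
proof -
  have ev: "eventually (\<lambda>i. r \<le> s i) sequentially" if "r < t" for r
    using order_tendstoD(1)[OF assms(2) that] by (rule eventually_mono) simp
  have lim: "(\<lambda>i. \<integral>r. indicator {..s i} r * f r \<partial>M) \<longlonglongrightarrow> (\<integral>r. indicator {..<t} r * f r \<partial>M)"
    if f: "integrable M f" and M: "sets M = sets borel" for f :: "real \<Rightarrow> complex" and M
  proof (rule integral_dominated_convergence[where w="\<lambda>r. norm (f r)"])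
    have fm: "f \<in> borel_measurable M" using f by auto
    show "(\<lambda>r. indicator {..<t} r * f r) \<in> borel_measurable M" "\<And>i. (\<lambda>r. indicator {..s i} r * f r) \<in> borel_measurable M"
      using integrable_ind_mult[OF f] by (auto simp: M intro!: borel_measurable_integrable)
    show "AE r in M. (\<lambda>i. indicator {..s i} r * f r) \<longlonglongrightarrow> indicator {..<t} r * f r"
    proof (rule AE_I2)
      fix r
      show "(\<lambda>i. indicator {..s i} r * f r) \<longlonglongrightarrow> indicator {..<t} r * f r"
      proof (cases "r < t")
        case True
        have "eventually (\<lambda>i. indicator {..s i} r * f r = indicator {..<t} r * f r) sequentially"
          using ev[OF True] by (rule eventually_mono) (use True in auto)
        then show ?thesis by (rule tendsto_eventually)
      next
        case False
        have "indicator {..s i} r * f r = indicator {..<t} r * f r" for i using False assms(1)[of i] by (auto simp: indicator_def)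
        then show ?thesis by (simp only: tendsto_const)
      qed
    qed
  qed (use f in \<open>auto simp: norm_mult indicator_def\<close>)
  have "(\<integral>r. indicator {..<t} r * \<phi> r \<partial>lborel) = \<Phi> t" unfolding \<Phi>_def
  proof (rule integral_cong_AE)
    show "AE r in lborel. indicator {..<t} r * \<phi> r = indicator {..t} r * \<phi> r"
      using AE_lborel_singleton[of t] by eventually_elim (auto simp: indicator_def)
  qed auto
  then have "(\<lambda>i. \<Phi> (s i)) \<longlonglongrightarrow> \<Phi> t" using lim[OF iphi] by (simp add: \<Phi>_def)
  moreover have "(\<lambda>i. J (s i)) \<longlonglongrightarrow> J' t" using lim[OF ic sets_n] by (simp add: J_def J'_def)
  ultimately show ?thesis unfolding E_def L_def by (intro tendsto_intros)
qed

end

subsection \<open>The mean measure of a stationary Hawkes process\<close>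

text \<open>The restriction to \<open>S\<close> makes the statement usable for the filtration: if
  \<open>S\<close> lies in the past of \<open>t\<close>, evaluations on subsets of \<open>S\<close>
  are known at time \<open>t\<close>, and \<open>G\<close> may be taken as the sigma-algebra of that
  past.\<close>

lemma nn_integral_random_measurable:
  assumes sK: "\<And>\<omega>. \<omega> \<in> space G \<Longrightarrow> sets (K \<omega>) = sets borel" and S: "S \<in> sets borel"
    and mK: "\<And>A. A \<in> sets borel \<Longrightarrow> A \<subseteq> S \<Longrightarrow> (\<lambda>\<omega>. emeasure (K \<omega>) A) \<in> borel_measurable G"
    and q: "q \<in> borel_measurable (borel :: real measure)"
  shows "(\<lambda>\<omega>. \<integral>\<^sup>+x. q x * indicator S x \<partial>K \<omega>) \<in> borel_measurable G"
  using q
proof (induction q rule: borel_measurable_induct)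
  case (cong f g)
  then show ?case by (simp add: space_borel)
next
  case (set A)
  have "(\<lambda>\<omega>. \<integral>\<^sup>+x. indicator A x * indicator S x \<partial>K \<omega>) \<in> borel_measurable G \<longleftrightarrow> (\<lambda>\<omega>. emeasure (K \<omega>) (A \<inter> S)) \<in> borel_measurable G"
  proof (rule measurable_cong)
    fix \<omega> assume "\<omega> \<in> space G"
    have "(\<integral>\<^sup>+x. indicator A x * indicator S x \<partial>K \<omega>) = (\<integral>\<^sup>+x. indicator (A \<inter> S) x \<partial>K \<omega>)" by (simp add: indicator_inter_arith)
    also have "\<dots> = emeasure (K \<omega>) (A \<inter> S)" using set S by (intro nn_integral_indicator) (simp add: sK[OF \<open>\<omega> \<in> space G\<close>])
    finally show "(\<integral>\<^sup>+x. indicator A x * indicator S x \<partial>K \<omega>) = emeasure (K \<omega>) (A \<inter> S)" .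
  qed
  then show ?case using mK[of "A \<inter> S"] set S by auto
next
  case (mult u c)
  have "(\<lambda>\<omega>. \<integral>\<^sup>+x. c * u x * indicator S x \<partial>K \<omega>) \<in> borel_measurable G \<longleftrightarrow> (\<lambda>\<omega>. c * (\<integral>\<^sup>+x. u x * indicator S x \<partial>K \<omega>)) \<in> borel_measurable G"
  proof (rule measurable_cong)
    fix \<omega> assume w: "\<omega> \<in> space G"
    note [measurable_cong] = sK[OF w]
    note [measurable] = mult(2) S
    have "(\<integral>\<^sup>+x. c * u x * indicator S x \<partial>K \<omega>) = (\<integral>\<^sup>+x. c * (u x * indicator S x) \<partial>K \<omega>)" by (simp add: mult.assoc)
    also have "\<dots> = c * (\<integral>\<^sup>+x. u x * indicator S x \<partial>K \<omega>)" by (rule nn_integral_cmult) measurable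
    finally show "(\<integral>\<^sup>+x. c * u x * indicator S x \<partial>K \<omega>) = c * (\<integral>\<^sup>+x. u x * indicator S x \<partial>K \<omega>)" .
  qed
  then show ?case using mult by auto
next
  case (add u v)
  have "(\<lambda>\<omega>. \<integral>\<^sup>+x. (v x + u x) * indicator S x \<partial>K \<omega>) \<in> borel_measurable G \<longleftrightarrow> (\<lambda>\<omega>. (\<integral>\<^sup>+x. v x * indicator S x \<partial>K \<omega>) + (\<integral>\<^sup>+x. u x * indicator S x \<partial>K \<omega>)) \<in> borel_measurable G"
  proof (rule measurable_cong)
    fix \<omega> assume w: "\<omega> \<in> space G"
    note [measurable_cong] = sK[OF w]
    note [measurable] = add(1,3) S
    have "(\<integral>\<^sup>+x. (v x + u x) * indicator S x \<partial>K \<omega>) = (\<integral>\<^sup>+x. v x * indicator S x + u x * indicator S x \<partial>K \<omega>)" by (simp add: distrib_right)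
    also have "\<dots> = (\<integral>\<^sup>+x. v x * indicator S x \<partial>K \<omega>) + (\<integral>\<^sup>+x. u x * indicator S x \<partial>K \<omega>)" by (rule nn_integral_add) measurable
    finally show "(\<integral>\<^sup>+x. (v x + u x) * indicator S x \<partial>K \<omega>) = (\<integral>\<^sup>+x. v x * indicator S x \<partial>K \<omega>) + (\<integral>\<^sup>+x. u x * indicator S x \<partial>K \<omega>)" .
  qed
  then show ?case using add by auto
next
  case (seq U)
  have "(\<lambda>\<omega>. \<integral>\<^sup>+x. (SUP i. U i) x * indicator S x \<partial>K \<omega>) \<in> borel_measurable G \<longleftrightarrow> (\<lambda>\<omega>. SUP i. (\<integral>\<^sup>+x. U i x * indicator S x \<partial>K \<omega>)) \<in> borel_measurable G"
  proof (rule measurable_cong)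
    fix \<omega> assume w: "\<omega> \<in> space G"
    note [measurable_cong] = sK[OF w]
    note [measurable] = seq(1) S
    have "(\<integral>\<^sup>+x. (SUP i. U i) x * indicator S x \<partial>K \<omega>) = (\<integral>\<^sup>+x. (SUP i. U i x * indicator S x) \<partial>K \<omega>)"
      by (simp add: SUP_mult_right_ennreal image_comp)
    also have "\<dots> = (SUP i. (\<integral>\<^sup>+x. U i x * indicator S x \<partial>K \<omega>))"
      using seq(3) by (intro nn_integral_monotone_convergence_SUP) (auto simp: incseq_def le_fun_def intro!: mult_right_mono)
    finally show "(\<integral>\<^sup>+x. (SUP i. U i) x * indicator S x \<partial>K \<omega>) = (SUP i. (\<integral>\<^sup>+x. U i x * indicator S x \<partial>K \<omega>))" .
  qed
  then show ?case using seq by auto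
qed

text \<open>For a fixed weight \<xi> this is the Campbell measure of the random measure. Identities
  between expectations can then be extended from intervals to functions by uniqueness of
  measures.\<close>

definition mixmeas :: "'a measure \<Rightarrow> ('a \<Rightarrow> ennreal) \<Rightarrow> ('a \<Rightarrow> real measure) \<Rightarrow> real measure" where
  "mixmeas M \<xi> K = measure_of UNIV (sets borel) (\<lambda>A. \<integral>\<^sup>+\<omega>. \<xi> \<omega> * emeasure (K \<omega>) A \<partial>M)"

lemma sets_mixmeas[measurable_cong, simp]: "sets (mixmeas M \<xi> K) = sets borel"
  using sets.sigma_sets_eq[of "borel :: real measure"] by (simp add: mixmeas_def)

lemma space_mixmeas[simp]: "space (mixmeas M \<xi> K) = UNIV"
  by (simp add: mixmeas_def)

locale random_meas =
  fixes M :: "'a measure" and K :: "'a \<Rightarrow> real measure"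
  assumes sK: "\<And>\<omega>. \<omega> \<in> space M \<Longrightarrow> sets (K \<omega>) = sets borel"
    and mK: "\<And>A. A \<in> sets borel \<Longrightarrow> (\<lambda>\<omega>. emeasure (K \<omega>) A) \<in> borel_measurable M"
begin

lemma mq: "q \<in> borel_measurable borel \<Longrightarrow> (\<lambda>\<omega>. \<integral>\<^sup>+x. q x \<partial>K \<omega>) \<in> borel_measurable M"
  using nn_integral_random_measurable[of M K UNIV q] sK mK by simp

lemma emeasure_mixmeas:
  assumes xi: "\<xi> \<in> borel_measurable M" and A: "A \<in> sets borel"
  shows "emeasure (mixmeas M \<xi> K) A = (\<integral>\<^sup>+\<omega>. \<xi> \<omega> * emeasure (K \<omega>) A \<partial>M)"
proof (rule emeasure_measure_of[OF mixmeas_def])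
  show "countably_additive (sets (mixmeas M \<xi> K)) (\<lambda>A. \<integral>\<^sup>+\<omega>. \<xi> \<omega> * emeasure (K \<omega>) A \<partial>M)"
  proof (rule countably_additiveI)
    fix A :: "nat \<Rightarrow> real set" assume A: "range A \<subseteq> sets (mixmeas M \<xi> K)" "disjoint_family A"
    then have Ai: "A i \<in> sets borel" for i by auto
    have "(\<Sum>i. \<integral>\<^sup>+\<omega>. \<xi> \<omega> * emeasure (K \<omega>) (A i) \<partial>M) = (\<integral>\<^sup>+\<omega>. (\<Sum>i. \<xi> \<omega> * emeasure (K \<omega>) (A i)) \<partial>M)"
      using xi mK Ai by (intro nn_integral_suminf[symmetric]) auto
    also have "\<dots> = (\<integral>\<^sup>+\<omega>. \<xi> \<omega> * emeasure (K \<omega>) (\<Union>i. A i) \<partial>M)"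
    proof (rule nn_integral_cong)
      fix \<omega> assume w: "\<omega> \<in> space M"
      have "(\<Sum>i. emeasure (K \<omega>) (A i)) = emeasure (K \<omega>) (\<Union>i. A i)"
        using A Ai by (intro suminf_emeasure) (auto simp: sK[OF w])
      then show "(\<Sum>i. \<xi> \<omega> * emeasure (K \<omega>) (A i)) = \<xi> \<omega> * emeasure (K \<omega>) (\<Union>i. A i)" by simp
    qed
    finally show "(\<Sum>i. \<integral>\<^sup>+\<omega>. \<xi> \<omega> * emeasure (K \<omega>) (A i) \<partial>M) = (\<integral>\<^sup>+\<omega>. \<xi> \<omega> * emeasure (K \<omega>) (\<Union>i. A i) \<partial>M)" .
  qed
qed (use A in \<open>auto simp: positive_def\<close>)

lemma nn_integral_mixmeas:
  assumes xi[measurable]: "\<xi> \<in> borel_measurable M" and q: "q \<in> borel_measurable borel"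
  shows "(\<integral>\<^sup>+x. q x \<partial>mixmeas M \<xi> K) = (\<integral>\<^sup>+\<omega>. \<xi> \<omega> * (\<integral>\<^sup>+x. q x \<partial>K \<omega>) \<partial>M)"
  using q
proof (induction q rule: borel_measurable_induct)
  case (cong f g)
  then show ?case by (simp add: space_borel)
next
  case (set A)
  have "(\<integral>\<^sup>+\<omega>. \<xi> \<omega> * (\<integral>\<^sup>+x. indicator A x \<partial>K \<omega>) \<partial>M) = (\<integral>\<^sup>+\<omega>. \<xi> \<omega> * emeasure (K \<omega>) A \<partial>M)"
    using set by (intro nn_integral_cong) (simp add: sK)
  then show ?case using set by (simp add: emeasure_mixmeas[OF xi])
next
  case (mult u c)
  note [measurable] = mult(2) mq[OF mult(2)]
  have "(\<integral>\<^sup>+\<omega>. \<xi> \<omega> * (\<integral>\<^sup>+x. c * u x \<partial>K \<omega>) \<partial>M) = (\<integral>\<^sup>+\<omega>. c * (\<xi> \<omega> * (\<integral>\<^sup>+x. u x \<partial>K \<omega>)) \<partial>M)"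
  proof (intro nn_integral_cong)
    fix \<omega> assume w: "\<omega> \<in> space M"
    note [measurable_cong] = sK[OF w]
    show "\<xi> \<omega> * (\<integral>\<^sup>+x. c * u x \<partial>K \<omega>) = c * (\<xi> \<omega> * (\<integral>\<^sup>+x. u x \<partial>K \<omega>))" by (simp add: nn_integral_cmult mult_ac)
  qed
  also have "\<dots> = c * (\<integral>\<^sup>+\<omega>. \<xi> \<omega> * (\<integral>\<^sup>+x. u x \<partial>K \<omega>) \<partial>M)" by (rule nn_integral_cmult) measurable
  finally show ?case using mult by (simp add: nn_integral_cmult)
next
  case (add u v)
  note [measurable] = add(1,3) mq[OF add(1)] mq[OF add(3)]
  have "(\<integral>\<^sup>+\<omega>. \<xi> \<omega> * (\<integral>\<^sup>+x. v x + u x \<partial>K \<omega>) \<partial>M) = (\<integral>\<^sup>+\<omega>. \<xi> \<omega> * (\<integral>\<^sup>+x. v x \<partial>K \<omega>) + \<xi> \<omega> * (\<integral>\<^sup>+x. u x \<partial>K \<omega>) \<partial>M)"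
  proof (intro nn_integral_cong)
    fix \<omega> assume w: "\<omega> \<in> space M"
    note [measurable_cong] = sK[OF w]
    show "\<xi> \<omega> * (\<integral>\<^sup>+x. v x + u x \<partial>K \<omega>) = \<xi> \<omega> * (\<integral>\<^sup>+x. v x \<partial>K \<omega>) + \<xi> \<omega> * (\<integral>\<^sup>+x. u x \<partial>K \<omega>)"
      by (simp add: nn_integral_add distrib_left)
  qed
  also have "\<dots> = (\<integral>\<^sup>+\<omega>. \<xi> \<omega> * (\<integral>\<^sup>+x. v x \<partial>K \<omega>) \<partial>M) + (\<integral>\<^sup>+\<omega>. \<xi> \<omega> * (\<integral>\<^sup>+x. u x \<partial>K \<omega>) \<partial>M)" by (rule nn_integral_add) measurable
  finally show ?case using add by (simp add: nn_integral_add)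
next
  case (seq U)
  note [measurable] = seq(1) mq[OF seq(1)]
  have inc: "incseq (\<lambda>i. \<integral>\<^sup>+x. U i x \<partial>K \<omega>)" for \<omega>
    using seq(3) by (auto simp: incseq_def le_fun_def intro!: nn_integral_mono)
  have "(\<integral>\<^sup>+\<omega>. \<xi> \<omega> * (\<integral>\<^sup>+x. (SUP i. U i) x \<partial>K \<omega>) \<partial>M) = (\<integral>\<^sup>+\<omega>. (SUP i. \<xi> \<omega> * (\<integral>\<^sup>+x. U i x \<partial>K \<omega>)) \<partial>M)"
  proof (intro nn_integral_cong)
    fix \<omega> assume w: "\<omega> \<in> space M"
    note [measurable_cong] = sK[OF w]
    have "(\<integral>\<^sup>+x. (SUP i. U i) x \<partial>K \<omega>) = (SUP i. (\<integral>\<^sup>+x. U i x \<partial>K \<omega>))"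
      using seq(3) by (simp add: image_comp) (intro nn_integral_monotone_convergence_SUP, auto)
    then show "\<xi> \<omega> * (\<integral>\<^sup>+x. (SUP i. U i) x \<partial>K \<omega>) = (SUP i. \<xi> \<omega> * (\<integral>\<^sup>+x. U i x \<partial>K \<omega>))"
      by (simp add: SUP_mult_left_ennreal)
  qed
  also have "\<dots> = (SUP i. (\<integral>\<^sup>+\<omega>. \<xi> \<omega> * (\<integral>\<^sup>+x. U i x \<partial>K \<omega>) \<partial>M))"
    using inc by (intro nn_integral_monotone_convergence_SUP) (auto simp: incseq_def le_fun_def intro!: mult_left_mono)
  also have "\<dots> = (SUP i. (\<integral>\<^sup>+x. U i x \<partial>mixmeas M \<xi> K))" using seq by simp
  also have "\<dots> = (\<integral>\<^sup>+x. (SUP i. U i) x \<partial>mixmeas M \<xi> K)"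
    using seq(3) by (simp add: image_comp) (intro nn_integral_monotone_convergence_SUP[symmetric], auto)
  finally show ?case ..
qed

end

section \<open>The Hawkes process, its filtration and its mean measure\<close>

locale hawkes = prob_space M for M :: "'a measure" +
  fixes N :: "'a \<Rightarrow> real measure" and \<nu> \<mu> :: real and h :: "real \<Rightarrow> real"
  assumes nu: "\<nu> > 0" and h_nonneg: "\<And>t. t \<ge> 0 \<Longrightarrow> h t \<ge> 0" and h_int: "set_integrable lborel {0..} h"
    and mu_def: "\<mu> = (LBINT t:{0..}. h t)" and mu1: "\<mu> < 1"
    and st: "stationary_linear_hawkes M \<nu> h N"
begin

text \<open>Extension by 0 to the nonpositive half-line, including the point 0, lets all integrals
  over the past run over the whole line: \<open>hp (t - s)\<close> vanishes unless
  \<open>s < t\<close>, in accordance with the open interval in the intensity.\<close>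

definition "hp s = (if s > 0 then h s else 0)"

lemma hp_nonneg: "hp s \<ge> 0" using h_nonneg by (simp add: hp_def)
lemma hp_zero: "s \<le> 0 \<Longrightarrow> hp s = 0" by (simp add: hp_def)

lemma hp_int: "integrable lborel hp" and mu_eq: "\<mu> = (LINT s|lborel. hp s)"
proof -
  have i: "integrable lborel (\<lambda>s. indicator {0..} s * h s)" using h_int by (simp add: set_integrable_def)
  have "hp = (\<lambda>s. indicator {0<..} s * (indicator {0..} s * h s))" by (auto simp: hp_def indicator_def)
  then show "integrable lborel hp" using integrable_Iic[OF i, of "{0<..}"] by simp
  then have m: "hp \<in> borel_measurable lborel" by auto
  have "(LINT s|lborel. indicator {0..} s * h s) = (LINT s|lborel. hp s)"
  proof (rule integral_cong_AE)
    show "AE s in lborel. indicator {0..} s * h s = hp s"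
      using AE_lborel_singleton[of 0] by eventually_elim (auto simp: hp_def indicator_def)
  qed (use i m in auto)
  then show "\<mu> = (LINT s|lborel. hp s)" by (simp add: mu_def set_lebesgue_integral_def)
qed

lemma hp_meas[measurable]: "hp \<in> borel_measurable borel" using hp_int by auto

lemma mu0: "\<mu> \<ge> 0" unfolding mu_eq using hp_nonneg by simp

lemma nn_hp: "(\<integral>\<^sup>+s. ennreal (hp s) \<partial>lborel) = ennreal \<mu>"
  unfolding mu_eq using hp_nonneg hp_int by (intro nn_integral_eq_integral) auto

definition "lam t \<omega> = hawkes_intensity \<nu> h N t \<omega>"
abbreviation "FN \<equiv> natural_filtration M N"

lemma pp: "point_process M N" and simp_N: "simple_process M N" and si: "stochastic_intensity M FN N lam"
    and stat: "stationary_process M N" and fin1: "(\<integral>\<^sup>+\<omega>. emeasure (N \<omega>) {0<..1} \<partial>M) < \<infinity>"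
  using st by (auto simp: stationary_linear_hawkes_def linear_hawkes_def lam_def[abs_def])

sublocale N: random_meas M N
  using pp by unfold_locales (auto simp: point_process_def)

lemmas sets_N = N.sK

lemma lam_eq: "lam t \<omega> = ennreal \<nu> + (\<integral>\<^sup>+s. ennreal (hp (t - s)) \<partial>N \<omega>)"
  unfolding lam_def hawkes_intensity_def
  by (intro arg_cong2[of _ _ _ _ "(+)"] refl nn_integral_cong) (auto simp: hp_def indicator_def)

lemma lam_meas[measurable]: "(\<lambda>(t, \<omega>). lam t \<omega>) \<in> borel_measurable (borel \<Otimes>\<^sub>M M)"
  using si by (simp add: stochastic_intensity_def cong: measurable_cong_sets)

lemma lam_meas1[measurable]: "\<omega> \<in> space M \<Longrightarrow> (\<lambda>t. lam t \<omega>) \<in> borel_measurable borel"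
  using measurable_compose[OF measurable_Pair2' lam_meas, of \<omega>] by simp

lemma sub: "subalgebra M (FN t)" using si by (simp add: stochastic_intensity_def)

lemma space_FN: "space (FN t) = space M" using sub[of t] by (simp add: subalgebra_def)

lemma FN_meas: "A \<in> sets borel \<Longrightarrow> A \<subseteq> {..t} \<Longrightarrow> (\<lambda>\<omega>. emeasure (N \<omega>) A) \<in> borel_measurable (FN t)"
proof -
  assume A: "A \<in> sets borel" "A \<subseteq> {..t}"
  show ?thesis
  proof (rule measurableI)
    fix B :: "ennreal set" assume "B \<in> sets borel"
    then show "(\<lambda>\<omega>. emeasure (N \<omega>) A) -` B \<inter> space (FN t) \<in> sets (FN t)"
      unfolding space_FN unfolding natural_filtration_def using A
      by (subst sets_measure_of) (auto intro!: sigma_sets.Basic)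
  qed simp
qed

lemma FN_mono:
  assumes st: "s \<le> t"
  shows "sets (FN s) \<subseteq> sets (FN t)"
proof -
  let ?G = "\<lambda>t. {(\<lambda>\<omega>. emeasure (N \<omega>) A) -` B \<inter> space M | A B. A \<in> sets borel \<and> A \<subseteq> {..t} \<and> B \<in> sets borel}"
  have P: "?G t \<subseteq> Pow (space M)" for t by auto
  have "?G s \<subseteq> ?G t"
  proof
    fix X assume "X \<in> ?G s"
    then obtain A B where "X = (\<lambda>\<omega>. emeasure (N \<omega>) A) -` B \<inter> space M" "A \<in> sets borel" "A \<subseteq> {..s}" "B \<in> sets borel" by blast
    moreover have "A \<subseteq> {..t}" using \<open>A \<subseteq> {..s}\<close> st by auto
    ultimately show "X \<in> ?G t" by blast
  qed
  then show ?thesis unfolding natural_filtration_def sets_measure_of[OF P] by (rule sigma_sets_mono')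
qed

lemma FN_meas_mono: "s \<le> t \<Longrightarrow> f \<in> borel_measurable (FN s) \<Longrightarrow> f \<in> borel_measurable (FN t)"
  using FN_mono[of s t] space_FN by (auto simp: measurable_def)

lemma FN_meas_M: "f \<in> borel_measurable (FN s) \<Longrightarrow> f \<in> borel_measurable M"
  using measurable_from_subalg[OF sub] .

text \<open>The equality of conditional expectations, tested with a weight known at time
  \<open>a\<close>. All variables take values in the extended half-line, so no integrability has to
  be checked.\<close>

lemma intensity_Ioc:
  assumes ab: "a < b" and xi: "\<xi> \<in> borel_measurable (FN a)"
  shows "(\<integral>\<^sup>+\<omega>. \<xi> \<omega> * emeasure (N \<omega>) {a<..b} \<partial>M) = (\<integral>\<^sup>+\<omega>. \<xi> \<omega> * (\<integral>\<^sup>+t. lam t \<omega> * indicator {a<..b} t \<partial>lborel) \<partial>M)"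
proof -
  interpret S: finite_measure_subalgebra M "FN a" by unfold_locales (rule sub)
  have m2: "(\<lambda>\<omega>. \<integral>\<^sup>+t. lam t \<omega> * indicator {a<..b} t \<partial>lborel) \<in> borel_measurable M"
  proof -
    have "(\<lambda>(\<omega>, t). lam t \<omega> * indicator {a<..b} t) \<in> borel_measurable (M \<Otimes>\<^sub>M lborel)"
      using measurable_compose[OF measurable_pair_swap' lam_meas] by (simp add: case_prod_beta', measurable)
    then show ?thesis by (rule lborel.borel_measurable_nn_integral)
  qed
  have AE: "AE \<omega> in M. nn_cond_exp M (FN a) (\<lambda>\<omega>. emeasure (N \<omega>) {a<..b}) \<omega> = nn_cond_exp M (FN a) (\<lambda>\<omega>. \<integral>\<^sup>+t. lam t \<omega> * indicator {a<..b} t \<partial>lborel) \<omega>"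
    using si ab by (simp add: stochastic_intensity_def)
  have "(\<integral>\<^sup>+\<omega>. \<xi> \<omega> * emeasure (N \<omega>) {a<..b} \<partial>M) = (\<integral>\<^sup>+\<omega>. \<xi> \<omega> * nn_cond_exp M (FN a) (\<lambda>\<omega>. emeasure (N \<omega>) {a<..b}) \<omega> \<partial>M)"
    by (rule S.nn_cond_exp_intg[symmetric, OF xi N.mK]) simp
  also have "\<dots> = (\<integral>\<^sup>+\<omega>. \<xi> \<omega> * nn_cond_exp M (FN a) (\<lambda>\<omega>. \<integral>\<^sup>+t. lam t \<omega> * indicator {a<..b} t \<partial>lborel) \<omega> \<partial>M)"
    using AE by (intro nn_integral_cong_AE) auto
  also have "\<dots> = (\<integral>\<^sup>+\<omega>. \<xi> \<omega> * (\<integral>\<^sup>+t. lam t \<omega> * indicator {a<..b} t \<partial>lborel) \<partial>M)"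
    by (rule S.nn_cond_exp_intg[OF xi m2])
  finally show ?thesis .
qed

definition "mean_meas = mixmeas M (\<lambda>_. 1) N"

lemma mean_meas_emeasure: "A \<in> sets borel \<Longrightarrow> emeasure mean_meas A = (\<integral>\<^sup>+\<omega>. emeasure (N \<omega>) A \<partial>M)"
  unfolding mean_meas_def by (subst N.emeasure_mixmeas) auto

lemma sets_mean_meas[measurable_cong]: "sets mean_meas = sets borel" by (simp add: mean_meas_def)

text \<open>The mean of \<open>N A\<close> is the integral of the coordinate with index
  \<open>A\<close> under the law of the random measure, and by stationarity this law does not change
  under translation.\<close>

lemma mean_meas_shift: "distr mean_meas borel (\<lambda>x. x + t) = mean_meas"
proof (rule measure_eqI)
  fix A assume "A \<in> sets (distr mean_meas borel (\<lambda>x. x + t))"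
  then have A[measurable]: "A \<in> sets borel" by simp
  let ?N' = "\<lambda>\<omega>. distr (N \<omega>) borel (\<lambda>x. x + t)"
  have pre: "(\<lambda>x. x + t) -` B \<in> sets borel" if "B \<in> sets borel" for B :: "real set"
    using measurable_sets[of "\<lambda>x. x + t" borel borel B] that by simp
  have law: "(\<integral>\<^sup>+x. x A \<partial>random_measure_law M R) = (\<integral>\<^sup>+\<omega>. emeasure (R \<omega>) A \<partial>M)"
    if R: "\<And>A. A \<in> sets borel \<Longrightarrow> (\<lambda>\<omega>. emeasure (R \<omega>) A) \<in> borel_measurable M" for R
  proof -
    have [measurable]: "(\<lambda>\<omega>. \<lambda>A\<in>sets borel. emeasure (R \<omega>) A) \<in> M \<rightarrow>\<^sub>M PiM (sets borel) (\<lambda>_. borel)"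
      by (rule measurable_restrict) (rule R)
    have "(\<integral>\<^sup>+x. x A \<partial>random_measure_law M R) = (\<integral>\<^sup>+\<omega>. (\<lambda>A\<in>sets borel. emeasure (R \<omega>) A) A \<partial>M)"
      unfolding random_measure_law_def by (rule nn_integral_distr) (use A in measurable)
    then show ?thesis using A by simp
  qed
  have e: "emeasure (?N' \<omega>) B = emeasure (N \<omega>) ((\<lambda>x. x + t) -` B)" if "B \<in> sets borel" "\<omega> \<in> space M" for B \<omega>
  proof -
    note [measurable_cong] = sets_N[OF that(2)]
    show ?thesis using that sets_eq_imp_space_eq[OF sets_N[OF that(2)]] by (subst emeasure_distr) auto
  qed
  have mB: "(\<lambda>\<omega>. emeasure (?N' \<omega>) B) \<in> borel_measurable M" if B: "B \<in> sets borel" for B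
  proof -
    show ?thesis using pre[OF B] e[OF B] N.mK by (subst measurable_cong) auto
  qed
  have "emeasure (distr mean_meas borel (\<lambda>x. x + t)) A = emeasure mean_meas ((\<lambda>x. x + t) -` A)"
    by (subst emeasure_distr) (auto simp: mean_meas_def)
  also have "\<dots> = (\<integral>\<^sup>+\<omega>. emeasure (N \<omega>) ((\<lambda>x. x + t) -` A) \<partial>M)" by (rule mean_meas_emeasure[OF pre[OF A]])
  also have "\<dots> = (\<integral>\<^sup>+\<omega>. emeasure (?N' \<omega>) A \<partial>M)" by (intro nn_integral_cong) (simp add: e)
  also have "\<dots> = (\<integral>\<^sup>+x. x A \<partial>random_measure_law M ?N')" by (rule law[symmetric, OF mB])
  also have "\<dots> = (\<integral>\<^sup>+x. x A \<partial>random_measure_law M N)" using stat by (simp add: stationary_process_def)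
  also have "\<dots> = emeasure mean_meas A" by (simp add: law[OF N.mK] mean_meas_emeasure)
  finally show "emeasure (distr mean_meas borel (\<lambda>x. x + t)) A = emeasure mean_meas A" .
qed (simp add: mean_meas_def)

lemma mean_meas_nn_shift: "q \<in> borel_measurable borel \<Longrightarrow> (\<integral>\<^sup>+x. q (x + t) \<partial>mean_meas) = (\<integral>\<^sup>+x. q x \<partial>mean_meas)"
  by (subst (2) mean_meas_shift[of t, symmetric]) (simp add: nn_integral_distr)

lemma mean_meas_sigma_finite: "sigma_finite_measure mean_meas"
proof
  have "emeasure mean_meas {real_of_int k<..real_of_int k + 1} < \<infinity>" for k
  proof -
    have "emeasure mean_meas {real_of_int k<..real_of_int k + 1} = (\<integral>\<^sup>+x. indicator {0<..1} (x + - real_of_int k) \<partial>mean_meas)"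
    proof -
      have "(\<integral>\<^sup>+x. indicator {0<..1} (x + - real_of_int k) \<partial>mean_meas) = (\<integral>\<^sup>+x. indicator {real_of_int k<..real_of_int k + 1} x \<partial>mean_meas)"
        by (intro nn_integral_cong) (auto simp: indicator_def)
      then show ?thesis by (simp add: sets_mean_meas)
    qed
    also have "\<dots> = emeasure mean_meas {0<..1}" by (subst mean_meas_nn_shift) (auto simp: mean_meas_def)
    also have "\<dots> < \<infinity>" using fin1 by (simp add: mean_meas_emeasure)
    finally show ?thesis .
  qed
  then show "\<exists>A. countable A \<and> A \<subseteq> sets mean_meas \<and> \<Union> A = space mean_meas \<and> (\<forall>a\<in>A. emeasure mean_meas a \<noteq> \<infinity>)"
  proof (intro exI[of _ "range (\<lambda>k::int. {real_of_int k<..real_of_int k + 1})"] conjI)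
    show "\<Union> (range (\<lambda>k::int. {real_of_int k<..real_of_int k + 1})) = space mean_meas"
    proof (auto simp: mean_meas_def)
      fix x :: real
      show "\<exists>k::int. real_of_int k < x \<and> x \<le> real_of_int k + 1"
        by (rule exI[of _ "\<lceil>x\<rceil> - 1"]) (simp, linarith)
    qed
  qed (auto simp: mean_meas_def less_top)
qed

definition "rate = emeasure mean_meas {0<..1}"

text \<open>Uniqueness of translation invariant measures: the indicator of \<open>A\<close> at
  \<open>x\<close> times that of \<open>{0<..1}\<close> at \<open>x + y\<close> is integrated over
  \<open>x\<close> and \<open>y\<close> in both orders, and each order uses the invariance of one of
  the two measures.\<close>

lemma mean_meas_lborel: "A \<in> sets borel \<Longrightarrow> emeasure mean_meas A = rate * emeasure lborel A"
proof -
  assume A[measurable]: "A \<in> sets borel"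
  interpret mean_meas: sigma_finite_measure mean_meas by (rule mean_meas_sigma_finite)
  interpret P: pair_sigma_finite mean_meas lborel ..
  let ?B = "{0<..1::real}"
  have lb: "(\<integral>\<^sup>+y. indicator S (c + y) \<partial>lborel) = emeasure lborel S" if [measurable]: "S \<in> sets borel" for S and c :: real
    using nn_integral_real_affine[of "indicator S" 1 c] by simp
  have "emeasure mean_meas A = (\<integral>\<^sup>+x. indicator A x * (\<integral>\<^sup>+y. indicator ?B (x + y) \<partial>lborel) \<partial>mean_meas)"
    by (subst lb) (auto simp: mean_meas_def)
  also have "\<dots> = (\<integral>\<^sup>+x. (\<integral>\<^sup>+y. indicator A x * indicator ?B (x + y) \<partial>lborel) \<partial>mean_meas)"
    by (intro nn_integral_cong nn_integral_cmult[symmetric]) measurable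
  also have "\<dots> = (\<integral>\<^sup>+y. (\<integral>\<^sup>+x. indicator A x * indicator ?B (x + y) \<partial>mean_meas) \<partial>lborel)"
    by (rule P.Fubini'[symmetric]) measurable
  also have "\<dots> = (\<integral>\<^sup>+y. (\<integral>\<^sup>+x. indicator A (x + - y) * indicator ?B x \<partial>mean_meas) \<partial>lborel)"
  proof (rule nn_integral_cong)
    fix y :: real
    show "(\<integral>\<^sup>+x. indicator A x * indicator ?B (x + y) \<partial>mean_meas) = (\<integral>\<^sup>+x. indicator A (x + - y) * indicator ?B x \<partial>mean_meas)"
      using mean_meas_nn_shift[of "\<lambda>x. indicator A (x + - y) * indicator ?B x" y] by simp
  qed
  also have "\<dots> = (\<integral>\<^sup>+x. (\<integral>\<^sup>+y. indicator A (x + - y) * indicator ?B x \<partial>lborel) \<partial>mean_meas)"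
    by (rule P.Fubini') measurable
  also have "\<dots> = (\<integral>\<^sup>+x. emeasure lborel A * indicator ?B x \<partial>mean_meas)"
  proof (rule nn_integral_cong)
    fix x :: real
    have "(\<integral>\<^sup>+y. indicator A (x + - y) \<partial>lborel) = emeasure lborel A"
      using nn_integral_real_affine[of "indicator A" "-1" x] by simp
    then show "(\<integral>\<^sup>+y. indicator A (x + - y) * indicator ?B x \<partial>lborel) = emeasure lborel A * indicator ?B x"
      by (subst nn_integral_multc) auto
  qed
  also have "\<dots> = emeasure lborel A * rate" by (subst nn_integral_cmult) (auto simp: rate_def mean_meas_def)
  finally show ?thesis by (simp add: mult.commute)
qed

lemma mean_meas_eq: "mean_meas = density lborel (\<lambda>_. rate)"
  by (rule measure_eqI) (auto simp: mean_meas_def[THEN arg_cong[of _ _ sets]] mean_meas_lborel emeasure_density nn_integral_cmult)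

lemma campbell_rate:
  assumes q: "q \<in> borel_measurable borel"
  shows "(\<integral>\<^sup>+\<omega>. (\<integral>\<^sup>+x. q x \<partial>N \<omega>) \<partial>M) = rate * (\<integral>\<^sup>+x. q x \<partial>lborel)"
proof -
  have "(\<integral>\<^sup>+\<omega>. (\<integral>\<^sup>+x. q x \<partial>N \<omega>) \<partial>M) = (\<integral>\<^sup>+x. q x \<partial>mean_meas)" unfolding mean_meas_def by (subst N.nn_integral_mixmeas[OF _ q]) auto
  also have "\<dots> = rate * (\<integral>\<^sup>+x. q x \<partial>lborel)" unfolding mean_meas_eq using q by (simp add: nn_integral_density nn_integral_cmult)
  finally show ?thesis .
qed

lemma E_lam_rate: "(\<integral>\<^sup>+\<omega>. lam t \<omega> \<partial>M) = ennreal \<nu> + rate * ennreal \<mu>"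
proof -
  have [measurable]: "(\<lambda>s. ennreal (hp (t - s))) \<in> borel_measurable borel" by measurable
  have "(\<integral>\<^sup>+s. ennreal (hp (t - s)) \<partial>lborel) = ennreal \<mu>"
    using nn_integral_real_affine[of "\<lambda>s. ennreal (hp s)" "-1" t] by (simp add: nn_hp)
  then show ?thesis unfolding lam_eq
    by (subst nn_integral_add) (auto simp: campbell_rate emeasure_space_1 intro!: N.mq)
qed

lemma nn_lam_swap:
  assumes [measurable]: "q \<in> borel_measurable borel"
  shows "(\<integral>\<^sup>+\<omega>. (\<integral>\<^sup>+t. q t * lam t \<omega> \<partial>lborel) \<partial>M) = (\<integral>\<^sup>+t. q t * (\<integral>\<^sup>+\<omega>. lam t \<omega> \<partial>M) \<partial>lborel)"
proof -
  interpret P: pair_sigma_finite lborel M ..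
  have [measurable]: "(\<lambda>\<omega>. lam t \<omega>) \<in> borel_measurable M" for t
    using measurable_compose[OF measurable_Pair1' lam_meas, of t] by simp
  have "(\<integral>\<^sup>+\<omega>. (\<integral>\<^sup>+t. q t * lam t \<omega> \<partial>lborel) \<partial>M) = (\<integral>\<^sup>+t. (\<integral>\<^sup>+\<omega>. q t * lam t \<omega> \<partial>M) \<partial>lborel)"
    by (rule P.Fubini') (use lam_meas in measurable)
  also have "\<dots> = (\<integral>\<^sup>+t. q t * (\<integral>\<^sup>+\<omega>. lam t \<omega> \<partial>M) \<partial>lborel)"
    by (intro nn_integral_cong nn_integral_cmult) measurable
  finally show ?thesis .
qed

text \<open>The intensity property over the unit interval gives
  \<open>rate = \<nu> + rate * \<mu>\<close>. In the extended half-line \<infinity> can solve this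
  as well; the assumption of a finite mean excludes it.\<close>

lemma rate_eq: "rate = ennreal (\<nu> / (1 - \<mu>))"
proof -
  have f: "rate < \<infinity>" using fin1 by (simp add: rate_def mean_meas_emeasure)
  have "rate = (\<integral>\<^sup>+\<omega>. 1 * emeasure (N \<omega>) {0<..1} \<partial>M)" by (simp add: rate_def mean_meas_emeasure)
  also have "\<dots> = (\<integral>\<^sup>+\<omega>. 1 * (\<integral>\<^sup>+t. lam t \<omega> * indicator {0<..1} t \<partial>lborel) \<partial>M)"
    by (rule intensity_Ioc) auto
  also have "\<dots> = (\<integral>\<^sup>+t. indicator {0<..1::real} t * (ennreal \<nu> + rate * ennreal \<mu>) \<partial>lborel)"
    using nn_lam_swap[of "indicator {0<..1}"] by (simp add: E_lam_rate mult.commute)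
  also have "\<dots> = ennreal \<nu> + rate * ennreal \<mu>" by (subst nn_integral_multc) auto
  finally have e: "rate = ennreal \<nu> + rate * ennreal \<mu>" .
  obtain r where r: "r \<ge> 0" "rate = ennreal r" using f by (cases rate) auto
  then have "ennreal r = ennreal (\<nu> + r * \<mu>)" using e mu0 nu by (simp add: ennreal_mult)
  then have "r = \<nu> + r * \<mu>" using r mu0 nu by (subst (asm) ennreal_inj) auto
  then have "r = \<nu> / (1 - \<mu>)" using mu1 by (simp add: field_simps)
  then show ?thesis using r by simp
qed

definition "mean_rate = \<nu> / (1 - \<mu>)"

lemma mean_rate_pos: "mean_rate > 0" using nu mu1 by (simp add: mean_rate_def)

lemma campbell: "q \<in> borel_measurable borel \<Longrightarrow> (\<integral>\<^sup>+\<omega>. (\<integral>\<^sup>+x. q x \<partial>N \<omega>) \<partial>M) = ennreal mean_rate * (\<integral>\<^sup>+x. q x \<partial>lborel)"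
  by (simp add: campbell_rate rate_eq mean_rate_def)

lemma E_lam: "(\<integral>\<^sup>+\<omega>. lam t \<omega> \<partial>M) = ennreal mean_rate"
proof -
  have "\<nu> + mean_rate * \<mu> = mean_rate" using mu1 by (simp add: mean_rate_def field_simps)
  then show ?thesis unfolding E_lam_rate rate_eq mean_rate_def[symmetric]
    using nu mu0 mean_rate_pos by (simp add: ennreal_mult[symmetric] ennreal_plus[symmetric] del: ennreal_plus)
qed

lemma E_lam_q: "q \<in> borel_measurable borel \<Longrightarrow> (\<integral>\<^sup>+\<omega>. (\<integral>\<^sup>+t. q t * lam t \<omega> \<partial>lborel) \<partial>M) = ennreal mean_rate * (\<integral>\<^sup>+x. q x \<partial>lborel)"
  by (simp add: nn_lam_swap E_lam nn_integral_multc mult.commute)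

end

subsection \<open>Martingale increments\<close>

lemma complex_integral_split:
  fixes f :: "'b \<Rightarrow> complex"
  shows "(\<integral>x. f x \<partial>M) = (if integrable M (\<lambda>x. Re (f x)) \<and> integrable M (\<lambda>x. Im (f x))
    then Complex (\<integral>x. Re (f x) \<partial>M) (\<integral>x. Im (f x) \<partial>M) else 0)"
proof (cases "integrable M f")
  case True
  then have "integrable M (\<lambda>x. Re (f x))" "integrable M (\<lambda>x. Im (f x))" by auto
  then show ?thesis using True by (simp add: complex_eq_iff)
next
  case False
  have "\<not> (integrable M (\<lambda>x. Re (f x)) \<and> integrable M (\<lambda>x. Im (f x)))"
  proof
    assume a: "integrable M (\<lambda>x. Re (f x)) \<and> integrable M (\<lambda>x. Im (f x))"
    then have "integrable M (\<lambda>x. of_real (Re (f x)) + \<i> * of_real (Im (f x)))"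
      by (intro Bochner_Integration.integrable_add integrable_mult_right integrable_of_real) auto
    also have "(\<lambda>x. of_real (Re (f x)) + \<i> * of_real (Im (f x))) = f" by (auto simp: complex_eq_iff)
    finally show False using False by simp
  qed
  then show ?thesis by (subst not_integrable_integral_eq[OF False]) auto
qed

lemma real_integral_split:
  fixes f :: "'b \<Rightarrow> real"
  assumes "f \<in> borel_measurable M"
  shows "(integrable M f) \<longleftrightarrow> (\<integral>\<^sup>+x. ennreal (f x) \<partial>M) < \<infinity> \<and> (\<integral>\<^sup>+x. ennreal (- f x) \<partial>M) < \<infinity>"
    "(\<integral>x. f x \<partial>M) = (if (\<integral>\<^sup>+x. ennreal (f x) \<partial>M) < \<infinity> \<and> (\<integral>\<^sup>+x. ennreal (- f x) \<partial>M) < \<infinity>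
      then enn2real (\<integral>\<^sup>+x. ennreal (f x) \<partial>M) - enn2real (\<integral>\<^sup>+x. ennreal (- f x) \<partial>M) else 0)"
proof -
  show i: "(integrable M f) \<longleftrightarrow> (\<integral>\<^sup>+x. ennreal (f x) \<partial>M) < \<infinity> \<and> (\<integral>\<^sup>+x. ennreal (- f x) \<partial>M) < \<infinity>"
    using assms by (auto simp: real_integrable_def less_top)
  show "(\<integral>x. f x \<partial>M) = (if (\<integral>\<^sup>+x. ennreal (f x) \<partial>M) < \<infinity> \<and> (\<integral>\<^sup>+x. ennreal (- f x) \<partial>M) < \<infinity>
      then enn2real (\<integral>\<^sup>+x. ennreal (f x) \<partial>M) - enn2real (\<integral>\<^sup>+x. ennreal (- f x) \<partial>M) else 0)"
    using i by (auto simp: real_lebesgue_integral_def not_integrable_integral_eq)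
qed

text \<open>Measurability is needed on the whole space, also at those points where the integral does
  not exist and is 0 by convention. The integral is therefore written as a case distinction on
  measurable events, between combinations of integrals of positive parts and the default
  value.\<close>

lemma random_integral_measurable:
  fixes f :: "real \<Rightarrow> complex"
  assumes sK: "\<And>\<omega>. \<omega> \<in> space G \<Longrightarrow> sets (K \<omega>) = sets borel" and S[measurable]: "S \<in> sets borel"
    and mK: "\<And>A. A \<in> sets borel \<Longrightarrow> A \<subseteq> S \<Longrightarrow> (\<lambda>\<omega>. emeasure (K \<omega>) A) \<in> borel_measurable G"
    and f[measurable]: "f \<in> borel_measurable borel"
  shows "(\<lambda>\<omega>. \<integral>x. indicator S x * f x \<partial>K \<omega>) \<in> borel_measurable G"
proof -
  have nn: "(\<lambda>\<omega>. \<integral>\<^sup>+x. ennreal (indicator S x * g x) \<partial>K \<omega>) \<in> borel_measurable G"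
    if g: "g \<in> borel_measurable borel" for g :: "real \<Rightarrow> real"
  proof -
    have "(\<lambda>\<omega>. \<integral>\<^sup>+x. ennreal (g x) * indicator S x \<partial>K \<omega>) \<in> borel_measurable G"
      by (rule nn_integral_random_measurable[OF sK S mK]) (use g in auto)
    also have "(\<lambda>x. ennreal (g x) * indicator S x) = (\<lambda>x. ennreal (indicator S x * g x))" by (auto simp: indicator_def)
    finally show ?thesis .
  qed
  define P where "P g \<omega> = (\<integral>\<^sup>+x. ennreal (indicator S x * g x) \<partial>K \<omega>)" for g :: "real \<Rightarrow> real" and \<omega>
  have [measurable]: "P g \<in> borel_measurable G" if "g \<in> borel_measurable borel" for g unfolding P_def using nn[OF that] .
  define B where "B g \<omega> \<longleftrightarrow> P g \<omega> < \<infinity> \<and> P (\<lambda>x. - g x) \<omega> < \<infinity>" for g \<omega>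
  have [measurable]: "Measurable.pred G (B g)" if [measurable]: "g \<in> borel_measurable borel" for g unfolding B_def[abs_def] by measurable
  have r: "integrable (K \<omega>) (\<lambda>x. indicator S x * g x) \<longleftrightarrow> B g \<omega>"
    "(\<integral>x. indicator S x * g x \<partial>K \<omega>) = (if B g \<omega> then enn2real (P g \<omega>) - enn2real (P (\<lambda>x. - g x) \<omega>) else 0)"
    if w: "\<omega> \<in> space G" and [measurable]: "g \<in> borel_measurable borel" for g :: "real \<Rightarrow> real" and \<omega>
  proof -
    note [measurable_cong] = sK[OF w]
    have m: "(\<lambda>x. indicator S x * g x) \<in> borel_measurable (K \<omega>)" by measurable
    show "integrable (K \<omega>) (\<lambda>x. indicator S x * g x) \<longleftrightarrow> B g \<omega>"
      unfolding real_integral_split(1)[OF m] B_def P_def by simp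
    show "(\<integral>x. indicator S x * g x \<partial>K \<omega>) = (if B g \<omega> then enn2real (P g \<omega>) - enn2real (P (\<lambda>x. - g x) \<omega>) else 0)"
      unfolding real_integral_split(2)[OF m] B_def P_def by simp
  qed
  let ?R = "\<lambda>x. Re (f x)" and ?I = "\<lambda>x. Im (f x)"
  have "(\<lambda>\<omega>. \<integral>x. indicator S x * f x \<partial>K \<omega>) \<in> borel_measurable G \<longleftrightarrow>
    (\<lambda>\<omega>. if B ?R \<omega> \<and> B ?I \<omega> then Complex (enn2real (P ?R \<omega>) - enn2real (P (\<lambda>x. - ?R x) \<omega>)) (enn2real (P ?I \<omega>) - enn2real (P (\<lambda>x. - ?I x) \<omega>)) else 0) \<in> borel_measurable G"
  proof (rule measurable_cong)
    fix \<omega> assume w: "\<omega> \<in> space G"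
    have e: "Re (indicator S x * f x) = indicator S x * Re (f x)" "Im (indicator S x * f x) = indicator S x * Im (f x)" for x
      by (auto simp: indicator_def)
    have [measurable]: "?R \<in> borel_measurable borel" "?I \<in> borel_measurable borel" by measurable
    show "(\<integral>x. indicator S x * f x \<partial>K \<omega>) = (if B ?R \<omega> \<and> B ?I \<omega> then Complex (enn2real (P ?R \<omega>) - enn2real (P (\<lambda>x. - ?R x) \<omega>)) (enn2real (P ?I \<omega>) - enn2real (P (\<lambda>x. - ?I x) \<omega>)) else 0)"
      unfolding complex_integral_split[of "K \<omega>" "\<lambda>x. indicator S x * f x"] e by (simp add: r[OF w])
  qed
  also have "\<dots>" unfolding Complex_eq by measurable
  finally show ?thesis .
qed

context hawkes
begin

text \<open>The measures \<open>K1\<close> and \<open>K2\<close> are the points and the intensity,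
  both restricted to \<open>{a<..b}\<close>. Their \<xi>-weighted means agree on half-open
  intervals, which are stable under intersection and generate the Borel sets. The bound on \<xi>
  makes the means finite on bounded intervals, as uniqueness of measures requires.\<close>

lemma intensity_q:
  assumes xi: "\<xi> \<in> borel_measurable (FN a)" and C: "\<And>\<omega>. \<xi> \<omega> \<le> ennreal C" and q[measurable]: "q \<in> borel_measurable borel"
  shows "(\<integral>\<^sup>+\<omega>. \<xi> \<omega> * (\<integral>\<^sup>+t. q t * indicator {a<..b} t \<partial>N \<omega>) \<partial>M) =
    (\<integral>\<^sup>+\<omega>. \<xi> \<omega> * (\<integral>\<^sup>+t. q t * lam t \<omega> * indicator {a<..b} t \<partial>lborel) \<partial>M)"
proof -
  define K1 where "K1 \<omega> = density (N \<omega>) (indicator {a<..b})" for \<omega>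
  define K2 where "K2 \<omega> = density lborel (\<lambda>t. lam t \<omega> * indicator {a<..b} t)" for \<omega>
  note xiM = FN_meas_M[OF xi]
  have e1: "emeasure (K1 \<omega>) A = emeasure (N \<omega>) (A \<inter> {a<..b})" if "\<omega> \<in> space M" "A \<in> sets borel" for \<omega> A
  proof -
    note [measurable_cong] = sets_N[OF that(1)] and [measurable] = that(2)
    have "emeasure (K1 \<omega>) A = (\<integral>\<^sup>+x. indicator {a<..b} x * indicator A x \<partial>N \<omega>)"
      unfolding K1_def by (subst emeasure_density) auto
    also have "\<dots> = (\<integral>\<^sup>+x. indicator (A \<inter> {a<..b}) x \<partial>N \<omega>)" by (intro nn_integral_cong) (auto simp: indicator_def)
    also have "\<dots> = emeasure (N \<omega>) (A \<inter> {a<..b})" by (rule nn_integral_indicator) measurable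
    finally show ?thesis .
  qed
  have e2: "emeasure (K2 \<omega>) A = (\<integral>\<^sup>+t. lam t \<omega> * indicator (A \<inter> {a<..b}) t \<partial>lborel)" if "\<omega> \<in> space M" "A \<in> sets borel" for \<omega> A
  proof -
    have "emeasure (K2 \<omega>) A = (\<integral>\<^sup>+t. lam t \<omega> * indicator {a<..b} t * indicator A t \<partial>lborel)"
      unfolding K2_def using lam_meas1[OF that(1)] that(2) by (subst emeasure_density) auto
    then show ?thesis by (simp add: indicator_inter_arith mult_ac)
  qed
  have lm: "(\<lambda>(\<omega>, t). lam t \<omega>) \<in> borel_measurable (M \<Otimes>\<^sub>M lborel)"
    using measurable_compose[OF measurable_pair_swap' lam_meas] by (simp add: case_prod_beta' cong: measurable_cong_sets)
  interpret K1: random_meas M K1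
  proof
    show "sets (K1 \<omega>) = sets borel" if "\<omega> \<in> space M" for \<omega> using sets_N[OF that] by (simp add: K1_def)
    show "(\<lambda>\<omega>. emeasure (K1 \<omega>) A) \<in> borel_measurable M" if "A \<in> sets borel" for A
      using e1 that N.mK[of "A \<inter> {a<..b}"] by (subst measurable_cong) auto
  qed
  interpret K2: random_meas M K2
  proof
    show "sets (K2 \<omega>) = sets borel" if "\<omega> \<in> space M" for \<omega> by (simp add: K2_def)
    show "(\<lambda>\<omega>. emeasure (K2 \<omega>) A) \<in> borel_measurable M" if A[measurable]: "A \<in> sets borel" for A
    proof -
      have "(\<lambda>(\<omega>, t). lam t \<omega> * indicator (A \<inter> {a<..b}) t) \<in> borel_measurable (M \<Otimes>\<^sub>M lborel)"
        using lm by (simp add: case_prod_beta') 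
      from lborel.borel_measurable_nn_integral[OF this] show ?thesis using e2 A by (subst measurable_cong) auto
    qed
  qed
  have "mixmeas M \<xi> K1 = mixmeas M \<xi> K2"
  proof (rule measure_eqI_generator_eq[where E="range (\<lambda>(c, d). {c<..d::real})" and \<Omega>=UNIV and A="\<lambda>i::nat. {- real i<..real i}"])
    show "Int_stable (range (\<lambda>(c, d). {c<..d::real}))"
      by (auto simp: Int_stable_def image_iff)
    show "sets (mixmeas M \<xi> K1) = sigma_sets UNIV (range (\<lambda>(c, d). {c<..d::real}))" "sets (mixmeas M \<xi> K2) = sigma_sets UNIV (range (\<lambda>(c, d). {c<..d::real}))"
      by (simp_all add: borel_sigma_sets_Ioc)
    show "(\<Union>i::nat. {- real i<..real i}) = UNIV"
    proof (auto)
      fix x :: real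
      obtain k :: nat where "\<bar>x\<bar> < real k" using reals_Archimedean2 by blast
      then show "\<exists>k::nat. - real k < x \<and> x \<le> real k" by (intro exI[of _ k]) auto
    qed
    show "emeasure (mixmeas M \<xi> K1) {- real i<..real i} \<noteq> \<infinity>" for i
    proof -
      have "emeasure (mixmeas M \<xi> K1) {- real i<..real i} = (\<integral>\<^sup>+\<omega>. \<xi> \<omega> * emeasure (N \<omega>) ({- real i<..real i} \<inter> {a<..b}) \<partial>M)"
        by (subst K1.emeasure_mixmeas[OF xiM]) (auto simp: e1 intro!: nn_integral_cong)
      also have "\<dots> \<le> (\<integral>\<^sup>+\<omega>. ennreal C * (\<integral>\<^sup>+x. indicator {a<..b} x \<partial>N \<omega>) \<partial>M)"
        using C by (intro nn_integral_mono mult_mono) (auto simp: sets_N intro!: emeasure_mono)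
      also have "\<dots> = ennreal C * (ennreal mean_rate * emeasure lborel {a<..b})"
        using N.mq[of "indicator {a<..b}"] campbell[of "indicator {a<..b}"] by (simp add: nn_integral_cmult)
      also have "\<dots> < \<infinity>" by (cases "a \<le> b") (auto simp: ennreal_mult_less_top)
      finally show ?thesis by simp
    qed
    fix X assume "X \<in> range (\<lambda>(c, d). {c<..d::real})"
    then obtain c d where X: "X = {c<..d}" by auto
    show "emeasure (mixmeas M \<xi> K1) X = emeasure (mixmeas M \<xi> K2) X"
    proof -
      have 1: "emeasure (mixmeas M \<xi> K1) X = (\<integral>\<^sup>+\<omega>. \<xi> \<omega> * emeasure (N \<omega>) {max c a<..min d b} \<partial>M)"
        by (subst K1.emeasure_mixmeas[OF xiM]) (auto simp: e1 X Int_greaterThanAtMost intro!: nn_integral_cong)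
      have 2: "emeasure (mixmeas M \<xi> K2) X = (\<integral>\<^sup>+\<omega>. \<xi> \<omega> * (\<integral>\<^sup>+t. lam t \<omega> * indicator {max c a<..min d b} t \<partial>lborel) \<partial>M)"
        by (subst K2.emeasure_mixmeas[OF xiM]) (auto simp: e2 X Int_greaterThanAtMost intro!: nn_integral_cong)
      show ?thesis
      proof (cases "max c a < min d b")
        case True
        \<comment> \<open>The weight is known at time \<open>a\<close>, hence also at the later left
          endpoint \<open>max c a\<close>.\<close>
        show ?thesis unfolding 1 2 by (rule intensity_Ioc[OF True FN_meas_mono[OF _ xi]]) simp
      next
        case False
        then have e: "{max c a<..min d b} = {}" by auto
        show ?thesis unfolding 1 2 e by simp
      qed
    qed
  qed auto
  then have "(\<integral>\<^sup>+x. q x \<partial>mixmeas M \<xi> K1) = (\<integral>\<^sup>+x. q x \<partial>mixmeas M \<xi> K2)" by simp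
  then have "(\<integral>\<^sup>+\<omega>. \<xi> \<omega> * (\<integral>\<^sup>+x. q x \<partial>K1 \<omega>) \<partial>M) = (\<integral>\<^sup>+\<omega>. \<xi> \<omega> * (\<integral>\<^sup>+x. q x \<partial>K2 \<omega>) \<partial>M)"
    by (simp add: K1.nn_integral_mixmeas[OF xiM q] K2.nn_integral_mixmeas[OF xiM q])
  moreover have "(\<integral>\<^sup>+\<omega>. \<xi> \<omega> * (\<integral>\<^sup>+x. q x \<partial>K1 \<omega>) \<partial>M) = (\<integral>\<^sup>+\<omega>. \<xi> \<omega> * (\<integral>\<^sup>+t. q t * indicator {a<..b} t \<partial>N \<omega>) \<partial>M)"
  proof (intro nn_integral_cong arg_cong2[of _ _ _ _ "(*)"] refl)
    fix \<omega> assume w: "\<omega> \<in> space M"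
    note [measurable_cong] = sets_N[OF w]
    show "(\<integral>\<^sup>+x. q x \<partial>K1 \<omega>) = (\<integral>\<^sup>+t. q t * indicator {a<..b} t \<partial>N \<omega>)"
      unfolding K1_def by (subst nn_integral_density) (auto simp: mult.commute)
  qed
  moreover have "(\<integral>\<^sup>+\<omega>. \<xi> \<omega> * (\<integral>\<^sup>+x. q x \<partial>K2 \<omega>) \<partial>M) = (\<integral>\<^sup>+\<omega>. \<xi> \<omega> * (\<integral>\<^sup>+t. q t * lam t \<omega> * indicator {a<..b} t \<partial>lborel) \<partial>M)"
  proof (intro nn_integral_cong arg_cong2[of _ _ _ _ "(*)"] refl)
    fix \<omega> assume w: "\<omega> \<in> space M"
    show "(\<integral>\<^sup>+x. q x \<partial>K2 \<omega>) = (\<integral>\<^sup>+t. q t * lam t \<omega> * indicator {a<..b} t \<partial>lborel)"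
      unfolding K2_def using lam_meas1[OF w] by (subst nn_integral_density) (auto simp: mult_ac)
  qed
  ultimately show ?thesis by simp
qed

definition "lam_real t \<omega> = enn2real (lam t \<omega>)"

lemma lam_real_meas1[measurable]: "\<omega> \<in> space M \<Longrightarrow> (\<lambda>t. lam_real t \<omega>) \<in> borel_measurable borel"
  unfolding lam_real_def using lam_meas1 by measurable

lemma lam_real_nonneg: "lam_real t \<omega> \<ge> 0" by (simp add: lam_real_def)

lemma lam_real_meas_swap: "(\<lambda>(\<omega>, t). lam_real t \<omega>) \<in> borel_measurable (M \<Otimes>\<^sub>M lborel)"
  using measurable_compose[OF measurable_pair_swap' lam_meas] unfolding lam_real_def by (simp add: case_prod_beta' cong: measurable_cong_sets)

text \<open>The exceptional paths are removed once and for all here. On the remaining ones both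
  pathwise integrals converge absolutely, so linearity and Fubini hold without default
  values.\<close>

definition path_integrable :: "(real \<Rightarrow> complex) \<Rightarrow> 'a \<Rightarrow> bool" where
  "path_integrable q \<omega> \<longleftrightarrow> \<omega> \<in> space M \<and> (\<integral>\<^sup>+t. ennreal (norm (q t)) \<partial>N \<omega>) < \<infinity> \<and> (\<integral>\<^sup>+t. ennreal (norm (q t)) * lam t \<omega> \<partial>lborel) < \<infinity>"

lemma lam_q_meas: "q \<in> borel_measurable borel \<Longrightarrow> (\<lambda>\<omega>. \<integral>\<^sup>+t. q t * lam t \<omega> \<partial>lborel) \<in> borel_measurable M"
proof -
  assume [measurable]: "q \<in> borel_measurable borel"
  have "(\<lambda>(\<omega>, t). lam t \<omega>) \<in> borel_measurable (M \<Otimes>\<^sub>M lborel)"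
    using measurable_compose[OF measurable_pair_swap' lam_meas] by (simp add: case_prod_beta' cong: measurable_cong_sets)
  then have "(\<lambda>(\<omega>, t). q t * lam t \<omega>) \<in> borel_measurable (M \<Otimes>\<^sub>M lborel)"
    by (simp add: case_prod_beta')
  from lborel.borel_measurable_nn_integral[OF this] show ?thesis .
qed

lemma AE_path_integrable:
  assumes q: "integrable lborel q"
  shows "AE \<omega> in M. path_integrable q \<omega>"
proof -
  have [measurable]: "q \<in> borel_measurable borel" using q by auto
  have f: "(\<integral>\<^sup>+t. ennreal (norm (q t)) \<partial>lborel) < \<infinity>" using q by (auto simp: integrable_iff_bounded)
  have nm: "(\<lambda>t. ennreal (norm (q t))) \<in> borel_measurable borel" by measurable
  have "AE \<omega> in M. (\<integral>\<^sup>+t. ennreal (norm (q t)) \<partial>N \<omega>) \<noteq> \<infinity>"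
    by (rule nn_integral_PInf_AE[OF N.mq[OF nm]]) (use f in \<open>simp add: campbell[OF nm] ennreal_mult_eq_top_iff less_top\<close>)
  moreover have "AE \<omega> in M. (\<integral>\<^sup>+t. ennreal (norm (q t)) * lam t \<omega> \<partial>lborel) \<noteq> \<infinity>"
    by (rule nn_integral_PInf_AE[OF lam_q_meas[OF nm]]) (use f in \<open>simp add: E_lam_q[OF nm] ennreal_mult_eq_top_iff less_top\<close>)
  ultimately show ?thesis using AE_space by eventually_elim (auto simp: path_integrable_def less_top)
qed

lemma path_integrable_N_int:
  assumes g: "path_integrable q \<omega>" and [measurable]: "q \<in> borel_measurable borel"
  shows "integrable (N \<omega>) q"
proof -
  have w: "\<omega> \<in> space M" using g by (simp add: path_integrable_def)
  note [measurable_cong] = sets_N[OF w]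
  show ?thesis using g by (auto simp: path_integrable_def integrable_iff_bounded)
qed

lemma path_integrable_AE_fin:
  assumes g: "path_integrable q \<omega>" and [measurable]: "q \<in> borel_measurable borel"
  shows "AE t in lborel. q t = 0 \<or> lam t \<omega> < \<infinity>"
proof -
  have w: "\<omega> \<in> space M" using g by (simp add: path_integrable_def)
  note [measurable] = lam_meas1[OF w]
  have "AE t in lborel. ennreal (norm (q t)) * lam t \<omega> \<noteq> \<infinity>"
    by (rule nn_integral_PInf_AE) (use g in \<open>auto simp: path_integrable_def\<close>)
  then show ?thesis by eventually_elim (auto simp: ennreal_mult_eq_top_iff less_top)
qed

lemma path_integrable_lam_real_eq:
  assumes g: "path_integrable q \<omega>" and q[measurable]: "q \<in> borel_measurable borel"
  shows "AE t in lborel. ennreal (norm (q t * of_real (lam_real t \<omega>))) = ennreal (norm (q t)) * lam t \<omega>"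
  using path_integrable_AE_fin[OF assms] by eventually_elim (auto simp: norm_mult lam_real_def ennreal_mult less_top)

lemma path_integrable_lam_real_int:
  assumes g: "path_integrable q \<omega>" and q[measurable]: "q \<in> borel_measurable borel"
  shows "integrable lborel (\<lambda>t. q t * of_real (lam_real t \<omega>))"
proof -
  have w: "\<omega> \<in> space M" using g by (simp add: path_integrable_def)
  note [measurable] = lam_real_meas1[OF w]
  have "(\<integral>\<^sup>+t. ennreal (norm (q t * of_real (lam_real t \<omega>))) \<partial>lborel) = (\<integral>\<^sup>+t. ennreal (norm (q t)) * lam t \<omega> \<partial>lborel)"
    by (rule nn_integral_cong_AE[OF path_integrable_lam_real_eq[OF assms]])
  then show ?thesis using g by (auto simp: integrable_iff_bounded path_integrable_def)
qed

definition intN :: "(real \<Rightarrow> complex) \<Rightarrow> real set \<Rightarrow> 'a \<Rightarrow> complex" where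
  "intN q S \<omega> = (\<integral>t. indicator S t * q t \<partial>N \<omega>)"
definition intL :: "(real \<Rightarrow> complex) \<Rightarrow> real set \<Rightarrow> 'a \<Rightarrow> complex" where
  "intL q S \<omega> = (\<integral>t. indicator S t * (q t * of_real (lam_real t \<omega>)) \<partial>lborel)"

lemma intN_meas:
  assumes "q \<in> borel_measurable borel" "S \<in> sets borel"
  shows "intN q S \<in> borel_measurable M"
  unfolding intN_def[abs_def] by (rule random_integral_measurable) (use assms N.mK sets_N in auto)

lemma intN_meas_FN:
  assumes "q \<in> borel_measurable borel" "S \<in> sets borel" "S \<subseteq> {..t}"
  shows "intN q S \<in> borel_measurable (FN t)"
  unfolding intN_def[abs_def]
  by (rule random_integral_measurable) (use assms FN_meas sets_N space_FN in \<open>auto intro: subset_trans\<close>)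

lemma intL_meas:
  assumes [measurable]: "q \<in> borel_measurable borel" "S \<in> sets borel"
  shows "intL q S \<in> borel_measurable M"
proof -
  have "(\<lambda>(\<omega>, t). indicator S t * (q t * complex_of_real (lam_real t \<omega>))) \<in> borel_measurable (M \<Otimes>\<^sub>M lborel)"
    using lam_real_meas_swap by (simp add: case_prod_beta')
  from lborel.borel_measurable_lebesgue_integral[OF this] show ?thesis unfolding intL_def[abs_def] .
qed

definition path_bound :: "(real \<Rightarrow> complex) \<Rightarrow> 'a \<Rightarrow> real" where
  "path_bound q \<omega> = enn2real (\<integral>\<^sup>+t. ennreal (norm (q t)) \<partial>N \<omega>) + enn2real (\<integral>\<^sup>+t. ennreal (norm (q t)) * lam t \<omega> \<partial>lborel)"

lemma path_bound_int:
  assumes q: "integrable lborel q"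
  shows "integrable M (path_bound q)"
proof -
  have [measurable]: "q \<in> borel_measurable borel" using q by auto
  have nm: "(\<lambda>t. ennreal (norm (q t))) \<in> borel_measurable borel" by measurable
  note [measurable] = N.mq[OF nm] lam_q_meas[OF nm]
  have f: "(\<integral>\<^sup>+t. ennreal (norm (q t)) \<partial>lborel) < \<infinity>" using q by (auto simp: integrable_iff_bounded)
  have i: "integrable M (\<lambda>\<omega>. enn2real (R \<omega>))" if [measurable]: "R \<in> borel_measurable M" and R: "(\<integral>\<^sup>+\<omega>. R \<omega> \<partial>M) < \<infinity>" for R
  proof -
    have "(\<integral>\<^sup>+\<omega>. ennreal (norm (enn2real (R \<omega>))) \<partial>M) \<le> (\<integral>\<^sup>+\<omega>. R \<omega> \<partial>M)"
      by (intro nn_integral_mono) (simp add: ennreal_enn2real_if)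
    then show ?thesis using R by (auto simp: integrable_iff_bounded)
  qed
  show ?thesis unfolding path_bound_def[abs_def]
    using f by (intro Bochner_Integration.integrable_add i) (auto simp: campbell[OF nm] E_lam_q[OF nm] ennreal_mult_less_top)
qed

text \<open>The bound does not depend on the integrand beyond the constant \<open>C\<close>, and
  \<open>path_bound q\<close> has finite expectation. It dominates the Riemann sums of the
  exponential simultaneously for all partitions.\<close>

lemma path_integrable_bounds:
  assumes g: "path_integrable q \<omega>" and q[measurable]: "q \<in> borel_measurable borel" and [measurable]: "S \<in> sets borel"
    and e: "\<And>t. norm (e t) \<le> C" and [measurable]: "e \<in> borel_measurable borel"
  shows "norm ((\<integral>t. indicator S t * (e t * q t) \<partial>N \<omega>) - (\<integral>t. indicator S t * (e t * (q t * of_real (lam_real t \<omega>))) \<partial>lborel)) \<le> C * path_bound q \<omega>"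
proof -
  have w: "\<omega> \<in> space M" using g by (simp add: path_integrable_def)
  have C: "C \<ge> 0" using e[of 0] norm_ge_zero order_trans by blast
  have b: "norm (\<integral>t. indicator S t * (e t * f t) \<partial>L) \<le> C * (\<integral>t. norm (f t) \<partial>L)"
    if f: "integrable L f" and s[measurable_cong]: "sets L = sets borel" for f and L :: "real measure"
  proof -
    have "norm (\<integral>t. indicator S t * (e t * f t) \<partial>L) \<le> (\<integral>t. norm (indicator S t * (e t * f t)) \<partial>L)" by (rule integral_norm_bound)
    also have "\<dots> \<le> (\<integral>t. C * norm (f t) \<partial>L)"
    proof (rule integral_mono')
      show "norm (indicator S t * (e t * f t)) \<le> C * norm (f t)" for t
        using C e[of t] by (auto simp: norm_mult indicator_def intro!: mult_right_mono)
    qed (use f C in auto)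
    finally show ?thesis by simp
  qed
  have 1: "(\<integral>t. norm (q t) \<partial>N \<omega>) = enn2real (\<integral>\<^sup>+t. ennreal (norm (q t)) \<partial>N \<omega>)"
    by (subst integral_eq_nn_integral) (use borel_measurable_integrable[OF path_integrable_N_int[OF g q]] in auto)
  have 2: "(\<integral>t. norm (q t * of_real (lam_real t \<omega>)) \<partial>lborel) = enn2real (\<integral>\<^sup>+t. ennreal (norm (q t)) * lam t \<omega> \<partial>lborel)"
    using nn_integral_cong_AE[OF path_integrable_lam_real_eq[OF g q]] borel_measurable_integrable[OF path_integrable_lam_real_int[OF g q]]
    by (subst integral_eq_nn_integral) auto
  have "norm ((\<integral>t. indicator S t * (e t * q t) \<partial>N \<omega>) - (\<integral>t. indicator S t * (e t * (q t * of_real (lam_real t \<omega>))) \<partial>lborel))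
    \<le> norm (\<integral>t. indicator S t * (e t * q t) \<partial>N \<omega>) + norm (\<integral>t. indicator S t * (e t * (q t * of_real (lam_real t \<omega>))) \<partial>lborel)"
    by (rule norm_triangle_ineq4)
  also have "\<dots> \<le> C * (\<integral>t. norm (q t) \<partial>N \<omega>) + C * (\<integral>t. norm (q t * of_real (lam_real t \<omega>)) \<partial>lborel)"
    by (intro add_mono b path_integrable_N_int[OF g q] path_integrable_lam_real_int[OF g q] sets_N[OF w]) auto
  also have "\<dots> = C * path_bound q \<omega>" unfolding 1 2 path_bound_def by (simp add: algebra_simps)
  finally show ?thesis .
qed


text \<open>For nonnegative data the two means are equal as extended numbers. Boundedness of the
  weight and the finite mean rate make the common value finite, which permits the subtraction and
  the passage to Bochner integrals.\<close>

lemma base_diff: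
  fixes p :: "real \<Rightarrow> real" and x :: "'a \<Rightarrow> real"
  assumes p: "integrable lborel p" and p0: "\<And>t. p t \<ge> 0"
    and x: "x \<in> borel_measurable (FN a)" and x0: "\<And>\<omega>. x \<omega> \<ge> 0" and xC: "\<And>\<omega>. x \<omega> \<le> C"
  shows "integrable M (\<lambda>\<omega>. of_real (x \<omega>) * (intN (\<lambda>t. of_real (p t)) {a<..b} \<omega> - intL (\<lambda>t. of_real (p t)) {a<..b} \<omega>))"
    "(\<integral>\<omega>. of_real (x \<omega>) * (intN (\<lambda>t. of_real (p t)) {a<..b} \<omega> - intL (\<lambda>t. of_real (p t)) {a<..b} \<omega>) \<partial>M) = 0"
proof -
  have pm[measurable]: "p \<in> borel_measurable borel" using p by auto
  have xM[measurable]: "x \<in> borel_measurable M" by (rule FN_meas_M[OF x])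
  let ?q = "\<lambda>t. complex_of_real (p t)"
  have q: "integrable lborel ?q" using p by (rule integrable_of_real)
  have qm[measurable]: "?q \<in> borel_measurable borel" by measurable
  define A where "A \<omega> = (\<integral>\<^sup>+t. ennreal (p t) * indicator {a<..b} t \<partial>N \<omega>)" for \<omega>
  define B where "B \<omega> = (\<integral>\<^sup>+t. ennreal (p t) * lam t \<omega> * indicator {a<..b} t \<partial>lborel)" for \<omega>
  have Am[measurable]: "A \<in> borel_measurable M" unfolding A_def[abs_def] by (rule N.mq) measurable
  have Bm[measurable]: "B \<in> borel_measurable M"
    unfolding B_def[abs_def] using lam_q_meas[of "\<lambda>t. ennreal (p t) * indicator {a<..b} t"] by (simp add: mult_ac)
  have AB: "(\<integral>\<^sup>+\<omega>. ennreal (x \<omega>) * A \<omega> \<partial>M) = (\<integral>\<^sup>+\<omega>. ennreal (x \<omega>) * B \<omega> \<partial>M)"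
    unfolding A_def B_def by (rule intensity_q[where C=C]) (use x xC in \<open>auto intro: ennreal_leI\<close>)
  have fA: "(\<integral>\<^sup>+\<omega>. ennreal (x \<omega>) * A \<omega> \<partial>M) < \<infinity>"
  proof -
    have "(\<integral>\<^sup>+\<omega>. ennreal (x \<omega>) * A \<omega> \<partial>M) \<le> (\<integral>\<^sup>+\<omega>. ennreal C * (\<integral>\<^sup>+t. ennreal (p t) \<partial>N \<omega>) \<partial>M)"
      unfolding A_def using xC by (intro nn_integral_mono mult_mono ennreal_leI) (auto simp: indicator_def intro!: nn_integral_mono)
    also have "\<dots> = ennreal C * (ennreal mean_rate * (\<integral>\<^sup>+t. ennreal (p t) \<partial>lborel))"
      using N.mq[of "\<lambda>t. ennreal (p t)"] campbell[of "\<lambda>t. ennreal (p t)"] by (simp add: nn_integral_cmult)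
    also have "(\<integral>\<^sup>+t. ennreal (p t) \<partial>lborel) < \<infinity>" using p p0 by (simp add: nn_integral_eq_integral)
    then have "ennreal C * (ennreal mean_rate * (\<integral>\<^sup>+t. ennreal (p t) \<partial>lborel)) < \<infinity>" by (simp add: ennreal_mult_less_top)
    finally show ?thesis .
  qed
  have NXA: "AE \<omega> in M. intN ?q {a<..b} \<omega> = of_real (enn2real (A \<omega>)) \<and> A \<omega> < \<infinity>"
    using AE_path_integrable[OF q]
  proof eventually_elim
    case (elim \<omega>)
    then have w: "\<omega> \<in> space M" by (simp add: path_integrable_def)
    note [measurable_cong] = sets_N[OF w]
    have "intN ?q {a<..b} \<omega> = (\<integral>t. complex_of_real (indicator {a<..b} t * p t) \<partial>N \<omega>)"
      unfolding intN_def by (intro Bochner_Integration.integral_cong) (auto simp: indicator_def)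
    also have "\<dots> = of_real (\<integral>t. indicator {a<..b} t * p t \<partial>N \<omega>)" by (rule integral_complex_of_real)
    also have "(\<integral>t. indicator {a<..b} t * p t \<partial>N \<omega>) = enn2real (\<integral>\<^sup>+t. ennreal (indicator {a<..b} t * p t) \<partial>N \<omega>)"
      using p0 by (intro integral_eq_nn_integral) auto
    also have "(\<integral>\<^sup>+t. ennreal (indicator {a<..b} t * p t) \<partial>N \<omega>) = A \<omega>"
      unfolding A_def by (intro nn_integral_cong) (auto simp: indicator_def)
    finally have 1: "intN ?q {a<..b} \<omega> = of_real (enn2real (A \<omega>))" .
    have "A \<omega> \<le> (\<integral>\<^sup>+t. ennreal (norm (?q t)) \<partial>N \<omega>)"
      unfolding A_def using p0 by (intro nn_integral_mono) (auto simp: indicator_def)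
    also have "\<dots> < \<infinity>" using elim by (simp add: path_integrable_def)
    finally show ?case using 1 by simp
  qed
  have LXB: "AE \<omega> in M. intL ?q {a<..b} \<omega> = of_real (enn2real (B \<omega>)) \<and> B \<omega> < \<infinity>"
    using AE_path_integrable[OF q]
  proof eventually_elim
    case (elim \<omega>)
    then have w: "\<omega> \<in> space M" by (simp add: path_integrable_def)
    note [measurable] = lam_real_meas1[OF w] lam_meas1[OF w]
    have "intL ?q {a<..b} \<omega> = (\<integral>t. complex_of_real (indicator {a<..b} t * (p t * lam_real t \<omega>)) \<partial>lborel)"
      unfolding intL_def by (intro Bochner_Integration.integral_cong) (auto simp: indicator_def)
    also have "\<dots> = of_real (\<integral>t. indicator {a<..b} t * (p t * lam_real t \<omega>) \<partial>lborel)" by (rule integral_complex_of_real)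
    also have "(\<integral>t. indicator {a<..b} t * (p t * lam_real t \<omega>) \<partial>lborel) = enn2real (\<integral>\<^sup>+t. ennreal (indicator {a<..b} t * (p t * lam_real t \<omega>)) \<partial>lborel)"
      using p0 lam_real_nonneg by (intro integral_eq_nn_integral) auto
    also have "(\<integral>\<^sup>+t. ennreal (indicator {a<..b} t * (p t * lam_real t \<omega>)) \<partial>lborel) = B \<omega>"
      unfolding B_def
    proof (rule nn_integral_cong_AE)
      show "AE t in lborel. ennreal (indicator {a<..b} t * (p t * lam_real t \<omega>)) = ennreal (p t) * lam t \<omega> * indicator {a<..b} t"
        using path_integrable_AE_fin[OF elim qm]
      proof eventually_elim
        case (elim t)
        then show ?case using p0[of t] by (auto simp: indicator_def lam_real_def ennreal_mult)
      qed
    qed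
    finally have 1: "intL ?q {a<..b} \<omega> = of_real (enn2real (B \<omega>))" .
    have "B \<omega> \<le> (\<integral>\<^sup>+t. ennreal (norm (?q t)) * lam t \<omega> \<partial>lborel)"
      unfolding B_def using p0 by (intro nn_integral_mono) (auto simp: indicator_def)
    also have "\<dots> < \<infinity>" using elim by (simp add: path_integrable_def)
    finally show ?case using 1 by simp
  qed
  have I: "integrable M (\<lambda>\<omega>. x \<omega> * enn2real (R \<omega>))" "(\<integral>\<omega>. x \<omega> * enn2real (R \<omega>) \<partial>M) = enn2real (\<integral>\<^sup>+\<omega>. ennreal (x \<omega>) * R \<omega> \<partial>M)"
    if [measurable]: "R \<in> borel_measurable M" and f: "(\<integral>\<^sup>+\<omega>. ennreal (x \<omega>) * R \<omega> \<partial>M) < \<infinity>" and R: "AE \<omega> in M. R \<omega> < \<infinity>" for R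
  proof -
    have e: "(\<integral>\<^sup>+\<omega>. ennreal (x \<omega> * enn2real (R \<omega>)) \<partial>M) = (\<integral>\<^sup>+\<omega>. ennreal (x \<omega>) * R \<omega> \<partial>M)"
    proof (rule nn_integral_cong_AE)
      show "AE \<omega> in M. ennreal (x \<omega> * enn2real (R \<omega>)) = ennreal (x \<omega>) * R \<omega>"
        using R by eventually_elim (use x0 in \<open>auto simp: ennreal_mult\<close>)
    qed
    show "integrable M (\<lambda>\<omega>. x \<omega> * enn2real (R \<omega>))"
      using e f x0 by (auto simp: integrable_iff_bounded)
    show "(\<integral>\<omega>. x \<omega> * enn2real (R \<omega>) \<partial>M) = enn2real (\<integral>\<^sup>+\<omega>. ennreal (x \<omega>) * R \<omega> \<partial>M)"
      unfolding e[symmetric] using x0 by (intro integral_eq_nn_integral) auto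
  qed
  have AEA: "AE \<omega> in M. A \<omega> < \<infinity>" and AEB: "AE \<omega> in M. B \<omega> < \<infinity>" using NXA LXB by auto
  note IA = I[OF Am fA AEA] and IB = I[OF Bm fA[unfolded AB] AEB]
  have eqAE: "AE \<omega> in M. of_real (x \<omega>) * (intN ?q {a<..b} \<omega> - intL ?q {a<..b} \<omega>) = complex_of_real (x \<omega> * enn2real (A \<omega>) - x \<omega> * enn2real (B \<omega>))"
    using NXA LXB by eventually_elim (simp add: algebra_simps)
  note [measurable] = intN_meas[OF qm, of "{a<..b}"] intL_meas[OF qm, of "{a<..b}"]
  have i: "integrable M (\<lambda>\<omega>. complex_of_real (x \<omega> * enn2real (A \<omega>) - x \<omega> * enn2real (B \<omega>)))"
    using IA(1) IB(1) by (intro integrable_of_real Bochner_Integration.integrable_diff)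
  show "integrable M (\<lambda>\<omega>. of_real (x \<omega>) * (intN ?q {a<..b} \<omega> - intL ?q {a<..b} \<omega>))"
    using i by (rule integrable_cong_AE_imp) (use eqAE in \<open>auto elim: AE_mp\<close>)
  have "(\<integral>\<omega>. of_real (x \<omega>) * (intN ?q {a<..b} \<omega> - intL ?q {a<..b} \<omega>) \<partial>M) = (\<integral>\<omega>. complex_of_real (x \<omega> * enn2real (A \<omega>) - x \<omega> * enn2real (B \<omega>)) \<partial>M)"
    by (rule integral_cong_AE[OF _ _ eqAE]) measurable
  also have "\<dots> = of_real (\<integral>\<omega>. x \<omega> * enn2real (A \<omega>) - x \<omega> * enn2real (B \<omega>) \<partial>M)" by (rule integral_complex_of_real)
  also have "(\<integral>\<omega>. x \<omega> * enn2real (A \<omega>) - x \<omega> * enn2real (B \<omega>) \<partial>M) = 0"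
    using IA IB AB by simp
  finally show "(\<integral>\<omega>. of_real (x \<omega>) * (intN ?q {a<..b} \<omega> - intL ?q {a<..b} \<omega>) \<partial>M) = 0" by simp
qed

text \<open>Decomposition of \<open>q\<close> into four nonnegative parts. The integrals are
  additive on almost every path only, namely where all four parts are absolutely integrable.\<close>

lemma pos_diff:
  fixes q :: "real \<Rightarrow> complex" and x :: "'a \<Rightarrow> real"
  assumes q: "integrable lborel q"
    and x: "x \<in> borel_measurable (FN a)" and x0: "\<And>\<omega>. x \<omega> \<ge> 0" and xC: "\<And>\<omega>. x \<omega> \<le> C"
  shows "integrable M (\<lambda>\<omega>. of_real (x \<omega>) * (intN q {a<..b} \<omega> - intL q {a<..b} \<omega>))"
    "(\<integral>\<omega>. of_real (x \<omega>) * (intN q {a<..b} \<omega> - intL q {a<..b} \<omega>) \<partial>M) = 0"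
proof -
  define p1 where "p1 t = max 0 (Re (q t))" for t
  define p2 where "p2 t = max 0 (- Re (q t))" for t
  define p3 where "p3 t = max 0 (Im (q t))" for t
  define p4 where "p4 t = max 0 (- Im (q t))" for t
  have qm[measurable]: "q \<in> borel_measurable borel" using q by auto
  have ip: "integrable lborel p1" "integrable lborel p2" "integrable lborel p3" "integrable lborel p4"
    unfolding p1_def p2_def p3_def p4_def using q by auto
  have p0: "p1 t \<ge> 0" "p2 t \<ge> 0" "p3 t \<ge> 0" "p4 t \<ge> 0" for t by (auto simp: p1_def p2_def p3_def p4_def)
  have qe: "q t = of_real (p1 t) - of_real (p2 t) + \<i> * (of_real (p3 t) - of_real (p4 t))" for t
    by (simp add: complex_eq_iff p1_def p2_def p3_def p4_def max_def)
  define D where "D r \<omega> = intN r {a<..b} \<omega> - intL r {a<..b} \<omega>" for r \<omega>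
  have "AE \<omega> in M. path_integrable (\<lambda>t. complex_of_real (p1 t)) \<omega> \<and> path_integrable (\<lambda>t. complex_of_real (p2 t)) \<omega> \<and> path_integrable (\<lambda>t. complex_of_real (p3 t)) \<omega> \<and> path_integrable (\<lambda>t. complex_of_real (p4 t)) \<omega>"
    using AE_path_integrable[OF integrable_of_real[OF ip(1)]] AE_path_integrable[OF integrable_of_real[OF ip(2)]] AE_path_integrable[OF integrable_of_real[OF ip(3)]] AE_path_integrable[OF integrable_of_real[OF ip(4)]]
    by eventually_elim simp
  then have eqAE: "AE \<omega> in M. of_real (x \<omega>) * D q \<omega> = of_real (x \<omega>) * D (\<lambda>t. of_real (p1 t)) \<omega> - of_real (x \<omega>) * D (\<lambda>t. of_real (p2 t)) \<omega>
      + \<i> * (of_real (x \<omega>) * D (\<lambda>t. of_real (p3 t)) \<omega> - of_real (x \<omega>) * D (\<lambda>t. of_real (p4 t)) \<omega>)"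
  proof eventually_elim
    case (elim \<omega>)
    then have w: "\<omega> \<in> space M" by (simp add: path_integrable_def)
    let ?S = "{a<..b}"
    have lin: "(\<integral>t. indicator ?S t * (f1 t - f2 t + \<i> * (f3 t - f4 t)) \<partial>R) =
      (\<integral>t. indicator ?S t * f1 t \<partial>R) - (\<integral>t. indicator ?S t * f2 t \<partial>R) + \<i> * ((\<integral>t. indicator ?S t * f3 t \<partial>R) - (\<integral>t. indicator ?S t * f4 t \<partial>R))"
      if i: "integrable R f1" "integrable R f2" "integrable R f3" "integrable R f4" and s: "sets R = sets borel"
      for f1 f2 f3 f4 :: "real \<Rightarrow> complex" and R
    proof -
      note j = i[THEN integrable_ind_mult, of ?S]
      have "(\<integral>t. indicator ?S t * (f1 t - f2 t + \<i> * (f3 t - f4 t)) \<partial>R) = (\<integral>t. indicator ?S t * f1 t - indicator ?S t * f2 t + \<i> * (indicator ?S t * f3 t - indicator ?S t * f4 t) \<partial>R)"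
        by (intro Bochner_Integration.integral_cong refl) (simp add: algebra_simps)
      also have "\<dots> = (\<integral>t. indicator ?S t * f1 t \<partial>R) - (\<integral>t. indicator ?S t * f2 t \<partial>R) + \<i> * ((\<integral>t. indicator ?S t * f3 t \<partial>R) - (\<integral>t. indicator ?S t * f4 t \<partial>R))"
        using j s by simp
      finally show ?thesis .
    qed
    have gN: "integrable (N \<omega>) (\<lambda>t. complex_of_real (p1 t))" "integrable (N \<omega>) (\<lambda>t. complex_of_real (p2 t))" "integrable (N \<omega>) (\<lambda>t. complex_of_real (p3 t))" "integrable (N \<omega>) (\<lambda>t. complex_of_real (p4 t))"
      using elim ip by (auto intro!: path_integrable_N_int)
    have gL: "integrable lborel (\<lambda>t. complex_of_real (p1 t) * of_real (lam_real t \<omega>))" "integrable lborel (\<lambda>t. complex_of_real (p2 t) * of_real (lam_real t \<omega>))"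
      "integrable lborel (\<lambda>t. complex_of_real (p3 t) * of_real (lam_real t \<omega>))" "integrable lborel (\<lambda>t. complex_of_real (p4 t) * of_real (lam_real t \<omega>))"
      by (rule path_integrable_lam_real_int; use elim ip in auto)+
    have 1: "intN q ?S \<omega> = intN (\<lambda>t. of_real (p1 t)) ?S \<omega> - intN (\<lambda>t. of_real (p2 t)) ?S \<omega> + \<i> * (intN (\<lambda>t. of_real (p3 t)) ?S \<omega> - intN (\<lambda>t. of_real (p4 t)) ?S \<omega>)"
      unfolding intN_def lin[OF gN sets_N[OF w], symmetric] qe ..
    have 2: "intL q ?S \<omega> = intL (\<lambda>t. of_real (p1 t)) ?S \<omega> - intL (\<lambda>t. of_real (p2 t)) ?S \<omega> + \<i> * (intL (\<lambda>t. of_real (p3 t)) ?S \<omega> - intL (\<lambda>t. of_real (p4 t)) ?S \<omega>)"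
      unfolding intL_def lin[OF gL, simplified, symmetric]
      by (intro Bochner_Integration.integral_cong refl) (simp add: qe algebra_simps)
    show ?case unfolding D_def 1 2 by (simp add: algebra_simps)
  qed
  note b1 = base_diff[OF ip(1) p0(1) x x0 xC, of b, folded D_def]
  note b2 = base_diff[OF ip(2) p0(2) x x0 xC, of b, folded D_def]
  note b3 = base_diff[OF ip(3) p0(3) x x0 xC, of b, folded D_def]
  note b4 = base_diff[OF ip(4) p0(4) x x0 xC, of b, folded D_def]
  have xM[measurable]: "x \<in> borel_measurable M" by (rule FN_meas_M[OF x])
  have Dm[measurable]: "D q \<in> borel_measurable M" unfolding D_def[abs_def] using intN_meas[OF qm, of "{a<..b}"] intL_meas[OF qm, of "{a<..b}"] by simp
  have i: "integrable M (\<lambda>\<omega>. of_real (x \<omega>) * D (\<lambda>t. of_real (p1 t)) \<omega> - of_real (x \<omega>) * D (\<lambda>t. of_real (p2 t)) \<omega>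
      + \<i> * (of_real (x \<omega>) * D (\<lambda>t. of_real (p3 t)) \<omega> - of_real (x \<omega>) * D (\<lambda>t. of_real (p4 t)) \<omega>))"
    by (intro Bochner_Integration.integrable_add Bochner_Integration.integrable_diff integrable_mult_right b1(1) b2(1) b3(1) b4(1))
  show "integrable M (\<lambda>\<omega>. of_real (x \<omega>) * (intN q {a<..b} \<omega> - intL q {a<..b} \<omega>))"
    unfolding D_def[symmetric] by (rule integrable_cong_AE_imp[OF i]) (use eqAE in \<open>auto elim: AE_mp\<close>)
  have "(\<integral>\<omega>. of_real (x \<omega>) * D q \<omega> \<partial>M) = (\<integral>\<omega>. of_real (x \<omega>) * D (\<lambda>t. of_real (p1 t)) \<omega> - of_real (x \<omega>) * D (\<lambda>t. of_real (p2 t)) \<omega>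
      + \<i> * (of_real (x \<omega>) * D (\<lambda>t. of_real (p3 t)) \<omega> - of_real (x \<omega>) * D (\<lambda>t. of_real (p4 t)) \<omega>) \<partial>M)"
    by (rule integral_cong_AE[OF _ _ eqAE]) (use borel_measurable_integrable[OF i] in auto)
  also have "\<dots> = 0" using b1 b2 b3 b4 by simp
  finally show "(\<integral>\<omega>. of_real (x \<omega>) * (intN q {a<..b} \<omega> - intL q {a<..b} \<omega>) \<partial>M) = 0" unfolding D_def .
qed

text \<open>Real and imaginary part of the weight are made nonnegative by adding the constant
  \<open>C\<close>. The constant weight is itself admissible, so its contribution can be subtracted
  again.\<close>

lemma mart_diff:
  fixes q :: "real \<Rightarrow> complex" and \<xi> :: "'a \<Rightarrow> complex"
  assumes q: "integrable lborel q" and xi: "\<xi> \<in> borel_measurable (FN a)" and C: "\<And>\<omega>. norm (\<xi> \<omega>) \<le> C"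
  shows "integrable M (\<lambda>\<omega>. \<xi> \<omega> * (intN q {a<..b} \<omega> - intL q {a<..b} \<omega>))"
    "(\<integral>\<omega>. \<xi> \<omega> * (intN q {a<..b} \<omega> - intL q {a<..b} \<omega>) \<partial>M) = 0"
proof -
  let ?Z = "\<lambda>\<omega>. intN q {a<..b} \<omega> - intL q {a<..b} \<omega>"
  have bR: "Re (\<xi> \<omega>) + C \<ge> 0" "Re (\<xi> \<omega>) + C \<le> 2 * C" for \<omega>
    using C[of \<omega>] abs_Re_le_cmod[of "\<xi> \<omega>"] by linarith+
  have bI: "Im (\<xi> \<omega>) + C \<ge> 0" "Im (\<xi> \<omega>) + C \<le> 2 * C" for \<omega>
    using C[of \<omega>] abs_Im_le_cmod[of "\<xi> \<omega>"] by linarith+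
  have C0: "C \<ge> 0" using C[of undefined] norm_ge_zero order_trans by blast
  note 1 = pos_diff[OF q, of "\<lambda>\<omega>. Re (\<xi> \<omega>) + C" a "2 * C" b]
  note 2 = pos_diff[OF q, of "\<lambda>\<omega>. Im (\<xi> \<omega>) + C" a "2 * C" b]
  note 3 = pos_diff[OF q, of "\<lambda>\<omega>. C" a C b]
  have m: "(\<lambda>\<omega>. Re (\<xi> \<omega>) + C) \<in> borel_measurable (FN a)" "(\<lambda>\<omega>. Im (\<xi> \<omega>) + C) \<in> borel_measurable (FN a)" using xi by auto
  have e: "\<xi> \<omega> * ?Z \<omega> = of_real (Re (\<xi> \<omega>) + C) * ?Z \<omega> - of_real C * ?Z \<omega> + \<i> * (of_real (Im (\<xi> \<omega>) + C) * ?Z \<omega> - of_real C * ?Z \<omega>)" for \<omega>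
  proof -
    have "\<xi> \<omega> = of_real (Re (\<xi> \<omega>) + C) - of_real C + \<i> * (of_real (Im (\<xi> \<omega>) + C) - of_real C)" by (simp add: complex_eq_iff)
    then show ?thesis by (metis (no_types, lifting) distrib_right left_diff_distrib mult.assoc)
  qed
  have i1: "integrable M (\<lambda>\<omega>. of_real (Re (\<xi> \<omega>) + C) * ?Z \<omega>)" "(\<integral>\<omega>. of_real (Re (\<xi> \<omega>) + C) * ?Z \<omega> \<partial>M) = 0"
    using 1[OF m(1) bR] by auto
  have i2: "integrable M (\<lambda>\<omega>. of_real (Im (\<xi> \<omega>) + C) * ?Z \<omega>)" "(\<integral>\<omega>. of_real (Im (\<xi> \<omega>) + C) * ?Z \<omega> \<partial>M) = 0"
    using 2[OF m(2) bI] by auto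
  have i3: "integrable M (\<lambda>\<omega>. of_real C * ?Z \<omega>)" "(\<integral>\<omega>. of_real C * ?Z \<omega> \<partial>M) = 0"
    using 3 C0 by auto
  have h: "has_bochner_integral M (\<lambda>\<omega>. of_real (Re (\<xi> \<omega>) + C) * ?Z \<omega>) 0" "has_bochner_integral M (\<lambda>\<omega>. of_real (Im (\<xi> \<omega>) + C) * ?Z \<omega>) 0"
    "has_bochner_integral M (\<lambda>\<omega>. of_real C * ?Z \<omega>) 0"
    using i1 i2 i3 unfolding has_bochner_integral_iff by blast+
  have "has_bochner_integral M (\<lambda>\<omega>. \<xi> \<omega> * ?Z \<omega>) (0 - 0 + \<i> * (0 - 0))"
    unfolding e by (intro has_bochner_integral_add has_bochner_integral_diff has_bochner_integral_mult_right h)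
  then show "integrable M (\<lambda>\<omega>. \<xi> \<omega> * ?Z \<omega>)" "(\<integral>\<omega>. \<xi> \<omega> * ?Z \<omega> \<partial>M) = 0"
    by (auto simp: has_bochner_integral_iff)
qed

end

subsection \<open>The exponential martingale\<close>

text \<open>The intervals are open on the left and partition \<open>{a<..b}\<close>, so exactly one
  summand survives at \<open>t\<close>. Its index is the ceiling of \<open>(t - a) / d\<close> minus
  1, and the left endpoint of that interval is strictly smaller than \<open>t\<close>.\<close>

lemma step_sum:
  fixes f :: "real \<Rightarrow> complex"
  assumes t: "a < t" "t \<le> b" and m: "m > 0"
  defines "d \<equiv> (b - a) / real m"
  shows "(\<Sum>k<m. f (a + d * real k) * indicator {a + d * real k<..a + d * real (Suc k)} t) = f (a + d * (real_of_int \<lceil>(t - a) / d\<rceil> - 1))"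
proof -
  have d: "d > 0" using t m by (simp add: d_def)
  define z where "z = \<lceil>(t - a) / d\<rceil>"
  have z1: "z \<ge> 1" using t d by (simp add: z_def)
  have "(t - a) / d \<le> real m" using t m d by (simp add: d_def field_simps)
  then have zm: "z \<le> int m" by (simp add: z_def ceiling_le_iff)
  define k0 where "k0 = nat (z - 1)"
  have k0: "k0 < m" "real k0 = real_of_int z - 1" using z1 zm by (auto simp: k0_def)
  have iff: "t \<in> {a + d * real k<..a + d * real (Suc k)} \<longleftrightarrow> k = k0" for k
  proof -
    have "t \<in> {a + d * real k<..a + d * real (Suc k)} \<longleftrightarrow> real k < (t - a) / d \<and> (t - a) / d \<le> real k + 1"
      using d by (auto simp: pos_less_divide_eq pos_divide_le_eq algebra_simps)
    also have "\<dots> \<longleftrightarrow> z = int k + 1" unfolding z_def by (simp add: ceiling_eq_iff)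
    also have "\<dots> \<longleftrightarrow> k = k0" using z1 by (auto simp: k0_def)
    finally show ?thesis .
  qed
  have "(\<Sum>k<m. f (a + d * real k) * indicator {a + d * real k<..a + d * real (Suc k)} t) = (\<Sum>k<m. if k = k0 then f (a + d * real k) else 0)"
    by (intro sum.cong refl) (unfold indicator_def iff, simp)
  also have "\<dots> = f (a + d * real k0)" using k0 by simp
  finally show ?thesis by (simp add: k0 z_def)
qed

lemma step_limit:
  assumes t: "a < (t::real)" and ab: "a < b"
  defines "d \<equiv> (\<lambda>m. (b - a) / real (Suc m))"
  shows "a + d m * (real_of_int \<lceil>(t - a) / d m\<rceil> - 1) < t" "(\<lambda>m. a + d m * (real_of_int \<lceil>(t - a) / d m\<rceil> - 1)) \<longlonglongrightarrow> t"
proof -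
  have d: "d m > 0" for m using ab by (simp add: d_def)
  have b: "t - d m \<le> a + d m * (real_of_int \<lceil>(t - a) / d m\<rceil> - 1) \<and> a + d m * (real_of_int \<lceil>(t - a) / d m\<rceil> - 1) < t" for m
  proof -
    have "real_of_int \<lceil>(t - a) / d m\<rceil> - 1 < (t - a) / d m" by linarith
    then have 1: "d m * (real_of_int \<lceil>(t - a) / d m\<rceil> - 1) < t - a" using d[of m] by (simp add: pos_less_divide_eq mult.commute)
    have e: "d m * ((t - a) / d m) = t - a" using d[of m] by simp
    have "(t - a) / d m - 1 \<le> real_of_int \<lceil>(t - a) / d m\<rceil> - 1" by linarith
    then have "d m * ((t - a) / d m - 1) \<le> d m * (real_of_int \<lceil>(t - a) / d m\<rceil> - 1)" using d[of m] by (intro mult_left_mono) auto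
    moreover have "d m * ((t - a) / d m - 1) = t - a - d m" by (simp only: right_diff_distrib[of "d m" "(t - a) / d m" 1] e mult_1_right)
    ultimately show ?thesis using 1 by linarith
  qed
  then show "a + d m * (real_of_int \<lceil>(t - a) / d m\<rceil> - 1) < t" by blast
  have "d \<longlonglongrightarrow> 0" unfolding d_def by (rule lim_const_over_n[THEN LIMSEQ_Suc])
  then have "(\<lambda>m. t - d m) \<longlonglongrightarrow> t - 0" by (intro tendsto_intros)
  then have l: "(\<lambda>m. t - d m) \<longlonglongrightarrow> t" by simp
  show "(\<lambda>m. a + d m * (real_of_int \<lceil>(t - a) / d m\<rceil> - 1)) \<longlonglongrightarrow> t"
  proof (rule tendsto_sandwich[OF _ _ l tendsto_const])
    show "\<forall>\<^sub>F m in sequentially. t - d m \<le> a + d m * (real_of_int \<lceil>(t - a) / d m\<rceil> - 1)"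
      using b by (intro always_eventually) blast
    show "\<forall>\<^sub>F m in sequentially. a + d m * (real_of_int \<lceil>(t - a) / d m\<rceil> - 1) \<le> t"
      using b by (intro always_eventually) (blast intro: less_imp_le)
  qed
qed

lemma ind_tail_limits:
  fixes f :: "real \<Rightarrow> complex"
  assumes f: "integrable L f" and s: "sets L = sets borel"
  shows "(\<lambda>n. \<integral>t. indicator {..- real n} t * f t \<partial>L) \<longlonglongrightarrow> 0" "(\<lambda>n. \<integral>t. indicator {..real n} t * f t \<partial>L) \<longlonglongrightarrow> (\<integral>t. f t \<partial>L)"
proof -
  have ev: "eventually (\<lambda>n. \<bar>t\<bar> < real n) sequentially" for t :: real
  proof -
    obtain k where "\<bar>t\<bar> < real k" using reals_Archimedean2 by blast
    then show ?thesis by (intro eventually_sequentiallyI[of k]) (meson less_le_trans of_nat_mono)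
  qed
  have "(\<lambda>n. \<integral>t. indicator {..- real n} t * f t \<partial>L) \<longlonglongrightarrow> (\<integral>t. 0 \<partial>L)"
  proof (rule integral_dominated_convergence[where w="\<lambda>t. norm (f t)"])
    show "AE t in L. (\<lambda>n. indicator {..- real n} t * f t) \<longlonglongrightarrow> 0"
    proof (rule AE_I2)
      fix t
      have "eventually (\<lambda>n. indicator {..- real n} t * f t = 0) sequentially"
        using ev[of t] by eventually_elim (auto simp: indicator_def)
      then show "(\<lambda>n. indicator {..- real n} t * f t) \<longlonglongrightarrow> 0" by (rule tendsto_eventually)
    qed
  qed (use f s in \<open>auto simp: norm_mult indicator_def intro!: borel_measurable_integrable integrable_ind_mult[unfolded indicator_def]\<close>)
  then show "(\<lambda>n. \<integral>t. indicator {..- real n} t * f t \<partial>L) \<longlonglongrightarrow> 0" by simp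
  show "(\<lambda>n. \<integral>t. indicator {..real n} t * f t \<partial>L) \<longlonglongrightarrow> (\<integral>t. f t \<partial>L)"
  proof (rule integral_dominated_convergence[where w="\<lambda>t. norm (f t)"])
    show "AE t in L. (\<lambda>n. indicator {..real n} t * f t) \<longlonglongrightarrow> f t"
    proof (rule AE_I2)
      fix t
      have "eventually (\<lambda>n. indicator {..real n} t * f t = f t) sequentially"
        using ev[of t] by eventually_elim (auto simp: indicator_def)
      then show "(\<lambda>n. indicator {..real n} t * f t) \<longlonglongrightarrow> f t" by (rule tendsto_eventually)
    qed
  qed (use f s in \<open>auto simp: norm_mult indicator_def intro!: borel_measurable_integrable integrable_ind_mult[unfolded indicator_def]\<close>)
qed

section \<open>The compensator as an integral over the points\<close>

context hawkes
begin

definition "simp_at \<omega> \<longleftrightarrow> \<omega> \<in> space M \<and> (\<forall>x. emeasure (N \<omega>) {x} \<le> 1)"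

lemma AE_simp_at: "AE \<omega> in M. simp_at \<omega>"
  using simp_N AE_space unfolding simple_process_def by eventually_elim (simp add: simp_at_def)

lemma jump_path_N:
  assumes "simp_at \<omega>" "integrable (N \<omega>) c" "integrable (N \<omega>) (\<lambda>t. exp (c t) - 1)" "integrable lborel \<phi>"
  shows "jump_path (N \<omega>) c \<phi>"
  using assms pp by unfold_locales (auto simp: simp_at_def point_process_def sets_N)

text \<open>The contribution of a point at \<open>s\<close> to the compensator integral of
  \<open>q\<close> over \<open>S\<close>.\<close>

definition hp_conv :: "(real \<Rightarrow> complex) \<Rightarrow> real set \<Rightarrow> real \<Rightarrow> complex" where
  "hp_conv q S s = (\<integral>r. indicator S r * (of_real (hp (r - s)) * q r) \<partial>lborel)"

lemma hp_conv_meas[measurable]: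
  assumes [measurable]: "q \<in> borel_measurable borel" "S \<in> sets borel"
  shows "hp_conv q S \<in> borel_measurable borel"
proof -
  have "(\<lambda>s. \<integral>r. (if r \<in> S then of_real (hp (r - s)) * q r else 0) \<partial>lborel) \<in> borel_measurable borel"
    by (rule lborel.borel_measurable_lebesgue_integral) (simp add: case_prod_beta, measurable)
  moreover have "hp_conv q S = (\<lambda>s. \<integral>r. (if r \<in> S then of_real (hp (r - s)) * q r else 0) \<partial>lborel)"
    unfolding hp_conv_def by (intro ext Bochner_Integration.integral_cong) (auto simp: indicator_def)
  ultimately show ?thesis by simp
qed

text \<open>The intensity is inserted as an integral over the points and the order of integration
  exchanged. Absolute convergence follows from \<open>path_integrable\<close>, because the
  contribution of the points to the intensity is at most the intensity itself.\<close>

lemma lam_fubini: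
  assumes sa: "simp_at \<omega>" and g: "path_integrable q \<omega>" and qi: "integrable lborel q" and S[measurable]: "S \<in> sets borel"
  shows "integrable (N \<omega>) (hp_conv q S)"
    "intL q S \<omega> = of_real \<nu> * (\<integral>r. indicator S r * q r \<partial>lborel) + (\<integral>s. hp_conv q S s \<partial>N \<omega>)"
proof -
  have q[measurable]: "q \<in> borel_measurable borel" using qi by auto
  have w: "\<omega> \<in> space M" using sa by (simp add: simp_at_def)
  note s = sets_N[OF w]
  note [measurable_cong] = s
  note [measurable] = lam_meas1[OF w] lam_real_meas1[OF w]
  \<comment> \<open>With zero functions the interpretation provides the sigma-finiteness of
    \<open>N \<omega>\<close>, which Fubini's theorem needs.\<close>
  interpret J: jump_path "N \<omega>" "\<lambda>_. 0" "\<lambda>_. 0" by (rule jump_path_N[OF sa]) auto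
  interpret P: pair_sigma_finite lborel "N \<omega>" ..
  define f where "f = (\<lambda>(r, s). indicator S r * (of_real (hp (r - s)) * q r))"
  have fm[measurable]: "f \<in> borel_measurable (lborel \<Otimes>\<^sub>M N \<omega>)" unfolding f_def case_prod_beta by measurable
  have lam_le: "(\<integral>\<^sup>+s. ennreal (hp (r - s)) \<partial>N \<omega>) \<le> lam r \<omega>" for r by (simp add: lam_eq)
  have "(\<integral>\<^sup>+p. ennreal (norm (f p)) \<partial>(lborel \<Otimes>\<^sub>M N \<omega>)) = (\<integral>\<^sup>+r. (\<integral>\<^sup>+s. ennreal (norm (f (r, s))) \<partial>N \<omega>) \<partial>lborel)"
    by (rule J.n.nn_integral_fst[symmetric]) measurable
  also have "\<dots> \<le> (\<integral>\<^sup>+r. ennreal (norm (q r)) * lam r \<omega> \<partial>lborel)"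
  proof (rule nn_integral_mono)
    fix r
    have "(\<integral>\<^sup>+s. ennreal (norm (f (r, s))) \<partial>N \<omega>) \<le> (\<integral>\<^sup>+s. ennreal (norm (q r)) * ennreal (hp (r - s)) \<partial>N \<omega>)"
      using hp_nonneg by (intro nn_integral_mono) (auto simp: f_def norm_mult indicator_def ennreal_mult[symmetric] mult.commute)
    also have "\<dots> = ennreal (norm (q r)) * (\<integral>\<^sup>+s. ennreal (hp (r - s)) \<partial>N \<omega>)" by (rule nn_integral_cmult) measurable
    also have "\<dots> \<le> ennreal (norm (q r)) * lam r \<omega>" by (intro mult_left_mono lam_le) simp
    finally show "(\<integral>\<^sup>+s. ennreal (norm (f (r, s))) \<partial>N \<omega>) \<le> ennreal (norm (q r)) * lam r \<omega>" .
  qed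
  also have "\<dots> < \<infinity>" using g by (simp add: path_integrable_def)
  finally have fi: "integrable (lborel \<Otimes>\<^sub>M N \<omega>) f" by (auto simp: integrable_iff_bounded)
  have HHf: "hp_conv q S s = (\<integral>r. f (r, s) \<partial>lborel)" for s by (simp add: hp_conv_def f_def)
  have fi': "integrable (lborel \<Otimes>\<^sub>M N \<omega>) (case_prod (\<lambda>r s. f (r, s)))" using fi by simp
  show "integrable (N \<omega>) (hp_conv q S)" unfolding HHf[abs_def] using P.integrable_snd[OF fi'] by simp
  have "(\<integral>s. hp_conv q S s \<partial>N \<omega>) = (\<integral>p. f p \<partial>(lborel \<Otimes>\<^sub>M N \<omega>))" unfolding HHf using P.integral_snd[OF fi'] by simp
  also have "\<dots> = (\<integral>r. (\<integral>s. f (r, s) \<partial>N \<omega>) \<partial>lborel)" by (rule P.integral_fst'[OF fi, symmetric])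
  finally have H: "(\<integral>s. hp_conv q S s \<partial>N \<omega>) = (\<integral>r. (\<integral>s. f (r, s) \<partial>N \<omega>) \<partial>lborel)" .
  have i1: "integrable lborel (\<lambda>r. indicator S r * q r)" by (rule integrable_ind_mult[OF qi]) simp
  have i2: "integrable lborel (\<lambda>r. \<integral>s. f (r, s) \<partial>N \<omega>)" by (rule P.integrable_fst'[OF fi])
  have "intL q S \<omega> = (\<integral>r. of_real \<nu> * (indicator S r * q r) + (\<integral>s. f (r, s) \<partial>N \<omega>) \<partial>lborel)"
    unfolding intL_def
  proof (rule integral_cong_AE)
    show "AE r in lborel. indicator S r * (q r * of_real (lam_real r \<omega>)) = of_real \<nu> * (indicator S r * q r) + (\<integral>s. f (r, s) \<partial>N \<omega>)"
      using path_integrable_AE_fin[OF g q]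
    proof eventually_elim
      case (elim r)
      show ?case
      proof (cases "q r = 0")
        case True
        then show ?thesis by (simp add: f_def)
      next
        case False
        then have "lam r \<omega> < \<infinity>" using elim by simp
        then have f1: "(\<integral>\<^sup>+s. ennreal (hp (r - s)) \<partial>N \<omega>) < \<infinity>" using lam_le[of r] by (rule le_less_trans[rotated])
        have "lam_real r \<omega> = \<nu> + enn2real (\<integral>\<^sup>+s. ennreal (hp (r - s)) \<partial>N \<omega>)"
          unfolding lam_real_def lam_eq using nu f1 by (subst enn2real_plus) auto
        also have "enn2real (\<integral>\<^sup>+s. ennreal (hp (r - s)) \<partial>N \<omega>) = (\<integral>s. hp (r - s) \<partial>N \<omega>)"
          using hp_nonneg by (intro integral_eq_nn_integral[symmetric]) auto
        finally have l: "lam_real r \<omega> = \<nu> + (\<integral>s. hp (r - s) \<partial>N \<omega>)" .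
        have "(\<integral>s. f (r, s) \<partial>N \<omega>) = (\<integral>s. (indicator S r * q r) * complex_of_real (hp (r - s)) \<partial>N \<omega>)"
          by (intro Bochner_Integration.integral_cong) (auto simp: f_def)
        also have "\<dots> = (indicator S r * q r) * of_real (\<integral>s. hp (r - s) \<partial>N \<omega>)" by simp
        finally show ?thesis by (simp add: l algebra_simps)
      qed
    qed
  qed (use i1 i2 in \<open>auto intro!: borel_measurable_integrable\<close>)
  also have "\<dots> = of_real \<nu> * (\<integral>r. indicator S r * q r \<partial>lborel) + (\<integral>r. (\<integral>s. f (r, s) \<partial>N \<omega>) \<partial>lborel)"
    using i1 i2 by simp
  finally show "intL q S \<omega> = of_real \<nu> * (\<integral>r. indicator S r * q r \<partial>lborel) + (\<integral>s. hp_conv q S s \<partial>N \<omega>)"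
    unfolding H .
qed

definition exp_proc :: "(real \<Rightarrow> complex) \<Rightarrow> (real \<Rightarrow> complex) \<Rightarrow> real \<Rightarrow> 'a \<Rightarrow> complex" where
  "exp_proc c q t \<omega> = exp (intN c {..t} \<omega> - intL q {..t} \<omega>)"

text \<open>The form of \<open>exp_proc\<close> after Fubini, with \<open>\<lambda>\<close> written as an integral over \<open>N\<close>. It shows that the process is adapted
  and, when the exponents have nonpositive real part, bounded.\<close>
definition exp_pred :: "(real \<Rightarrow> complex) \<Rightarrow> (real \<Rightarrow> complex) \<Rightarrow> real \<Rightarrow> 'a \<Rightarrow> complex" where
  "exp_pred c q t \<omega> = exp (- of_real \<nu> * (\<integral>r. indicator {..t} r * q r \<partial>lborel) + intN (\<lambda>s. c s - hp_conv q {..t} s) {..t} \<omega>)"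

lemma exp_proc_eq_exp_pred:
  assumes sa: "simp_at \<omega>" and gq: "path_integrable q \<omega>" and gc: "path_integrable c \<omega>" and qi: "integrable lborel q" and cm: "c \<in> borel_measurable borel"
  shows "exp_proc c q t \<omega> = exp_pred c q t \<omega>"
proof -
  have w: "\<omega> \<in> space M" using sa by (simp add: simp_at_def)
  note L = lam_fubini[OF sa gq qi, of "{..t}"]
  \<comment> \<open>A point after \<open>t\<close> does not influence the intensity up to
    \<open>t\<close>. The integral over all points thus reduces to the points in
    \<open>{..t}\<close>, and the result is known at time \<open>t\<close>.\<close>
  have Hz: "hp_conv q {..t} s = 0" if "s > t" for s
  proof -
    have "(\<lambda>r. indicator {..t} r * (of_real (hp (r - s)) * q r)) = (\<lambda>r. 0)" using that by (auto simp: indicator_def hp_zero)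
    then show ?thesis by (simp add: hp_conv_def)
  qed
  have e1: "(\<integral>s. hp_conv q {..t} s \<partial>N \<omega>) = (\<integral>s. indicator {..t} s * hp_conv q {..t} s \<partial>N \<omega>)"
    by (intro Bochner_Integration.integral_cong) (auto simp: indicator_def Hz)
  have e2: "intN (\<lambda>s. c s - hp_conv q {..t} s) {..t} \<omega> = intN c {..t} \<omega> - (\<integral>s. indicator {..t} s * hp_conv q {..t} s \<partial>N \<omega>)"
    unfolding intN_def right_diff_distrib
    by (intro Bochner_Integration.integral_diff integrable_ind_mult path_integrable_N_int[OF gc cm] L(1)) (auto simp: sets_N[OF w])
  have L2: "intL q {..t} \<omega> = of_real \<nu> * (\<integral>r. indicator {..t} r * q r \<partial>lborel) + (\<integral>s. hp_conv q {..t} s \<partial>N \<omega>)" by (rule L(2)) simp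
  show ?thesis unfolding exp_proc_def exp_pred_def L2 e1 e2 by (rule arg_cong[of _ _ exp]) simp
qed

text \<open>The estimate has to hold at every \<omega>, not just almost surely, because
  \<open>mart_diff\<close> asks for weights bounded everywhere. Where the integral over the points
  does not exist, its value 0 satisfies the same inequality.\<close>

lemma exp_pred_bound:
  assumes qi: "integrable lborel q" and cm: "c \<in> borel_measurable borel"
    and H: "\<And>s t. s \<le> t \<Longrightarrow> Re (c s - hp_conv q {..t} s) \<le> 0"
  shows "norm (exp_pred c q t \<omega>) \<le> exp (\<nu> * (\<integral>r. norm (q r) \<partial>lborel))"
proof -
  have "Re (- of_real \<nu> * (\<integral>r. indicator {..t} r * q r \<partial>lborel)) \<le> norm (- of_real \<nu> * (\<integral>r. indicator {..t} r * q r \<partial>lborel))"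
    by (rule complex_Re_le_cmod)
  also have "\<dots> = \<nu> * norm (\<integral>r. indicator {..t} r * q r \<partial>lborel)" using nu by (simp add: norm_mult)
  also have "\<dots> \<le> \<nu> * (\<integral>r. norm (indicator {..t} r * q r) \<partial>lborel)" using nu by (intro mult_left_mono integral_norm_bound) simp
  also have "\<dots> \<le> \<nu> * (\<integral>r. norm (q r) \<partial>lborel)"
    using nu qi by (intro mult_left_mono integral_mono integrable_norm integrable_ind_mult) (auto simp: norm_mult indicator_def)
  finally have 1: "Re (- of_real \<nu> * (\<integral>r. indicator {..t} r * q r \<partial>lborel)) \<le> \<nu> * (\<integral>r. norm (q r) \<partial>lborel)" .
  have 2: "Re (intN (\<lambda>s. c s - hp_conv q {..t} s) {..t} \<omega>) \<le> 0"
  proof (cases "integrable (N \<omega>) (\<lambda>s. indicator {..t} s * (c s - hp_conv q {..t} s))")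
    case True
    have "Re (intN (\<lambda>s. c s - hp_conv q {..t} s) {..t} \<omega>) = (\<integral>s. Re (indicator {..t} s * (c s - hp_conv q {..t} s)) \<partial>N \<omega>)"
      unfolding intN_def by (rule integral_Re[OF True, symmetric])
    also have "\<dots> \<le> (\<integral>s. 0 \<partial>N \<omega>)"
    proof (rule integral_mono')
      show "Re (indicator {..t} s * (c s - hp_conv q {..t} s)) \<le> 0" for s using H[of s t] by (auto simp: indicator_def)
    qed auto
    finally show ?thesis by simp
  qed (simp add: intN_def not_integrable_integral_eq)
  show ?thesis unfolding exp_pred_def using 1 2 by simp
qed

lemma exp_pred_meas_FN:
  assumes [measurable]: "q \<in> borel_measurable borel" "c \<in> borel_measurable borel"
  shows "exp_pred c q t \<in> borel_measurable (FN t)"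
proof -
  have [measurable]: "intN (\<lambda>s. c s - hp_conv q {..t} s) {..t} \<in> borel_measurable (FN t)"
    by (rule intN_meas_FN) auto
  show ?thesis unfolding exp_pred_def[abs_def] by measurable
qed

lemma exp_proc_meas:
  assumes q: "q \<in> borel_measurable borel" and c: "c \<in> borel_measurable borel"
  shows "exp_proc c q t \<in> borel_measurable M"
proof -
  have [measurable]: "intN c {..t} \<in> borel_measurable M" "intL q {..t} \<in> borel_measurable M"
    by (rule intN_meas[OF c] intL_meas[OF q]; simp)+
  show ?thesis unfolding exp_proc_def[abs_def] by measurable
qed

section \<open>Constancy of the expectation of the exponential\<close>

context
  fixes c q :: "real \<Rightarrow> complex"
  assumes ci: "integrable lborel c" and qi: "integrable lborel q" and qc: "\<And>t. q t = exp (c t) - 1"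
    and H: "\<And>s t. s \<le> t \<Longrightarrow> Re (c s - hp_conv q {..t} s) \<le> 0"
begin

lemma cm[measurable]: "c \<in> borel_measurable borel" and qm[measurable]: "q \<in> borel_measurable borel"
  using ci qi by auto

definition "exp_bd = exp (\<nu> * (\<integral>r. norm (q r) \<partial>lborel))"

definition "regular \<omega> \<longleftrightarrow> simp_at \<omega> \<and> path_integrable q \<omega> \<and> path_integrable c \<omega>"

lemma AE_regular: "AE \<omega> in M. regular \<omega>"
  using AE_simp_at AE_path_integrable[OF ci] AE_path_integrable[OF qi] by eventually_elim (simp add: regular_def)

lemma regular_space: "regular \<omega> \<Longrightarrow> \<omega> \<in> space M" by (simp add: regular_def simp_at_def)

lemma exp_proc_bound: "regular \<omega> \<Longrightarrow> norm (exp_proc c q t \<omega>) \<le> exp_bd"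
  using exp_proc_eq_exp_pred[of \<omega> q c t] exp_pred_bound[OF qi cm H, of t \<omega>] qi cm by (simp add: regular_def exp_bd_def)

lemma jp: "regular \<omega> \<Longrightarrow> jump_path (N \<omega>) c (\<lambda>t. q t * of_real (lam_real t \<omega>))"
  using path_integrable_N_int[of c \<omega>] path_integrable_N_int[of q \<omega>] path_integrable_lam_real_int[of q \<omega>]
  by (intro jump_path_N) (auto simp: regular_def qc[symmetric])

lemma exp_proc_jp: "regular \<omega> \<Longrightarrow> exp_proc c q t \<omega> = jump_path.E (N \<omega>) c (\<lambda>t. q t * of_real (lam_real t \<omega>)) t"
  using jp[of \<omega>] by (simp add: exp_proc_def jump_path.E_def jump_path.J_def jump_path.\<Phi>_def intN_def intL_def)

text \<open>Riemann sums for the increment of the exponential, with weights at the left endpoints,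
  so that every summand has mean zero. The weights are \<open>exp_pred\<close>, which is adapted and
  bounded everywhere, whereas \<open>exp_proc\<close> agrees with it on regular paths.\<close>

definition "exp_step a b m \<omega> = (\<Sum>k<Suc m. exp_pred c q (a + (b - a) / real (Suc m) * real k) \<omega> *
   (intN q {a + (b - a) / real (Suc m) * real k<..a + (b - a) / real (Suc m) * real (Suc k)} \<omega>
    - intL q {a + (b - a) / real (Suc m) * real k<..a + (b - a) / real (Suc m) * real (Suc k)} \<omega>))"

lemma exp_step_int: "integrable M (exp_step a b m)" "(\<integral>\<omega>. exp_step a b m \<omega> \<partial>M) = 0"
proof -
  let ?t = "\<lambda>k. a + (b - a) / real (Suc m) * real k"
  note md = mart_diff[OF qi exp_pred_meas_FN[OF qm cm] exp_pred_bound[OF qi cm H]]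
  have i: "integrable M (\<lambda>\<omega>. exp_pred c q (?t k) \<omega> * (intN q {?t k<..?t (Suc k)} \<omega> - intL q {?t k<..?t (Suc k)} \<omega>))" for k
    by (rule md(1))
  have z: "(\<integral>\<omega>. exp_pred c q (?t k) \<omega> * (intN q {?t k<..?t (Suc k)} \<omega> - intL q {?t k<..?t (Suc k)} \<omega>) \<partial>M) = 0" for k
    by (rule md(2))
  show "integrable M (exp_step a b m)" unfolding exp_step_def[abs_def] by (intro Bochner_Integration.integrable_sum i)
  show "(\<integral>\<omega>. exp_step a b m \<omega> \<partial>M) = 0" unfolding exp_step_def by (subst Bochner_Integration.integral_sum[OF i]) (simp only: z sum.neutral_const)
qed

text \<open>The sums are integrals of step functions against the points minus the compensator. The
  step functions converge to the left limit of the exponential, so by dominated convergence the sums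
  converge to the right side of \<open>jump_identity\<close>, that is, to the increment.\<close>

lemma exp_step_path:
  assumes ok: "regular \<omega>" and ab: "a < b"
  shows "norm (exp_step a b m \<omega>) \<le> exp_bd * path_bound q \<omega>" "(\<lambda>m. exp_step a b m \<omega>) \<longlonglongrightarrow> exp_proc c q b \<omega> - exp_proc c q a \<omega>"
proof -
  have w: "\<omega> \<in> space M" using ok by (rule regular_space)
  note s = sets_N[OF w]
  note [measurable_cong] = s
  have g: "path_integrable q \<omega>" using ok by (simp add: regular_def)
  interpret J: jump_path "N \<omega>" c "\<lambda>t. q t * of_real (lam_real t \<omega>)" by (rule jp[OF ok])
  define e where "e m t = (\<Sum>k<Suc m. exp_proc c q (a + (b - a) / real (Suc m) * real k) \<omega> *
     indicator {a + (b - a) / real (Suc m) * real k<..a + (b - a) / real (Suc m) * real (Suc k)} t)" for m and t :: real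
  have em[measurable]: "e m \<in> borel_measurable borel" for m unfolding e_def[abs_def] by measurable
  have ein: "e m t = exp_proc c q (a + (b - a) / real (Suc m) * (real_of_int \<lceil>(t - a) / ((b - a) / real (Suc m))\<rceil> - 1)) \<omega>" if "t \<in> {a<..b}" for m t
    unfolding e_def using step_sum[of a t b "Suc m" "\<lambda>t. exp_proc c q t \<omega>"] that by simp
  have sub: "{a + (b - a) / real (Suc m) * real k<..a + (b - a) / real (Suc m) * real (Suc k)} \<subseteq> {a<..b}" if "k < Suc m" for k m
  proof -
    have "0 \<le> (b - a) / real (Suc m) * real k" using ab by simp
    moreover have "(b - a) / real (Suc m) * real (Suc k) \<le> (b - a) / real (Suc m) * real (Suc m)"
      using that ab by (intro mult_left_mono) auto
    then have "(b - a) / real (Suc m) * real (Suc k) \<le> b - a" by (simp del: of_nat_Suc)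
    ultimately show ?thesis by auto
  qed
  have eout: "e m t = 0" if "t \<notin> {a<..b}" for m t
    unfolding e_def
  proof (intro sum.neutral ballI)
    fix k assume "k \<in> {..<Suc m}"
    then have "t \<notin> {a + (b - a) / real (Suc m) * real k<..a + (b - a) / real (Suc m) * real (Suc k)}" using sub[of k m] that by blast
    then show "exp_proc c q (a + (b - a) / real (Suc m) * real k) \<omega> * indicator {a + (b - a) / real (Suc m) * real k<..a + (b - a) / real (Suc m) * real (Suc k)} t = 0"
      by (simp only: indicator_simps not_False_eq_True mult_zero_right)
  qed
  have eb: "norm (e m t) \<le> exp_bd" for m t
  proof (cases "t \<in> {a<..b}")
    case True
    then show ?thesis using exp_proc_bound[OF ok] by (simp add: ein del: of_nat_Suc)
  next
    case False
    then show ?thesis by (simp add: eout exp_bd_def)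
  qed
  have ie: "(\<integral>t. indicator UNIV t * (e m t * f t) \<partial>L) = (\<Sum>k<Suc m. exp_proc c q (a + (b - a) / real (Suc m) * real k) \<omega> *
      (\<integral>t. indicator {a + (b - a) / real (Suc m) * real k<..a + (b - a) / real (Suc m) * real (Suc k)} t * f t \<partial>L))"
    if f: "integrable L f" and sL: "sets L = sets borel" for f and L :: "real measure" and m
  proof -
    let ?I = "\<lambda>k. {a + (b - a) / real (Suc m) * real k<..a + (b - a) / real (Suc m) * real (Suc k)}"
    have "(\<integral>t. indicator UNIV t * (e m t * f t) \<partial>L) = (\<integral>t. (\<Sum>k<Suc m. exp_proc c q (a + (b - a) / real (Suc m) * real k) \<omega> * (indicator (?I k) t * f t)) \<partial>L)"
      by (intro Bochner_Integration.integral_cong refl) (simp only: e_def sum_distrib_right mult.assoc indicator_simps UNIV_I mult_1_left)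
    also have "\<dots> = (\<Sum>k<Suc m. (\<integral>t. exp_proc c q (a + (b - a) / real (Suc m) * real k) \<omega> * (indicator (?I k) t * f t) \<partial>L))"
      by (intro Bochner_Integration.integral_sum integrable_mult_right integrable_ind_mult f) (simp add: sL)
    finally show ?thesis by simp
  qed
  \<comment> \<open>Regularity of the path allows \<open>exp_pred\<close> to be replaced by
    \<open>exp_proc\<close>; the sum over the partition is then one integral of the step function
    \<open>e m\<close> for each of the two measures.\<close>
  have SSe: "exp_step a b m \<omega> = (\<integral>t. indicator UNIV t * (e m t * q t) \<partial>N \<omega>) - (\<integral>t. indicator UNIV t * (e m t * (q t * of_real (lam_real t \<omega>))) \<partial>lborel)" for m
    unfolding ie[OF path_integrable_N_int[OF g qm] s] ie[OF path_integrable_lam_real_int[OF g qm] sets_lborel] exp_step_def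
    using ok exp_proc_eq_exp_pred[of \<omega> q c] qi cm
    by (simp add: regular_def intN_def intL_def sum_subtractf[symmetric] right_diff_distrib del: sum.lessThan_Suc of_nat_Suc)
  show "norm (exp_step a b m \<omega>) \<le> exp_bd * path_bound q \<omega>"
    unfolding SSe by (rule path_integrable_bounds[OF g qm _ eb em]) simp
  have lim: "(\<lambda>m. e m t) \<longlonglongrightarrow> indicator {a<..b} t * J.L t" for t
  proof (cases "t \<in> {a<..b}")
    case True
    then have "(\<lambda>m. J.E (a + (b - a) / real (Suc m) * (real_of_int \<lceil>(t - a) / ((b - a) / real (Suc m))\<rceil> - 1))) \<longlonglongrightarrow> J.L t"
      using step_limit[of a t b] ab by (intro J.E_tendsto_L) auto
    then show ?thesis using True by (simp add: ein exp_proc_jp[OF ok] del: of_nat_Suc)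
  next
    case False
    then show ?thesis by (simp add: eout)
  qed
  have lI: "(\<lambda>m. \<integral>t. indicator UNIV t * (e m t * f t) \<partial>L) \<longlonglongrightarrow> (\<integral>t. indicator {a<..b} t * (f t * J.L t) \<partial>L)"
    if f: "integrable L f" and sL[measurable_cong]: "sets L = sets borel" for f and L :: "real measure"
  proof (rule integral_dominated_convergence[where w="\<lambda>t. exp_bd * norm (f t)"])
    note [measurable] = borel_measurable_integrable[OF f]
    show "(\<lambda>t. indicator {a<..b} t * (f t * J.L t)) \<in> borel_measurable L" by measurable
    show "(\<lambda>t. indicator UNIV t * (e m t * f t)) \<in> borel_measurable L" for m by measurable
    show "AE t in L. (\<lambda>m. indicator UNIV t * (e m t * f t)) \<longlonglongrightarrow> indicator {a<..b} t * (f t * J.L t)"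
    proof (rule AE_I2)
      fix t
      have "(\<lambda>m. e m t * f t) \<longlonglongrightarrow> (indicator {a<..b} t * J.L t) * f t" by (intro tendsto_intros lim)
      then show "(\<lambda>m. indicator UNIV t * (e m t * f t)) \<longlonglongrightarrow> indicator {a<..b} t * (f t * J.L t)" by (simp add: mult_ac)
    qed
    show "AE t in L. norm (indicator UNIV t * (e m t * f t)) \<le> exp_bd * norm (f t)" for m
      using eb by (intro AE_I2) (simp add: norm_mult mult_right_mono)
  qed (use f in auto)
  have "(\<lambda>m. exp_step a b m \<omega>) \<longlonglongrightarrow> (\<integral>t. indicator {a<..b} t * (q t * J.L t) \<partial>N \<omega>) - (\<integral>t. indicator {a<..b} t * (q t * of_real (lam_real t \<omega>) * J.L t) \<partial>lborel)"
    unfolding SSe by (intro tendsto_diff lI path_integrable_N_int[OF g qm] s path_integrable_lam_real_int[OF g qm] sets_lborel)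
  also have "(\<integral>t. indicator {a<..b} t * (q t * J.L t) \<partial>N \<omega>) - (\<integral>t. indicator {a<..b} t * (q t * of_real (lam_real t \<omega>) * J.L t) \<partial>lborel) = J.E b - J.E a"
    using J.jump_identity_all[OF less_imp_le[OF ab]] unfolding J.jump_identity_def qc[symmetric] by simp
  finally show "(\<lambda>m. exp_step a b m \<omega>) \<longlonglongrightarrow> exp_proc c q b \<omega> - exp_proc c q a \<omega>" by (simp add: exp_proc_jp[OF ok])
qed

lemma exp_proc_int: "integrable M (exp_proc c q t)"
  by (rule integrable_const_bound[of _ exp_bd]) (use AE_regular exp_proc_bound exp_proc_meas[OF qm cm] in \<open>auto elim: AE_mp\<close>)

lemma exp_proc_const: "a < b \<Longrightarrow> (\<integral>\<omega>. exp_proc c q b \<omega> \<partial>M) = (\<integral>\<omega>. exp_proc c q a \<omega> \<partial>M)"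
proof -
  assume ab: "a < b"
  have "(\<lambda>m. \<integral>\<omega>. exp_step a b m \<omega> \<partial>M) \<longlonglongrightarrow> (\<integral>\<omega>. exp_proc c q b \<omega> - exp_proc c q a \<omega> \<partial>M)"
  proof (rule integral_dominated_convergence[where w="\<lambda>\<omega>. exp_bd * path_bound q \<omega>"])
    show "integrable M (\<lambda>\<omega>. exp_bd * path_bound q \<omega>)" using path_bound_int[OF qi] by simp
    show "AE \<omega> in M. (\<lambda>m. exp_step a b m \<omega>) \<longlonglongrightarrow> exp_proc c q b \<omega> - exp_proc c q a \<omega>"
      using AE_regular by eventually_elim (rule exp_step_path(2)[OF _ ab])
    show "AE \<omega> in M. norm (exp_step a b m \<omega>) \<le> exp_bd * path_bound q \<omega>" for m
      using AE_regular by eventually_elim (rule exp_step_path(1)[OF _ ab])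
  qed (use exp_step_int(1) exp_proc_meas[OF qm cm] in \<open>auto intro!: borel_measurable_diff\<close>)
  then have "(\<lambda>m. 0 :: complex) \<longlonglongrightarrow> (\<integral>\<omega>. exp_proc c q b \<omega> - exp_proc c q a \<omega> \<partial>M)" by (simp add: exp_step_int(2))
  then have "(\<integral>\<omega>. exp_proc c q b \<omega> - exp_proc c q a \<omega> \<partial>M) = 0" by (simp add: tendsto_const_iff)
  then show ?thesis using exp_proc_int by simp
qed

text \<open>The expectation is constant in time and is followed to both ends of the line: towards
  minus infinity both integrals over \<open>{..t}\<close> disappear and the exponential tends to 1,
  towards plus infinity it tends to the full exponential. Both limits are dominated by
  \<open>exp_bd\<close>.\<close>

lemma exp_mart: "(\<integral>\<omega>. exp (intN c UNIV \<omega> - intL q UNIV \<omega>) \<partial>M) = 1"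
proof -
  have conv: "(\<lambda>n. exp_proc c q (- real n) \<omega>) \<longlonglongrightarrow> 1 \<and> (\<lambda>n. exp_proc c q (real n) \<omega>) \<longlonglongrightarrow> exp (intN c UNIV \<omega> - intL q UNIV \<omega>)" if ok: "regular \<omega>" for \<omega>
  proof
    have g: "path_integrable q \<omega>" "path_integrable c \<omega>" using ok by (auto simp: regular_def)
    note l1 = ind_tail_limits[OF path_integrable_N_int[OF g(2) cm] sets_N[OF regular_space[OF ok]]]
    note l2 = ind_tail_limits[OF path_integrable_lam_real_int[OF g(1) qm] sets_lborel]
    have "(\<lambda>n. exp_proc c q (- real n) \<omega>) \<longlonglongrightarrow> exp (0 - 0)"
      unfolding exp_proc_def intN_def intL_def by (intro tendsto_intros l1 l2)
    then show "(\<lambda>n. exp_proc c q (- real n) \<omega>) \<longlonglongrightarrow> 1" by simp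
    show "(\<lambda>n. exp_proc c q (real n) \<omega>) \<longlonglongrightarrow> exp (intN c UNIV \<omega> - intL q UNIV \<omega>)"
      unfolding exp_proc_def intN_def intL_def using l1 l2 by (simp, intro tendsto_intros)
  qed
  have lim: "(\<lambda>n. \<integral>\<omega>. exp_proc c q (g n) \<omega> \<partial>M) \<longlonglongrightarrow> (\<integral>\<omega>. l \<omega> \<partial>M)"
    if l: "\<And>\<omega>. regular \<omega> \<Longrightarrow> (\<lambda>n. exp_proc c q (g n) \<omega>) \<longlonglongrightarrow> l \<omega>" and lm: "l \<in> borel_measurable M" for g l
  proof (rule integral_dominated_convergence[where w="\<lambda>_. exp_bd"])
    show "AE \<omega> in M. (\<lambda>n. exp_proc c q (g n) \<omega>) \<longlonglongrightarrow> l \<omega>" using AE_regular by eventually_elim (rule l)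
    show "AE \<omega> in M. norm (exp_proc c q (g n) \<omega>) \<le> exp_bd" for n using AE_regular by eventually_elim (rule exp_proc_bound)
  qed (use lm exp_proc_meas[OF qm cm] in auto)
  have l1: "(\<lambda>n. \<integral>\<omega>. exp_proc c q (- real n) \<omega> \<partial>M) \<longlonglongrightarrow> (\<integral>\<omega>. 1 \<partial>M)" by (rule lim) (use conv in auto)
  have l2: "(\<lambda>n. \<integral>\<omega>. exp_proc c q (real n) \<omega> \<partial>M) \<longlonglongrightarrow> (\<integral>\<omega>. exp (intN c UNIV \<omega> - intL q UNIV \<omega>) \<partial>M)"
    by (rule lim) (use conv intN_meas[OF cm, of UNIV] intL_meas[OF qm, of UNIV] in auto)
  have ev: "eventually (\<lambda>n. (\<integral>\<omega>. exp_proc c q (- real n) \<omega> \<partial>M) = (\<integral>\<omega>. exp_proc c q (real n) \<omega> \<partial>M)) sequentially"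
    by (intro eventually_sequentiallyI[of 1]) (intro exp_proc_const[symmetric], linarith)
  have "(\<integral>\<omega>. 1 \<partial>M) = (\<integral>\<omega>. exp (intN c UNIV \<omega> - intL q UNIV \<omega>) \<partial>M)"
    by (rule LIMSEQ_unique[OF Lim_transform_eventually[OF l1 ev] l2])
  then show ?thesis by (simp add: prob_space)
qed

end

end

subsection \<open>The law of the compensated integral\<close>

text \<open>\<open>f x\<close> is the average of \<open>g\<close> over an interval of length
  \<open>e\<close> to the right of \<open>x\<close>. By the mean value theorem it is a value of
  \<open>g\<close> within this interval, which gives the distance \<open>e\<close> and preserves
  bounds; its derivative is a difference quotient of \<open>g\<close>.\<close>

lemma lipschitz_smoothing:
  fixes g :: "real \<Rightarrow> real"
  assumes g: "1-lipschitz_on UNIV g" and e: "e > 0"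
  obtains f f' where "\<And>x. (f has_real_derivative f' x) (at x)" "\<And>x. \<bar>f' x\<bar> \<le> 1" "\<And>x. \<bar>f x - g x\<bar> \<le> e"
    "\<And>x K. (\<And>y. \<bar>g y\<bar> \<le> K) \<Longrightarrow> \<bar>f x\<bar> \<le> K"
proof -
  have gc: "isCont g x" for x
    using lipschitz_on_continuous_on[OF g] by (simp add: continuous_on_eq_continuous_at)
  have gl: "\<bar>g x - g y\<bar> \<le> \<bar>x - y\<bar>" for x y using lipschitz_onD[OF g, of x y] by (simp add: dist_real_def)
  have "\<exists>F. \<forall>x. -\<infinity> < ereal x \<longrightarrow> ereal x < \<infinity> \<longrightarrow> (F has_vector_derivative g x) (at x)"
    by (rule einterval_antiderivative) (auto intro: gc)
  then obtain F where F: "\<And>x. (F has_real_derivative g x) (at x)" by (auto simp: has_real_derivative_iff_has_vector_derivative)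
  define f where "f x = (F (x + e) - F x) / e" for x
  have mv: "\<exists>z. x < z \<and> z < x + e \<and> f x = g z" for x
  proof -
    obtain z where "z > x" "z < x + e" "F (x + e) - F x = (x + e - x) * g z"
      using MVT2[of x "x + e" F g] F e by auto
    then show ?thesis using e by (auto simp: f_def)
  qed
  show ?thesis
  proof (rule that[of f "\<lambda>x. (g (x + e) - g x) / e"])
    show "(f has_real_derivative (g (x + e) - g x) / e) (at x)" for x
      unfolding f_def[abs_def]
      by (intro DERIV_cdivide DERIV_diff F) (use F[of "x + e"] in \<open>simp add: DERIV_shift\<close>)
    show "\<bar>(g (x + e) - g x) / e\<bar> \<le> 1" for x
    proof -
      have "\<bar>g (x + e) - g x\<bar> \<le> e" using gl[of "x + e" x] e by simp
      then show ?thesis using e by (simp add: pos_divide_le_eq)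
    qed
    show "\<bar>f x - g x\<bar> \<le> e" for x
    proof -
      obtain z where "x < z" "z < x + e" "f x = g z" using mv by blast
      then show ?thesis using gl[of z x] by simp
    qed
    show "\<bar>f x\<bar> \<le> K" if "\<And>y. \<bar>g y\<bar> \<le> K" for x K using mv[of x] that by auto
  qed
qed

lemma lipschitz_integrable:
  fixes g :: "real \<Rightarrow> real"
  assumes "real_distribution P" and i: "integrable P (\<lambda>x. x)" and g: "1-lipschitz_on UNIV g"
  shows "integrable P g"
proof -
  interpret P: real_distribution P by fact
  have "continuous_on UNIV g" by (rule lipschitz_on_continuous_on[OF g])
  then have m: "g \<in> borel_measurable borel" by (rule borel_measurable_continuous_onI)
  have b: "\<bar>g x\<bar> \<le> \<bar>g 0\<bar> + \<bar>x\<bar>" for x using lipschitz_onD[OF g, of x 0] by (simp add: dist_real_def)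
  show ?thesis
  proof (rule Bochner_Integration.integrable_bound)
    show "integrable P (\<lambda>x. \<bar>g 0\<bar> + \<bar>x\<bar>)" by (intro Bochner_Integration.integrable_add integrable_abs i) simp
    show "g \<in> borel_measurable P" by (subst measurable_cong_sets[OF P.events_eq_borel refl]) (rule m)
    show "AE x in P. norm (g x) \<le> norm (\<bar>g 0\<bar> + \<bar>x\<bar>)"
      by (rule AE_I2) (unfold real_norm_def, rule order_trans[OF b abs_ge_self])
  qed
qed

text \<open>Weak convergence controls bounded test functions and the Stein estimate differentiable
  ones. General Lipschitz functions are reached by averaging a bounded one over short intervals and
  then by cutting off at height \<open>n\<close>; the first moments dominate the second
  limit.\<close>

lemma wasserstein_test_smooth:
  fixes g :: "real \<Rightarrow> real"
  assumes P: "real_distribution P" and Q: "real_distribution Q"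
    and iP: "integrable P (\<lambda>x. x)" and iQ: "integrable Q (\<lambda>x. x)"
    and sm: "\<And>f f' K. (\<And>x. (f has_real_derivative f' x) (at x)) \<Longrightarrow> (\<And>x. \<bar>f' x\<bar> \<le> 1) \<Longrightarrow> (\<And>x. \<bar>f x\<bar> \<le> K) \<Longrightarrow>
      \<bar>(\<integral>x. f x \<partial>P) - (\<integral>x. f x \<partial>Q)\<bar> \<le> B"
    and g: "1-lipschitz_on UNIV g"
  shows "\<bar>(\<integral>x. g x \<partial>P) - (\<integral>x. g x \<partial>Q)\<bar> \<le> B"
proof -
  interpret P: real_distribution P by fact
  interpret Q: real_distribution Q by fact
  have bdd: "\<bar>(\<integral>x. k x \<partial>P) - (\<integral>x. k x \<partial>Q)\<bar> \<le> B" if k: "1-lipschitz_on UNIV k" and kK: "\<And>x. \<bar>k x\<bar> \<le> K" for k :: "real \<Rightarrow> real" and K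
  proof (rule field_le_epsilon)
    fix e :: real assume e: "e > 0"
    obtain f f' where f: "\<And>x. (f has_real_derivative f' x) (at x)" "\<And>x. \<bar>f' x\<bar> \<le> 1" "\<And>x. \<bar>f x - k x\<bar> \<le> e / 2"
      "\<And>x K. (\<And>y. \<bar>k y\<bar> \<le> K) \<Longrightarrow> \<bar>f x\<bar> \<le> K" using lipschitz_smoothing[OF k, of "e / 2"] e by auto
    have fl: "1-lipschitz_on UNIV f"
    proof (rule lipschitz_onI)
      fix x y :: real
      show "dist (f x) (f y) \<le> 1 * dist x y"
        using field_differentiable_bound[of UNIV f f' 1 x y] f by (simp add: dist_norm)
    qed simp
    have main: "\<bar>(\<integral>x. f x \<partial>P) - (\<integral>x. f x \<partial>Q)\<bar> \<le> B" by (rule sm[OF f(1,2)]) (rule f(4)[OF kK])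
    have d: "\<bar>(\<integral>x. f x \<partial>L) - (\<integral>x. k x \<partial>L)\<bar> \<le> e / 2" if L: "real_distribution L" and iL: "integrable L (\<lambda>x. x)" for L
    proof -
      interpret L: real_distribution L by fact
      note fi = lipschitz_integrable[OF L iL fl] and ki = lipschitz_integrable[OF L iL k]
      have "(\<integral>x. f x \<partial>L) - (\<integral>x. k x \<partial>L) = (\<integral>x. f x - k x \<partial>L)" using fi ki by simp
      also have "\<bar>(\<integral>x. f x - k x \<partial>L)\<bar> \<le> (\<integral>x. \<bar>f x - k x\<bar> \<partial>L)" by (rule integral_abs_bound)
      also have "\<dots> \<le> (\<integral>x. e / 2 \<partial>L)" by (intro integral_mono integrable_abs Bochner_Integration.integrable_diff fi ki f(3)) auto
      finally show ?thesis using L.prob_space by simp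
    qed
    show "\<bar>(\<integral>x. k x \<partial>P) - (\<integral>x. k x \<partial>Q)\<bar> \<le> B + e" using d[OF P iP] d[OF Q iQ] main by linarith
  qed
  define t where "t n x = max (- real n) (min (real n) (g x))" for n x
  have tl: "1-lipschitz_on UNIV (t n)" for n
  proof (rule lipschitz_onI)
    fix x y :: real
    show "dist (t n x) (t n y) \<le> 1 * dist x y" using lipschitz_onD[OF g, of x y] by (auto simp: t_def dist_real_def)
  qed simp
  have lim: "(\<lambda>n. \<integral>x. t n x \<partial>L) \<longlonglongrightarrow> (\<integral>x. g x \<partial>L)" if L: "real_distribution L" and iL: "integrable L (\<lambda>x. x)" for L
  proof (rule integral_dominated_convergence[where w="\<lambda>x. \<bar>g x\<bar>"])
    note gi = lipschitz_integrable[OF L iL g]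
    show "integrable L (\<lambda>x. \<bar>g x\<bar>)" using gi by simp
    show "g \<in> borel_measurable L" using gi by simp
    show "t n \<in> borel_measurable L" for n using lipschitz_integrable[OF L iL tl[of n]] by simp
    show "AE x in L. (\<lambda>n. t n x) \<longlonglongrightarrow> g x"
    proof (rule AE_I2)
      fix x
      obtain k where k: "\<bar>g x\<bar> < real k" using reals_Archimedean2 by blast
      have "eventually (\<lambda>n. t n x = g x) sequentially"
        by (rule eventually_sequentiallyI[of k]) (use k in \<open>auto simp: t_def max_def min_def\<close>)
      then show "(\<lambda>n. t n x) \<longlonglongrightarrow> g x" by (rule tendsto_eventually)
    qed
    show "AE x in L. norm (t n x) \<le> \<bar>g x\<bar>" for n by (rule AE_I2) (auto simp: t_def)
  qed
  have "(\<lambda>n. \<bar>(\<integral>x. t n x \<partial>P) - (\<integral>x. t n x \<partial>Q)\<bar>) \<longlonglongrightarrow> \<bar>(\<integral>x. g x \<partial>P) - (\<integral>x. g x \<partial>Q)\<bar>"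
    by (intro tendsto_intros lim P Q iP iQ)
  moreover have "\<bar>(\<integral>x. t n x \<partial>P) - (\<integral>x. t n x \<partial>Q)\<bar> \<le> B" for n
  proof (rule bdd[OF tl])
    fix x :: real
    show "\<bar>t n x\<bar> \<le> real n" unfolding t_def by linarith
  qed
  ultimately show ?thesis by (intro LIMSEQ_le_const2) blast+
qed

context hawkes
begin

lemma hawkes_delta_lam_real: "hawkes_delta \<nu> h N u \<omega> = (\<integral>t. u t \<partial>N \<omega>) - (\<integral>t. u t * lam_real t \<omega> \<partial>lborel)"
  by (simp add: hawkes_delta_def lam_real_def lam_def)

lemma hawkes_delta_complex:
  "complex_of_real (hawkes_delta \<nu> h N u \<omega>) = intN (\<lambda>t. of_real (u t)) UNIV \<omega> - intL (\<lambda>t. of_real (u t)) UNIV \<omega>"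
  unfolding hawkes_delta_lam_real intN_def intL_def by (simp add: integral_complex_of_real flip: of_real_mult)

lemma hawkes_delta_meas:
  assumes "u \<in> borel_measurable borel"
  shows "hawkes_delta \<nu> h N u \<in> borel_measurable M"
proof -
  have [measurable]: "intN (\<lambda>t. of_real (u t)) UNIV \<in> borel_measurable M" "intL (\<lambda>t. of_real (u t)) UNIV \<in> borel_measurable M"
    using assms by (auto intro!: intN_meas intL_meas)
  have "hawkes_delta \<nu> h N u = (\<lambda>\<omega>. Re (intN (\<lambda>t. of_real (u t)) UNIV \<omega> - intL (\<lambda>t. of_real (u t)) UNIV \<omega>))"
    unfolding hawkes_delta_complex[symmetric] by simp
  then show ?thesis by simp
qed

text \<open>The integrals of \<open>\<bar>u\<bar>\<close> against the points and against the
  intensity have the same mean, \<open>mean_rate\<close> times the L1 norm of \<open>u\<close>;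
  hence the factor 2. Default values of Bochner integrals only decrease the left side.\<close>

lemma E_abs_delta:
  assumes u: "integrable lborel u"
  shows "(\<integral>\<^sup>+\<omega>. ennreal \<bar>hawkes_delta \<nu> h N u \<omega>\<bar> \<partial>M) \<le> ennreal (2 * mean_rate * (\<integral>t. \<bar>u t\<bar> \<partial>lborel))"
proof -
  have [measurable]: "u \<in> borel_measurable borel" using u by auto
  let ?A = "\<lambda>\<omega>. \<integral>\<^sup>+t. ennreal \<bar>u t\<bar> \<partial>N \<omega>" and ?B = "\<lambda>\<omega>. \<integral>\<^sup>+t. ennreal \<bar>u t\<bar> * lam t \<omega> \<partial>lborel"
  have nb: "ennreal \<bar>\<integral>t. f t \<partial>L\<bar> \<le> (\<integral>\<^sup>+t. ennreal \<bar>f t\<bar> \<partial>L)" for f :: "real \<Rightarrow> real" and L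
    using integral_norm_bound_ennreal[of L f] by (cases "integrable L f") (auto simp: not_integrable_integral_eq)
  have "ennreal \<bar>hawkes_delta \<nu> h N u \<omega>\<bar> \<le> ?A \<omega> + ?B \<omega>" for \<omega>
  proof -
    have "ennreal \<bar>hawkes_delta \<nu> h N u \<omega>\<bar> \<le> ennreal (\<bar>\<integral>t. u t \<partial>N \<omega>\<bar> + \<bar>\<integral>t. u t * lam_real t \<omega> \<partial>lborel\<bar>)"
      unfolding hawkes_delta_lam_real by (intro ennreal_leI) (rule abs_triangle_ineq4)
    also have "\<dots> = ennreal \<bar>\<integral>t. u t \<partial>N \<omega>\<bar> + ennreal \<bar>\<integral>t. u t * lam_real t \<omega> \<partial>lborel\<bar>" by simp
    also have "\<dots> \<le> ?A \<omega> + (\<integral>\<^sup>+t. ennreal \<bar>u t * lam_real t \<omega>\<bar> \<partial>lborel)" by (intro add_mono nb)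
    also have "(\<integral>\<^sup>+t. ennreal \<bar>u t * lam_real t \<omega>\<bar> \<partial>lborel) \<le> ?B \<omega>"
    proof (rule nn_integral_mono)
      fix t
      have "ennreal (enn2real (lam t \<omega>)) \<le> lam t \<omega>" by (cases "lam t \<omega>") auto
      then show "ennreal \<bar>u t * lam_real t \<omega>\<bar> \<le> ennreal \<bar>u t\<bar> * lam t \<omega>"
        by (simp add: lam_real_def abs_mult ennreal_mult mult_left_mono)
    qed
    finally show ?thesis by (simp add: add_left_mono)
  qed
  then have "(\<integral>\<^sup>+\<omega>. ennreal \<bar>hawkes_delta \<nu> h N u \<omega>\<bar> \<partial>M) \<le> (\<integral>\<^sup>+\<omega>. ?A \<omega> + ?B \<omega> \<partial>M)" by (intro nn_integral_mono)
  also have "\<dots> = (\<integral>\<^sup>+\<omega>. ?A \<omega> \<partial>M) + (\<integral>\<^sup>+\<omega>. ?B \<omega> \<partial>M)"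
    by (intro nn_integral_add lam_q_meas N.mq) auto
  also have "\<dots> = ennreal mean_rate * ennreal (\<integral>t. \<bar>u t\<bar> \<partial>lborel) + ennreal mean_rate * ennreal (\<integral>t. \<bar>u t\<bar> \<partial>lborel)"
    using u by (simp add: campbell E_lam_q nn_integral_eq_integral)
  also have "\<dots> = ennreal (2 * mean_rate * (\<integral>t. \<bar>u t\<bar> \<partial>lborel))"
    using mean_rate_pos by (simp add: ennreal_mult[symmetric] ennreal_plus[symmetric] del: ennreal_plus)
  finally show ?thesis .
qed

lemma delta_int:
  assumes u: "integrable lborel u"
  shows "integrable M (hawkes_delta \<nu> h N u)"
  using E_abs_delta[OF u] hawkes_delta_meas[of u] u by (auto simp: integrable_iff_bounded intro: le_less_trans)

lemma delta_diff:
  assumes u: "integrable lborel u" and v: "integrable lborel v"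
  shows "AE \<omega> in M. hawkes_delta \<nu> h N u \<omega> - hawkes_delta \<nu> h N v \<omega> = hawkes_delta \<nu> h N (\<lambda>t. u t - v t) \<omega>"
proof -
  let ?c = "\<lambda>u t. complex_of_real (u t)"
  have [measurable]: "u \<in> borel_measurable borel" "v \<in> borel_measurable borel" using u v by auto
  have "AE \<omega> in M. path_integrable (?c u) \<omega>" "AE \<omega> in M. path_integrable (?c v) \<omega>" by (intro AE_path_integrable; use u v in simp)+
  then show ?thesis
  proof eventually_elim
    case (elim \<omega>)
    have m: "?c u \<in> borel_measurable borel" "?c v \<in> borel_measurable borel" by measurable
    note gn = path_integrable_N_int[OF elim(1) m(1)] path_integrable_N_int[OF elim(2) m(2)]
    note gl = path_integrable_lam_real_int[OF elim(1) m(1)] path_integrable_lam_real_int[OF elim(2) m(2)]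
    have "complex_of_real (hawkes_delta \<nu> h N u \<omega> - hawkes_delta \<nu> h N v \<omega>) = complex_of_real (hawkes_delta \<nu> h N (\<lambda>t. u t - v t) \<omega>)"
      unfolding of_real_diff hawkes_delta_complex intN_def intL_def using gn gl by (simp add: left_diff_distrib)
    then show ?case by (simp only: of_real_eq_iff)
  qed
qed

lemma hp_conv_UNIV: "hp_conv q UNIV t = (\<integral>s. of_real (hp s) * q (t + s) \<partial>lborel)"
  unfolding hp_conv_def by (subst lborel_integral_real_affine[of 1 _ t]) simp_all

text \<open>Young's inequality for the L1 norm: integrating against the kernel multiplies the norm
  by at most \<mu>.\<close>

lemma hp_conv_UNIV_int:
  assumes q: "integrable lborel q"
  shows "integrable lborel (hp_conv q UNIV)"
proof -
  have [measurable]: "q \<in> borel_measurable borel" using q by auto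
  have "(\<integral>\<^sup>+t. ennreal (norm (hp_conv q UNIV t)) \<partial>lborel) \<le> (\<integral>\<^sup>+t. (\<integral>\<^sup>+s. ennreal (hp s) * ennreal (norm (q (t + s))) \<partial>lborel) \<partial>lborel)"
  proof (rule nn_integral_mono)
    fix t
    let ?f = "\<lambda>s. of_real (hp s) * q (t + s)"
    have "ennreal (norm (\<integral>s. ?f s \<partial>lborel)) \<le> (\<integral>\<^sup>+s. ennreal (norm (?f s)) \<partial>lborel)"
      using integral_norm_bound_ennreal[of lborel ?f] by (cases "integrable lborel ?f") (auto simp: not_integrable_integral_eq)
    also have "\<dots> = (\<integral>\<^sup>+s. ennreal (hp s) * ennreal (norm (q (t + s))) \<partial>lborel)"
      using hp_nonneg by (intro nn_integral_cong) (simp add: norm_mult ennreal_mult)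
    finally show "ennreal (norm (hp_conv q UNIV t)) \<le> (\<integral>\<^sup>+s. ennreal (hp s) * ennreal (norm (q (t + s))) \<partial>lborel)"
      by (simp add: hp_conv_UNIV)
  qed
  also have "\<dots> = (\<integral>\<^sup>+s. (\<integral>\<^sup>+t. ennreal (hp s) * ennreal (norm (q (t + s))) \<partial>lborel) \<partial>lborel)"
    by (rule lborel_pair.Fubini') measurable
  also have "\<dots> = (\<integral>\<^sup>+s. ennreal (hp s) * (\<integral>\<^sup>+t. ennreal (norm (q t)) \<partial>lborel) \<partial>lborel)"
    using nn_integral_real_affine[of "\<lambda>t. ennreal (norm (q t))" 1] by (simp add: nn_integral_cmult add.commute)
  also have "\<dots> = ennreal \<mu> * (\<integral>\<^sup>+t. ennreal (norm (q t)) \<partial>lborel)" by (simp add: nn_integral_multc nn_hp)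
  finally have le: "(\<integral>\<^sup>+t. ennreal (norm (hp_conv q UNIV t)) \<partial>lborel) \<le> ennreal \<mu> * (\<integral>\<^sup>+t. ennreal (norm (q t)) \<partial>lborel)" .
  have "(\<integral>\<^sup>+t. ennreal (norm (q t)) \<partial>lborel) < \<infinity>" using q unfolding integrable_iff_bounded by (rule conjunct2)
  then have "ennreal \<mu> * (\<integral>\<^sup>+t. ennreal (norm (q t)) \<partial>lborel) < \<infinity>"
    unfolding infinity_ennreal_def ennreal_mult_less_top by (intro disjI2 conjI ennreal_less_top)
  then show ?thesis using le by (intro integrableI_bounded) (simp, rule le_less_trans)
qed

end

lemma (in cluster) window_law_sets:
  assumes "\<nu> > 0"
  shows "sets (window_law \<nu> n) = sets borel"
proof -
  interpret w: weight "window \<nu> n" by (rule weight_window[OF assms])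
  show ?thesis unfolding window_law_def using w.cp_mixture_prob[OF cluster_law_kernel] by (simp add: space_prob_algebra)
qed

section \<open>The law for bounded integrands with bounded support\<close>

context hawkes
begin

context
  fixes u :: "real \<Rightarrow> real" and U T :: real
  assumes um: "u \<in> borel_measurable borel" and ub: "\<And>t. \<bar>u t\<bar> \<le> U" and us: "\<And>t. \<bar>t\<bar> > T \<Longrightarrow> u t = 0"
begin

interpretation cl: cluster hp u \<mu> U T
  using um ub us hp_nonneg hp_zero hp_int mu_eq mu1 by unfold_locales auto

abbreviation "delta_law \<equiv> distr M borel (hawkes_delta \<nu> h N u)"

lemma delta_law_dist: "real_distribution delta_law"
  using hawkes_delta_meas[OF um] by (rule real_distribution_distr)

text \<open>The expectation 1 of the exponential determines the characteristic function of the
  compensated integral as \<open>exp (\<nu> * \<integral> \<kappa>)\<close>. The exponents of the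
  window laws converge to the same \<open>\<nu> * \<integral> \<kappa>\<close>, so no representation
  of the given process by clusters enters.\<close>

lemma delta_char_limit:
  "(\<lambda>n. char (distr (cl.window_law \<nu> n) borel (\<lambda>x. x - cl.an \<nu> n)) \<theta>) \<longlonglongrightarrow> char delta_law \<theta>"
proof -
  obtain \<kappa> where ki: "integrable lborel \<kappa>"
    and k1: "\<And>t. norm (\<kappa> t + 1 + \<i> * of_real (\<theta> * u t)) \<le> 1"
    and k2: "\<And>t. \<kappa> t + 1 + \<i> * of_real (\<theta> * u t) = exp (\<i> * of_real (\<theta> * u t) + (\<integral>s. of_real (hp s) * \<kappa> (t + s) \<partial>lborel))"
    and k3: "(\<lambda>n. \<integral>s. of_real (cl.window \<nu> n s) * (cl.psi n \<theta> s - 1 - \<i> * of_real (\<theta> * u s)) \<partial>lborel) \<longlonglongrightarrow> of_real \<nu> * (\<integral>s. \<kappa> s \<partial>lborel)"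
    using cl.kappa_exists[OF nu] by blast
  have km[measurable]: "\<kappa> \<in> borel_measurable borel" using ki by auto
  note [measurable] = um
  define v where "v t = \<i> * complex_of_real (\<theta> * u t)" for t
  have vi: "integrable lborel v"
    unfolding v_def using cl.u_int by (intro integrable_mult_right integrable_of_real) simp
  \<comment> \<open>\<open>q\<close> is \<psi> - 1. With \<open>c\<close> as defined next,
    \<open>q = exp c - 1\<close> is precisely the fixed point equation of \<kappa>.\<close>
  define q where "q t = v t + \<kappa> t" for t
  define c where "c t = v t + hp_conv \<kappa> UNIV t" for t
  have qi: "integrable lborel q" unfolding q_def by (intro Bochner_Integration.integrable_add vi ki)
  have Gi: "integrable lborel (hp_conv \<kappa> UNIV)" by (rule hp_conv_UNIV_int[OF ki])
  have ci: "integrable lborel c" unfolding c_def by (intro Bochner_Integration.integrable_add vi Gi)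
  have qc: "q t = exp (c t) - 1" for t using k2[of t] by (simp add: q_def c_def v_def hp_conv_UNIV algebra_simps)
  have qm[measurable]: "q \<in> borel_measurable borel" using qi by auto
  have qb: "norm (q t) \<le> 2" for t
    using norm_triangle_ineq4[of "q t + 1" 1] k1[of t] by (simp add: q_def v_def algebra_simps)
  have vb: "norm (v t) \<le> \<bar>\<theta>\<bar> * U" for t unfolding v_def using ub[of t] by (simp add: norm_mult abs_mult mult_left_mono)
  have kb: "norm (\<kappa> t) \<le> 2 + \<bar>\<theta>\<bar> * U" for t using norm_triangle_ineq4[of "q t" "v t"] qb[of t] vb[of t] by (simp add: q_def)
  have Rk: "Re (\<kappa> t) \<le> 0" for t
    using complex_Re_le_cmod[of "\<kappa> t + 1 + \<i> * of_real (\<theta> * u t)"] k1[of t] by simp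
  have Rq: "Re (q t) = Re (\<kappa> t)" for t by (simp add: q_def v_def)
  have hs: "integrable lborel (\<lambda>r. hp (r - s))" for s
    using lborel_integrable_real_affine[OF hp_int, of 1 "- s"] by simp
  have hf: "integrable lborel (\<lambda>r. complex_of_real (hp (r - s)) * f r)"
    if [measurable]: "f \<in> borel_measurable borel" and fb: "\<And>t. norm (f t) \<le> B" for f :: "real \<Rightarrow> complex" and B s
    by (rule Bochner_Integration.integrable_bound[OF integrable_mult_right[OF hs[of s], of B]])
      (use fb[THEN order_trans[OF _ abs_ge_self]] hp_nonneg in \<open>auto intro!: AE_I2 mult_right_mono simp: norm_mult abs_mult mult.commute[of _ "hp _"] mult_left_mono\<close>)
  \<comment> \<open>Since \<open>v\<close> is purely imaginary, \<open>q\<close> and \<kappa> have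
    the same real part. The difference is therefore the integral of
    \<open>hp (r - s) * Re (\<kappa> r)\<close> over \<open>r > t\<close>, and
    \<open>Re (\<kappa> r) \<le> 0\<close>.\<close>
  have H: "Re (c s - hp_conv q {..t} s) \<le> 0" if "s \<le> t" for s t
  proof -
    note i1 = hf[OF km kb, of s] and i2 = integrable_ind_mult[OF hf[OF qm qb, of s], of "{..t}"]
    have i2': "integrable lborel (\<lambda>r. indicator {..t} r * (complex_of_real (hp (r - s)) * q r))" by (rule i2) simp
    have a: "Re (hp_conv \<kappa> UNIV s) = (\<integral>r. hp (r - s) * Re (\<kappa> r) \<partial>lborel)"
      unfolding hp_conv_def using integral_Re[OF i1] by simp
    have b: "Re (hp_conv q {..t} s) = (\<integral>r. Re (indicator {..t} r * (complex_of_real (hp (r - s)) * q r)) \<partial>lborel)"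
      unfolding hp_conv_def using integral_Re[OF i2'] by simp
    have "(\<integral>r. hp (r - s) * Re (\<kappa> r) \<partial>lborel) \<le> (\<integral>r. Re (indicator {..t} r * (complex_of_real (hp (r - s)) * q r)) \<partial>lborel)"
    proof (rule integral_mono)
      show "integrable lborel (\<lambda>r. hp (r - s) * Re (\<kappa> r))" using integrable_Re[OF i1] by simp
      show "integrable lborel (\<lambda>r. Re (indicator {..t} r * (complex_of_real (hp (r - s)) * q r)))" by (rule integrable_Re[OF i2'])
      show "hp (r - s) * Re (\<kappa> r) \<le> Re (indicator {..t} r * (complex_of_real (hp (r - s)) * q r))" for r
        using hp_nonneg[of "r - s"] Rk[of r] by (auto simp: indicator_def Rq mult_nonneg_nonpos)
    qed
    then show ?thesis by (simp add: c_def v_def a b)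
  qed
  have one: "(\<integral>\<omega>. exp (intN c UNIV \<omega> - intL q UNIV \<omega>) \<partial>M) = 1" by (rule exp_mart[OF ci qi qc H])
  have "AE \<omega> in M. exp (intN c UNIV \<omega> - intL q UNIV \<omega>) = exp (- (of_real \<nu> * (\<integral>s. \<kappa> s \<partial>lborel))) * iexp (\<theta> * hawkes_delta \<nu> h N u \<omega>)"
    using AE_path_integrable[OF ki] AE_path_integrable[OF vi] AE_simp_at
  proof eventually_elim
    case (elim \<omega>)
    have vm: "v \<in> borel_measurable borel" using vi by auto
    \<comment> \<open>Fubini turns the compensator of \<kappa> into
      \<open>\<nu> * \<integral> \<kappa>\<close> plus the sum of
      \<open>hp_conv \<kappa> UNIV\<close> over the points. That sum also occurs in the integral of
      \<open>c\<close> and cancels, so what is left of \<kappa> is deterministic.\<close>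
    note L = lam_fubini[OF elim(3,1) ki, of UNIV]
    have n: "intN c UNIV \<omega> = intN v UNIV \<omega> + (\<integral>s. hp_conv \<kappa> UNIV s \<partial>N \<omega>)"
      unfolding intN_def c_def using path_integrable_N_int[OF elim(2) vm] L(1) by simp
    have l: "intL q UNIV \<omega> = intL v UNIV \<omega> + intL \<kappa> UNIV \<omega>"
      unfolding intL_def q_def using path_integrable_lam_real_int[OF elim(2) vm] path_integrable_lam_real_int[OF elim(1) km] by (simp add: distrib_right)
    have l2: "intL \<kappa> UNIV \<omega> = of_real \<nu> * (\<integral>s. \<kappa> s \<partial>lborel) + (\<integral>s. hp_conv \<kappa> UNIV s \<partial>N \<omega>)" using L(2) by simp
    have v: "intN v UNIV \<omega> - intL v UNIV \<omega> = \<i> * of_real (\<theta> * hawkes_delta \<nu> h N u \<omega>)"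
      unfolding of_real_mult hawkes_delta_complex intN_def intL_def v_def
      by (simp add: mult.assoc right_diff_distrib)
    have "intN c UNIV \<omega> - intL q UNIV \<omega> = - (of_real \<nu> * (\<integral>s. \<kappa> s \<partial>lborel)) + \<i> * of_real (\<theta> * hawkes_delta \<nu> h N u \<omega>)"
      unfolding n l l2 v[symmetric] by simp
    then show ?case by (simp only: exp_add)
  qed
  then have "1 = (\<integral>\<omega>. exp (- (of_real \<nu> * (\<integral>s. \<kappa> s \<partial>lborel))) * iexp (\<theta> * hawkes_delta \<nu> h N u \<omega>) \<partial>M)"
    unfolding one[symmetric]
    using intN_meas[of c UNIV] intL_meas[of q UNIV] hawkes_delta_meas[OF um] ci
    by (intro integral_cong_AE borel_measurable_exp borel_measurable_diff borel_measurable_times) auto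
  also have "\<dots> = exp (- (of_real \<nu> * (\<integral>s. \<kappa> s \<partial>lborel))) * char delta_law \<theta>"
    unfolding char_def using hawkes_delta_meas[OF um] by (subst integral_distr) auto
  finally have ch: "char delta_law \<theta> = exp (of_real \<nu> * (\<integral>s. \<kappa> s \<partial>lborel))"
    by (simp add: exp_minus field_simps)
  show ?thesis unfolding ch cl.window_law_char(2)[OF nu] by (intro tendsto_exp k3)
qed

text \<open>Levy's continuity theorem turns the convergence of characteristic functions into weak
  convergence, which carries the estimate of \<open>window_law_stein\<close> over for bounded
  differentiable test functions. On its right side only the windowed variance depends on
  \<open>n\<close>, and it tends to \<open>mean_rate\<close> times the integral of
  \<open>u^2\<close>.\<close>

lemma delta_stein:
  assumes g: "1-lipschitz_on UNIV g"
  shows "\<bar>(\<integral>\<omega>. g (hawkes_delta \<nu> h N u \<omega>) \<partial>M) - (LINT t|lborel. gphi t * g t)\<bar> \<le>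
    sqrt (2 / pi) * \<bar>1 - mean_rate * (LINT t|lborel. (u t)^2)\<bar>
    + \<nu> * ((LINT t|lborel. \<bar>u t\<bar>^3) + \<mu> / (1 - \<mu>) * (sqrt (LINT t|lborel. (u t)^2) * sqrt (LINT t|lborel. (u t)^4))
           + 2 * sqrt (2 / pi) * (\<mu> * (LINT t|lborel. (u t)^2) / (1 - \<mu>)))" (is "_ \<le> ?B")
proof -
  let ?Q = "density lborel (\<lambda>x. ennreal (gphi x))"
  let ?R = "\<lambda>n. distr (cl.window_law \<nu> n) borel (\<lambda>x. x - cl.an \<nu> n)"
  have Qd: "real_distribution ?Q"
    using prob_space_normal_density[of 1 0] by (intro real_distribution.intro real_distribution_axioms.intro) auto
  have Qe: "(\<integral>x. f x \<partial>?Q) = (LINT t|lborel. gphi t * f t)" if [measurable]: "f \<in> borel_measurable borel" for f :: "real \<Rightarrow> real"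
    by (subst integral_density) auto
  have Qi: "integrable ?Q (\<lambda>x. x)"
    using integrable_std_normal_moment[of 1] by (subst integrable_density) auto
  interpret D: real_distribution delta_law by (rule delta_law_dist)
  have dm: "hawkes_delta \<nu> h N u \<in> borel_measurable M" by (rule hawkes_delta_meas[OF um])
  have Di: "integrable delta_law (\<lambda>x. x)"
    using delta_int[of u] cl.u_int dm by (subst integrable_distr_eq) auto
  have wc: "weak_conv_m ?R delta_law"
    by (rule levy_continuity[OF cl.window_law_char(1)[OF nu] delta_law_dist delta_char_limit])
  have "\<bar>(\<integral>x. g x \<partial>delta_law) - (\<integral>x. g x \<partial>?Q)\<bar> \<le> ?B"
  proof (rule wasserstein_test_smooth[OF delta_law_dist Qd Di Qi _ g])
    fix f f' :: "real \<Rightarrow> real" and K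
    assume f: "\<And>x. (f has_real_derivative f' x) (at x)" "\<And>x. \<bar>f' x\<bar> \<le> 1" "\<And>x. \<bar>f x\<bar> \<le> K"
    have fc: "isCont f x" for x using f(1) by (rule DERIV_isCont)
    then have fm[measurable]: "f \<in> borel_measurable borel"
      by (intro borel_measurable_continuous_onI) (simp add: continuous_on_eq_continuous_at)
    let ?b = "\<lambda>m. sqrt (2 / pi) * \<bar>1 - m\<bar> + \<nu> * (cl.S3 + \<mu> / (1 - \<mu>) * (sqrt cl.S2 * sqrt cl.S4) + 2 * sqrt (2 / pi) * (\<mu> * cl.S2 / (1 - \<mu>)))"
    have l: "(\<lambda>n. \<integral>x. f x \<partial>?R n) \<longlonglongrightarrow> (\<integral>x. f x \<partial>delta_law)"
      by (rule weak_conv_imp_integral_bdd_continuous_conv[OF cl.window_law_char(1)[OF nu] delta_law_dist wc fc]) (use f(3) in auto)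
    have "\<bar>(\<integral>x. f x \<partial>delta_law) - (\<integral>x. f x \<partial>?Q)\<bar> \<le> ?b (\<nu> * cl.S2 / (1 - \<mu>))"
    proof (rule LIMSEQ_le)
      show "(\<lambda>n. \<bar>(\<integral>x. f x \<partial>?R n) - (\<integral>x. f x \<partial>?Q)\<bar>) \<longlonglongrightarrow> \<bar>(\<integral>x. f x \<partial>delta_law) - (\<integral>x. f x \<partial>?Q)\<bar>"
        by (intro tendsto_intros l)
      show "(\<lambda>n. ?b (\<integral>s. cl.window \<nu> n s * cl.m2 n s \<partial>lborel)) \<longlonglongrightarrow> ?b (\<nu> * cl.S2 / (1 - \<mu>))"
        by (intro tendsto_intros cl.window_limit[OF nu])
      have "(\<integral>x. f x \<partial>?R n) = (\<integral>x. f (x - cl.an \<nu> n) \<partial>cl.window_law \<nu> n)" for n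
        by (rule integral_distr) (simp_all add: measurable_cong_sets[OF cl.window_law_sets[OF nu] refl] fm)
      then show "\<exists>k. \<forall>n\<ge>k. \<bar>(\<integral>x. f x \<partial>?R n) - (\<integral>x. f x \<partial>?Q)\<bar> \<le> ?b (\<integral>s. cl.window \<nu> n s * cl.m2 n s \<partial>lborel)"
        using cl.window_law_stein[OF nu f(1,2)] by (simp add: Qe)
    qed
    then show "\<bar>(\<integral>x. f x \<partial>delta_law) - (\<integral>x. f x \<partial>?Q)\<bar> \<le> ?B" by (simp add: cl.S2_def cl.S3_def cl.S4_def mean_rate_def)
  qed
  moreover have gm: "g \<in> borel_measurable borel"
    by (intro borel_measurable_continuous_onI lipschitz_on_continuous_on[OF g])
  moreover have "(\<integral>x. g x \<partial>delta_law) = (\<integral>\<omega>. g (hawkes_delta \<nu> h N u \<omega>) \<partial>M)"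
    using dm gm by (intro integral_distr) auto
  ultimately show ?thesis by (simp add: Qe)
qed

end

end

lemma (in prob_space) lipschitz_expectation_diff:
  fixes g :: "real \<Rightarrow> real"
  assumes X: "integrable M X" and Y: "integrable M Y" and g: "1-lipschitz_on UNIV g"
  shows "\<bar>expectation (\<lambda>\<omega>. g (X \<omega>)) - expectation (\<lambda>\<omega>. g (Y \<omega>))\<bar> \<le> expectation (\<lambda>\<omega>. \<bar>X \<omega> - Y \<omega>\<bar>)"
proof -
  have gm[measurable]: "g \<in> borel_measurable borel"
    by (intro borel_measurable_continuous_onI lipschitz_on_continuous_on[OF g])
  have gi: "integrable M (\<lambda>\<omega>. g (V \<omega>))" if V: "integrable M V" for V
  proof (rule Bochner_Integration.integrable_bound)
    show "integrable M (\<lambda>\<omega>. \<bar>g 0\<bar> + \<bar>V \<omega>\<bar>)" by (intro Bochner_Integration.integrable_add integrable_abs V) simp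
    show "(\<lambda>\<omega>. g (V \<omega>)) \<in> borel_measurable M" using V by measurable
    show "AE \<omega> in M. norm (g (V \<omega>)) \<le> norm (\<bar>g 0\<bar> + \<bar>V \<omega>\<bar>)"
    proof (rule AE_I2)
      fix \<omega>
      show "norm (g (V \<omega>)) \<le> norm (\<bar>g 0\<bar> + \<bar>V \<omega>\<bar>)"
        using lipschitz_onD[OF g, of "V \<omega>" 0] by (simp add: dist_real_def)
    qed
  qed
  have "expectation (\<lambda>\<omega>. g (X \<omega>)) - expectation (\<lambda>\<omega>. g (Y \<omega>)) = expectation (\<lambda>\<omega>. g (X \<omega>) - g (Y \<omega>))"
    using gi[OF X] gi[OF Y] by simp
  moreover have "\<bar>expectation (\<lambda>\<omega>. g (X \<omega>) - g (Y \<omega>))\<bar> \<le> expectation (\<lambda>\<omega>. \<bar>g (X \<omega>) - g (Y \<omega>)\<bar>)" by (rule integral_abs_bound)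
  moreover have "expectation (\<lambda>\<omega>. \<bar>g (X \<omega>) - g (Y \<omega>)\<bar>) \<le> expectation (\<lambda>\<omega>. \<bar>X \<omega> - Y \<omega>\<bar>)"
  proof (rule integral_mono)
    show "integrable M (\<lambda>\<omega>. \<bar>g (X \<omega>) - g (Y \<omega>)\<bar>)" using gi[OF X] gi[OF Y] by simp
    show "integrable M (\<lambda>\<omega>. \<bar>X \<omega> - Y \<omega>\<bar>)" using X Y by simp
    show "\<bar>g (X \<omega>) - g (Y \<omega>)\<bar> \<le> \<bar>X \<omega> - Y \<omega>\<bar>" for \<omega>
      using lipschitz_onD[OF g, of "X \<omega>" "Y \<omega>"] by (simp add: dist_real_def)
  qed
  ultimately show ?thesis by linarith
qed

lemma integral_abs_le_of_nn:
  fixes f :: "'a \<Rightarrow> real"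
  assumes f: "f \<in> borel_measurable M" and b: "(\<integral>\<^sup>+x. ennreal \<bar>f x\<bar> \<partial>M) \<le> ennreal r" and r: "0 \<le> r"
  shows "integrable M f" "(\<integral>x. \<bar>f x\<bar> \<partial>M) \<le> r"
proof -
  show i: "integrable M f"
    by (rule integrableI_bounded[OF f]) (simp, rule le_less_trans[OF b], simp)
  have "ennreal (\<integral>x. \<bar>f x\<bar> \<partial>M) \<le> ennreal r"
    using b i by (subst (asm) nn_integral_eq_integral) auto
  then show "(\<integral>x. \<bar>f x\<bar> \<partial>M) \<le> r" using r by (simp add: ennreal_le_iff)
qed

section \<open>Removal of the truncation and replacement of the compensator\<close>

context hawkes
begin

lemma E_abs_delta_diff:
  assumes u: "integrable lborel u" and v: "integrable lborel v"
  shows "(\<integral>\<omega>. \<bar>hawkes_delta \<nu> h N u \<omega> - hawkes_delta \<nu> h N v \<omega>\<bar> \<partial>M) \<le> 2 * mean_rate * (\<integral>t. \<bar>u t - v t\<bar> \<partial>lborel)"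
proof -
  have w: "integrable lborel (\<lambda>t. u t - v t)" using u v by simp
  have "(\<integral>\<omega>. \<bar>hawkes_delta \<nu> h N u \<omega> - hawkes_delta \<nu> h N v \<omega>\<bar> \<partial>M) = (\<integral>\<omega>. \<bar>hawkes_delta \<nu> h N (\<lambda>t. u t - v t) \<omega>\<bar> \<partial>M)"
    using delta_int[OF u] delta_int[OF v] delta_int[OF w] delta_diff[OF u v]
    by (intro integral_cong_AE) (auto elim: AE_mp)
  moreover have "(\<integral>\<omega>. \<bar>hawkes_delta \<nu> h N (\<lambda>t. u t - v t) \<omega>\<bar> \<partial>M) \<le> 2 * mean_rate * (\<integral>t. \<bar>u t - v t\<bar> \<partial>lborel)"
    using delta_int[OF w] mean_rate_pos by (intro integral_abs_le_of_nn(2) E_abs_delta w) auto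
  ultimately show ?thesis by simp
qed

text \<open>For \<open>\<mu> = 0\<close> the fourth power of \<open>u\<close> need not be integrable; its integral is then 0, but has coefficient 0.\<close>
definition stein_rhs :: "(real \<Rightarrow> real) \<Rightarrow> real" where
  "stein_rhs u = sqrt (2 / pi) * \<bar>1 - mean_rate * (LINT t|lborel. (u t)^2)\<bar>
    + \<nu> * ((LINT t|lborel. \<bar>u t\<bar>^3) + \<mu> / (1 - \<mu>) * (sqrt (LINT t|lborel. (u t)^2) * sqrt (LINT t|lborel. (u t)^4))
           + 2 * sqrt (2 / pi) * (\<mu> * (LINT t|lborel. (u t)^2) / (1 - \<mu>)))"

text \<open>The integrand is cut off where \<open>\<bar>t\<bar>\<close> or
  \<open>\<bar>u t\<bar>\<close> exceeds \<open>k\<close>. The compensated integrals of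
  \<open>u\<close> and of its truncation differ in mean by at most \<open>2 * mean_rate\<close>
  times their L1 distance, and all integrals in the bound converge by dominated convergence.\<close>

lemma delta_stein_general:
  assumes u1: "integrable lborel u" and u2: "integrable lborel (\<lambda>t. (u t)^2)" and u3: "integrable lborel (\<lambda>t. \<bar>u t\<bar>^3)"
    and u4: "\<mu> > 0 \<Longrightarrow> integrable lborel (\<lambda>t. (u t)^4)" and g: "1-lipschitz_on UNIV g"
  shows "\<bar>(\<integral>\<omega>. g (hawkes_delta \<nu> h N u \<omega>) \<partial>M) - (LINT t|lborel. gphi t * g t)\<bar> \<le> stein_rhs u"
proof -
  have um[measurable]: "u \<in> borel_measurable borel" using u1 by auto
  define A where "A k = {t. \<bar>t\<bar> \<le> real k \<and> \<bar>u t\<bar> \<le> real k}" for k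
  have Am[measurable]: "A k \<in> sets borel" for k unfolding A_def by measurable
  define v where "v k t = indicator (A k) t * u t" for k t
  have lim: "(\<lambda>k. LINT t|lborel. indicator (A k) t * f t) \<longlonglongrightarrow> (LINT t|lborel. f t)" if f: "integrable lborel f" for f :: "real \<Rightarrow> real"
  proof (rule integral_dominated_convergence[where w="\<lambda>t. \<bar>f t\<bar>"])
    have fm[measurable]: "f \<in> borel_measurable borel" using f by auto
    show "f \<in> borel_measurable lborel" "(\<lambda>t. indicator (A k) t * f t) \<in> borel_measurable lborel" for k by measurable
    show "integrable lborel (\<lambda>t. \<bar>f t\<bar>)" using f by simp
    show "AE t in lborel. norm (indicator (A k) t * f t) \<le> \<bar>f t\<bar>" for k by (rule AE_I2) (simp add: indicator_def)
    show "AE t in lborel. (\<lambda>k. indicator (A k) t * f t) \<longlonglongrightarrow> f t"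
    proof (rule AE_I2)
      fix t
      obtain k where k: "max \<bar>t\<bar> \<bar>u t\<bar> < real k" using reals_Archimedean2 by blast
      have "indicator (A n) t * f t = f t" if "n \<ge> k" for n
      proof -
        have "real k \<le> real n" using that by simp
        then have "t \<in> A n" using k unfolding A_def by auto
        then show ?thesis by simp
      qed
      then have "eventually (\<lambda>n. indicator (A n) t * f t = f t) sequentially" by (rule eventually_sequentiallyI)
      then show "(\<lambda>k. indicator (A k) t * f t) \<longlonglongrightarrow> f t" by (rule tendsto_eventually)
    qed
  qed
  have pw: "(v k t)^2 = indicator (A k) t * (u t)^2" "\<bar>v k t\<bar>^3 = indicator (A k) t * \<bar>u t\<bar>^3" "(v k t)^4 = indicator (A k) t * (u t)^4" for k t
    by (simp_all add: v_def indicator_def)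
  have vi: "integrable lborel (v k)" for k
    unfolding v_def using integrable_mult_indicator[of "A k" lborel u] u1 by simp
  have vm: "v k \<in> borel_measurable borel" for k using vi[of k] by auto
  have st: "\<bar>(\<integral>\<omega>. g (hawkes_delta \<nu> h N (v k) \<omega>) \<partial>M) - (LINT t|lborel. gphi t * g t)\<bar> \<le> stein_rhs (v k)" for k
    unfolding stein_rhs_def by (rule delta_stein[of "v k" "real k" "real k", OF vm _ _ g]) (auto simp: v_def A_def indicator_def)
  have rl: "(\<lambda>k. stein_rhs (v k)) \<longlonglongrightarrow> stein_rhs u"
  \<comment> \<open>For \<open>\<mu> = 0\<close> the fourth power need not be integrable, so its
    integrals need not converge; there the term has coefficient 0 and is removed before the limit is
    taken.\<close>
  proof (cases "\<mu> > 0")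
    case True
    show ?thesis unfolding stein_rhs_def pw using mu1 by (intro tendsto_intros lim u2 u3 u4 True) auto
  next
    case False
    then have m: "\<mu> = 0" using mu0 by simp
    have e: "stein_rhs w = sqrt (2 / pi) * \<bar>1 - mean_rate * (LINT t|lborel. (w t)^2)\<bar> + \<nu> * (LINT t|lborel. \<bar>w t\<bar>^3)" for w
      unfolding stein_rhs_def by (simp add: m)
    show ?thesis unfolding e pw by (intro tendsto_intros lim u2 u3)
  qed
  have dl: "(\<lambda>k. 2 * mean_rate * (\<integral>t. \<bar>u t - v k t\<bar> \<partial>lborel)) \<longlonglongrightarrow> 0"
  proof -
    have e: "(\<integral>t. \<bar>u t - v k t\<bar> \<partial>lborel) = (\<integral>t. \<bar>u t\<bar> \<partial>lborel) - (\<integral>t. indicator (A k) t * \<bar>u t\<bar> \<partial>lborel)" for k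
    proof -
      have "(\<integral>t. \<bar>u t - v k t\<bar> \<partial>lborel) = (\<integral>t. \<bar>u t\<bar> - indicator (A k) t * \<bar>u t\<bar> \<partial>lborel)"
        by (intro Bochner_Integration.integral_cong) (auto simp: v_def indicator_def)
      also have "\<dots> = (\<integral>t. \<bar>u t\<bar> \<partial>lborel) - (\<integral>t. indicator (A k) t * \<bar>u t\<bar> \<partial>lborel)"
        using integrable_mult_indicator[of "A k" lborel "\<lambda>t. \<bar>u t\<bar>"] u1 by (intro Bochner_Integration.integral_diff) auto
      finally show ?thesis .
    qed
    have "(\<lambda>k. 2 * mean_rate * ((\<integral>t. \<bar>u t\<bar> \<partial>lborel) - (\<integral>t. indicator (A k) t * \<bar>u t\<bar> \<partial>lborel))) \<longlonglongrightarrow> 2 * mean_rate * ((\<integral>t. \<bar>u t\<bar> \<partial>lborel) - (\<integral>t. \<bar>u t\<bar> \<partial>lborel))"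
      using u1 by (intro tendsto_intros lim) simp
    then show ?thesis unfolding e by simp
  qed
  show ?thesis
  proof (rule LIMSEQ_le_const)
    show "(\<lambda>k. stein_rhs (v k) + 2 * mean_rate * (\<integral>t. \<bar>u t - v k t\<bar> \<partial>lborel)) \<longlonglongrightarrow> stein_rhs u" using tendsto_add[OF rl dl] by simp
    have "\<bar>(\<integral>\<omega>. g (hawkes_delta \<nu> h N u \<omega>) \<partial>M) - (LINT t|lborel. gphi t * g t)\<bar> \<le> stein_rhs (v k) + 2 * mean_rate * (\<integral>t. \<bar>u t - v k t\<bar> \<partial>lborel)" for k
      using st[of k] lipschitz_expectation_diff[OF delta_int[OF u1] delta_int[OF vi] g, of k] E_abs_delta_diff[OF u1 vi, of k] by linarith
    then show "\<exists>n. \<forall>k\<ge>n. \<bar>(\<integral>\<omega>. g (hawkes_delta \<nu> h N u \<omega>) \<partial>M) - (LINT t|lborel. gphi t * g t)\<bar> \<le> stein_rhs (v k) + 2 * mean_rate * (\<integral>t. \<bar>u t - v k t\<bar> \<partial>lborel)" by blast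
  qed
qed

lemma compensator_int:
  assumes u: "integrable lborel u"
  shows "integrable M (\<lambda>\<omega>. \<integral>t. u t * lam_real t \<omega> \<partial>lborel)"
    "(\<integral>\<omega>. \<bar>\<integral>t. u t * lam_real t \<omega> \<partial>lborel\<bar> \<partial>M) \<le> mean_rate * (\<integral>t. \<bar>u t\<bar> \<partial>lborel)"
proof -
  have um[measurable]: "u \<in> borel_measurable borel" using u by auto
  have cu: "(\<lambda>t. complex_of_real (u t)) \<in> borel_measurable borel" by measurable
  have "(\<lambda>\<omega>. \<integral>t. u t * lam_real t \<omega> \<partial>lborel) = (\<lambda>\<omega>. Re (intL (\<lambda>t. of_real (u t)) UNIV \<omega>))"
    unfolding intL_def by (simp add: integral_complex_of_real flip: of_real_mult)
  moreover have "(\<lambda>\<omega>. Re (intL (\<lambda>t. of_real (u t)) UNIV \<omega>)) \<in> borel_measurable M"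
    by (rule measurable_compose[OF intL_meas[OF cu]]) simp_all
  ultimately have m: "(\<lambda>\<omega>. \<integral>t. u t * lam_real t \<omega> \<partial>lborel) \<in> borel_measurable M" by simp
  have "(\<integral>\<^sup>+\<omega>. ennreal \<bar>\<integral>t. u t * lam_real t \<omega> \<partial>lborel\<bar> \<partial>M) \<le> (\<integral>\<^sup>+\<omega>. (\<integral>\<^sup>+t. ennreal \<bar>u t\<bar> * lam t \<omega> \<partial>lborel) \<partial>M)"
  proof (rule nn_integral_mono)
    fix \<omega>
    have "ennreal \<bar>\<integral>t. u t * lam_real t \<omega> \<partial>lborel\<bar> \<le> (\<integral>\<^sup>+t. ennreal \<bar>u t * lam_real t \<omega>\<bar> \<partial>lborel)"
      using integral_norm_bound_ennreal[of lborel "\<lambda>t. u t * lam_real t \<omega>"]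
      by (cases "integrable lborel (\<lambda>t. u t * lam_real t \<omega>)") (auto simp: not_integrable_integral_eq)
    also have "(\<integral>\<^sup>+t. ennreal \<bar>u t * lam_real t \<omega>\<bar> \<partial>lborel) \<le> (\<integral>\<^sup>+t. ennreal \<bar>u t\<bar> * lam t \<omega> \<partial>lborel)"
    proof (rule nn_integral_mono)
      fix t
      have "ennreal (enn2real (lam t \<omega>)) \<le> lam t \<omega>" by (cases "lam t \<omega>") auto
      then show "ennreal \<bar>u t * lam_real t \<omega>\<bar> \<le> ennreal \<bar>u t\<bar> * lam t \<omega>"
        by (simp add: lam_real_def abs_mult ennreal_mult mult_left_mono)
    qed
    finally show "ennreal \<bar>\<integral>t. u t * lam_real t \<omega> \<partial>lborel\<bar> \<le> (\<integral>\<^sup>+t. ennreal \<bar>u t\<bar> * lam t \<omega> \<partial>lborel)" .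
  qed
  also have "\<dots> = ennreal (mean_rate * (\<integral>t. \<bar>u t\<bar> \<partial>lborel))"
    using u mean_rate_pos by (simp add: E_lam_q nn_integral_eq_integral ennreal_mult)
  finally have b: "(\<integral>\<^sup>+\<omega>. ennreal \<bar>\<integral>t. u t * lam_real t \<omega> \<partial>lborel\<bar> \<partial>M) \<le> ennreal (mean_rate * (\<integral>t. \<bar>u t\<bar> \<partial>lborel))" .
  have p: "0 \<le> mean_rate * (\<integral>t. \<bar>u t\<bar> \<partial>lborel)" using mean_rate_pos by simp
  show "integrable M (\<lambda>\<omega>. \<integral>t. u t * lam_real t \<omega> \<partial>lborel)"
    "(\<integral>\<omega>. \<bar>\<integral>t. u t * lam_real t \<omega> \<partial>lborel\<bar> \<partial>M) \<le> mean_rate * (\<integral>t. \<bar>u t\<bar> \<partial>lborel)"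
    using integral_abs_le_of_nn[OF m b p] by auto
qed

lemma delta_a_eq: "hawkes_delta_a \<nu> \<mu> N u \<omega> = hawkes_delta \<nu> h N u \<omega> + ((\<integral>t. u t * lam_real t \<omega> \<partial>lborel) - (\<integral>t. u t * mean_rate \<partial>lborel))"
  by (simp add: hawkes_delta_a_def hawkes_delta_lam_real mean_rate_def)

lemma delta_a_int:
  assumes u: "integrable lborel u"
  shows "integrable M (hawkes_delta_a \<nu> \<mu> N u)"
  unfolding delta_a_eq[abs_def] using delta_int[OF u] compensator_int(1)[OF u] by simp

text \<open>Both the intensity and its mean \<open>mean_rate\<close> are at least \<nu>, so their
  distance is at most the intensity plus \<open>mean_rate - 2 * \<nu>\<close>. This majorant is
  linear in the intensity, and its expectation is
  \<open>2 * (mean_rate - \<nu>) = 2 * \<nu> * \<mu> / (1 - \<mu>)\<close>; no second moment of the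
  intensity enters.\<close>

lemma E_abs_delta_a_diff:
  assumes u: "integrable lborel u"
  shows "(\<integral>\<omega>. \<bar>hawkes_delta_a \<nu> \<mu> N u \<omega> - hawkes_delta \<nu> h N u \<omega>\<bar> \<partial>M) \<le> 2 * \<nu> * \<mu> / (1 - \<mu>) * (\<integral>t. \<bar>u t\<bar> \<partial>lborel)"
proof -
  let ?I = "\<integral>t. \<bar>u t\<bar> \<partial>lborel"
  have um[measurable]: "u \<in> borel_measurable borel" using u by auto
  have ua: "integrable lborel (\<lambda>t. \<bar>u t\<bar>)" using u by simp
  have cu: "(\<lambda>t. complex_of_real (u t)) \<in> borel_measurable borel" by measurable
  have ci: "integrable lborel (\<lambda>t. complex_of_real (u t))" using u by simp
  have cn: "mean_rate \<ge> \<nu>" using nu mu0 mu1 by (simp add: mean_rate_def field_simps)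
  have "AE \<omega> in M. \<bar>hawkes_delta_a \<nu> \<mu> N u \<omega> - hawkes_delta \<nu> h N u \<omega>\<bar> \<le> (\<integral>t. \<bar>u t\<bar> * lam_real t \<omega> \<partial>lborel) + (mean_rate - 2 * \<nu>) * ?I"
    using AE_path_integrable[OF ci]
  proof eventually_elim
    case (elim \<omega>)
    have i: "integrable lborel (\<lambda>t. u t * lam_real t \<omega>)"
      using integrable_Re[OF path_integrable_lam_real_int[OF elim cu]] by simp
    have ia: "integrable lborel (\<lambda>t. \<bar>u t\<bar> * lam_real t \<omega>)"
      using integrable_abs[OF i] by (simp add: abs_mult lam_real_nonneg)
    have "hawkes_delta_a \<nu> \<mu> N u \<omega> - hawkes_delta \<nu> h N u \<omega> = (\<integral>t. u t * lam_real t \<omega> - u t * mean_rate \<partial>lborel)"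
      unfolding delta_a_eq using i u by (subst Bochner_Integration.integral_diff) auto
    moreover have "\<bar>\<integral>t. u t * lam_real t \<omega> - u t * mean_rate \<partial>lborel\<bar> \<le> (\<integral>t. \<bar>u t * lam_real t \<omega> - u t * mean_rate\<bar> \<partial>lborel)" by (rule integral_abs_bound)
    moreover have "(\<integral>t. \<bar>u t * lam_real t \<omega> - u t * mean_rate\<bar> \<partial>lborel) \<le> (\<integral>t. \<bar>u t\<bar> * lam_real t \<omega> + (mean_rate - 2 * \<nu>) * \<bar>u t\<bar> \<partial>lborel)"
    proof (rule integral_mono_AE)
      show "integrable lborel (\<lambda>t. \<bar>u t * lam_real t \<omega> - u t * mean_rate\<bar>)" using i u by (intro integrable_abs Bochner_Integration.integrable_diff) auto
      show "integrable lborel (\<lambda>t. \<bar>u t\<bar> * lam_real t \<omega> + (mean_rate - 2 * \<nu>) * \<bar>u t\<bar>)" using ia ua by (intro Bochner_Integration.integrable_add) auto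
      show "AE t in lborel. \<bar>u t * lam_real t \<omega> - u t * mean_rate\<bar> \<le> \<bar>u t\<bar> * lam_real t \<omega> + (mean_rate - 2 * \<nu>) * \<bar>u t\<bar>"
        using path_integrable_AE_fin[OF elim cu]
      proof eventually_elim
        case (elim t)
        show ?case
        proof (cases "u t = 0")
          case False
          then have f: "lam t \<omega> < \<infinity>" using elim by simp
          have "ennreal \<nu> \<le> lam t \<omega>" by (simp add: lam_eq)
          then have l: "\<nu> \<le> lam_real t \<omega>" unfolding lam_real_def using enn2real_mono[of "ennreal \<nu>" "lam t \<omega>"] f nu by simp
          have "\<bar>u t * lam_real t \<omega> - u t * mean_rate\<bar> = \<bar>u t\<bar> * \<bar>lam_real t \<omega> - mean_rate\<bar>" by (simp flip: right_diff_distrib abs_mult)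
          moreover have "\<bar>u t\<bar> * \<bar>lam_real t \<omega> - mean_rate\<bar> \<le> \<bar>u t\<bar> * (lam_real t \<omega> + (mean_rate - 2 * \<nu>))" using l cn by (intro mult_left_mono) auto
          ultimately show ?thesis by (simp add: algebra_simps)
        qed simp
      qed
    qed
    moreover have "(\<integral>t. \<bar>u t\<bar> * lam_real t \<omega> + (mean_rate - 2 * \<nu>) * \<bar>u t\<bar> \<partial>lborel) = (\<integral>t. \<bar>u t\<bar> * lam_real t \<omega> \<partial>lborel) + (mean_rate - 2 * \<nu>) * ?I"
      using ia ua by simp
    ultimately show ?case by linarith
  qed
  then have "(\<integral>\<omega>. \<bar>hawkes_delta_a \<nu> \<mu> N u \<omega> - hawkes_delta \<nu> h N u \<omega>\<bar> \<partial>M) \<le> (\<integral>\<omega>. (\<integral>t. \<bar>u t\<bar> * lam_real t \<omega> \<partial>lborel) + (mean_rate - 2 * \<nu>) * ?I \<partial>M)"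
    using delta_int[OF u] delta_a_int[OF u] compensator_int(1)[OF ua] by (intro integral_mono_AE) auto
  also have "\<dots> = (\<integral>\<omega>. (\<integral>t. \<bar>u t\<bar> * lam_real t \<omega> \<partial>lborel) \<partial>M) + (mean_rate - 2 * \<nu>) * ?I"
    using compensator_int(1)[OF ua] prob_space by simp
  finally have 1: "(\<integral>\<omega>. \<bar>hawkes_delta_a \<nu> \<mu> N u \<omega> - hawkes_delta \<nu> h N u \<omega>\<bar> \<partial>M) \<le> (\<integral>\<omega>. (\<integral>t. \<bar>u t\<bar> * lam_real t \<omega> \<partial>lborel) \<partial>M) + (mean_rate - 2 * \<nu>) * ?I" .
  have "(\<integral>\<omega>. (\<integral>t. \<bar>u t\<bar> * lam_real t \<omega> \<partial>lborel) \<partial>M) \<le> (\<integral>\<omega>. \<bar>\<integral>t. \<bar>u t\<bar> * lam_real t \<omega> \<partial>lborel\<bar> \<partial>M)"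
    using compensator_int(1)[OF ua] by (intro integral_mono integrable_abs) auto
  moreover have "(\<integral>\<omega>. \<bar>\<integral>t. \<bar>u t\<bar> * lam_real t \<omega> \<partial>lborel\<bar> \<partial>M) \<le> mean_rate * ?I" using compensator_int(2)[OF ua] by simp
  moreover have "mean_rate * ?I + (mean_rate - 2 * \<nu>) * ?I = 2 * \<nu> * \<mu> / (1 - \<mu>) * ?I"
  proof -
    have "mean_rate + (mean_rate - 2 * \<nu>) = 2 * \<nu> * \<mu> / (1 - \<mu>)" 
    proof -
      have "mean_rate * (1 - \<mu>) = \<nu>" using mu1 by (simp add: mean_rate_def)
      then have "(mean_rate + (mean_rate - 2 * \<nu>)) * (1 - \<mu>) = 2 * \<nu> * \<mu>" by (simp add: algebra_simps)
      then show ?thesis using mu1 by (intro eq_divide_imp) auto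
    qed
    then show ?thesis unfolding distrib_right[symmetric] by simp
  qed
  ultimately show ?thesis using 1 by linarith
qed

end

subsection \<open>The norms in the bound\<close>

lemma Lp_norm_nat:
  assumes n: "n > 0" and u[measurable]: "u \<in> borel_measurable borel"
  shows "Lp_norm (real n) u = (if integrable lborel (\<lambda>x. \<bar>u x\<bar> ^ n) then ereal (root n (\<integral>x. \<bar>u x\<bar> ^ n \<partial>lborel)) else \<infinity>)"
proof -
  have p: "\<bar>u x\<bar> powr real n = \<bar>u x\<bar> ^ n" for x
    using n by (cases "u x = 0") (auto simp: powr_realpow)
  show ?thesis
  proof (cases "integrable lborel (\<lambda>x. \<bar>u x\<bar> ^ n)")
    case True
    define J where "J = (\<integral>x. \<bar>u x\<bar> ^ n \<partial>lborel)"
    have J: "J \<ge> 0" by (simp add: J_def)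
    have "(\<integral>\<^sup>+x. ennreal (\<bar>u x\<bar> ^ n) \<partial>lborel) = ennreal J"
      unfolding J_def using True by (intro nn_integral_eq_integral) auto
    moreover have "J powr (1 / real n) = root n J"
      using J n by (cases "J = 0") (auto simp: root_powr_inverse)
    ultimately show ?thesis using True J by (simp add: Lp_norm_def p J_def[symmetric])
  next
    case False
    then have "(\<integral>\<^sup>+x. ennreal (\<bar>u x\<bar> ^ n) \<partial>lborel) = \<infinity>"
      by (simp add: integrable_iff_bounded less_top[symmetric] power_abs)
    then show ?thesis using False by (simp add: Lp_norm_def p)
  qed
qed

context hawkes
begin

text \<open>Either an infinite norm makes the bound infinite and the estimate void, or all integrals
  with nonzero coefficient in \<open>stein_rhs\<close> exist and the comparison takes place between
  real numbers.\<close>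

lemma hawkes_bound_cases:
  assumes u1: "integrable lborel u"
  obtains "hawkes_bound \<nu> \<mu> u = \<infinity>"
  | "integrable lborel (\<lambda>t. (u t)^2)" "integrable lborel (\<lambda>t. \<bar>u t\<bar>^3)" "\<mu> > 0 \<Longrightarrow> integrable lborel (\<lambda>t. (u t)^4)"
    "ereal (stein_rhs u) \<le> hawkes_bound \<nu> \<mu> u"
proof -
  have um[measurable]: "u \<in> borel_measurable borel" using u1 by auto
  define S2 S3 S4 where "S2 = (\<integral>t. (u t)^2 \<partial>lborel)" and "S3 = (\<integral>t. \<bar>u t\<bar>^3 \<partial>lborel)" and "S4 = (\<integral>t. (u t)^4 \<partial>lborel)"
  have S: "S2 \<ge> 0" "S3 \<ge> 0" "S4 \<ge> 0" by (simp_all add: S2_def S3_def S4_def)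
  have L2: "Lp_norm 2 u = (if integrable lborel (\<lambda>t. (u t)^2) then ereal (sqrt S2) else \<infinity>)"
    using Lp_norm_nat[of 2 u] um by (simp add: S2_def sqrt_def)
  have L3: "Lp_norm 3 u = (if integrable lborel (\<lambda>t. \<bar>u t\<bar>^3) then ereal (root 3 S3) else \<infinity>)"
    using Lp_norm_nat[of 3 u] um by (simp add: S3_def)
  have L4: "Lp_norm 2 (\<lambda>x. (u x)^2) = (if integrable lborel (\<lambda>t. (u t)^4) then ereal (sqrt S4) else \<infinity>)"
    using Lp_norm_nat[of 2 "\<lambda>x. (u x)^2"] um by (simp add: S4_def sqrt_def flip: power_mult)
  define k3 k4 where "k3 = 2 * sqrt (2 / pi) * \<nu> * \<mu> * (2 - \<mu>) / (1 - \<mu>)^2" and "k4 = \<nu> * \<mu> / (1 - \<mu>)^2"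
  have k: "k3 \<ge> 0" "k4 \<ge> 0" using nu mu0 mu1 by (simp_all add: k3_def k4_def)
  have hb: "hawkes_bound \<nu> \<mu> u = ereal (sqrt (2 / pi)) * \<bar>1 - ereal mean_rate * (Lp_norm 2 u)^2\<bar> + ereal mean_rate * (Lp_norm 3 u)^3
     + ereal k3 * (Lp_norm 2 u)^2 + ereal k4 * (Lp_norm 2 u * Lp_norm 2 (\<lambda>x. (u x)^2))"
    by (simp add: hawkes_bound_def mean_rate_def k3_def k4_def)
  have inf_sq: "(\<infinity> :: ereal)^2 = \<infinity>" "(\<infinity> :: ereal)^3 = \<infinity>" "\<bar>1 - \<infinity> :: ereal\<bar> = \<infinity>"
    by (simp_all add: power2_eq_square power3_eq_cube one_ereal_def)
  consider (a) "\<not> integrable lborel (\<lambda>t. (u t)^2)" | (b) "integrable lborel (\<lambda>t. (u t)^2)" "\<not> integrable lborel (\<lambda>t. \<bar>u t\<bar>^3)"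
    | (c) "integrable lborel (\<lambda>t. (u t)^2)" "integrable lborel (\<lambda>t. \<bar>u t\<bar>^3)" "\<mu> > 0" "\<not> integrable lborel (\<lambda>t. (u t)^4)"
    | (d) "integrable lborel (\<lambda>t. (u t)^2)" "integrable lborel (\<lambda>t. \<bar>u t\<bar>^3)" "\<mu> > 0 \<Longrightarrow> integrable lborel (\<lambda>t. (u t)^4)" by blast
  then show thesis
  proof cases
    case a
    have "hawkes_bound \<nu> \<mu> u = \<infinity>" unfolding hb L2 using a mean_rate_pos by (simp add: inf_sq)
    then show thesis by (rule that(1))
  next
    case b
    have "hawkes_bound \<nu> \<mu> u = \<infinity>" unfolding hb L2 L3 using b mean_rate_pos by (simp add: inf_sq)
    then show thesis by (rule that(1))
  next
    case c
    \<comment> \<open>The product of the two norms is to be \<infinity>, but 0 times \<infinity> is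
      0. If the first norm were 0, then \<open>u\<close> would vanish almost everywhere and its
      fourth power would be integrable after all.\<close>
    have "S2 \<noteq> 0"
    proof
      assume "S2 = 0"
      then have "AE t in lborel. (u t)^2 = 0" using c(1) by (subst (asm) S2_def, subst (asm) integral_nonneg_eq_0_iff_AE) auto
      then have "AE t in lborel. (u t)^4 = 0" by eventually_elim simp
      then have "integrable lborel (\<lambda>t. (u t)^4)" by (subst integrable_cong_AE[of _ _ "\<lambda>_. 0"]) auto
      then show False using c(4) by simp
    qed
    then have "sqrt S2 > 0" using S by simp
    moreover have "k4 > 0" using c(3) nu mu1 by (simp add: k4_def)
    ultimately have "hawkes_bound \<nu> \<mu> u = \<infinity>" unfolding hb L2 L3 L4 using c by simp
    then show thesis by (rule that(1))
  next
    case d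
    \<comment> \<open>For \<open>\<mu> = 0\<close> the coefficient is 0, and the extended product
      with 0 is 0 also when the last norm is infinite.\<close>
    have last: "ereal k4 * (Lp_norm 2 u * Lp_norm 2 (\<lambda>x. (u x)^2)) = ereal (k4 * (sqrt S2 * sqrt S4))"
    proof (cases "\<mu> > 0")
      case True
      then show ?thesis unfolding L2 L4 using d by simp
    next
      case False
      then have "k4 = 0" using mu0 by (simp add: k4_def)
      then show ?thesis by (simp add: zero_ereal_def[symmetric])
    qed
    have p: "(sqrt S2)^2 = S2" "(root 3 S3)^3 = S3" using S by simp_all
    have hr: "hawkes_bound \<nu> \<mu> u = ereal (sqrt (2 / pi) * \<bar>1 - mean_rate * S2\<bar> + mean_rate * S3 + k3 * S2 + k4 * (sqrt S2 * sqrt S4))"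
      unfolding hb last unfolding L2 L3 using d p by (simp add: one_ereal_def)
    define a where "a = \<nu> * \<mu> / (1 - \<mu>)"
    have a0: "a \<ge> 0" using nu mu0 mu1 by (simp add: a_def)
    \<comment> \<open>The Stein estimate has \<nu> for the cubic term,
      \<open>\<nu> * \<mu> / (1 - \<mu>)\<close> for the product of norms and
      \<open>2 * sqrt (2 / pi)\<close> times the same for the quadratic term. The factors
      \<open>1 / (1 - \<mu>)\<close> and \<open>(2 - \<mu>) / (1 - \<mu>)\<close>, both at least 1,
      lead to the claimed coefficients.\<close>
    have i1: "1 \<le> 1 / (1 - \<mu>)" using mu0 mu1 by simp
    have i2: "1 \<le> (2 - \<mu>) / (1 - \<mu>)" using mu1 by simp
    have t2: "\<nu> * S3 \<le> mean_rate * S3" using mult_left_mono[OF i1, of \<nu>] nu S by (intro mult_right_mono) (simp_all add: mean_rate_def)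
    have "a \<le> k4" using mult_left_mono[OF i1 a0] by (simp add: a_def k4_def power2_eq_square)
    then have t4: "a * (sqrt S2 * sqrt S4) \<le> k4 * (sqrt S2 * sqrt S4)" using S by (intro mult_right_mono) auto
    have "2 * sqrt (2 / pi) * a * 1 \<le> 2 * sqrt (2 / pi) * a * ((2 - \<mu>) / (1 - \<mu>))" using a0 by (intro mult_left_mono i2) auto
    also have "\<dots> = k3" by (simp add: a_def k3_def power2_eq_square)
    finally have "2 * sqrt (2 / pi) * a \<le> k3" by simp
    then have t3: "2 * sqrt (2 / pi) * a * S2 \<le> k3 * S2" using S by (intro mult_right_mono) auto
    have "stein_rhs u = sqrt (2 / pi) * \<bar>1 - mean_rate * S2\<bar> + \<nu> * S3 + 2 * sqrt (2 / pi) * a * S2 + a * (sqrt S2 * sqrt S4)"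
      unfolding stein_rhs_def S2_def[symmetric] S3_def[symmetric] S4_def[symmetric] a_def by (simp add: algebra_simps)
    then have "stein_rhs u \<le> sqrt (2 / pi) * \<bar>1 - mean_rate * S2\<bar> + mean_rate * S3 + k3 * S2 + k4 * (sqrt S2 * sqrt S4)"
      using t2 t3 t4 by linarith
    then show thesis using d by (intro that(2)) (simp_all add: hr)
  qed
qed

lemma delta_le_hawkes_bound:
  assumes u1: "integrable lborel u" and g: "1-lipschitz_on UNIV g"
  shows "ereal \<bar>(\<integral>\<omega>. g (hawkes_delta \<nu> h N u \<omega>) \<partial>M) - (LINT t|lborel. gphi t * g t)\<bar> \<le> hawkes_bound \<nu> \<mu> u"
  using u1
proof (cases rule: hawkes_bound_cases)
  case 2
  show ?thesis by (rule order_trans[OF _ 2(4)]) (use delta_stein_general[OF u1 2(1-3) g] in simp)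
qed simp

lemma delta_a_le_hawkes_bound:
  assumes u1: "integrable lborel u" and g: "1-lipschitz_on UNIV g"
  shows "ereal \<bar>(\<integral>\<omega>. g (hawkes_delta_a \<nu> \<mu> N u \<omega>) \<partial>M) - (LINT t|lborel. gphi t * g t)\<bar> \<le>
    hawkes_bound \<nu> \<mu> u + ereal (2 * \<nu> * \<mu> / (1 - \<mu>)) * Lp_norm 1 u"
proof -
  have um: "u \<in> borel_measurable borel" using u1 by auto
  have L1: "Lp_norm 1 u = ereal (\<integral>t. \<bar>u t\<bar> \<partial>lborel)" using Lp_norm_nat[of 1 u] um u1 by simp
  let ?d = "2 * \<nu> * \<mu> / (1 - \<mu>) * (\<integral>t. \<bar>u t\<bar> \<partial>lborel)"
  have "\<bar>(\<integral>\<omega>. g (hawkes_delta_a \<nu> \<mu> N u \<omega>) \<partial>M) - (LINT t|lborel. gphi t * g t)\<bar> \<le> \<bar>(\<integral>\<omega>. g (hawkes_delta \<nu> h N u \<omega>) \<partial>M) - (LINT t|lborel. gphi t * g t)\<bar> + ?d"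
    using lipschitz_expectation_diff[OF delta_a_int[OF u1] delta_int[OF u1] g] E_abs_delta_a_diff[OF u1] by linarith
  then have "ereal \<bar>(\<integral>\<omega>. g (hawkes_delta_a \<nu> \<mu> N u \<omega>) \<partial>M) - (LINT t|lborel. gphi t * g t)\<bar> \<le>
    ereal \<bar>(\<integral>\<omega>. g (hawkes_delta \<nu> h N u \<omega>) \<partial>M) - (LINT t|lborel. gphi t * g t)\<bar> + ereal ?d" by simp
  also have "\<dots> \<le> hawkes_bound \<nu> \<mu> u + ereal ?d" by (intro add_right_mono delta_le_hawkes_bound u1 g)
  finally show ?thesis by (simp add: L1)
qed

end

theorem theorem5p1:
  fixes M :: "'a measure" and N :: "'a \<Rightarrow> real measure"
    and M' :: "'b measure" and Z :: "'b \<Rightarrow> real"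
    and \<nu> \<mu> :: real and h u :: "real \<Rightarrow> real"
  assumes "\<nu> > 0"
    and "\<And>t. t \<ge> 0 \<Longrightarrow> h t \<ge> 0"
    and "\<And>T. bounded (h ` {0..T})"
    and "set_integrable lborel {0..} h"
    and "\<mu> = (LBINT t:{0..}. h t)"
    and "\<mu> < 1"
    and "prob_space M"
    and "stationary_linear_hawkes M \<nu> h N"
    and "prob_space M'"
    and "distributed M' lborel Z std_normal_density"
    and "integrable lborel u"
  shows "wasserstein_dist M (hawkes_delta \<nu> h N u) M' Z \<le> hawkes_bound \<nu> \<mu> u \<and>
         wasserstein_dist M (hawkes_delta_a \<nu> \<mu> N u) M' Z
           \<le> hawkes_bound \<nu> \<mu> u + ereal (2 * \<nu> * \<mu> / (1 - \<mu>)) * Lp_norm 1 u"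
proof -
  interpret hawkes M N \<nu> \<mu> h
    using assms by (intro hawkes.intro hawkes_axioms.intro) auto
  have Z: "(\<integral>\<omega>. g (Z \<omega>) \<partial>M') = (LINT t|lborel. gphi t * g t)" if "1-lipschitz_on UNIV g" for g :: "real \<Rightarrow> real"
  proof -
    have "g \<in> borel_measurable lborel"
      using that by (auto intro!: borel_measurable_continuous_onI lipschitz_on_continuous_on)
    then show ?thesis using distributed_integral[OF assms(10), of g] by simp
  qed
  show ?thesis
    unfolding wasserstein_dist_def
    using delta_le_hawkes_bound[OF assms(11)] delta_a_le_hawkes_bound[OF assms(11)] Z
    by (intro conjI SUP_least) auto
qed

end
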